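(* Let $u\in C^\infty(\mathbb{R}^3)$ be a solution (in the sense defined in the context) of $$(-\Delta)^{\frac32}u=2e^{3u}\quad\text{in }\mathbb{R}^3,\qquad V:=\int_{\mathbb{R}^3}e^{3u}\,dx<\infty,$$ and suppose that $u$ is non-spherical, i.e. $u$ is not of the form $x\mapsto\log\left(\frac{2\lambda}{1+\lambda^2|x-x_0|^2}\right)$ for any $\lambda>0$ and $x_0\in\mathbb{R}^3$. Then $V<2\pi^2$.
   Context: For $\varphi$ in the Schwartz space $\mathcal{S}(\mathbb{R}^3)$, $(-\Delta)^{\frac12}\varphi$ is the function with Fourier transform $|\xi|\hat\varphi(\xi)$. Let $$L_{1/2}(\mathbb{R}^3)=\Big\{v\in L^1_{\mathrm{loc}}(\mathbb{R}^3):\int_{\mathbb{R}^3}\frac{|v(x)|}{1+|x|^4}\,dx<\infty\Big\}.$$ Given a tempered distribution $f$ on $\mathbb{R}^3$, a function $u$ is a solution of $(-\Delta)^{\frac32}u=f$ if $u\in W^{2,1}_{\mathrm{loc}}(\mathbb{R}^3)$, $\Delta u\in L_{1/2}(\mathbb{R}^3)$ and $$\int_{\mathbb{R}^3}(-\Delta u)\,(-\Delta)^{\frac12}\varphi\,dx=\langle f,\varphi\rangle\quad\text{for every }\varphi\in\mathcal{S}(\mathbb{R}^3).$$ *)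

theory Defs
  imports "HOL-Analysis.Analysis"
begin

definition partial :: "'n \<Rightarrow> (real ^ 'n \<Rightarrow> 'b) \<Rightarrow> real ^ 'n::finite \<Rightarrow> 'b::real_normed_vector" where
  "partial i f x = frechet_derivative f (at x) (axis i 1)"

text \<open>Higher partial derivatives are indexed by lists of coordinates: the list
  \<open>[i\<^sub>1, \<dots>, i\<^sub>k]\<close> stands for \<open>\<partial>\<^sub>i\<^sub>1 \<dots> \<partial>\<^sub>i\<^sub>k\<close>, which has order \<open>k\<close>.\<close>

primrec partials :: "'n list \<Rightarrow> (real ^ 'n \<Rightarrow> 'b) \<Rightarrow> real ^ 'n::finite \<Rightarrow> 'b::real_normed_vector" where
  "partials [] f = f"
| "partials (i # \<alpha>) f = partial i (partials \<alpha> f)"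

text \<open>If every iterated partial derivative is (Frechet) differentiable everywhere, then all of them
  are continuous; so this is \<open>C\<^sup>\<infinity>\<close> on the whole space.\<close>

definition smooth :: "(real ^ 'n::finite \<Rightarrow> 'b::real_normed_vector) \<Rightarrow> bool" where
  "smooth f \<longleftrightarrow> (\<forall>\<alpha>. partials \<alpha> f differentiable_on UNIV)"

definition test_function :: "(real ^ 'n::finite \<Rightarrow> real) \<Rightarrow> bool" where
  "test_function \<psi> \<longleftrightarrow> smooth \<psi> \<and> compact (closure {x. \<psi> x \<noteq> 0})"

definition schwartz :: "(real ^ 'n::finite \<Rightarrow> complex) \<Rightarrow> bool" where
  "schwartz \<phi> \<longleftrightarrow> smooth \<phi> \<and> (\<forall>k \<alpha>. bounded (range (\<lambda>x. norm x ^ k *\<^sub>R partials \<alpha> \<phi> x)))"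

definition schwartz_seminorm :: "nat \<Rightarrow> 'n list \<Rightarrow> (real ^ 'n::finite \<Rightarrow> complex) \<Rightarrow> real" where
  "schwartz_seminorm k \<alpha> \<phi> = (SUP x. norm x ^ k * norm (partials \<alpha> \<phi> x))"

text \<open>A distribution is a functional on functions of which only the values on Schwartz functions
  matter; continuity is expressed by domination by finitely many Schwartz seminorms.\<close>

definition tempered_distribution :: "((real ^ 'n::finite \<Rightarrow> complex) \<Rightarrow> complex) \<Rightarrow> bool" where
  "tempered_distribution T \<longleftrightarrow>
     (\<forall>\<phi> \<psi>. schwartz \<phi> \<longrightarrow> schwartz \<psi> \<longrightarrow> T (\<lambda>x. \<phi> x + \<psi> x) = T \<phi> + T \<psi>) \<and>
     (\<forall>c \<phi>. schwartz \<phi> \<longrightarrow> T (\<lambda>x. c * \<phi> x) = c * T \<phi>) \<and>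
     (\<exists>C N. \<forall>\<phi>. schwartz \<phi> \<longrightarrow>
        norm (T \<phi>) \<le> C * (\<Sum>k\<le>N. \<Sum>\<alpha> | length \<alpha> \<le> N. schwartz_seminorm k \<alpha> \<phi>))"

definition regular_distribution :: "(real ^ 'n::finite \<Rightarrow> real) \<Rightarrow> (real ^ 'n \<Rightarrow> complex) \<Rightarrow> complex" where
  "regular_distribution g \<phi> = (LINT x|lebesgue. complex_of_real (g x) * \<phi> x)"

definition locally_integrable :: "(real ^ 'n::finite \<Rightarrow> real) \<Rightarrow> bool" where
  "locally_integrable v \<longleftrightarrow> (\<forall>K. compact K \<longrightarrow> v absolutely_integrable_on K)"

definition has_weak_partials :: "'n list \<Rightarrow> (real ^ 'n::finite \<Rightarrow> real) \<Rightarrow> (real ^ 'n \<Rightarrow> real) \<Rightarrow> bool" where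
  "has_weak_partials \<alpha> u g \<longleftrightarrow> locally_integrable u \<and> locally_integrable g \<and>
     (\<forall>\<psi>. test_function \<psi> \<longrightarrow>
        (LINT x|lebesgue. u x * partials \<alpha> \<psi> x) = (- 1) ^ length \<alpha> * (LINT x|lebesgue. g x * \<psi> x))"

text \<open>The Sobolev space \<open>W(k, 1)\<close>, localised.\<close>

definition sobolev1_loc :: "nat \<Rightarrow> (real ^ 'n::finite \<Rightarrow> real) \<Rightarrow> bool" where
  "sobolev1_loc k u \<longleftrightarrow> (\<forall>\<alpha>. length \<alpha> \<le> k \<longrightarrow> (\<exists>g. has_weak_partials \<alpha> u g))"

text \<open>Weak derivatives are unique only up to null sets; \<open>weak_partials\<close> picks an
  arbitrary representative, and below it is only used under integrals.\<close>

definition weak_partials :: "'n list \<Rightarrow> (real ^ 'n::finite \<Rightarrow> real) \<Rightarrow> real ^ 'n \<Rightarrow> real" where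
  "weak_partials \<alpha> u = (SOME g. has_weak_partials \<alpha> u g)"

definition weak_laplacian :: "(real ^ 'n::finite \<Rightarrow> real) \<Rightarrow> real ^ 'n \<Rightarrow> real" where
  "weak_laplacian u x = (\<Sum>i\<in>UNIV. weak_partials [i, i] u x)"

text \<open>The transform has kernel \<open>exp (- i \<xi> \<bullet> x)\<close>, without a factor \<open>2 * pi\<close> in the exponent,
  since it must turn \<open>- \<Delta>\<close> into multiplication by the square of \<open>norm \<xi>\<close>.\<close>

definition fourier :: "(real ^ 3 \<Rightarrow> complex) \<Rightarrow> real ^ 3 \<Rightarrow> complex" where
  "fourier \<phi> \<xi> = (LINT x|lebesgue. cis (- (\<xi> \<bullet> x)) * \<phi> x)"

definition inverse_fourier :: "(real ^ 3 \<Rightarrow> complex) \<Rightarrow> real ^ 3 \<Rightarrow> complex" where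
  "inverse_fourier h x = (LINT \<xi>|lebesgue. cis (\<xi> \<bullet> x) * h \<xi>) / complex_of_real ((2 * pi) ^ 3)"

definition half_laplacian :: "(real ^ 3 \<Rightarrow> complex) \<Rightarrow> real ^ 3 \<Rightarrow> complex" where
  "half_laplacian \<phi> = inverse_fourier (\<lambda>\<xi>. complex_of_real (norm \<xi>) * fourier \<phi> \<xi>)"

definition L_half :: "(real ^ 3 \<Rightarrow> real) set" where
  "L_half = {v. locally_integrable v \<and> integrable lebesgue (\<lambda>x. \<bar>v x\<bar> / (1 + norm x ^ 4))}"

definition is_solution :: "(real ^ 3 \<Rightarrow> real) \<Rightarrow> ((real ^ 3 \<Rightarrow> complex) \<Rightarrow> complex) \<Rightarrow> bool" where
  "is_solution u f \<longleftrightarrow> tempered_distribution f \<and> sobolev1_loc 2 u \<and> weak_laplacian u \<in> L_half \<and>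
     (\<forall>\<phi>. schwartz \<phi> \<longrightarrow>
        (LINT x|lebesgue. complex_of_real (- weak_laplacian u x) * half_laplacian \<phi> x) = f \<phi>)"

definition spherical :: "(real ^ 3 \<Rightarrow> real) \<Rightarrow> bool" where
  "spherical u \<longleftrightarrow> (\<exists>l x0. l > 0 \<and> u = (\<lambda>x. ln (2 * l / (1 + l\<^sup>2 * (norm (x - x0))\<^sup>2))))"

end

theory Submission
  imports Defs "HOL-Probability.Probability" "HOL-Real_Asymp.Real_Asymp"
begin

text \<open>Testing the equation with translated Gaussians of vanishing width shows that \<open>- \<Delta>u\<close> differs by a constant from
  the Riesz potential \<open>1 / pi\<^sup>2 * (\<integral>y. exp (3 * u y) / (norm (x - y))\<^sup>2)\<close>. Hence \<open>u\<close> minus the logarithmic potential of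
  \<open>exp (3 * u)\<close> is harmonic up to a quadratic polynomial and has at most quadratic growth from above, so by Liouville it
  is a polynomial of degree two. Finiteness of \<open>V\<close> forces it to be \<open>q + B (x - x0) (x - x0) / 2\<close> with \<open>B \<le> 0\<close>, and the
  Pohozaev identity around \<open>x0\<close> equates \<open>V\<^sup>2 / (2 * pi\<^sup>2) - V\<close> with the integral of
  \<open>B (x - x0) (x - x0) * exp (3 * u x)\<close>. So \<open>V < 2 * pi\<^sup>2\<close> unless \<open>B = 0\<close>. In that case \<open>V = 2 * pi\<^sup>2\<close>, and the method of
  moving spheres, applied to the integral equation around every point, yields for each centre a sphere whose
  conformal inversion leaves \<open>u\<close> invariant; this makes \<open>exp (- u)\<close> a quadratic polynomial and \<open>u\<close> spherical.\<close>

subsection \<open>Gaussians, singular integrals and the divergence theorem\<close>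

text \<open>Only the weight 1 / (1 + |y|^4) controls \<open>- \<Delta>u\<close> at infinity. The
  kernel that inverts the half Laplacian is bounded in absolute value only by |y|^-3, but its
  difference at two centres gains one power; hence only differences of \<open>- \<Delta>u\<close>
  are recovered, and the free constant is what lets a quadratic polynomial in. Nothing is proved
  about derivatives or asymptotics of the logarithmic potential: its Laplacian is used through
  weighted ball averages, and the Pohozaev identity integrates by parts against the kernel under a
  cutoff, after which symmetrising in the two variables keeps everything bounded. In the moving
  spheres a positive kernel replaces the maximum principle: a set of small measure on which the
  comparison with the reflected function fails must be empty, and this gives both the start and the
  continuation. The value 2 * pi^2 is where V / pi^2 equals the coefficient 2 of the logarithm in
  the conformal factor of an inversion, so that the integral equation becomes invariant.\<close>

lemma continuous_on_compact_abs_le: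
  fixes f :: "'a::topological_space \<Rightarrow> real"
  assumes "continuous_on S f" "compact S"
  obtains B where "B \<ge> 0" "\<And>x. x \<in> S \<Longrightarrow> \<bar>f x\<bar> \<le> B"
proof -
  have "bounded (f ` S)"
    using assms by (intro compact_imp_bounded compact_continuous_image)
  then obtain B where "\<forall>x\<in>S. \<bar>f x\<bar> \<le> B"
    by (auto simp: bounded_iff)
  then have "max B 0 \<ge> 0" "\<And>x. x \<in> S \<Longrightarrow> \<bar>f x\<bar> \<le> max B 0"
    by force+
  then show thesis by (rule that)
qed

lemma borel_measurable_cis [measurable]: "cis \<in> borel_measurable borel"
  by (intro borel_measurable_continuous_onI continuous_intros)

lemma integrable_continuous_compact_support:
  fixes g :: "'a::euclidean_space \<Rightarrow> real"
  assumes "continuous_on UNIV g" "\<And>x. norm x > R \<Longrightarrow> g x = 0"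
  shows "integrable lborel g"
proof -
  have "integrable lborel (\<lambda>x. indicator (cball 0 R) x *\<^sub>R g x)"
    by (intro borel_integrable_compact continuous_on_subset[OF assms(1)]) auto
  also have "(\<lambda>x. indicator (cball 0 R) x *\<^sub>R g x) = g"
    using assms(2) by (auto simp: indicator_def fun_eq_iff)
  finally show ?thesis .
qed

text \<open>The zero set is closed and has full measure; its complement is open and null, hence
  empty.\<close>

lemma integral_eq_0_continuous:
  fixes g :: "'a::euclidean_space \<Rightarrow> real"
  assumes g: "continuous_on UNIV g" "\<And>x. 0 \<le> g x" "integrable lborel g" and z: "(\<integral>x. g x \<partial>lborel) = 0"
  shows "g x = 0"
proof -
  have "AE x in lborel. g x = 0" using z by (subst (asm) integral_nonneg_eq_0_iff_AE) (use g in auto)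
  then have "AE x in lebesgue. x \<in> {x. g x = 0}" by (simp add: AE_completion)
  moreover have "closed {x. g x = 0}"
    using continuous_closed_preimage_constant[of UNIV g 0] g(1) by simp
  ultimately have "x \<in> {x. g x = 0}" by (intro mem_closed_if_AE_lebesgue)
  then show ?thesis by simp
qed

text \<open>Reduces the kernel 1 / s, which comes from differentiating the logarithm, to the inverse
  square kernel, for which integrability is available.\<close>

lemma inverse_le_one_plus_inverse_square: "1 / s \<le> 1 + 1 / s\<^sup>2" if "s > 0" for s :: real
proof -
  have "0 \<le> (1 - 1 / s)\<^sup>2" by simp
  moreover have "0 \<le> 1 / s" using that by simp
  moreover have "(1 - 1 / s)\<^sup>2 = 1 - 2 * (1 / s) + 1 / s\<^sup>2" by (simp add: power2_eq_square algebra_simps)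
  ultimately show ?thesis by linarith
qed

section \<open>Affine changes of variables\<close>

lemma nn_integral_affine:
  fixes f :: "'a::euclidean_space \<Rightarrow> ennreal"
  assumes [measurable]: "f \<in> borel_measurable borel" and c: "c \<noteq> 0"
  shows "(\<integral>\<^sup>+x. f x \<partial>lborel) = ennreal (\<bar>c\<bar> ^ DIM('a)) * (\<integral>\<^sup>+x. f (t + c *\<^sub>R x) \<partial>lborel)"
  by (subst lborel_affine[OF c, of t])
     (simp add: nn_integral_density nn_integral_distr nn_integral_cmult)

lemma integrable_affine:
  fixes f :: "'a::euclidean_space \<Rightarrow> 'b::{banach, second_countable_topology}"
  assumes f: "integrable lborel f" and c: "c \<noteq> 0"
  shows "integrable lborel (\<lambda>x. f (t + c *\<^sub>R x))"
  using f f[THEN borel_measurable_integrable] c unfolding integrable_iff_bounded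
  by (subst (asm) nn_integral_affine[where c=c and t=t]) (auto simp: ennreal_mult_less_top)

lemma integrable_affine_iff:
  fixes f :: "'a::euclidean_space \<Rightarrow> 'b::{banach, second_countable_topology}"
  assumes c: "c \<noteq> 0"
  shows "integrable lborel (\<lambda>x. f (t + c *\<^sub>R x)) \<longleftrightarrow> integrable lborel f"
  using integrable_affine[of f c t] integrable_affine[of "\<lambda>x. f (t + c *\<^sub>R x)" "1/c" "-(1/c) *\<^sub>R t"] c
  by (auto simp: algebra_simps)

lemma integral_affine:
  fixes f :: "'a::euclidean_space \<Rightarrow> 'b::{banach, second_countable_topology}"
  assumes c: "c \<noteq> 0"
  shows "(\<integral>x. f (t + c *\<^sub>R x) \<partial>lborel) = (\<integral>x. f x \<partial>lborel) /\<^sub>R (\<bar>c\<bar> ^ DIM('a))"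
proof cases
  assume f: "integrable lborel f"
  note [measurable] = f[THEN borel_measurable_integrable]
  have "(\<integral>x. f x \<partial>lborel) = (\<bar>c\<bar> ^ DIM('a)) *\<^sub>R (\<integral>x. f (t + c *\<^sub>R x) \<partial>lborel)"
    using integrable_affine[OF f c, of t]
    by (subst lborel_affine[OF c, of t]) (simp add: integral_density integral_distr)
  then show ?thesis using c by simp
next
  assume "\<not> integrable lborel f"
  then show ?thesis using c by (simp add: integrable_affine_iff not_integrable_integral_eq)
qed

lemma integrable_translate_iff:
  fixes f :: "'a::euclidean_space \<Rightarrow> 'b::{banach, second_countable_topology}"
  shows "integrable lborel (\<lambda>x. f (t + x)) \<longleftrightarrow> integrable lborel f"
  using integrable_affine_iff[of 1 f t] by simp

lemma integral_translate:
  fixes f :: "'a::euclidean_space \<Rightarrow> 'b::{banach, second_countable_topology}"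
  shows "(\<integral>x. f (t + x) \<partial>lborel) = (\<integral>x. f x \<partial>lborel)"
  using integral_affine[of 1 f t] by simp

lemma integrable_reflect_iff:
  fixes f :: "'a::euclidean_space \<Rightarrow> 'b::{banach, second_countable_topology}"
  shows "integrable lborel (\<lambda>x. f (t - x)) \<longleftrightarrow> integrable lborel f"
  using integrable_affine_iff[of "-1" f t] by simp

lemma integral_reflect:
  fixes f :: "'a::euclidean_space \<Rightarrow> 'b::{banach, second_countable_topology}"
  shows "(\<integral>x. f (t - x) \<partial>lborel) = (\<integral>x. f x \<partial>lborel)"
  using integral_affine[of "-1" f t] by simp

section \<open>Fourier transforms of Gaussians\<close>

lemma
  fixes F :: "'a::euclidean_space \<Rightarrow> real \<Rightarrow> 'b::{real_normed_field, banach, second_countable_topology}"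
  assumes F: "\<And>b. b \<in> Basis \<Longrightarrow> integrable lborel (F b)"
  shows integrable_prod_Basis: "integrable lborel (\<lambda>x::'a. \<Prod>b\<in>Basis. F b (x \<bullet> b))"
    and integral_prod_Basis:
      "(\<integral>(x::'a). (\<Prod>b\<in>Basis. F b (x \<bullet> b)) \<partial>lborel) = (\<Prod>b\<in>Basis. \<integral>t. F b t \<partial>lborel)"
proof -
  interpret product_sigma_finite "\<lambda>_::'a. lborel :: real measure" ..
  have [measurable]: "F b \<in> borel_measurable borel" if "b \<in> Basis" for b
    using F[OF that] by (auto dest: borel_measurable_integrable)
  have m: "(\<lambda>x::'a. \<Prod>b\<in>Basis. F b (x \<bullet> b)) \<in> borel_measurable borel"
    by measurable
  have T: "(\<lambda>f. \<Sum>b\<in>Basis. f b *\<^sub>R b) \<in> measurable (\<Pi>\<^sub>M b\<in>Basis. (lborel::real measure)) (borel::'a measure)"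
    by measurable
  have eq: "(\<Prod>b\<in>Basis. F b ((\<Sum>b\<in>Basis. f b *\<^sub>R b) \<bullet> b)) = (\<Prod>b\<in>Basis. F b (f b))" for f
    by (intro prod.cong refl) (simp add: inner_sum_left_Basis)
  show "integrable lborel (\<lambda>x::'a. \<Prod>b\<in>Basis. F b (x \<bullet> b))"
    apply (subst lborel_eq)
    apply (subst integrable_distr_eq[OF T m])
    unfolding eq by (intro product_integrable_prod F) auto
  show "(\<integral>(x::'a). (\<Prod>b\<in>Basis. F b (x \<bullet> b)) \<partial>lborel) = (\<Prod>b\<in>Basis. \<integral>t. F b t \<partial>lborel)"
    apply (subst lborel_eq)
    apply (subst integral_distr[OF T m])
    unfolding eq by (intro product_integral_prod F) auto
qed

text \<open>The characteristic function of the standard normal distribution, rescaled by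
  \<open>sqrt (2 * t)\<close>, which turns the exponent - x^2 / 2 into - t * x^2.\<close>

lemma
  fixes t s :: real
  assumes t: "t > 0"
  shows integrable_cis_gaussian_real: "integrable lborel (\<lambda>x. cis (s * x) * complex_of_real (exp (- t * x\<^sup>2)))"
    and integral_cis_gaussian_real: "(\<integral>x. cis (s * x) * complex_of_real (exp (- t * x\<^sup>2)) \<partial>lborel)
      = complex_of_real (sqrt (pi / t) * exp (- s\<^sup>2 / (4 * t)))"
proof -
  define c where "c = sqrt (2 * t)"
  have c: "c > 0" "c\<^sup>2 = 2 * t" using t by (auto simp: c_def)
  let ?g = "\<lambda>x. std_normal_density x *\<^sub>R cis (s / c * x)"
  have i0: "integrable lborel ?g"
    by (rule Bochner_Integration.integrable_bound[OF integrable_normal_density[where \<mu>=0 and \<sigma>=1]]) auto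
  have "char std_normal_distribution (s / c) = (\<integral>x. ?g x \<partial>lborel)"
    unfolding char_def by (subst integral_density) (auto simp: cis_conv_exp)
  then have v: "(\<integral>x. ?g x \<partial>lborel) = complex_of_real (exp (- (s/c)\<^sup>2 / 2))"
    by (simp add: char_std_normal_distribution)
  have eq: "?g (0 + c * x) = complex_of_real (1 / sqrt (2 * pi)) * (cis (s * x) * complex_of_real (exp (- t * x\<^sup>2)))" for x
    using c by (simp add: std_normal_density_def scaleR_conv_of_real power_mult_distrib mult_ac)
  have "integrable lborel (\<lambda>x. ?g (0 + c * x))"
    using lborel_integrable_real_affine[OF i0, of c 0] c by simp
  then have "integrable lborel (\<lambda>x. complex_of_real (sqrt (2 * pi)) * ?g (0 + c * x))"
    by (intro integrable_mult_right)
  also have "(\<lambda>x. complex_of_real (sqrt (2 * pi)) * ?g (0 + c * x)) = (\<lambda>x. cis (s * x) * complex_of_real (exp (- t * x\<^sup>2)))"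
    unfolding eq by (auto simp: fun_eq_iff simp flip: of_real_mult mult.assoc)
  finally show "integrable lborel (\<lambda>x. cis (s * x) * complex_of_real (exp (- t * x\<^sup>2)))" .
  have "(\<integral>x. ?g x \<partial>lborel) = \<bar>c\<bar> *\<^sub>R (\<integral>x. ?g (0 + c * x) \<partial>lborel)"
    using c by (intro lborel_integral_real_affine) auto
  also have "\<dots> = complex_of_real (c / sqrt (2 * pi)) * (\<integral>x. cis (s * x) * complex_of_real (exp (- t * x\<^sup>2)) \<partial>lborel)"
    unfolding eq using c by (simp add: scaleR_conv_of_real)
  finally have "(\<integral>x. cis (s * x) * complex_of_real (exp (- t * x\<^sup>2)) \<partial>lborel) =
     complex_of_real (sqrt (2 * pi) / c * exp (- (s/c)\<^sup>2 / 2))"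
    using c v by (simp add: field_simps)
  also have "sqrt (2 * pi) / c = sqrt (pi / t)"
    by (simp add: c_def real_sqrt_divide[symmetric])
  also have "- (s/c)\<^sup>2 / 2 = - s\<^sup>2 / (4 * t)" using c by (simp add: power_divide)
  finally show "(\<integral>x. cis (s * x) * complex_of_real (exp (- t * x\<^sup>2)) \<partial>lborel)
      = complex_of_real (sqrt (pi / t) * exp (- s\<^sup>2 / (4 * t)))" .
qed

text \<open>Gaussian and character both factor over the coordinates, so the integral is a product of
  integrals on the line.\<close>

lemma
  fixes \<xi> :: "'a::euclidean_space"
  assumes t: "t > 0"
  shows integrable_cis_gaussian: "integrable lborel (\<lambda>x. cis (\<xi> \<bullet> x) * complex_of_real (exp (- t * (norm x)\<^sup>2)))"
    and integral_cis_gaussian: "(\<integral>x. cis (\<xi> \<bullet> x) * complex_of_real (exp (- t * (norm x)\<^sup>2)) \<partial>lborel)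
      = complex_of_real (sqrt (pi / t) ^ DIM('a) * exp (- (norm \<xi>)\<^sup>2 / (4 * t)))"
proof -
  let ?F = "\<lambda>b x. cis ((\<xi> \<bullet> b) * x) * complex_of_real (exp (- t * x\<^sup>2))"
  have cs: "cis (\<Sum>b\<in>A. f b) = (\<Prod>b\<in>A. cis (f b))" for f :: "'a \<Rightarrow> real" and A
    by (induction A rule: infinite_finite_induct) (auto simp: cis_mult[symmetric])
  have nn: "(norm x)\<^sup>2 = (\<Sum>b\<in>Basis. (x \<bullet> b)\<^sup>2)" for x :: 'a
    unfolding power2_norm_eq_inner by (subst euclidean_inner) (simp add: power2_eq_square)
  have eq: "cis (\<xi> \<bullet> x) * complex_of_real (exp (- t * (norm x)\<^sup>2)) = (\<Prod>b\<in>Basis. ?F b (x \<bullet> b))" for x :: 'a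
  proof -
    have "exp (- t * (norm x)\<^sup>2) = (\<Prod>b\<in>Basis. exp (- t * (x \<bullet> b)\<^sup>2))"
      unfolding nn by (simp add: sum_distrib_left exp_sum flip: sum_negf)
    moreover have "cis (\<xi> \<bullet> x) = (\<Prod>b\<in>Basis. cis ((\<xi> \<bullet> b) * (x \<bullet> b)))"
      unfolding euclidean_inner[of \<xi> x] cs ..
    ultimately show ?thesis by (simp add: prod.distrib)
  qed
  show "integrable lborel (\<lambda>x. cis (\<xi> \<bullet> x) * complex_of_real (exp (- t * (norm x)\<^sup>2)))"
    unfolding eq by (intro integrable_prod_Basis integrable_cis_gaussian_real t)
  have "(\<integral>x. cis (\<xi> \<bullet> x) * complex_of_real (exp (- t * (norm x)\<^sup>2)) \<partial>lborel)
     = (\<Prod>b\<in>Basis. complex_of_real (sqrt (pi / t) * exp (- (\<xi> \<bullet> b)\<^sup>2 / (4 * t))))"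
    unfolding eq by (subst integral_prod_Basis)
      (auto intro!: integrable_cis_gaussian_real t prod.cong simp only: integral_cis_gaussian_real[OF t])
  also have "\<dots> = complex_of_real (sqrt (pi / t) ^ DIM('a) * (\<Prod>b\<in>(Basis::'a set). exp (- (\<xi> \<bullet> b)\<^sup>2 / (4 * t))))"
    by (simp add: prod.distrib)
  also have "(\<Prod>b\<in>(Basis::'a set). exp (- (\<xi> \<bullet> b)\<^sup>2 / (4 * t))) = exp (- (norm \<xi>)\<^sup>2 / (4 * t))"
    unfolding nn by (simp add: sum_divide_distrib exp_sum flip: sum_negf)
  finally show "(\<integral>x. cis (\<xi> \<bullet> x) * complex_of_real (exp (- t * (norm x)\<^sup>2)) \<partial>lborel)
      = complex_of_real (sqrt (pi / t) ^ DIM('a) * exp (- (norm \<xi>)\<^sup>2 / (4 * t)))" .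
qed

lemma
  assumes t: "t > 0"
  shows integrable_gaussian: "integrable lborel (\<lambda>x::'a::euclidean_space. exp (- t * (norm x)\<^sup>2))"
    and integral_gaussian: "(\<integral>(x::'a). exp (- t * (norm x)\<^sup>2) \<partial>lborel) = sqrt (pi / t) ^ DIM('a)"
proof -
  from integrable_cis_gaussian[OF t, of "0::'a"]
  show i: "integrable lborel (\<lambda>x::'a. exp (- t * (norm x)\<^sup>2))"
    by (simp add: complex_of_real_integrable_eq)
  from integral_cis_gaussian[OF t, of "0::'a"]
  have "complex_of_real (\<integral>(x::'a). exp (- t * (norm x)\<^sup>2) \<partial>lborel) = complex_of_real (sqrt (pi / t) ^ DIM('a))"
    by (simp del: of_real_power)
  then show "(\<integral>(x::'a). exp (- t * (norm x)\<^sup>2) \<partial>lborel) = sqrt (pi / t) ^ DIM('a)"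
    by (simp only: of_real_eq_iff)
qed


text \<open>Local integrability of the inverse square without polar coordinates: with r = |x|^2, the
  quotient exp (- r) / r is the integral of exp (- t * r) over t \<ge> 1. Tonelli then leaves the
  integral of (pi / t)^(3/2) over t \<ge> 1, which is finite.\<close>

lemma integrable_gaussian_div_norm_sq:
  "integrable lborel (\<lambda>x::real^3. exp (- (norm x)\<^sup>2) / (norm x)\<^sup>2)"
proof -
  have "(\<integral>\<^sup>+(x::real^3). ennreal (exp (- (norm x)\<^sup>2) / (norm x)\<^sup>2) \<partial>lborel) =
        (\<integral>\<^sup>+(x::real^3). (\<integral>\<^sup>+t. ennreal (exp (- t * (norm x)\<^sup>2)) * indicator {1..} t \<partial>lborel) \<partial>lborel)"
  proof (rule nn_integral_cong_AE, rule AE_mp[OF AE_lborel_singleton[of 0]], intro AE_I2 impI)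
    fix x :: "real^3" assume x: "x \<noteq> 0"
    have "(\<integral>\<^sup>+t. ennreal (exp (- t * (norm x)\<^sup>2)) * indicator {1..} t \<partial>lborel)
       = ennreal (0 - (- exp (- 1 * (norm x)\<^sup>2) / (norm x)\<^sup>2))"
    proof (rule nn_integral_FTC_atLeast)
      show "((\<lambda>t. - exp (- t * (norm x)\<^sup>2) / (norm x)\<^sup>2) \<longlongrightarrow> 0) at_top"
        using x by real_asymp
      show "DERIV (\<lambda>t. - exp (- t * (norm x)\<^sup>2) / (norm x)\<^sup>2) t :> exp (- t * (norm x)\<^sup>2)" for t
        using x by (auto intro!: derivative_eq_intros simp: power4_eq_xxxx power2_eq_square)
    qed auto
    then show "ennreal (exp (- (norm x)\<^sup>2) / (norm x)\<^sup>2) = (\<integral>\<^sup>+t. ennreal (exp (- t * (norm x)\<^sup>2)) * indicator {1..} t \<partial>lborel)"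
      by simp
  qed
  also have "\<dots> = (\<integral>\<^sup>+t. (\<integral>\<^sup>+(x::real^3). ennreal (exp (- t * (norm x)\<^sup>2)) * indicator {1..} t \<partial>lborel) \<partial>lborel)"
    by (rule lborel_pair.Fubini') measurable
  also have "\<dots> = (\<integral>\<^sup>+t. ennreal (sqrt (pi / t) ^ 3) * indicator {1..} t \<partial>lborel)"
  proof (rule nn_integral_cong)
    fix t :: real
    show "(\<integral>\<^sup>+(x::real^3). ennreal (exp (- t * (norm x)\<^sup>2)) * indicator {1..} t \<partial>lborel) = ennreal (sqrt (pi / t) ^ 3) * indicator {1..} t"
    proof (cases "t \<ge> 1")
      case True
      then have "t > 0" by simp
      from integrable_gaussian[OF this, where 'a="real^3"] integral_gaussian[OF this, where 'a="real^3"] True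
      show ?thesis by (simp add: nn_integral_eq_integral)
    qed simp
  qed
  also have "\<dots> = ennreal (0 - (- 2 * sqrt pi ^ 3 / sqrt 1))"
  proof (rule nn_integral_FTC_atLeast)
    show "((\<lambda>t. - 2 * sqrt pi ^ 3 / sqrt t) \<longlongrightarrow> 0) at_top"
      by real_asymp
    show "DERIV (\<lambda>t. - 2 * sqrt pi ^ 3 / sqrt t) t :> sqrt (pi / t) ^ 3" if "1 \<le> t" for t
    proof -
      have "sqrt (pi / t) ^ 3 = sqrt pi ^ 3 / (sqrt t ^ 2 * sqrt t)"
        by (simp add: real_sqrt_divide power_divide power3_eq_cube power2_eq_square)
      then show ?thesis using that
        by (auto intro!: derivative_eq_intros simp: field_simps)
    qed
  qed auto
  finally have "(\<integral>\<^sup>+(x::real^3). ennreal (exp (- (norm x)\<^sup>2) / (norm x)\<^sup>2) \<partial>lborel) < \<infinity>"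
    by (simp only:) (simp add: ennreal_less_top)
  then show ?thesis
    by (intro integrableI_bounded) auto
qed

text \<open>On the ball of radius R the factor exp (R^2) * exp (- |x|^2) is at least 1, so the
  Gaussian version dominates.\<close>

lemma integrable_indicator_div_norm_sq:
  "integrable lborel (\<lambda>x::real^3. indicator (cball 0 R) x / (norm x)\<^sup>2)"
proof (rule Bochner_Integration.integrable_bound)
  have [measurable]: "cball (0::real^3) R \<in> sets borel" by simp
  show "(\<lambda>x::real^3. indicator (cball 0 R) x / (norm x)\<^sup>2) \<in> borel_measurable lborel"
    by measurable
  show "integrable lborel (\<lambda>x::real^3. exp (R\<^sup>2) * (exp (- (norm x)\<^sup>2) / (norm x)\<^sup>2))"
    by (intro integrable_mult_right integrable_gaussian_div_norm_sq)
  have *: "exp (R\<^sup>2) * exp (- (norm x)\<^sup>2) \<ge> 1" if "norm x \<le> R" for x :: "real^3"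
    using power_mono[OF that, of 2] by (simp flip: exp_add)
  show "AE x::real^3 in lborel. norm (indicator (cball 0 R) x / (norm x)\<^sup>2) \<le>
     norm (exp (R\<^sup>2) * (exp (- (norm x)\<^sup>2) / (norm x)\<^sup>2))"
    using * by (intro AE_I2) (auto split: split_indicator intro!: divide_right_mono)
qed

text \<open>Continuity bounds \<open>\<rho>\<close> on the unit ball around x, where the kernel is
  singular; elsewhere the kernel is at most 1. No global bound on \<open>\<rho>\<close>
  enters.\<close>

lemma integrable_div_dist_sq:
  fixes \<rho> :: "real^3 \<Rightarrow> real"
  assumes \<rho>: "integrable lborel \<rho>" and c: "continuous_on UNIV \<rho>"
  shows "integrable lborel (\<lambda>y. \<rho> y / (norm (x - y))\<^sup>2)"
proof -
  have [measurable]: "\<rho> \<in> borel_measurable borel" using \<rho> by auto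
  obtain B where B: "\<And>y. y \<in> cball x 1 \<Longrightarrow> \<bar>\<rho> y\<bar> \<le> B"
    by (rule continuous_on_compact_abs_le[OF continuous_on_subset[OF c], of "cball x 1"]) auto
  show ?thesis
  proof (rule Bochner_Integration.integrable_bound)
    have "integrable lborel (\<lambda>y. indicator (cball 0 1) (x - y) / (norm (x - y))\<^sup>2)"
      using integrable_reflect_iff[of "\<lambda>z. indicator (cball 0 1) z / (norm z)\<^sup>2" x] integrable_indicator_div_norm_sq[of 1]
      by simp
    then show "integrable lborel (\<lambda>y. B * (indicator (cball 0 1) (x - y) / (norm (x - y))\<^sup>2) + \<bar>\<rho> y\<bar>)"
      using \<rho> by (intro Bochner_Integration.integrable_add integrable_mult_right integrable_abs)
    show "AE y in lborel. norm (\<rho> y / (norm (x - y))\<^sup>2) \<le> norm (B * (indicator (cball 0 1) (x - y) / (norm (x - y))\<^sup>2) + \<bar>\<rho> y\<bar>)"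
    proof (intro AE_I2)
      fix y
      show "norm (\<rho> y / (norm (x - y))\<^sup>2) \<le> norm (B * (indicator (cball 0 1) (x - y) / (norm (x - y))\<^sup>2) + \<bar>\<rho> y\<bar>)"
      proof (cases "norm (x - y) \<le> 1")
        case True
        then have "\<bar>\<rho> y\<bar> \<le> B" by (intro B) (simp add: dist_norm)
        then have "\<bar>\<rho> y\<bar> / (norm (x - y))\<^sup>2 \<le> B / (norm (x - y))\<^sup>2" by (intro divide_right_mono) auto
        then show ?thesis using True by simp
      next
        case False
        then have "1 \<le> (norm (x - y))\<^sup>2" by simp
        then have "\<bar>\<rho> y\<bar> / (norm (x - y))\<^sup>2 \<le> \<bar>\<rho> y\<bar> / 1" by (intro divide_left_mono) auto
        with False show ?thesis by (simp add: indicator_def)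
      qed
    qed
  qed measurable
qed

text \<open>Translation invariance makes every difference quotient integrate to zero. The mean value
  theorem dominates the quotients, so the statement passes to the limit.\<close>

lemma integral_directional_derivative_eq_0:
  fixes F :: "'a::euclidean_space \<Rightarrow> real"
  assumes F: "\<And>x. (F has_derivative F' x) (at x)" and c: "continuous_on UNIV (\<lambda>x. F' x a)"
    and z: "\<And>x. norm x > R \<Longrightarrow> F x = 0"
  shows "(\<integral>x. F' x a \<partial>lborel) = 0"
proof -
  define q where "q n x = (F (x + a /\<^sub>R real (Suc n)) - F x) * real (Suc n)" for n x
  have cF: "continuous_on UNIV F"
    by (rule has_derivative_continuous_on[where f'=F']) (simp add: F)
  have [measurable]: "F \<in> borel_measurable borel" "(\<lambda>x. F' x a) \<in> borel_measurable borel"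
    using cF c by (auto intro!: borel_measurable_continuous_onI)
  \<comment> \<open>Large enough to contain the intermediate point of the mean value theorem for
    every quotient that does not vanish.\<close>
  let ?S = "cball (0::'a) (\<bar>R\<bar> + 1 + 2 * norm a)"
  obtain B where B: "\<And>y. y \<in> ?S \<Longrightarrow> \<bar>F' y a\<bar> \<le> B"
    by (rule continuous_on_compact_abs_le[OF continuous_on_subset[OF c], of ?S]) auto
  have iF: "integrable lborel F"
    by (rule integrable_continuous_compact_support[OF cF, of "\<bar>R\<bar>"]) (use z in auto)
  have I0: "(\<integral>x. q n x \<partial>lborel) = 0" for n
    using iF unfolding q_def
    by (simp add: integrable_translate_iff integral_translate add.commute[of _ "a /\<^sub>R _"])
  have MVT: "\<exists>\<theta>\<in>{0..1}. q n x = F' (x + \<theta> *\<^sub>R (a /\<^sub>R real (Suc n))) a" for n x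
  proof -
    have lin: "linear (F' y)" for y using F has_derivative_linear by blast
    let ?b = "a /\<^sub>R real (Suc n)"
    have "\<exists>\<theta>. 0 < \<theta> \<and> \<theta> < 1 \<and> F (x + 1 *\<^sub>R ?b) - F (x + 0 *\<^sub>R ?b) = (1 - 0) * F' (x + \<theta> *\<^sub>R ?b) ?b"
    proof (rule MVT2)
      fix \<theta> :: real
      have "((\<lambda>\<theta>. F (x + \<theta> *\<^sub>R ?b)) has_derivative (\<lambda>h. F' (x + \<theta> *\<^sub>R ?b) (h *\<^sub>R ?b))) (at \<theta>)"
        by (rule has_derivative_compose[OF _ F, where f="\<lambda>\<theta>. x + \<theta> *\<^sub>R ?b"]) (auto intro!: derivative_eq_intros)
      then show "((\<lambda>\<theta>. F (x + \<theta> *\<^sub>R ?b)) has_real_derivative F' (x + \<theta> *\<^sub>R ?b) ?b) (at \<theta>)"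
        unfolding has_field_derivative_def
        by (rule has_derivative_eq_rhs) (auto simp: linear_scale[OF lin] fun_eq_iff)
    qed simp
    then obtain \<theta> where "0 < \<theta>" "\<theta> < 1" "F (x + ?b) - F x = F' (x + \<theta> *\<^sub>R ?b) ?b" by auto
    moreover have "F' (x + \<theta> *\<^sub>R ?b) ?b * real (Suc n) = F' (x + \<theta> *\<^sub>R ?b) a"
      by (simp add: linear_scale[OF lin] del: of_nat_Suc)
    ultimately show ?thesis unfolding q_def by (intro bexI[of _ \<theta>]) auto
  qed
  have small: "norm (\<theta> *\<^sub>R (a /\<^sub>R real (Suc n))) \<le> norm a" if "\<theta> \<in> {0..1}" for \<theta> n
  proof -
    have "norm (\<theta> *\<^sub>R (a /\<^sub>R real (Suc n))) = (\<theta> / real (Suc n)) * norm a" using that by (simp add: divide_inverse)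
    also have "\<dots> \<le> 1 * norm a" using that by (intro mult_right_mono) (auto simp: divide_le_eq)
    finally show ?thesis by simp
  qed
  have "(\<lambda>n. \<integral>x. q n x \<partial>lborel) \<longlonglongrightarrow> (\<integral>x. F' x a \<partial>lborel)"
  proof (rule integral_dominated_convergence[where w="\<lambda>x. B * indicator ?S x"])
    show "integrable lborel (\<lambda>x. B * indicator ?S x)"
      by (intro integrable_mult_right integrable_real_indicator emeasure_lborel_cball_finite) auto
    show "AE x in lborel. (\<lambda>n. q n x) \<longlonglongrightarrow> F' x a"
    proof (intro AE_I2)
      fix x
      obtain \<theta> where \<theta>: "\<And>n. \<theta> n \<in> {0..1}" "\<And>n. q n x = F' (x + \<theta> n *\<^sub>R (a /\<^sub>R real (Suc n))) a"
        using MVT[of _ x] by metis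
      have t0: "(\<lambda>n. \<theta> n *\<^sub>R (a /\<^sub>R real (Suc n))) \<longlonglongrightarrow> 0"
      proof (rule Lim_null_comparison)
        show "\<forall>\<^sub>F n in sequentially. norm (\<theta> n *\<^sub>R (a /\<^sub>R real (Suc n))) \<le> norm a / real (Suc n)"
        proof (intro always_eventually allI)
          fix n
          have "norm (\<theta> n *\<^sub>R (a /\<^sub>R real (Suc n))) = \<theta> n * (norm a / real (Suc n))" using \<theta>(1)[of n] by (simp add: divide_inverse)
          also have "\<dots> \<le> 1 * (norm a / real (Suc n))" using \<theta>(1)[of n] by (intro mult_right_mono) auto
          finally show "norm (\<theta> n *\<^sub>R (a /\<^sub>R real (Suc n))) \<le> norm a / real (Suc n)" by simp
        qed
        show "(\<lambda>n. norm a / real (Suc n)) \<longlonglongrightarrow> 0" by real_asymp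
      qed
      have "isCont (\<lambda>x. F' x a) x" using c by (simp add: continuous_on_eq_continuous_at)
      moreover have "(\<lambda>n. x + \<theta> n *\<^sub>R (a /\<^sub>R real (Suc n))) \<longlonglongrightarrow> x"
        using tendsto_add[OF tendsto_const[of x] t0] by simp
      ultimately have "(\<lambda>n. F' (x + \<theta> n *\<^sub>R (a /\<^sub>R real (Suc n))) a) \<longlonglongrightarrow> F' x a"
        by (rule isCont_tendsto_compose)
      then show "(\<lambda>n. q n x) \<longlonglongrightarrow> F' x a" unfolding \<theta>(2) .
    qed
    fix n
    show "AE x in lborel. norm (q n x) \<le> B * indicator ?S x"
    proof (intro AE_I2)
      fix x
      show "norm (q n x) \<le> B * indicator ?S x"
      proof (cases "norm x \<le> \<bar>R\<bar> + 1 + norm a")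
        case True
        obtain \<theta> where \<theta>: "\<theta> \<in> {0..1}" "q n x = F' (x + \<theta> *\<^sub>R (a /\<^sub>R real (Suc n))) a"
          using MVT by metis
        have "x + \<theta> *\<^sub>R (a /\<^sub>R real (Suc n)) \<in> ?S"
          using norm_triangle_ineq[of x "\<theta> *\<^sub>R (a /\<^sub>R real (Suc n))"] small[OF \<theta>(1), of n] True by simp
        moreover have "x \<in> ?S" using True norm_ge_zero[of a] by (simp del: norm_ge_zero)
        ultimately show ?thesis using B \<theta>(2) by simp
      next
        case False
        have "norm (a /\<^sub>R real (Suc n)) \<le> norm a" using small[of 1 n] by simp
        then have "norm (x + a /\<^sub>R real (Suc n)) > R" using norm_diff_ineq[of x "a /\<^sub>R real (Suc n)"] False by linarith
        moreover have "norm x > R" using False norm_ge_zero[of a] by linarith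
        moreover have "0 \<le> B" using B[of 0] by (simp add: order_trans[OF abs_ge_zero])
        ultimately show ?thesis by (simp add: q_def z)
      qed
    qed
  qed (auto simp: q_def)
  then show ?thesis unfolding I0 by (simp add: LIMSEQ_const_iff)
qed

lemma integral_divergence_eq_0:
  fixes F :: "'a::euclidean_space \<Rightarrow> 'a"
  assumes F: "\<And>x. (F has_derivative F' x) (at x)" and c: "\<And>b. b \<in> Basis \<Longrightarrow> continuous_on UNIV (\<lambda>x. F' x b \<bullet> b)"
    and z: "\<And>x. norm x > R \<Longrightarrow> F x = 0"
  shows "(\<integral>x. (\<Sum>b\<in>Basis. F' x b \<bullet> b) \<partial>lborel) = 0"
proof -
  have d: "((\<lambda>x. F x \<bullet> b) has_derivative (\<lambda>h. F' x h \<bullet> b)) (at x)" for x b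
    using F by (auto intro!: derivative_eq_intros)
  have z': "F' x b = 0" if "norm x > R" for x b
  proof -
    have "(F has_derivative (\<lambda>_. 0)) (at x)"
    proof (rule has_derivative_transform_within_open[of "\<lambda>_. 0" _ _ _ "- cball 0 R"])
      show "x \<in> - cball 0 R" using that by simp
    qed (use z in auto)
    with F[of x] have "F' x = (\<lambda>_. 0)" by (rule has_derivative_unique)
    then show ?thesis by simp
  qed
  have i: "integrable lborel (\<lambda>x. F' x b \<bullet> b)" if "b \<in> Basis" for b
    by (rule integrable_continuous_compact_support[OF c[OF that], of R]) (simp add: z')
  have "(\<integral>x. F' x b \<bullet> b \<partial>lborel) = 0" if "b \<in> Basis" for b
    by (rule integral_directional_derivative_eq_0[OF d c[OF that], where R=R]) (simp add: z)
  then show ?thesis using i by simp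
qed

subsection \<open>Smooth functions and weak derivatives\<close>

lemma partial_eq:
  assumes "(f has_derivative f') (at x)"
  shows "partial k f x = f' (axis k 1)"
  unfolding partial_def using frechet_derivative_at[OF assms] by simp

lemma smooth_partials:
  assumes "smooth f"
  shows "smooth (partials \<alpha> f)"
proof -
  have "partials \<beta> (partials \<alpha> f) = partials (\<beta> @ \<alpha>) f" for \<beta>
    by (induction \<beta>) auto
  then show ?thesis using assms by (simp add: smooth_def)
qed

lemma smooth_partial: "smooth f \<Longrightarrow> smooth (partial i f)"
  using smooth_partials[of f "[i]"] by simp

lemma smooth_continuous_on: "smooth f \<Longrightarrow> continuous_on S f"
  unfolding smooth_def using differentiable_imp_continuous_on[of "partials [] f" UNIV]
  by (metis continuous_on_subset partials.simps(1) subset_UNIV)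

lemma smooth_has_derivative:
  fixes f :: "real^'n::finite \<Rightarrow> 'b::real_normed_vector"
  assumes "smooth f"
  shows "(f has_derivative (\<lambda>h. \<Sum>i\<in>UNIV. h $ i *\<^sub>R partial i f x)) (at x)"
proof -
  have "f differentiable_on UNIV" using assms unfolding smooth_def by (metis partials.simps(1))
  then have d: "(f has_derivative frechet_derivative f (at x)) (at x)"
    by (simp add: differentiable_on_def frechet_derivative_works)
  then have lin: "linear (frechet_derivative f (at x))" by (rule has_derivative_linear)
  have "frechet_derivative f (at x) = (\<lambda>h. \<Sum>i\<in>UNIV. h $ i *\<^sub>R partial i f x)"
  proof
    fix h :: "real^'n"
    have "h = (\<Sum>i\<in>UNIV. (h $ i) *\<^sub>R axis i 1)"
      by (simp add: vec_eq_iff axis_def if_distrib sum.delta cong: if_cong)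
    then have "frechet_derivative f (at x) h = frechet_derivative f (at x) (\<Sum>i\<in>UNIV. (h $ i) *\<^sub>R axis i 1)" by simp
    also have "\<dots> = (\<Sum>i\<in>UNIV. h $ i *\<^sub>R partial i f x)"
      by (simp add: linear_sum[OF lin] linear_scale[OF lin] partial_def)
    finally show "frechet_derivative f (at x) h = (\<Sum>i\<in>UNIV. h $ i *\<^sub>R partial i f x)" .
  qed
  with d show ?thesis by simp
qed

text \<open>Smoothness without a formula for iterated partials: it suffices to find a class of
  differentiable functions closed under \<open>partial\<close>. The bumps and the Gaussians below
  each come with such a class.\<close>

lemma smoothI_closed:
  assumes "f \<in> A" and d: "\<And>g. g \<in> A \<Longrightarrow> g differentiable_on UNIV" and p: "\<And>g k. g \<in> A \<Longrightarrow> partial k g \<in> A"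
  shows "partials \<alpha> f \<in> A" "smooth f"
proof -
  show *: "partials \<alpha> f \<in> A" for \<alpha>
    using assms(1) p by (induction \<alpha>) auto
  show "smooth f" unfolding smooth_def using * d by blast
qed

subsection \<open>Smooth bumps\<close>

text \<open>For \<open>p = 1\<close> this is the classical function exp (- c / s), flat at 0. The
  polynomial in 1 / s is carried along because it makes the family closed under
  differentiation.\<close>

definition flat :: "real \<Rightarrow> real poly \<Rightarrow> real \<Rightarrow> real" where
  "flat c p s = (if s > 0 then poly p (1 / s) * exp (- c / s) else 0)"

text \<open>Half of the exponent absorbs the extra factor u of the next coefficient and the other
  half serves the induction hypothesis; hence the induction is over all c.\<close>

lemma poly_times_exp_tendsto_0:
  fixes q :: "real poly"
  assumes "c > 0"
  shows "((\<lambda>u. poly q u * exp (- c * u)) \<longlongrightarrow> 0) at_top"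
  using assms
proof (induction q arbitrary: c)
  case 0
  then show ?case by simp
next
  case (pCons a q)
  have "((\<lambda>u. a * exp (- c * u)) \<longlongrightarrow> 0) at_top" "((\<lambda>u. u * exp (- (c/2) * u)) \<longlongrightarrow> 0) at_top"
    using pCons(3) by real_asymp+
  moreover have "((\<lambda>u. poly q u * exp (- (c/2) * u)) \<longlongrightarrow> 0) at_top"
    using pCons(2)[of "c/2"] pCons(3) by simp
  ultimately have "((\<lambda>u. a * exp (- c * u) + (u * exp (- (c/2) * u)) * (poly q u * exp (- (c/2) * u))) \<longlongrightarrow> 0 + 0 * 0) at_top"
    by (intro tendsto_add tendsto_mult)
  moreover have "a * exp (- c * u) + (u * exp (- (c/2) * u)) * (poly q u * exp (- (c/2) * u)) = poly (pCons a q) u * exp (- c * u)" for u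
  proof -
    have "exp (- (c/2) * u) * exp (- (c/2) * u) = exp (- c * u)" by (simp flip: exp_add)
    then show ?thesis by (simp add: algebra_simps)
  qed
  ultimately show ?case by simp
qed

lemma flat_has_derivative:
  assumes c: "c > 0"
  shows "(flat c p has_real_derivative flat c (monom 1 2 * (smult c p - pderiv p)) s) (at s)"
proof -
  consider "s > 0" | "s < 0" | "s = 0" by linarith
  then show ?thesis
  proof cases
    case 1
    have "((\<lambda>s. poly p (1 / s) * exp (- c / s)) has_real_derivative flat c (monom 1 2 * (smult c p - pderiv p)) s) (at s)"
      using 1 by (auto intro!: derivative_eq_intros DERIV_chain2[OF poly_DERIV] simp: flat_def poly_monom field_simps power2_eq_square)
    then show ?thesis
      by (rule has_field_derivative_transform_within_open[where S="{0<..}"]) (use 1 in \<open>auto simp: flat_def\<close>)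
  next
    case 2
    have "((\<lambda>_. 0) has_real_derivative flat c (monom 1 2 * (smult c p - pderiv p)) s) (at s)"
      using 2 by (auto intro!: derivative_eq_intros simp: flat_def)
    then show ?thesis
      by (rule has_field_derivative_transform_within_open[where S="{..<0}"]) (use 2 in \<open>auto simp: flat_def\<close>)
  next
    case 3
    have "((\<lambda>h. flat c p h / h) \<longlongrightarrow> 0) (at 0)"
    proof (rule filterlim_split_at)
      have "\<forall>\<^sub>F h in at_left (0::real). h < 0" by (simp add: eventually_at_filter)
      then show "((\<lambda>h. flat c p h / h) \<longlongrightarrow> 0) (at_left 0)"
        by (intro tendsto_eventually) (auto elim!: eventually_mono simp: flat_def)
      \<comment> \<open>Under u = 1 / h the division by h becomes a factor u, that is, a shift of
        the coefficients of p.\<close>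
      have "((\<lambda>u. poly (pCons 0 p) u * exp (- c * u)) \<longlongrightarrow> 0) at_top"
        by (rule poly_times_exp_tendsto_0[OF c])
      moreover have "\<forall>\<^sub>F u in at_top. poly (pCons 0 p) u * exp (- c * u) = flat c p (inverse u) / inverse u"
        using eventually_gt_at_top[of "0::real"] by eventually_elim (auto simp: flat_def divide_inverse)
      ultimately have "((\<lambda>u. flat c p (inverse u) / inverse u) \<longlongrightarrow> 0) at_top"
        by (simp cong: filterlim_cong)
      then show "((\<lambda>h. flat c p h / h) \<longlongrightarrow> 0) (at_right 0)"
        by (simp add: filterlim_at_right_to_top)
    qed
    then show ?thesis using 3 unfolding DERIV_def by (simp add: flat_def)
  qed
qed

text \<open>The algebra generated by flat functions of affine functions of one coordinate. It is
  closed under partial derivatives and is the class required by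
  \<open>smoothI_closed\<close>.\<close>

inductive bump_alg :: "real \<Rightarrow> (real^'n::finite \<Rightarrow> real) \<Rightarrow> bool" for c where
  flat: "bump_alg c (\<lambda>x. flat c p (\<sigma> * x $ i + \<tau>))"
| const: "bump_alg c (\<lambda>x. k)"
| add: "bump_alg c f \<Longrightarrow> bump_alg c g \<Longrightarrow> bump_alg c (\<lambda>x. f x + g x)"
| mult: "bump_alg c f \<Longrightarrow> bump_alg c g \<Longrightarrow> bump_alg c (\<lambda>x. f x * g x)"

lemma bump_alg_prod: "(\<And>i. i \<in> I \<Longrightarrow> bump_alg c (f i)) \<Longrightarrow> bump_alg c (\<lambda>x. \<Prod>i\<in>I. f i x)"
  by (induction I rule: infinite_finite_induct) (auto intro: bump_alg.intros)

lemma bump_alg_has_derivative: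
  fixes f :: "real^'n::finite \<Rightarrow> real"
  assumes c: "c > 0" and f: "bump_alg c f"
  shows "\<exists>f'. \<forall>x. (f has_derivative f' x) (at x) \<and> (\<forall>k. bump_alg c (\<lambda>x. f' x (axis k 1)))"
  using f
proof induction
  case (flat p \<sigma> i \<tau>)
  let ?d = "\<lambda>x. flat c (monom 1 2 * (smult c p - pderiv p)) (\<sigma> * x $ i + \<tau>)"
  have "((\<lambda>x::real^'n. flat c p (\<sigma> * x $ i + \<tau>)) has_derivative (\<lambda>h. ?d x * (\<sigma> * h $ i))) (at x)" for x :: "real^'n"
  proof -
    have 1: "((\<lambda>x::real^'n. \<sigma> * x $ i + \<tau>) has_derivative (\<lambda>h. \<sigma> * h $ i)) (at x)"
      by (auto intro!: derivative_eq_intros bounded_linear.has_derivative[OF bounded_linear_vec_nth])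
    show ?thesis
      using has_derivative_compose[OF 1 flat_has_derivative[OF c, unfolded has_field_derivative_def]] by simp
  qed
  moreover have "bump_alg c (\<lambda>x. ?d x * (\<sigma> * axis k 1 $ i))" for k
    by (intro bump_alg.intros)
  ultimately show ?case by (intro exI[of _ "\<lambda>x h. ?d x * (\<sigma> * h $ i)"]) auto
next
  case (const k)
  show ?case by (intro exI[of _ "\<lambda>x h. 0"]) (auto intro: bump_alg.intros)
next
  case (add f g)
  then obtain f' g' where "\<forall>x. (f has_derivative f' x) (at x) \<and> (\<forall>k. bump_alg c (\<lambda>x. f' x (axis k 1)))"
    "\<forall>x. (g has_derivative g' x) (at x) \<and> (\<forall>k. bump_alg c (\<lambda>x. g' x (axis k 1)))" by auto
  then show ?case
    by (intro exI[of _ "\<lambda>x h. f' x h + g' x h"]) (auto intro!: bump_alg.intros derivative_intros)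
next
  case (mult f g)
  then obtain f' g' where "\<forall>x. (f has_derivative f' x) (at x) \<and> (\<forall>k. bump_alg c (\<lambda>x. f' x (axis k 1)))"
    "\<forall>x. (g has_derivative g' x) (at x) \<and> (\<forall>k. bump_alg c (\<lambda>x. g' x (axis k 1)))" by auto
  then show ?case using mult.hyps
    by (intro exI[of _ "\<lambda>x h. f x * g' x h + f' x h * g x"]) (auto intro!: bump_alg.intros derivative_intros)
qed

lemma bump_alg_smooth:
  assumes c: "c > 0" and f: "bump_alg c f"
  shows "smooth f"
proof (rule smoothI_closed[where A="{f. bump_alg c f}"])
  show "f \<in> {f. bump_alg c f}" using f by simp
  fix g :: "real^'a \<Rightarrow> real" assume "g \<in> {f. bump_alg c f}"
  then obtain g' where g': "\<And>x. (g has_derivative g' x) (at x)" "\<And>k. bump_alg c (\<lambda>x. g' x (axis k 1))"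
    using bump_alg_has_derivative[OF c] by blast
  show "g differentiable_on UNIV"
    using g' by (auto simp: differentiable_on_def differentiable_def)
  have "partial k g = (\<lambda>x. g' x (axis k 1))" for k
    by (rule ext) (rule partial_eq[OF g'(1)])
  with g'(2) show "partial k g \<in> {f. bump_alg c f}" for k by simp
qed

text \<open>The rate \<open>c\<close> is a parameter because these bumps increase to the indicator
  of the open box as \<open>c\<close> tends to 0; a single fixed bump would not determine a function
  almost everywhere.\<close>

definition box_bump :: "real \<Rightarrow> real^'n::finite \<Rightarrow> real^'n \<Rightarrow> real^'n \<Rightarrow> real" where
  "box_bump c a b x = (\<Prod>i\<in>UNIV. flat c 1 (x $ i - a $ i) * flat c 1 (b $ i - x $ i))"

lemma box_bump_eq_0: "x \<notin> box a b \<Longrightarrow> box_bump c a b x = 0"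
proof -
  assume "x \<notin> box a b"
  then obtain i where "x $ i \<le> a $ i \<or> b $ i \<le> x $ i" by (force simp: mem_box_cart not_less)
  then have "flat c 1 (x $ i - a $ i) * flat c 1 (b $ i - x $ i) = 0" by (auto simp: flat_def)
  then show ?thesis unfolding box_bump_def by (meson UNIV_I finite prod_zero)
qed

lemma box_bump_bounds: "c > 0 \<Longrightarrow> 0 \<le> box_bump c a b x" "c > 0 \<Longrightarrow> box_bump c a b x \<le> 1"
  by (auto simp: box_bump_def flat_def intro!: prod_nonneg prod_le_1 mult_le_one)

lemma test_function_box_bump:
  assumes "c > 0"
  shows "test_function (box_bump c a b)"
proof -
  have "bump_alg c (\<lambda>x. \<Prod>i\<in>UNIV. flat c 1 (1 * x $ i + (- a $ i)) * flat c 1 (- 1 * x $ i + b $ i))"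
    by (intro bump_alg_prod bump_alg.intros)
  then have "bump_alg c (box_bump c a b)" by (simp add: box_bump_def[abs_def] add.commute)
  then have "smooth (box_bump c a b)" by (rule bump_alg_smooth[OF assms])
  moreover have "{x. box_bump c a b x \<noteq> 0} \<subseteq> box a b"
    using box_bump_eq_0 by blast
  then have "bounded {x. box_bump c a b x \<noteq> 0}"
    using bounded_box bounded_subset by blast
  ultimately show ?thesis by (auto simp: test_function_def)
qed

lemma box_bump_tendsto: "(\<lambda>n. box_bump (1 / real (Suc n)) a b x) \<longlonglongrightarrow> indicator (box a b) x"
proof (cases "x \<in> box a b")
  case True
  have "(\<lambda>n. flat (1 / real (Suc n)) 1 s) \<longlonglongrightarrow> 1" if "s > 0" for s
  proof -
    have "(\<lambda>n. exp (- (1 / real (Suc n)) / s)) \<longlonglongrightarrow> 1"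
      using that by real_asymp
    then show ?thesis using that by (simp add: flat_def del: of_nat_Suc)
  qed
  then have "(\<lambda>n. box_bump (1 / real (Suc n)) a b x) \<longlonglongrightarrow> (\<Prod>i::'a\<in>UNIV. 1 * 1)"
    unfolding box_bump_def using True by (intro tendsto_prod tendsto_mult) (auto simp: mem_box_cart)
  then show ?thesis using True by simp
next
  case False
  then show ?thesis by (simp add: box_bump_eq_0)
qed

text \<open>The positive and the negative part of d are densities of two measures that agree on
  boxes. Boxes are stable under intersection and generate the Borel sets, so the measures coincide,
  and with them their densities.\<close>

lemma AE_eq_0_if_box_integrals_eq_0:
  fixes d :: "'a::euclidean_space \<Rightarrow> real"
  assumes i: "\<And>a b. integrable lebesgue (\<lambda>x. indicator (box a b) x * d x)"
    and z: "\<And>a b. (\<integral>x. indicator (box a b) x * d x \<partial>lebesgue) = 0"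
  shows "AE x in lebesgue. d x = 0"
proof -
  have "d \<in> borel_measurable lebesgue"
  proof (rule borel_measurable_LIMSEQ_real)
    show "(\<lambda>x. indicator (box (- (real n *\<^sub>R One)) (real n *\<^sub>R One)) x * d x) \<in> borel_measurable lebesgue" for n
      using i by blast
    fix x :: 'a
    have "x \<in> (\<Union>n. box (- (real n *\<^sub>R One)) (real n *\<^sub>R One))" by (simp add: UN_box_eq_UNIV)
    then obtain m where m: "x \<in> box (- (real m *\<^sub>R One)) (real m *\<^sub>R One)" by blast
    have "x \<in> box (- (real n *\<^sub>R One)) (real n *\<^sub>R One)" if "n \<ge> m" for n
      using m that by (force simp: mem_box)
    then show "(\<lambda>n. indicator (box (- (real n *\<^sub>R One)) (real n *\<^sub>R One)) x * d x) \<longlonglongrightarrow> d x"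
      by (intro tendsto_eventually eventually_sequentiallyI[of m]) auto
  qed
  then obtain d' where d'[measurable]: "d' \<in> borel_measurable lborel" and ae: "AE x in lborel. d x = d' x"
    using completion_ex_borel_measurable_real by blast
  have ae': "AE x in lebesgue. d x = d' x" using ae by (simp add: AE_completion)
  have m: "(\<lambda>x. indicator (box a b) x * d' x) \<in> borel_measurable lebesgue" for a b
    by (rule measurable_completion) measurable
  have i': "integrable lborel (\<lambda>x. indicator (box a b) x * d' x)" for a b
  proof -
    have "integrable lebesgue (\<lambda>x. indicator (box a b) x * d' x)"
      using i[of a b] ae' m by (subst integrable_cong_AE[of _ _ "\<lambda>x. indicator (box a b) x * d x"]) (auto intro: borel_measurable_integrable)
    then show ?thesis by (subst (asm) integrable_completion) auto
  qed
  have z': "(\<integral>x. indicator (box a b) x * d' x \<partial>lborel) = 0" for a b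
  proof -
    have "(\<integral>x. indicator (box a b) x * d' x \<partial>lborel) = (\<integral>x. indicator (box a b) x * d' x \<partial>lebesgue)"
      by (subst integral_completion) auto
    also have "\<dots> = (\<integral>x. indicator (box a b) x * d x \<partial>lebesgue)"
      using i[of a b] ae' m by (intro integral_cong_AE) (auto intro: borel_measurable_integrable)
    finally show ?thesis using z by simp
  qed
  have ind: "ennreal (f x) * indicator A x = ennreal (indicator A x * f x)" for A f and x :: 'a
    by (auto simp: indicator_def)
  have ind': "ennreal (- f x) * indicator A x = ennreal (- (indicator A x * f x))" for A f and x :: 'a
    by (auto simp: indicator_def)
  have fin: "(\<integral>\<^sup>+x. ennreal (indicator (box a b) x * d' x) \<partial>lborel) \<noteq> \<infinity>"
    "(\<integral>\<^sup>+x. ennreal (- (indicator (box a b) x * d' x)) \<partial>lborel) \<noteq> \<infinity>" for a b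
    using i'[of a b] unfolding real_integrable_def by auto
  have eq: "(\<integral>\<^sup>+x. ennreal (indicator (box a b) x * d' x) \<partial>lborel) = (\<integral>\<^sup>+x. ennreal (- (indicator (box a b) x * d' x)) \<partial>lborel)" for a b
  proof -
    let ?P = "\<integral>\<^sup>+x. ennreal (indicator (box a b) x * d' x) \<partial>lborel"
    let ?N = "\<integral>\<^sup>+x. ennreal (- (indicator (box a b) x * d' x)) \<partial>lborel"
    have "enn2real ?P = enn2real ?N"
      using z'[of a b] unfolding real_lebesgue_integral_def[OF i'[of a b]] by linarith
    then have "ennreal (enn2real ?P) = ennreal (enn2real ?N)" by (rule arg_cong)
    moreover have "?P < top" "?N < top" using fin[of a b] by (simp_all add: less_top)
    ultimately show "?P = ?N" by (simp only: ennreal_enn2real)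
  qed
  have "density lborel (\<lambda>x. ennreal (d' x)) = density lborel (\<lambda>x. ennreal (- d' x))"
  proof (rule measure_eqI_generator_eq)
    let ?E = "range (\<lambda>(a, b). box a b::'a set)"
    show "Int_stable ?E"
      by (auto simp: Int_stable_def box_Int_box)
    show "?E \<subseteq> Pow UNIV" "sets (density lborel (\<lambda>x. ennreal (d' x))) = sigma_sets UNIV ?E"
      "sets (density lborel (\<lambda>x. ennreal (- d' x))) = sigma_sets UNIV ?E"
      by (simp_all add: borel_eq_box)
    let ?A = "\<lambda>n::nat. box (- (real n *\<^sub>R One)) (real n *\<^sub>R One) :: 'a set"
    show "range ?A \<subseteq> ?E" "(\<Union>i. ?A i) = UNIV"
      unfolding UN_box_eq_UNIV by auto
    show "emeasure (density lborel (\<lambda>x. ennreal (d' x))) (?A n) \<noteq> \<infinity>" for n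
      using fin(1) by (subst emeasure_density) (auto simp: ind)
    show "emeasure (density lborel (\<lambda>x. ennreal (d' x))) X = emeasure (density lborel (\<lambda>x. ennreal (- d' x))) X" if "X \<in> ?E" for X
      using that eq by (auto simp: emeasure_density ind ind')
  qed
  \<comment> \<open>At most one of the two parts is nonzero at a point because
    \<open>ennreal\<close> truncates at 0; equality therefore makes both vanish.\<close>
  then have "AE x in lborel. ennreal (d' x) = ennreal (- d' x)"
    by (intro sigma_finite_measure.density_unique[OF sigma_finite_lborel]) auto
  with ae have "AE x in lborel. d x = 0"
  proof eventually_elim
    case (elim x)
    then have "\<not> 0 < d' x" "\<not> 0 < - d' x"
      by (metis ennreal_eq_0_iff ennreal_less_zero_iff less_eq_real_def neg_less_0_iff_less not_gr_zero)+
    then show ?case using elim by auto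
  qed
  then show ?thesis by (simp add: AE_completion)
qed


section \<open>Weak derivatives of smooth functions\<close>

lemma sum_axis_scaleR:
  fixes p :: "'n::finite \<Rightarrow> 'b::real_vector"
  shows "(\<Sum>j\<in>UNIV. axis i (1::real) $ j *\<^sub>R p j) = p i"
proof -
  have "axis i (1::real) $ j *\<^sub>R p j = (if j = i then p j else 0)" for j
    by (simp add: axis_def)
  then show ?thesis by simp
qed

lemma indicator_cbox_integrable:
  assumes "locally_integrable g"
  shows "integrable lebesgue (\<lambda>x. indicator (cbox a b) x * g x)"
  using assms unfolding locally_integrable_def set_integrable_def by (auto dest!: spec[of _ "cbox a b"])

lemma locally_integrable_continuous:
  assumes "continuous_on UNIV g"
  shows "locally_integrable g"
  unfolding locally_integrable_def
proof safe
  fix K :: "(real^'a) set" assume K: "compact K"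
  have "integrable lborel (\<lambda>x. indicator K x *\<^sub>R g x)"
    by (intro borel_integrable_compact K continuous_on_subset[OF assms]) auto
  then show "g absolutely_integrable_on K"
    unfolding set_integrable_def by (subst integrable_completion) (auto dest: borel_measurable_integrable)
qed

text \<open>This is what makes the arbitrary choice in \<open>weak_partials\<close> harmless:
  testing against box bumps with rate tending to 0 shows that two candidates have the same integral
  over every box.\<close>

lemma weak_partials_unique:
  fixes u g h :: "real^'n::finite \<Rightarrow> real"
  assumes g: "has_weak_partials \<alpha> u g" and h: "has_weak_partials \<alpha> u h"
  shows "AE x in lebesgue. g x = h x"
proof -
  define d where "d x = g x - h x" for x
  have ig: "integrable lebesgue (\<lambda>x. indicator (cbox a b) x * g x)" for a b
    using g by (auto simp: has_weak_partials_def intro: indicator_cbox_integrable)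
  have ih: "integrable lebesgue (\<lambda>x. indicator (cbox a b) x * h x)" for a b
    using h by (auto simp: has_weak_partials_def intro: indicator_cbox_integrable)
  have id: "integrable lebesgue (\<lambda>x. indicator (cbox a b) x * d x)" for a b
    using Bochner_Integration.integrable_diff[OF ig ih, of a b a b] by (simp add: d_def algebra_simps)
  have meas: "box_bump c a b \<in> borel_measurable lebesgue" if "c > 0" for a b :: "real^'n" and c
    using test_function_box_bump[OF that] unfolding test_function_def
    by (intro measurable_completion) (auto intro!: borel_measurable_continuous_onI smooth_continuous_on)
  have bump: "integrable lebesgue (\<lambda>x. k x * box_bump c a b x)"
    if "integrable lebesgue (\<lambda>x. indicator (cbox a b) x * k x)" "c > 0" for k c and a b :: "real^'n"
  proof -
    have "integrable lebesgue (\<lambda>x. (indicator (cbox a b) x * k x) * box_bump c a b x)"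
    proof (rule Bochner_Integration.integrable_bound[OF that(1)])
      show "(\<lambda>x. (indicator (cbox a b) x * k x) * box_bump c a b x) \<in> borel_measurable lebesgue"
        by (intro borel_measurable_times[OF borel_measurable_integrable[OF that(1)]] meas that(2))
      show "AE x in lebesgue. norm (indicat_real (cbox a b) x * k x * box_bump c a b x) \<le> norm (indicat_real (cbox a b) x * k x)"
        using box_bump_bounds[OF that(2), of a b] by (intro AE_I2) (auto simp: abs_mult intro!: mult_left_le)
    qed
    also have "(\<lambda>x. (indicator (cbox a b) x * k x) * box_bump c a b x) = (\<lambda>x. k x * box_bump c a b x)"
    proof
      fix x show "(indicator (cbox a b) x * k x) * box_bump c a b x = k x * box_bump c a b x"
        using box_subset_cbox[of a b] box_bump_eq_0[of x a b c] by (cases "x \<in> box a b") (auto simp: indicator_def)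
    qed
    finally show ?thesis .
  qed
  have z: "(\<integral>x. d x * box_bump c a b x \<partial>lebesgue) = 0" if "c > 0" for c and a b :: "real^'n"
  proof -
    have "(- 1) ^ length \<alpha> * (\<integral>x. g x * box_bump c a b x \<partial>lebesgue) = (- 1) ^ length \<alpha> * (\<integral>x. h x * box_bump c a b x \<partial>lebesgue)"
    proof -
      have "(\<integral>x. u x * partials \<alpha> (box_bump c a b) x \<partial>lebesgue) = (- 1) ^ length \<alpha> * (\<integral>x. g x * box_bump c a b x \<partial>lebesgue)"
        using g test_function_box_bump[OF that, of a b] unfolding has_weak_partials_def by blast
      moreover have "(\<integral>x. u x * partials \<alpha> (box_bump c a b) x \<partial>lebesgue) = (- 1) ^ length \<alpha> * (\<integral>x. h x * box_bump c a b x \<partial>lebesgue)"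
        using h test_function_box_bump[OF that, of a b] unfolding has_weak_partials_def by blast
      ultimately show ?thesis by simp
    qed
    then have "(\<integral>x. g x * box_bump c a b x \<partial>lebesgue) = (\<integral>x. h x * box_bump c a b x \<partial>lebesgue)" by simp
    then show ?thesis using bump[OF ig that] bump[OF ih that]
      by (simp add: d_def left_diff_distrib)
  qed
  have "AE x in lebesgue. d x = 0"
  proof (rule AE_eq_0_if_box_integrals_eq_0)
    fix a b :: "real^'n"
    have eq: "indicator (box a b) x * d x = indicator (box a b) x * (indicator (cbox a b) x * d x)" for x
      using box_subset_cbox[of a b] by (auto simp: indicator_def)
    show "integrable lebesgue (\<lambda>x. indicator (box a b) x * d x)"
    proof (rule Bochner_Integration.integrable_bound[OF id[of a b]])
      show "(\<lambda>x. indicator (box a b) x * d x) \<in> borel_measurable lebesgue"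
        unfolding eq by (intro borel_measurable_times borel_measurable_integrable[OF id]) (auto intro!: borel_measurable_indicator)
    qed (use box_subset_cbox[of a b] in \<open>auto simp: indicator_def\<close>)
    have "(\<lambda>n. \<integral>x. d x * box_bump (1 / real (Suc n)) a b x \<partial>lebesgue) \<longlonglongrightarrow> (\<integral>x. indicator (box a b) x * d x \<partial>lebesgue)"
    proof (rule integral_dominated_convergence[where w="\<lambda>x. \<bar>indicator (cbox a b) x * d x\<bar>"])
      show "integrable lebesgue (\<lambda>x. \<bar>indicator (cbox a b) x * d x\<bar>)" using id by auto
      show "(\<lambda>x. indicator (box a b) x * d x) \<in> borel_measurable lebesgue"
        unfolding eq by (intro borel_measurable_times borel_measurable_integrable[OF id]) (auto intro!: borel_measurable_indicator)
      show "(\<lambda>x. d x * box_bump (1 / real (Suc n)) a b x) \<in> borel_measurable lebesgue" for n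
        by (intro borel_measurable_integrable bump id) auto
      show "AE x in lebesgue. (\<lambda>n. d x * box_bump (1 / real (Suc n)) a b x) \<longlonglongrightarrow> indicator (box a b) x * d x"
        by (intro AE_I2) (subst mult.commute, intro tendsto_mult tendsto_const box_bump_tendsto)
      fix n
      have c: "1 / real (Suc n) > 0" by simp
      show "AE x in lebesgue. norm (d x * box_bump (1 / real (Suc n)) a b x) \<le> \<bar>indicat_real (cbox a b) x * d x\<bar>"
      proof (intro AE_I2)
        fix x
        show "norm (d x * box_bump (1 / real (Suc n)) a b x) \<le> \<bar>indicat_real (cbox a b) x * d x\<bar>"
        proof (cases "x \<in> cbox a b")
          case True
          then show ?thesis using box_bump_bounds[OF c, of a b x] by (auto simp: abs_mult intro!: mult_left_le)
        next
          case False
          then have "x \<notin> box a b" using box_subset_cbox by blast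
          then show ?thesis by (simp add: box_bump_eq_0)
        qed
      qed
    qed
    then show "(\<integral>x. indicator (box a b) x * d x \<partial>lebesgue) = 0"
      by (subst (asm) z) (auto simp: LIMSEQ_const_iff)
  qed
  then show ?thesis by (simp add: d_def)
qed

text \<open>One radius serves all derivatives at once, since a function vanishing on the open
  complement of a ball has vanishing derivatives there.\<close>

lemma test_function_support:
  assumes "test_function \<psi>"
  obtains R where "\<And>\<alpha> x. norm x > R \<Longrightarrow> partials \<alpha> \<psi> x = 0"
proof -
  have "bounded (closure {x. \<psi> x \<noteq> 0})"
    by (rule compact_imp_bounded) (use assms in \<open>simp add: test_function_def\<close>)
  then obtain R where R: "\<forall>x\<in>closure {x. \<psi> x \<noteq> 0}. norm x \<le> R"
    unfolding bounded_iff ..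
  have "\<forall>x. norm x > R \<longrightarrow> partials \<alpha> \<psi> x = 0" for \<alpha>
  proof (induction \<alpha>)
    case Nil
    show ?case using R closure_subset[of "{x. \<psi> x \<noteq> 0}"] by (auto simp: subset_eq not_le[symmetric])
  next
    case (Cons i \<alpha>)
    show ?case
    proof safe
      fix x :: "real^'a" assume x: "norm x > R"
      have "(partials \<alpha> \<psi> has_derivative (\<lambda>_. 0)) (at x)"
      proof (rule has_derivative_transform_within_open[of "\<lambda>_. 0" _ _ _ "- cball 0 R"])
        show "x \<in> - cball 0 R" using x by simp
      qed (use Cons in auto)
      then show "partials (i # \<alpha>) \<psi> x = 0" by (simp add: partial_eq)
    qed
  qed
  then show thesis by (intro that[of R]) auto
qed

text \<open>Both integrations by parts are done together: the derivative in direction i of u *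
  \<partial>\<psi> - \<psi> * \<partial>u is u * \<partial>\<partial>\<psi> - \<psi> *
  \<partial>\<partial>u, because the mixed terms cancel.\<close>

lemma has_weak_second_partial:
  fixes u :: "real^'n::finite \<Rightarrow> real"
  assumes u: "smooth u"
  shows "has_weak_partials [i, i] u (partials [i, i] u)"
  unfolding has_weak_partials_def
proof (intro conjI allI impI)
  show "locally_integrable u" by (intro locally_integrable_continuous smooth_continuous_on u)
  show "locally_integrable (partials [i, i] u)" by (intro locally_integrable_continuous smooth_continuous_on smooth_partials u)
  fix \<psi> :: "real^'n \<Rightarrow> real" assume t: "test_function \<psi>"
  then have \<psi>: "smooth \<psi>" by (simp add: test_function_def)
  obtain R where R: "\<And>\<alpha> x. norm x > R \<Longrightarrow> partials \<alpha> \<psi> x = 0" using test_function_support[OF t] by blast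
  let ?D = "\<lambda>f x h. \<Sum>j\<in>UNIV. h $ j *\<^sub>R partial j f x"
  let ?F = "\<lambda>x. u x * partial i \<psi> x - \<psi> x * partial i u x"
  let ?F' = "\<lambda>x h. (u x * ?D (partial i \<psi>) x h + ?D u x h * partial i \<psi> x) - (\<psi> x * ?D (partial i u) x h + ?D \<psi> x h * partial i u x)"
  have eq: "?F' x (axis i 1) = u x * partials [i, i] \<psi> x - partials [i, i] u x * \<psi> x" for x
    by (simp only: sum_axis_scaleR) (simp add: algebra_simps)
  have c: "continuous_on S (partials \<alpha> u)" "continuous_on S (partials \<alpha> \<psi>)" "continuous_on S u" "continuous_on S \<psi>" for S \<alpha>
    by (intro smooth_continuous_on smooth_partials u \<psi>)+
  have "(\<integral>x. ?F' x (axis i 1) \<partial>lborel) = 0"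
  proof (rule integral_directional_derivative_eq_0[where F="?F" and F'="?F'" and a="axis i 1" and R=R])
    show "(?F has_derivative ?F' x) (at x)" for x
      by (intro has_derivative_diff has_derivative_mult smooth_has_derivative smooth_partial u \<psi>)
    show "continuous_on UNIV (\<lambda>x. ?F' x (axis i 1))"
      unfolding eq by (intro continuous_intros c)
    show "?F x = 0" if "norm x > R" for x
      using R[OF that, of "[]"] R[OF that, of "[i]"] by simp
  qed
  then have *: "(\<integral>x. u x * partials [i, i] \<psi> x - partials [i, i] u x * \<psi> x \<partial>lborel) = 0"
    unfolding eq .
  have int: "integrable lborel (\<lambda>x. k x * partials \<alpha> \<psi> x)" if "continuous_on UNIV k" for k \<alpha>
    by (rule integrable_continuous_compact_support[OF continuous_on_mult[OF that c(2)], of R]) (simp add: R)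
  have i1: "integrable lborel (\<lambda>x. u x * partials [i, i] \<psi> x)" "integrable lborel (\<lambda>x. partials [i, i] u x * \<psi> x)"
    using int[OF c(3), of "[i,i]"] int[OF c(1)[of _ "[i,i]"], of "[]"] by auto
  have "(\<integral>x. u x * partials [i, i] \<psi> x \<partial>lborel) = (\<integral>x. partials [i, i] u x * \<psi> x \<partial>lborel)"
    using * Bochner_Integration.integral_diff[OF i1] by (simp del: partials.simps)
  then show "(\<integral>x. u x * partials [i, i] \<psi> x \<partial>lebesgue) = (- 1) ^ length [i, i] * (\<integral>x. partials [i, i] u x * \<psi> x \<partial>lebesgue)"
    using i1 by (simp del: partials.simps add: integral_completion borel_measurable_integrable)
qed

definition laplacian :: "(real^'n::finite \<Rightarrow> real) \<Rightarrow> real^'n \<Rightarrow> real" where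
  "laplacian u x = (\<Sum>i\<in>UNIV. partials [i, i] u x)"

lemma weak_laplacian_eq_AE:
  assumes "smooth u"
  shows "AE x in lebesgue. weak_laplacian u x = laplacian u x"
proof -
  have "AE x in lebesgue. weak_partials [i, i] u x = partials [i, i] u x" for i
    unfolding weak_partials_def
    by (rule weak_partials_unique[OF someI[of "has_weak_partials [i, i] u"]])
       (rule has_weak_second_partial[OF assms])+
  then have "AE x in lebesgue. \<forall>i\<in>UNIV. weak_partials [i, i] u x = partials [i, i] u x"
    by (intro AE_finite_allI) auto
  then show ?thesis
    by eventually_elim (simp add: weak_laplacian_def laplacian_def)
qed

lemma continuous_on_laplacian: "smooth u \<Longrightarrow> continuous_on S (laplacian u)"
  unfolding laplacian_def[abs_def] by (intro continuous_on_sum smooth_continuous_on smooth_partials)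

subsection \<open>Gaussians are Schwartz functions\<close>

lemma real_polynomial_function_has_derivative:
  fixes p :: "'a::real_normed_vector \<Rightarrow> real"
  assumes "real_polynomial_function p"
  shows "\<exists>p'. \<forall>x. (p has_derivative p' x) (at x) \<and> (\<forall>k. real_polynomial_function (\<lambda>x. p' x k))"
  using assms
proof induction
  case (linear f)
  then show ?case by (intro exI[of _ "\<lambda>x. f"]) (auto intro: bounded_linear_imp_has_derivative)
next
  case (const c)
  show ?case by (intro exI[of _ "\<lambda>x h. 0"]) auto
next
  case (add f g)
  then obtain f' g' where "\<forall>x. (f has_derivative f' x) (at x) \<and> (\<forall>k. real_polynomial_function (\<lambda>x. f' x k))"
    "\<forall>x. (g has_derivative g' x) (at x) \<and> (\<forall>k. real_polynomial_function (\<lambda>x. g' x k))" by auto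
  then show ?case
    by (intro exI[of _ "\<lambda>x h. f' x h + g' x h"]) (auto intro!: derivative_intros)
next
  case (mult f g)
  then obtain f' g' where "\<forall>x. (f has_derivative f' x) (at x) \<and> (\<forall>k. real_polynomial_function (\<lambda>x. f' x k))"
    "\<forall>x. (g has_derivative g' x) (at x) \<and> (\<forall>k. real_polynomial_function (\<lambda>x. g' x k))" by auto
  then show ?case using mult.hyps
    by (intro exI[of _ "\<lambda>x h. f x * g' x h + f' x h * g x"] allI conjI has_derivative_mult
          real_polynomial_function.intros(3,4)) blast+
qed

lemma real_polynomial_function_growth:
  fixes p :: "'a::real_normed_vector \<Rightarrow> real"
  assumes "real_polynomial_function p"
  shows "\<exists>C N. \<forall>x. \<bar>p x\<bar> \<le> C * (1 + norm x) ^ N"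
  using assms
proof induction
  case (linear f)
  then obtain K where K: "\<And>x. norm (f x) \<le> norm x * K" "K > 0" using bounded_linear.pos_bounded by blast
  have "\<bar>f x\<bar> \<le> K * (1 + norm x) ^ 1" for x
    using K(1)[of x] K(2) by (simp add: algebra_simps)
  then show ?case by blast
next
  case (const c)
  have "\<bar>c\<bar> \<le> \<bar>c\<bar> * (1 + norm x) ^ 0" for x :: 'a by simp
  then show ?case by blast
next
  case (add f g)
  then obtain C N D M where *: "\<And>x. \<bar>f x\<bar> \<le> C * (1 + norm x) ^ N" "\<And>x. \<bar>g x\<bar> \<le> D * (1 + norm x) ^ M" by blast
  have nn: "C \<ge> 0" "D \<ge> 0" using *(1)[of 0] *(2)[of 0] by auto
  have "\<bar>f x + g x\<bar> \<le> (C + D) * (1 + norm x) ^ (N + M)" for x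
  proof -
    have "C * (1 + norm x) ^ N \<le> C * (1 + norm x) ^ (N + M)" "D * (1 + norm x) ^ M \<le> D * (1 + norm x) ^ (N + M)"
      using nn by (auto intro!: mult_left_mono power_increasing)
    then show ?thesis using *(1)[of x] *(2)[of x] unfolding distrib_right by linarith
  qed
  then show ?case by blast
next
  case (mult f g)
  then obtain C N D M where *: "\<And>x. \<bar>f x\<bar> \<le> C * (1 + norm x) ^ N" "\<And>x. \<bar>g x\<bar> \<le> D * (1 + norm x) ^ M" by blast
  have "\<bar>f x * g x\<bar> \<le> (C * D) * (1 + norm x) ^ (N + M)" for x
    using mult_mono[OF *(1)[of x] *(2)[of x]] order_trans[OF abs_ge_zero *(1)[of x]]
    by (simp add: abs_mult power_add mult_ac)
  then show ?case by blast
qed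

text \<open>One term of the exponential series gives (1 + |x|)^N \<le> N! * exp (1 + |x|), and
  completing the square absorbs the linear exponent into the Gaussian.\<close>

lemma power_times_gaussian_bounded:
  fixes m :: "'a::real_normed_vector"
  assumes a: "a > 0"
  shows "\<exists>B. \<forall>x. (1 + norm x) ^ N * exp (- a * (norm (x - m))\<^sup>2) \<le> B"
proof -
  have "(1 + norm x) ^ N * exp (- a * (norm (x - m))\<^sup>2) \<le> fact N * exp (1 + norm m + 1 / (4 * a))" for x
  proof -
    have "(1 + norm x) ^ N / fact N \<le> exp (1 + norm x)"
    proof -
      have s: "(\<lambda>n. (1 + norm x) ^ n /\<^sub>R fact n) sums exp (1 + norm x)" by (rule exp_converges)
      have "(\<Sum>n\<in>{N}. (1 + norm x) ^ n /\<^sub>R fact n) \<le> exp (1 + norm x)"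
        unfolding sums_unique[OF s] by (intro sum_le_suminf sums_summable[OF s]) auto
      then show ?thesis by (simp add: divide_inverse mult.commute)
    qed
    then have "(1 + norm x) ^ N \<le> fact N * exp (1 + norm x)" by (simp add: field_simps)
    then have "(1 + norm x) ^ N * exp (- a * (norm (x - m))\<^sup>2) \<le> fact N * exp (1 + norm x) * exp (- a * (norm (x - m))\<^sup>2)"
      by (intro mult_right_mono) auto
    also have "\<dots> = fact N * exp (1 + norm x - a * (norm (x - m))\<^sup>2)" by (simp flip: exp_add)
    also have "\<dots> \<le> fact N * exp (1 + norm m + 1 / (4 * a))"
    proof -
      let ?r = "norm (x - m)"
      have "0 \<le> (2 * a * ?r - 1)\<^sup>2 / (4 * a)" using a by simp
      also have "\<dots> = a * ?r\<^sup>2 - ?r + 1 / (4 * a)" using a by (simp add: power2_eq_square field_simps)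
      finally have "?r - a * ?r\<^sup>2 \<le> 1 / (4 * a)" by simp
      moreover have "norm x \<le> norm m + ?r" using norm_triangle_ineq[of m "x - m"] by simp
      ultimately have "1 + norm x - a * ?r\<^sup>2 \<le> 1 + norm m + 1 / (4 * a)" by linarith
      then show ?thesis by simp
    qed
    finally show ?thesis .
  qed
  then show ?thesis by blast
qed

text \<open>Polynomials times the fixed Gaussian are closed under partial derivatives, and each of
  them decays faster than any power.\<close>

lemma schwartz_gaussian:
  fixes m :: "real^'n::finite"
  assumes a: "a > 0"
  shows "schwartz (\<lambda>x. complex_of_real (exp (- a * (norm (x - m))\<^sup>2)))"
proof -
  define A where "A = {(\<lambda>x. complex_of_real (p x * exp (- a * (norm (x - m))\<^sup>2))) | p. real_polynomial_function p}"
  let ?g = "\<lambda>x. complex_of_real (exp (- a * (norm (x - m))\<^sup>2))"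
  have AI: "(\<lambda>x. complex_of_real (p x * exp (- a * (norm (x - m))\<^sup>2))) \<in> A" if "real_polynomial_function p" for p
    unfolding A_def mem_Collect_eq by (rule exI[of _ p], rule conjI[OF refl that])
  have gA: "?g \<in> A"
    unfolding A_def mem_Collect_eq
    by (rule exI[of _ "\<lambda>_. 1"]) (simp add: real_polynomial_function.intros(2))
  have der: "\<exists>f'. \<forall>x. (f has_derivative f' x) (at x) \<and> (\<forall>k. (\<lambda>x. f' x (axis k 1)) \<in> A)" if "f \<in> A" for f
  proof -
    have "\<exists>p. f = (\<lambda>x. complex_of_real (p x * exp (- a * (norm (x - m))\<^sup>2))) \<and> real_polynomial_function p"
      using that unfolding A_def mem_Collect_eq .
    then obtain p where pf: "f = (\<lambda>x. complex_of_real (p x * exp (- a * (norm (x - m))\<^sup>2))) \<and> real_polynomial_function p" ..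
    note f = conjunct1[OF pf] and p = conjunct2[OF pf]
    obtain p' where p': "\<And>x. (p has_derivative p' x) (at x)" "\<And>k. real_polynomial_function (\<lambda>x. p' x k)"
      using real_polynomial_function_has_derivative[OF p] by blast
    let ?q = "\<lambda>x h. p' x h - 2 * a * ((x - m) \<bullet> h) * p x"
    have "(f has_derivative (\<lambda>h. complex_of_real (?q x h * exp (- a * (norm (x - m))\<^sup>2)))) (at x)" for x
    proof -
      have "((\<lambda>x. (x - m) \<bullet> (x - m)) has_derivative (\<lambda>h. (x - m) \<bullet> h + h \<bullet> (x - m))) (at x)"
        by (intro has_derivative_inner) (auto intro!: derivative_eq_intros)
      then have "((\<lambda>x. exp (- a * ((x - m) \<bullet> (x - m)))) has_derivative (\<lambda>h. (- a * ((x - m) \<bullet> h + h \<bullet> (x - m))) * exp (- a * ((x - m) \<bullet> (x - m))))) (at x)"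
        by (intro has_derivative_exp has_derivative_mult_right)
      from has_derivative_mult[OF p'(1) this]
      have "((\<lambda>x. p x * exp (- a * (norm (x - m))\<^sup>2)) has_derivative (\<lambda>h. ?q x h * exp (- a * (norm (x - m))\<^sup>2))) (at x)"
        unfolding power2_norm_eq_inner by (rule has_derivative_eq_rhs) (auto simp: fun_eq_iff inner_commute algebra_simps)
      then show ?thesis unfolding f by (rule has_derivative_of_real)
    qed
    moreover have "real_polynomial_function (\<lambda>x. ?q x h)" for h
    proof -
      have "real_polynomial_function (\<lambda>x::real^'n. x \<bullet> h)" by (intro real_polynomial_function.intros(1) bounded_linear_intros)
      then have "real_polynomial_function (\<lambda>x. p' x h + (- 2 * a) * (x \<bullet> h + (- (m \<bullet> h))) * p x)"
        by (intro real_polynomial_function.intros(3)[OF p'(2) real_polynomial_function.intros(4)[OF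
          real_polynomial_function.intros(4)[OF real_polynomial_function.intros(2)
            real_polynomial_function.intros(3)[OF _ real_polynomial_function.intros(2)]] p]])
      then show ?thesis by (simp add: inner_diff_left algebra_simps)
    qed
    then have "(\<lambda>x. complex_of_real (?q x (axis k 1) * exp (- a * (norm (x - m))\<^sup>2))) \<in> A" for k
      by (rule AI)
    ultimately show ?thesis
      by (intro exI[of _ "\<lambda>x h. complex_of_real (?q x h * exp (- a * (norm (x - m))\<^sup>2))"] allI conjI)
  qed
  have d: "f differentiable_on UNIV" and p: "partial k f \<in> A" if "f \<in> A" for f k
  proof -
    obtain f' where f': "\<And>x. (f has_derivative f' x) (at x)" "\<And>k. (\<lambda>x. f' x (axis k 1)) \<in> A"
      using der[OF \<open>f \<in> A\<close>] by blast
    show "f differentiable_on UNIV" using f' by (auto simp: differentiable_on_def differentiable_def)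
    have "partial k f = (\<lambda>x. f' x (axis k 1))" by (rule ext) (rule partial_eq[OF f'(1)])
    with f'(2) show "partial k f \<in> A" by simp
  qed
  show ?thesis
    unfolding schwartz_def
  proof (intro conjI allI)
    show "smooth ?g" using smoothI_closed(2)[OF gA d p] .
    fix k \<alpha>
    have "partials \<alpha> ?g \<in> A" using smoothI_closed(1)[OF gA d p] .
    then obtain p where p: "real_polynomial_function p" and f: "partials \<alpha> ?g = (\<lambda>x. complex_of_real (p x * exp (- a * (norm (x - m))\<^sup>2)))"
      by (auto simp: A_def)
    obtain C N where C: "\<And>x. \<bar>p x\<bar> \<le> C * (1 + norm x) ^ N" using real_polynomial_function_growth[OF p] by blast
    obtain B where B: "\<And>x. (1 + norm x) ^ (k + N) * exp (- a * (norm (x - m))\<^sup>2) \<le> B"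
      using power_times_gaussian_bounded[OF a, where N="k+N" and m=m] by blast
    have C0: "C \<ge> 0" using C[of 0] by simp
    have "norm (norm x ^ k *\<^sub>R partials \<alpha> ?g x) \<le> C * B" for x
    proof -
      have "norm (norm x ^ k *\<^sub>R partials \<alpha> ?g x) = norm x ^ k * \<bar>p x\<bar> * exp (- a * (norm (x - m))\<^sup>2)"
        unfolding f by (simp add: norm_mult abs_mult del: of_real_mult)
      also have "\<dots> \<le> (1 + norm x) ^ k * (C * (1 + norm x) ^ N) * exp (- a * (norm (x - m))\<^sup>2)"
        by (intro mult_right_mono mult_mono C power_mono) auto
      also have "\<dots> = C * ((1 + norm x) ^ (k + N) * exp (- a * (norm (x - m))\<^sup>2))" by (simp add: power_add)
      also have "\<dots> \<le> C * B" by (intro mult_left_mono B C0)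
      finally show ?thesis .
    qed
    then show "bounded (range (\<lambda>x. norm x ^ k *\<^sub>R partials \<alpha> ?g x))"
      by (auto simp: bounded_iff)
  qed
qed

subsection \<open>The heat kernel and the half Laplacian\<close>

lemma
  fixes f :: "'a::euclidean_space \<Rightarrow> 'b::euclidean_space \<Rightarrow> 'c::{banach, second_countable_topology}"
  assumes m: "(\<lambda>(x, y). f x y) \<in> borel_measurable (lborel \<Otimes>\<^sub>M lborel)"
    and i1: "AE x in lborel. integrable lborel (f x)"
    and i2: "integrable lborel (\<lambda>x. \<integral>y. norm (f x y) \<partial>lborel)"
  shows integrable_pair_lborel: "integrable (lborel \<Otimes>\<^sub>M lborel) (\<lambda>(x, y). f x y)"
    and integral_swap_lborel: "(\<integral>x. \<integral>y. f x y \<partial>lborel \<partial>lborel) = (\<integral>y. \<integral>x. f x y \<partial>lborel \<partial>lborel)"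
proof -
  show i: "integrable (lborel \<Otimes>\<^sub>M lborel) (\<lambda>(x, y). f x y)"
    using assms by (intro lborel_pair.Fubini_integrable) auto
  show "(\<integral>x. \<integral>y. f x y \<partial>lborel \<partial>lborel) = (\<integral>y. \<integral>x. f x y \<partial>lborel \<partial>lborel)"
    using lborel_pair.Fubini_integral[OF i] by simp
qed

definition heat :: "real \<Rightarrow> real^3 \<Rightarrow> real" where
  "heat t z = exp (- (norm z)\<^sup>2 / (4 * t)) / sqrt (4 * pi * t) ^ 3"

text \<open>Minus the time derivative of \<open>heat\<close>, hence by the heat equation minus its
  Laplacian. On the Fourier side it carries the multiplier |\<xi>|^2.\<close>

definition heat' :: "real \<Rightarrow> real^3 \<Rightarrow> real" where
  "heat' t z = (3 / (2 * t) - (norm z)\<^sup>2 / (4 * t\<^sup>2)) * heat t z"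

lemma borel_measurable_heat [measurable (raw)]:
  assumes [measurable]: "f \<in> borel_measurable M" "g \<in> borel_measurable M"
  shows "(\<lambda>x. heat (f x) (g x)) \<in> borel_measurable M"
  unfolding heat_def by measurable

lemma borel_measurable_heat' [measurable (raw)]:
  assumes [measurable]: "f \<in> borel_measurable M" "g \<in> borel_measurable M"
  shows "(\<lambda>x. heat' (f x) (g x)) \<in> borel_measurable M"
  unfolding heat'_def by measurable

lemma heat_nonneg: "t \<ge> 0 \<Longrightarrow> heat t z \<ge> 0"
  by (simp add: heat_def)

lemma heat_minus: "heat t (x - y) = heat t (y - x)" "heat' t (x - y) = heat' t (y - x)"
  by (simp_all add: heat_def heat'_def norm_minus_commute)

lemma heat_deriv:
  assumes t: "t > 0"
  shows "((\<lambda>t. heat t z) has_real_derivative - heat' t z) (at t)"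
proof -
  have s: "sqrt (4 * pi * t) ^ 3 = (4 * pi * t) * sqrt (4 * pi * t)" using t
    by (simp add: power3_eq_cube)
  have s2: "sqrt (4 * pi * t) * sqrt (4 * pi * t) = 4 * pi * t" using t by simp
  have ne: "sqrt (4 * pi * t) \<noteq> 0" "pi * t > 0" using t by simp_all
  have "((\<lambda>t. exp (- (norm z)\<^sup>2 / (4 * t)) * inverse (sqrt (4 * pi * t) ^ 3)) has_real_derivative
     exp (- (norm z)\<^sup>2 / (4 * t)) * ((norm z)\<^sup>2 / (4 * t\<^sup>2)) * inverse (sqrt (4 * pi * t) ^ 3) +
     exp (- (norm z)\<^sup>2 / (4 * t)) * (- (3 * sqrt (4 * pi * t) ^ 2 * (4 * pi / (2 * sqrt (4 * pi * t)))) / (sqrt (4 * pi * t) ^ 3)\<^sup>2)) (at t)"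
    using t by (auto intro!: derivative_eq_intros simp: power2_eq_square field_simps mult_less_0_iff)
  moreover have "- (3 * sqrt (4 * pi * t) ^ 2 * (4 * pi / (2 * sqrt (4 * pi * t)))) / (sqrt (4 * pi * t) ^ 3)\<^sup>2
      = - (3 / (2 * t)) * inverse (sqrt (4 * pi * t) ^ 3)"
  proof -
    let ?s = "sqrt (4 * pi * t)"
    have "- (3 * ?s ^ 2 * (4 * pi / (2 * ?s))) / (?s ^ 3)\<^sup>2 = - (3 * (2 * pi) / (?s * ?s)) * inverse (?s ^ 3)"
      using ne by (simp add: field_simps power2_eq_square power3_eq_cube)
    also have "3 * (2 * pi) / (?s * ?s) = 3 / (2 * t)" unfolding s2 using t by (simp add: field_simps)
    finally show ?thesis .
  qed
  moreover have "E * b * inverse S + E * (- a * inverse S) = - ((a - b) * (E / S))" for a b E S :: real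
    by (simp add: divide_inverse algebra_simps)
  ultimately show ?thesis
    unfolding heat_def heat'_def divide_inverse[of "exp _" "sqrt _ ^ 3"] by (simp only: divide_inverse)
qed

lemma fourier_heat:
  assumes t: "t > 0"
  shows "(\<integral>\<xi>. cis (\<xi> \<bullet> z) * complex_of_real (exp (- t * (norm \<xi>)\<^sup>2)) \<partial>lborel) = complex_of_real ((2 * pi) ^ 3 * heat t z)"
proof -
  have "sqrt (pi / t) = 2 * pi / sqrt (4 * pi * t)"
    using t by (simp add: real_sqrt_divide real_sqrt_mult field_simps)
  then show ?thesis
    using integral_cis_gaussian[OF t, of z]
    by (simp add: heat_def inner_commute power_divide mult.commute)
qed

lemma sq_times_exp_le:
  fixes t r :: real
  assumes "t > 0"
  shows "r * exp (- t * r) \<le> (2 / t) * exp (- (t / 2) * r)"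
proof -
  have "t / 2 * r \<le> exp (t / 2 * r)" using exp_ge_add_one_self[of "t / 2 * r"] by linarith
  then have "t / 2 * r * exp (- t * r) \<le> exp (t / 2 * r) * exp (- t * r)" by (intro mult_right_mono) auto
  also have "\<dots> = exp (- (t / 2) * r)" by (simp flip: exp_add)
  finally show ?thesis using assms by (simp add: field_simps)
qed

lemma integrable_norm_sq_gaussian:
  assumes t: "t > 0"
  shows "integrable lborel (\<lambda>x::'a::euclidean_space. (norm x)\<^sup>2 * exp (- t * (norm x)\<^sup>2))"
proof (rule Bochner_Integration.integrable_bound)
  show "integrable lborel (\<lambda>x::'a. (2 / t) * exp (- (t / 2) * (norm x)\<^sup>2))"
    using t by (intro integrable_mult_right integrable_gaussian) auto
qed (use sq_times_exp_le[OF t] t in \<open>auto intro!: AE_I2 simp: abs_mult\<close>)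

lemma integrable_norm_gaussian:
  assumes t: "t > 0"
  shows "integrable lborel (\<lambda>x::'a::euclidean_space. norm x * exp (- t * (norm x)\<^sup>2))"
proof (rule Bochner_Integration.integrable_bound)
  show "integrable lborel (\<lambda>x::'a. exp (- t * (norm x)\<^sup>2) + (norm x)\<^sup>2 * exp (- t * (norm x)\<^sup>2))"
    using t by (intro Bochner_Integration.integrable_add integrable_norm_sq_gaussian integrable_gaussian)
  show "AE x::'a in lborel. norm (norm x * exp (- t * (norm x)\<^sup>2)) \<le> norm (exp (- t * (norm x)\<^sup>2) + (norm x)\<^sup>2 * exp (- t * (norm x)\<^sup>2))"
  proof (intro AE_I2)
    fix x :: 'a
    have "0 \<le> (norm x - 1)\<^sup>2" by simp
    then have "2 * norm x \<le> 1 + (norm x)\<^sup>2" unfolding power2_diff by simp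
    then have "norm x \<le> 1 + (norm x)\<^sup>2" using norm_ge_zero[of x] by linarith
    then have "norm x * exp (- t * (norm x)\<^sup>2) \<le> (1 + (norm x)\<^sup>2) * exp (- t * (norm x)\<^sup>2)" by (intro mult_right_mono) auto
    then show "norm (norm x * exp (- t * (norm x)\<^sup>2)) \<le> norm (exp (- t * (norm x)\<^sup>2) + (norm x)\<^sup>2 * exp (- t * (norm x)\<^sup>2))"
      by (simp add: algebra_simps)
  qed
qed auto

lemma integrable_cis_times:
  fixes k :: "'a::euclidean_space \<Rightarrow> real"
  assumes "integrable lborel k"
  shows "integrable lborel (\<lambda>x. cis (x \<bullet> z) * complex_of_real (k x))"
proof (rule Bochner_Integration.integrable_bound[OF assms])
  have [measurable]: "k \<in> borel_measurable borel" using assms by auto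
  show "(\<lambda>x. cis (x \<bullet> z) * complex_of_real (k x)) \<in> borel_measurable lborel" by measurable
qed (auto simp: norm_mult)

text \<open>Differentiates the transform of the heat kernel in time. The difference quotients are
  dominated by |\<xi>|^2 * exp (- t * |\<xi>|^2) because 1 - exp (- r) \<le> r.\<close>

lemma fourier_heat':
  assumes t: "t > 0"
  shows "(\<integral>\<xi>. cis (\<xi> \<bullet> z) * complex_of_real ((norm \<xi>)\<^sup>2 * exp (- t * (norm \<xi>)\<^sup>2)) \<partial>lborel) = complex_of_real ((2 * pi) ^ 3 * heat' t z)"
proof (rule LIMSEQ_unique)
  define d where "d n = 1 / real (Suc n)" for n
  have d: "d n > 0" for n by (simp add: d_def)
  have d0: "d \<longlonglongrightarrow> 0" unfolding d_def by real_asymp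
  let ?q = "\<lambda>n r. (exp (- t * r) - exp (- (t + d n) * r)) / d n"
  let ?f = "\<lambda>n. \<integral>\<xi>. cis (\<xi> \<bullet> z) * complex_of_real (?q n ((norm \<xi>)\<^sup>2)) \<partial>lborel"
  show "?f \<longlonglongrightarrow> (\<integral>\<xi>. cis (\<xi> \<bullet> z) * complex_of_real ((norm \<xi>)\<^sup>2 * exp (- t * (norm \<xi>)\<^sup>2)) \<partial>lborel)"
  proof (rule integral_dominated_convergence[where w="\<lambda>\<xi>. (norm \<xi>)\<^sup>2 * exp (- t * (norm \<xi>)\<^sup>2)"])
    show "integrable lborel (\<lambda>\<xi>::real^3. (norm \<xi>)\<^sup>2 * exp (- t * (norm \<xi>)\<^sup>2))"
      by (rule integrable_norm_sq_gaussian[OF t])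
    show "AE \<xi> in lborel. (\<lambda>n. cis (\<xi> \<bullet> z) * complex_of_real (?q n ((norm \<xi>)\<^sup>2))) \<longlonglongrightarrow> cis (\<xi> \<bullet> z) * complex_of_real ((norm \<xi>)\<^sup>2 * exp (- t * (norm \<xi>)\<^sup>2))"
    proof (intro AE_I2 tendsto_mult tendsto_const tendsto_of_real)
      fix \<xi> :: "real^3"
      show "(\<lambda>n. ?q n ((norm \<xi>)\<^sup>2)) \<longlonglongrightarrow> (norm \<xi>)\<^sup>2 * exp (- t * (norm \<xi>)\<^sup>2)"
        unfolding d_def by real_asymp
    qed
    fix n
    show "AE \<xi> in lborel. norm (cis (\<xi> \<bullet> z) * complex_of_real (?q n ((norm \<xi>)\<^sup>2))) \<le> (norm \<xi>)\<^sup>2 * exp (- t * (norm \<xi>)\<^sup>2)"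
    proof (intro AE_I2)
      fix \<xi> :: "real^3"
      let ?r = "(norm \<xi>)\<^sup>2"
      have e: "exp (- (t + d n) * ?r) = exp (- t * ?r) * exp (- (d n * ?r))" by (simp add: algebra_simps flip: exp_add)
      have "1 - exp (- (d n * ?r)) \<le> d n * ?r" using exp_ge_add_one_self[of "- (d n * ?r)"] by linarith
      then have "exp (- t * ?r) * (1 - exp (- (d n * ?r))) \<le> exp (- t * ?r) * (d n * ?r)" by (intro mult_left_mono) auto
      moreover have "0 \<le> 1 - exp (- (d n * ?r))" using d[of n] by simp
      ultimately have "0 \<le> ?q n ?r" "?q n ?r \<le> ?r * exp (- t * ?r)"
        unfolding e using d[of n] by (auto simp: field_simps)
      then show "norm (cis (\<xi> \<bullet> z) * complex_of_real (?q n ?r)) \<le> ?r * exp (- t * ?r)"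
        by (simp add: norm_mult del: of_real_divide of_real_diff)
    qed
  qed measurable
  have "?f = (\<lambda>n. complex_of_real ((2 * pi) ^ 3 * ((heat t z - heat (t + d n) z) / d n)))"
  proof
    fix n
    have td: "t + d n > 0" using t d[of n] by simp
    have i: "integrable lborel (\<lambda>\<xi>. cis (\<xi> \<bullet> z) * complex_of_real (exp (- s * (norm \<xi>)\<^sup>2)))" if "s > 0" for s
      using integrable_cis_gaussian[OF that, of z] by (simp add: inner_commute)
    let ?A = "\<lambda>s \<xi>. cis (\<xi> \<bullet> z) * complex_of_real (exp (- s * (norm \<xi>)\<^sup>2))"
    have "?f n = (\<integral>\<xi>. (?A t \<xi> - ?A (t + d n) \<xi>) / complex_of_real (d n) \<partial>lborel)"
      by (intro Bochner_Integration.integral_cong refl) (simp add: right_diff_distrib diff_divide_distrib)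
    also have "\<dots> = (\<integral>\<xi>. ?A t \<xi> - ?A (t + d n) \<xi> \<partial>lborel) / complex_of_real (d n)"
      by (rule integral_divide_zero)
    also have "(\<integral>\<xi>. ?A t \<xi> - ?A (t + d n) \<xi> \<partial>lborel) = (\<integral>\<xi>. ?A t \<xi> \<partial>lborel) - (\<integral>\<xi>. ?A (t + d n) \<xi> \<partial>lborel)"
      by (rule Bochner_Integration.integral_diff[OF i[OF t] i[OF td]])
    also have "((\<integral>\<xi>. ?A t \<xi> \<partial>lborel) - (\<integral>\<xi>. ?A (t + d n) \<xi> \<partial>lborel)) / complex_of_real (d n) = complex_of_real ((2 * pi) ^ 3 * ((heat t z - heat (t + d n) z) / d n))"
      unfolding fourier_heat[OF t] fourier_heat[OF td] by (simp add: right_diff_distrib)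
    finally show "?f n = complex_of_real ((2 * pi) ^ 3 * ((heat t z - heat (t + d n) z) / d n))" .
  qed
  moreover have "(\<lambda>n. (heat t z - heat (t + d n) z) / d n) \<longlonglongrightarrow> heat' t z"
  proof -
    have "((\<lambda>h. (heat (t + h) z - heat t z) / h) \<longlongrightarrow> - heat' t z) (at 0)"
      using heat_deriv[OF t, of z] unfolding DERIV_def .
    then have "(\<lambda>n. (heat (t + d n) z - heat t z) / d n) \<longlonglongrightarrow> - heat' t z"
      by (rule filterlim_compose) (use d d0 in \<open>auto simp: filterlim_at less_imp_neq[symmetric] intro!: always_eventually\<close>)
    then have "(\<lambda>n. - ((heat (t + d n) z - heat t z) / d n)) \<longlonglongrightarrow> - (- heat' t z)" by (rule tendsto_minus)
    then show ?thesis by (simp add: minus_divide_left)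
  qed
  ultimately show "?f \<longlonglongrightarrow> complex_of_real ((2 * pi) ^ 3 * heat' t z)"
    by (simp only:) (intro tendsto_of_real tendsto_mult tendsto_const)
qed

text \<open>The half Laplacian of a Gaussian, by \<open>norm \<xi> = 1 / sqrt pi * (\<integral>a. (norm \<xi>)\<^sup>2 * exp (- a\<^sup>2 * (norm \<xi>)\<^sup>2))\<close>.\<close>

definition half_heat :: "real \<Rightarrow> real^3 \<Rightarrow> real" where
  "half_heat t z = (\<integral>a. heat' (t + a\<^sup>2) z \<partial>lborel) / sqrt pi"

lemma integral_gaussian_real:
  "r > 0 \<Longrightarrow> integrable lborel (\<lambda>a::real. exp (- r * a\<^sup>2))"
  "r > 0 \<Longrightarrow> (\<integral>a. exp (- r * a\<^sup>2) \<partial>lborel) = sqrt (pi / r)"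
  using integrable_gaussian[of r, where 'a=real] integral_gaussian[of r, where 'a=real] by simp_all

text \<open>Division by |\<xi>| is integration of exp (- a^2 * |\<xi>|^2) over a, up to the factor
  sqrt pi; Fubini moves that integral outside. It is used twice: it turns the multiplier |\<xi>|^2
  into |\<xi>| and then |\<xi>| into 1.\<close>

lemma subordinated_transform:
  fixes k :: "real^3 \<Rightarrow> real"
  assumes k: "integrable lborel (\<lambda>\<xi>. k \<xi> / norm \<xi>)" and m[measurable]: "k \<in> borel_measurable borel"
    and K: "\<And>a. (\<integral>\<xi>. cis (\<xi> \<bullet> z) * complex_of_real (k \<xi> * exp (- a\<^sup>2 * (norm \<xi>)\<^sup>2)) \<partial>lborel) = complex_of_real (K a)"
  shows "(\<integral>\<xi>. cis (\<xi> \<bullet> z) * complex_of_real (k \<xi> / norm \<xi>) \<partial>lborel) = complex_of_real ((\<integral>a. K a \<partial>lborel) / sqrt pi)"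
proof -
  let ?f = "\<lambda>\<xi> a. cis (\<xi> \<bullet> z) * complex_of_real (k \<xi> * exp (- a\<^sup>2 * (norm \<xi>)\<^sup>2))"
  have e: "exp (- a\<^sup>2 * (norm \<xi>)\<^sup>2) = exp (- (norm \<xi>)\<^sup>2 * a\<^sup>2)" for a and \<xi> :: "real^3" by (simp add: mult.commute)
  have r: "(\<integral>a. exp (- a\<^sup>2 * (norm \<xi>)\<^sup>2) \<partial>lborel) = sqrt pi / norm \<xi>" "integrable lborel (\<lambda>a. exp (- a\<^sup>2 * (norm \<xi>)\<^sup>2))" if "\<xi> \<noteq> 0" for \<xi> :: "real^3"
    unfolding e using integral_gaussian_real[of "(norm \<xi>)\<^sup>2"] that by (simp_all add: real_sqrt_divide)
  have ae: "AE \<xi> in lborel. (\<xi>::real^3) \<noteq> 0" by (rule AE_lborel_singleton)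
  have n: "norm (?f \<xi> a) = \<bar>k \<xi>\<bar> * exp (- a\<^sup>2 * (norm \<xi>)\<^sup>2)" for \<xi> a by (simp add: norm_mult abs_mult del: of_real_mult)
  have "(\<integral>\<xi>. \<integral>a. ?f \<xi> a \<partial>lborel \<partial>lborel) = (\<integral>a. \<integral>\<xi>. ?f \<xi> a \<partial>lborel \<partial>lborel)"
  proof (rule integral_swap_lborel)
    show "AE \<xi> in lborel. integrable lborel (?f \<xi>)"
      using ae by eventually_elim (use r in \<open>auto intro!: integrable_mult_right integrable_of_real simp del: of_real_mult\<close>)
    have "integrable lborel (\<lambda>\<xi>. sqrt pi * \<bar>k \<xi> / norm \<xi>\<bar>)" by (intro integrable_mult_right integrable_abs k)
    then show "integrable lborel (\<lambda>\<xi>. \<integral>a. norm (?f \<xi> a) \<partial>lborel)"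
      unfolding n
    proof (rule integrable_cong_AE_imp)
      show "AE \<xi> in lborel. sqrt pi * \<bar>k \<xi> / norm \<xi>\<bar> = (\<integral>a. \<bar>k \<xi>\<bar> * exp (- a\<^sup>2 * (norm \<xi>)\<^sup>2) \<partial>lborel)"
        using ae
      proof eventually_elim
        case (elim \<xi>)
        have "(\<integral>a. \<bar>k \<xi>\<bar> * exp (- a\<^sup>2 * (norm \<xi>)\<^sup>2) \<partial>lborel) = \<bar>k \<xi>\<bar> * (\<integral>a. exp (- a\<^sup>2 * (norm \<xi>)\<^sup>2) \<partial>lborel)"
          by (rule integral_mult_right_zero)
        then show ?case unfolding r(1)[OF elim] by simp
      qed
    qed measurable
  qed measurable
  also have "\<dots> = complex_of_real (\<integral>a. K a \<partial>lborel)" unfolding K by simp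
  also have "(\<integral>\<xi>. \<integral>a. ?f \<xi> a \<partial>lborel \<partial>lborel) = (\<integral>\<xi>. complex_of_real (sqrt pi) * (cis (\<xi> \<bullet> z) * complex_of_real (k \<xi> / norm \<xi>)) \<partial>lborel)"
  proof (rule integral_cong_AE)
    show "AE \<xi> in lborel. (\<integral>a. ?f \<xi> a \<partial>lborel) = complex_of_real (sqrt pi) * (cis (\<xi> \<bullet> z) * complex_of_real (k \<xi> / norm \<xi>))"
      using ae
    proof eventually_elim
      case (elim \<xi>)
      have "(\<integral>a. ?f \<xi> a \<partial>lborel) = cis (\<xi> \<bullet> z) * complex_of_real (\<integral>a. k \<xi> * exp (- a\<^sup>2 * (norm \<xi>)\<^sup>2) \<partial>lborel)"
        by (simp del: of_real_mult)
      also have "(\<integral>a. k \<xi> * exp (- a\<^sup>2 * (norm \<xi>)\<^sup>2) \<partial>lborel) = k \<xi> * (sqrt pi / norm \<xi>)" unfolding r(1)[OF elim, symmetric] by (rule integral_mult_right_zero)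
      finally show ?case by simp
    qed
  qed measurable
  also have "\<dots> = complex_of_real (sqrt pi) * (\<integral>\<xi>. cis (\<xi> \<bullet> z) * complex_of_real (k \<xi> / norm \<xi>) \<partial>lborel)"
    using integrable_cis_times[OF k] by (simp del: of_real_divide)
  finally show ?thesis by (simp add: field_simps)
qed

lemma fourier_half_heat:
  assumes t: "t > 0"
  shows "(\<integral>\<xi>. cis (\<xi> \<bullet> z) * complex_of_real (norm \<xi> * exp (- t * (norm \<xi>)\<^sup>2)) \<partial>lborel) = complex_of_real ((2 * pi) ^ 3 * half_heat t z)"
proof -
  let ?k = "\<lambda>\<xi>::real^3. (norm \<xi>)\<^sup>2 * exp (- t * (norm \<xi>)\<^sup>2)"
  have eq: "?k \<xi> / norm \<xi> = norm \<xi> * exp (- t * (norm \<xi>)\<^sup>2)" for \<xi> by (simp add: power2_eq_square)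
  have "(\<integral>\<xi>. cis (\<xi> \<bullet> z) * complex_of_real (?k \<xi> / norm \<xi>) \<partial>lborel) = complex_of_real ((\<integral>a. (2 * pi) ^ 3 * heat' (t + a\<^sup>2) z \<partial>lborel) / sqrt pi)"
  proof (rule subordinated_transform)
    show "integrable lborel (\<lambda>\<xi>. ?k \<xi> / norm \<xi>)" unfolding eq by (rule integrable_norm_gaussian[OF t])
    fix a :: real
    have e: "exp (- t * r) * exp (- a\<^sup>2 * r) = exp (- (t + a\<^sup>2) * r)" for r by (simp add: algebra_simps flip: exp_add)
    have "t + a\<^sup>2 > 0" using t by (simp add: add_pos_nonneg)
    from fourier_heat'[OF this, of z]
    show "(\<integral>\<xi>. cis (\<xi> \<bullet> z) * complex_of_real (?k \<xi> * exp (- a\<^sup>2 * (norm \<xi>)\<^sup>2)) \<partial>lborel) = complex_of_real ((2 * pi) ^ 3 * heat' (t + a\<^sup>2) z)"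
      by (simp only: e mult.assoc)
  qed measurable
  then show ?thesis unfolding eq by (simp add: half_heat_def)
qed

text \<open>The half Laplacian is undone here: replacing t by t + b^2 multiplies the transform by
  exp (- b^2 * |\<xi>|^2), and integrating over b divides it by |\<xi>|.\<close>

lemma integral_half_heat:
  assumes t: "t > 0"
  shows "(\<integral>b. half_heat (t + b\<^sup>2) z \<partial>lborel) / sqrt pi = heat t z"
proof -
  let ?k = "\<lambda>\<xi>::real^3. norm \<xi> * exp (- t * (norm \<xi>)\<^sup>2)"
  have eq: "AE \<xi> in lborel. exp (- t * (norm \<xi>)\<^sup>2) = ?k \<xi> / norm \<xi>"
    using AE_lborel_singleton[of "0::real^3"] by eventually_elim simp
  have "(\<integral>\<xi>. cis (\<xi> \<bullet> z) * complex_of_real (?k \<xi> / norm \<xi>) \<partial>lborel) = complex_of_real ((\<integral>a. (2 * pi) ^ 3 * half_heat (t + a\<^sup>2) z \<partial>lborel) / sqrt pi)"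
  proof (rule subordinated_transform)
    show "integrable lborel (\<lambda>\<xi>. ?k \<xi> / norm \<xi>)"
      by (rule integrable_cong_AE_imp[OF integrable_gaussian[OF t] _ eq]) measurable
    fix a :: real
    have e: "exp (- t * r) * exp (- a\<^sup>2 * r) = exp (- (t + a\<^sup>2) * r)" for r by (simp add: algebra_simps flip: exp_add)
    have "t + a\<^sup>2 > 0" using t by (simp add: add_pos_nonneg)
    from fourier_half_heat[OF this, of z]
    show "(\<integral>\<xi>. cis (\<xi> \<bullet> z) * complex_of_real (?k \<xi> * exp (- a\<^sup>2 * (norm \<xi>)\<^sup>2)) \<partial>lborel) = complex_of_real ((2 * pi) ^ 3 * half_heat (t + a\<^sup>2) z)"
      by (simp only: e mult.assoc)
  qed measurable
  moreover have "(\<integral>\<xi>. cis (\<xi> \<bullet> z) * complex_of_real (?k \<xi> / norm \<xi>) \<partial>lborel) = (\<integral>\<xi>. cis (\<xi> \<bullet> z) * complex_of_real (exp (- t * (norm \<xi>)\<^sup>2)) \<partial>lborel)"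
    by (rule integral_cong_AE) (use eq in \<open>auto elim!: eventually_mono\<close>)
  ultimately have "complex_of_real ((\<integral>a. (2 * pi) ^ 3 * half_heat (t + a\<^sup>2) z \<partial>lborel) / sqrt pi) = complex_of_real ((2 * pi) ^ 3 * heat t z)"
    using fourier_heat[OF t, of z] by simp
  then have "(\<integral>a. (2 * pi) ^ 3 * half_heat (t + a\<^sup>2) z \<partial>lborel) / sqrt pi = (2 * pi) ^ 3 * heat t z"
    by (simp only: of_real_eq_iff)
  then have "(2 * pi) ^ 3 * ((\<integral>a. half_heat (t + a\<^sup>2) z \<partial>lborel) / sqrt pi) = (2 * pi) ^ 3 * heat t z"
    by (simp only: integral_mult_right_zero times_divide_eq_right)
  then show ?thesis by (subst (asm) mult_left_cancel) auto
qed

lemma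
  assumes q: "q > 0"
  shows integrable_inverse_plus_square: "integrable lborel (\<lambda>b::real. 1 / (q + b\<^sup>2))"
    and integral_inverse_plus_square: "(\<integral>(b::real). 1 / (q + b\<^sup>2) \<partial>lborel) = pi / sqrt q"
proof -
  have U: "einterval (-\<infinity>) \<infinity> = UNIV" by (auto simp: einterval_def)
  have i: "integrable lborel (\<lambda>x::real. inverse (1 + x\<^sup>2))"
    using integrable_inverse_1_plus_square unfolding set_integrable_def U by simp
  have v: "(\<integral>(x::real). inverse (1 + x\<^sup>2) \<partial>lborel) = pi"
    using LBINT_inverse_1_plus_square unfolding interval_lebesgue_integral_def set_lebesgue_integral_def U by simp
  have eq: "1 / (q + b\<^sup>2) = inverse (1 + (0 + (1 / sqrt q) * b)\<^sup>2) / q" for b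
  proof -
    have "(1 + (0 + (1 / sqrt q) * b)\<^sup>2) * q = q + b\<^sup>2" using q by (simp add: power_divide distrib_right)
    then have "1 / (q + b\<^sup>2) = 1 / ((1 + (0 + (1 / sqrt q) * b)\<^sup>2) * q)" by (rule arg_cong[symmetric])
    then show ?thesis by (simp add: divide_inverse)
  qed
  show "integrable lborel (\<lambda>b::real. 1 / (q + b\<^sup>2))"
    unfolding eq using q by (intro integrable_divide_zero lborel_integrable_real_affine[OF i]) auto
  have "(\<integral>(x::real). inverse (1 + x\<^sup>2) \<partial>lborel) = \<bar>1 / sqrt q\<bar> *\<^sub>R (\<integral>b. inverse (1 + (0 + (1 / sqrt q) * b)\<^sup>2) \<partial>lborel)"
    using q by (intro lborel_integral_real_affine) auto
  then have "(\<integral>b. inverse (1 + (0 + (1 / sqrt q) * b)\<^sup>2) \<partial>lborel) = pi * sqrt q"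
    using v q by (simp add: field_simps)
  then show "(\<integral>(b::real). 1 / (q + b\<^sup>2) \<partial>lborel) = pi / sqrt q"
    unfolding eq integral_divide_zero using q by (simp add: field_simps real_sqrt_mult_self)
qed

section \<open>Uniform bounds for the heat kernel and its relatives\<close>

lemma power5_exp_bounded: "\<exists>K>0. \<forall>u\<ge>1. u ^ 5 * exp (- (u - 1) / 4) \<le> (K::real)"
proof -
  \<comment> \<open>The constant is \<open>fact 5 * 4 ^ 5\<close>, from the fifth term of the series
    of exp (u / 4).\<close>
  have "u ^ 5 * exp (- (u - 1) / 4) \<le> 122880 * exp (1 / 4)" if "u \<ge> 1" for u :: real
  proof -
    have s: "(\<lambda>n. (u / 4) ^ n /\<^sub>R fact n) sums exp (u / 4)" by (rule exp_converges)
    have "(\<Sum>n\<in>{5}. (u / 4) ^ n /\<^sub>R fact n) \<le> exp (u / 4)"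
      unfolding sums_unique[OF s] using that by (intro sum_le_suminf sums_summable[OF s]) auto
    then have "u ^ 5 \<le> 122880 * exp (u / 4)" by (simp add: power_divide eval_nat_numeral)
    then have "u ^ 5 * exp (- (u - 1) / 4) \<le> 122880 * exp (u / 4) * exp (- (u - 1) / 4)"
      by (intro mult_right_mono) auto
    also have "\<dots> = 122880 * exp (1 / 4)" by (simp add: diff_divide_distrib flip: exp_add)
    finally show ?thesis .
  qed
  then show ?thesis by (intro exI[of _ "122880 * exp (1 / 4)"]) auto
qed

text \<open>One constant for all kernel bounds below. The fifth power suffices because the worst
  loss is u^4 * sqrt u with u \<ge> 1.\<close>

definition Kc :: real where "Kc = (SOME K. K > 0 \<and> (\<forall>u\<ge>1. u ^ 5 * exp (- (u - 1) / 4) \<le> K))"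

lemma Kc: "Kc > 0" "u \<ge> 1 \<Longrightarrow> u ^ 5 * exp (- (u - 1) / 4) \<le> Kc"
  using someI_ex[OF power5_exp_bounded[unfolded Bex_def]] unfolding Kc_def by auto

text \<open>With u = (t + \<rho>) / t the exponent - \<rho> / (4 * t) equals - (u - 1) / 4, so the
  expression depends on u alone. This exchanges powers of t in a denominator for powers of t +
  \<rho>.\<close>

lemma Kc_le:
  assumes t: "t > 0" and \<rho>: "\<rho> \<ge> 0" and j: "j \<le> 4"
  shows "((t + \<rho>) / t) ^ j * (sqrt (t + \<rho>) / sqrt t) * exp (- \<rho> / (4 * t)) \<le> Kc"
proof -
  define u where "u = (t + \<rho>) / t"
  have u: "u \<ge> 1" using t \<rho> by (simp add: u_def)
  have e: "- \<rho> / (4 * t) = - (u - 1) / 4" using t by (simp add: u_def field_simps)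
  have "sqrt u \<le> u" using u by (intro real_le_lsqrt) (auto simp: power2_eq_square)
  then have "u ^ j * sqrt u * exp (- (u - 1) / 4) \<le> u ^ 4 * u * exp (- (u - 1) / 4)"
    using u j by (intro mult_right_mono mult_mono power_increasing) auto
  also have "\<dots> \<le> Kc" using Kc(2)[OF u] by (simp add: eval_nat_numeral mult_ac)
  finally show ?thesis unfolding e u_def[symmetric] by (simp add: u_def real_sqrt_divide)
qed

lemma Kc_divide_le:
  assumes t: "t > 0" and \<rho>: "\<rho> \<ge> 0" and j: "j \<le> 4"
    and D: "((t + \<rho>) / t) ^ j * (sqrt (t + \<rho>) / sqrt t) * exp (- \<rho> / (4 * t)) = X * D" and D0: "D > 0"
  shows "X \<le> Kc / D"
  using Kc_le[OF t \<rho> j] D0 unfolding D by (simp add: field_simps)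

lemma heat_denominator:
  assumes "t > 0"
  shows "t * sqrt t \<le> sqrt (4 * pi * t) ^ 3"
proof -
  have "1 * t \<le> (4 * pi) * t" using assms pi_gt3 by (intro mult_right_mono) auto
  then have "sqrt t ^ 3 \<le> sqrt (4 * pi * t) ^ 3" using assms by (intro power_mono) auto
  then show ?thesis using assms by (simp add: power3_eq_cube)
qed

text \<open>A bound in t + |z|^2 alone is chosen because after the substitution t = s + b^2 it can
  be compared with 1 / (q + b^2), whose integral over b is explicit.\<close>

lemma heat_le:
  assumes t: "t > 0" and \<rho>: "\<rho> = (norm z)\<^sup>2"
  shows "heat t z \<le> Kc / ((t + \<rho>) * sqrt (t + \<rho>))"
proof -
  have r: "\<rho> \<ge> 0" by (simp add: \<rho>)
  have "heat t z \<le> exp (- \<rho> / (4 * t)) / (t * sqrt t)"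
    unfolding heat_def \<rho> using t heat_denominator[OF t] by (intro divide_left_mono) auto
  also have "\<dots> \<le> Kc / ((t + \<rho>) * sqrt (t + \<rho>))"
  proof (rule Kc_divide_le[OF t r, of 1])
    show "((t + \<rho>) / t) ^ 1 * (sqrt (t + \<rho>) / sqrt t) * exp (- \<rho> / (4 * t)) =
      exp (- \<rho> / (4 * t)) / (t * sqrt t) * ((t + \<rho>) * sqrt (t + \<rho>))" by simp
  qed (use t r in \<open>auto intro!: mult_pos_pos add_pos_nonneg\<close>)
  finally show ?thesis .
qed

text \<open>\<open>heat'\<close> as a function of the squared distance, so that its values at two
  points can be compared by a mean value estimate in one variable.\<close>

definition heat'_profile :: "real \<Rightarrow> real \<Rightarrow> real" where
  "heat'_profile t \<rho> = (3 / (2 * t) - \<rho> / (4 * t\<^sup>2)) * (exp (- \<rho> / (4 * t)) / sqrt (4 * pi * t) ^ 3)"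

lemma heat'_eq_profile: "heat' t z = heat'_profile t ((norm z)\<^sup>2)"
  by (simp add: heat'_def heat'_profile_def heat_def)

lemma heat'_le:
  assumes t: "t > 0" and \<rho>: "\<rho> = (norm z)\<^sup>2"
  shows "\<bar>heat' t z\<bar> \<le> 2 * Kc / ((t + \<rho>)\<^sup>2 * sqrt (t + \<rho>))"
proof -
  have r: "\<rho> \<ge> 0" by (simp add: \<rho>)
  have "\<bar>3 / (2 * t) - \<rho> / (4 * t\<^sup>2)\<bar> \<le> 3 / (2 * t) + \<rho> / (4 * t\<^sup>2)"
    using t r by (intro order_trans[OF abs_triangle_ineq4]) auto
  also have "\<dots> \<le> 2 * ((t + \<rho>) / t / t)" using t r by (simp add: field_simps power2_eq_square)
  finally have a: "\<bar>3 / (2 * t) - \<rho> / (4 * t\<^sup>2)\<bar> \<le> 2 * ((t + \<rho>) / t / t)" .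
  have "\<bar>heat' t z\<bar> = \<bar>3 / (2 * t) - \<rho> / (4 * t\<^sup>2)\<bar> * (exp (- \<rho> / (4 * t)) / sqrt (4 * pi * t) ^ 3)"
    unfolding heat'_def heat_def \<rho> using t by (simp add: abs_mult)
  also have "\<dots> \<le> (2 * ((t + \<rho>) / t / t)) * (exp (- \<rho> / (4 * t)) / (t * sqrt t))"
    using a t r heat_denominator[OF t] by (intro mult_mono divide_left_mono) auto
  also have "\<dots> = 2 * (((t + \<rho>) / t / t) * (exp (- \<rho> / (4 * t)) / (t * sqrt t)))" by simp
  also have "((t + \<rho>) / t / t) * (exp (- \<rho> / (4 * t)) / (t * sqrt t)) \<le> Kc / ((t + \<rho>)\<^sup>2 * sqrt (t + \<rho>))"
  proof (rule Kc_divide_le[OF t r, of 3])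
    show "((t + \<rho>) / t) ^ 3 * (sqrt (t + \<rho>) / sqrt t) * exp (- \<rho> / (4 * t)) =
      ((t + \<rho>) / t / t) * (exp (- \<rho> / (4 * t)) / (t * sqrt t)) * ((t + \<rho>)\<^sup>2 * sqrt (t + \<rho>))"
      by (simp add: power2_eq_square power3_eq_cube mult_ac)
  qed (use t r in \<open>auto intro!: mult_pos_pos add_pos_nonneg zero_less_power\<close>)
  finally show ?thesis by simp
qed

text \<open>Differentiation in the squared distance gains one power of t + \<rho>. This gain is what
  makes differences of kernels integrable against the available weight.\<close>

lemma heat'_profile_Lipschitz:
  assumes t: "t > 0" and q: "0 < q" "q \<le> t + \<rho>1" "q \<le> t + \<rho>2" and r: "\<rho>1 \<ge> 0" "\<rho>2 \<ge> 0"
  shows "\<bar>heat'_profile t \<rho>1 - heat'_profile t \<rho>2\<bar> \<le> \<bar>\<rho>1 - \<rho>2\<bar> * (Kc / (q ^ 3 * sqrt q))"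
proof -
  let ?d = "\<lambda>\<rho>. (- (5 / 8) / t\<^sup>2 + \<rho> / (16 * t ^ 3)) * (exp (- \<rho> / (4 * t)) / sqrt (4 * pi * t) ^ 3)"
  have der: "(heat'_profile t has_real_derivative ?d \<rho>) (at \<rho>)" for \<rho>
  proof -
    have ne: "sqrt (4 * pi * t) ^ 3 \<noteq> 0" using t by simp
    have "((\<lambda>\<rho>. (3 / (2 * t) - \<rho> / (4 * t\<^sup>2)) * (exp (- \<rho> / (4 * t)) * c)) has_real_derivative
        (- 1 / (4 * t\<^sup>2)) * (exp (- \<rho> / (4 * t)) * c) + (exp (- \<rho> / (4 * t)) * (- 1 / (4 * t)) * c) * (3 / (2 * t) - \<rho> / (4 * t\<^sup>2))) (at \<rho>)" for c
    proof (rule DERIV_mult)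
      show "((\<lambda>\<rho>. 3 / (2 * t) - \<rho> / (4 * t\<^sup>2)) has_real_derivative - 1 / (4 * t\<^sup>2)) (at \<rho>)"
        using t by (auto intro!: derivative_eq_intros simp: power4_eq_xxxx power2_eq_square)
      show "((\<lambda>\<rho>. exp (- \<rho> / (4 * t)) * c) has_real_derivative exp (- \<rho> / (4 * t)) * (- 1 / (4 * t)) * c) (at \<rho>)"
        using t by (auto intro!: derivative_eq_intros simp: power2_eq_square)
    qed
    moreover have "(- 1 / (4 * t\<^sup>2)) * (exp (- \<rho> / (4 * t)) * c) + (exp (- \<rho> / (4 * t)) * (- 1 / (4 * t)) * c) * (3 / (2 * t) - \<rho> / (4 * t\<^sup>2))
       = (- (5 / 8) / t\<^sup>2 + \<rho> / (16 * t ^ 3)) * (exp (- \<rho> / (4 * t)) * c)" for c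
    proof -
      define E where "E = exp (- \<rho> / (4 * t)) * c"
      have "(- 1 / (4 * t\<^sup>2)) * E + (E * (- 1 / (4 * t))) * (3 / (2 * t) - \<rho> / (4 * t\<^sup>2)) = (- (5 / 8) / t\<^sup>2 + \<rho> / (16 * t ^ 3)) * E"
        using t by (simp add: field_simps power2_eq_square power3_eq_cube)
      then show ?thesis unfolding E_def by (simp add: mult_ac)
    qed
    ultimately show ?thesis unfolding heat'_profile_def[abs_def] divide_inverse[of "exp _" "sqrt _ ^ 3"] by simp
  qed
  have bound: "\<bar>?d \<rho>\<bar> \<le> Kc / (q ^ 3 * sqrt q)" if \<rho>: "q \<le> t + \<rho>" "\<rho> \<ge> 0" for \<rho>
  proof -
    have "\<bar>- (5 / 8) / t\<^sup>2 + \<rho> / (16 * t ^ 3)\<bar> \<le> (5 / 8) / t\<^sup>2 + \<rho> / (16 * t ^ 3)"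
      using t \<rho> by (intro order_trans[OF abs_triangle_ineq]) auto
    also have "\<dots> \<le> (t + \<rho>) / t / t\<^sup>2" using t \<rho> by (simp add: field_simps power2_eq_square power3_eq_cube)
    finally have a: "\<bar>- (5 / 8) / t\<^sup>2 + \<rho> / (16 * t ^ 3)\<bar> \<le> (t + \<rho>) / t / t\<^sup>2" .
    have "\<bar>?d \<rho>\<bar> = \<bar>- (5 / 8) / t\<^sup>2 + \<rho> / (16 * t ^ 3)\<bar> * (exp (- \<rho> / (4 * t)) / sqrt (4 * pi * t) ^ 3)"
      using t by (simp add: abs_mult)
    also have "\<dots> \<le> ((t + \<rho>) / t / t\<^sup>2) * (exp (- \<rho> / (4 * t)) / (t * sqrt t))"
      using a t \<rho> heat_denominator[OF t] by (intro mult_mono divide_left_mono) auto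
    also have "\<dots> \<le> Kc / ((t + \<rho>) ^ 3 * sqrt (t + \<rho>))"
    proof (rule Kc_divide_le[OF t \<rho>(2), of 4])
      show "((t + \<rho>) / t) ^ 4 * (sqrt (t + \<rho>) / sqrt t) * exp (- \<rho> / (4 * t)) =
        ((t + \<rho>) / t / t\<^sup>2) * (exp (- \<rho> / (4 * t)) / (t * sqrt t)) * ((t + \<rho>) ^ 3 * sqrt (t + \<rho>))"
        by (simp add: power2_eq_square power3_eq_cube power4_eq_xxxx mult_ac)
    qed (use t \<rho> in \<open>auto intro!: mult_pos_pos add_pos_nonneg zero_less_power\<close>)
    also have "\<dots> \<le> Kc / (q ^ 3 * sqrt q)"
      using Kc(1) q \<rho> by (intro divide_left_mono mult_mono power_mono) auto
    finally show ?thesis .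
  qed
  \<comment> \<open>The half-line is convex, contains both arguments, and consists of nonnegative
    numbers with t + \<rho> \<ge> q, so the derivative bound holds between them.\<close>
  have "norm (heat'_profile t \<rho>1 - heat'_profile t \<rho>2) \<le> (Kc / (q ^ 3 * sqrt q)) * norm (\<rho>1 - \<rho>2)"
  proof (rule field_differentiable_bound[where S="{max 0 (q - t)..}"])
    show "(heat'_profile t has_field_derivative ?d \<rho>) (at \<rho> within {max 0 (q - t)..})" for \<rho>
      by (rule has_field_derivative_at_within[OF der])
    show "norm (?d \<rho>) \<le> Kc / (q ^ 3 * sqrt q)" if "\<rho> \<in> {max 0 (q - t)..}" for \<rho>
      using bound[of \<rho>] that by (simp add: algebra_simps)
  qed (use q r in auto)
  then show ?thesis by (simp add: mult.commute)
qed

lemma borel_measurable_half_heat [measurable (raw)]: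
  assumes [measurable]: "f \<in> borel_measurable M" "g \<in> borel_measurable M"
  shows "(\<lambda>x. half_heat (f x) (g x)) \<in> borel_measurable M"
  unfolding half_heat_def by measurable

lemma half_heat_minus: "half_heat t (x - y) = half_heat t (y - x)"
  by (simp add: half_heat_def heat_minus(2))

text \<open>The bound for \<open>half_heat\<close> decays like |z|^-4, matching the weight in
  \<open>L_half\<close>, so for fixed t it can be paired with a function controlled only by that
  weight.\<close>

lemma integrable_heat':
  assumes t: "t > 0"
  shows "integrable lborel (\<lambda>a. heat' (t + a\<^sup>2) z)"
    and "\<bar>half_heat t z\<bar> \<le> 2 * Kc * sqrt pi / (t + (norm z)\<^sup>2)\<^sup>2"
proof -
  define q where "q = t + (norm z)\<^sup>2"
  have q: "q > 0" using t by (simp add: q_def add_pos_nonneg)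
  have b: "\<bar>heat' (t + a\<^sup>2) z\<bar> \<le> (2 * Kc / (q * sqrt q)) * (1 / (q + a\<^sup>2))" for a
  proof -
    have "t + a\<^sup>2 > 0" using t by (simp add: add_pos_nonneg)
    from heat'_le[OF this refl, of z]
    have "\<bar>heat' (t + a\<^sup>2) z\<bar> \<le> 2 * Kc / ((q + a\<^sup>2)\<^sup>2 * sqrt (q + a\<^sup>2))" by (simp add: q_def algebra_simps)
    also have "\<dots> \<le> 2 * Kc / ((q * (q + a\<^sup>2)) * sqrt q)"
      using q Kc(1) by (intro divide_left_mono mult_mono) (auto simp: power2_eq_square add_pos_nonneg intro!: mult_right_mono)
    finally show ?thesis by (simp add: mult_ac)
  qed
  have i: "integrable lborel (\<lambda>a. (2 * Kc / (q * sqrt q)) * (1 / (q + a\<^sup>2)))"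
    by (intro integrable_mult_right integrable_inverse_plus_square q)
  show ii: "integrable lborel (\<lambda>a. heat' (t + a\<^sup>2) z)"
    by (rule Bochner_Integration.integrable_bound[OF i]) (use b q Kc(1) in \<open>auto intro!: AE_I2 simp: add_nonneg_nonneg\<close>)
  have "\<bar>half_heat t z\<bar> \<le> (\<integral>a. \<bar>heat' (t + a\<^sup>2) z\<bar> \<partial>lborel) / sqrt pi"
    unfolding half_heat_def using integral_abs_bound[of lborel "\<lambda>a. heat' (t + a\<^sup>2) z"] by (simp add: divide_right_mono)
  also have "\<dots> \<le> (\<integral>a. (2 * Kc / (q * sqrt q)) * (1 / (q + a\<^sup>2)) \<partial>lborel) / sqrt pi"
    by (intro divide_right_mono integral_mono integrable_abs ii i b) auto
  also have "\<dots> = (2 * Kc / (q * sqrt q)) * (pi / sqrt q) / sqrt pi"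
    unfolding integral_mult_right_zero integral_inverse_plus_square[OF q] ..
  also have "\<dots> = 2 * Kc * sqrt pi / q\<^sup>2"
    using q by (simp add: field_simps power2_eq_square)
  finally show "\<bar>half_heat t z\<bar> \<le> 2 * Kc * sqrt pi / (t + (norm z)\<^sup>2)\<^sup>2" by (simp add: q_def)
qed

text \<open>After integration over b the bound for a single kernel decays only like |z|^-3. Here the
  result is of order D * q^(-5/2), where D is the difference of the squared distances; D grows
  linearly in the common shift, which leaves fourth order decay.\<close>

lemma half_heat_diff_le:
  assumes s: "s > 0" and q: "0 < q" "q \<le> s + (norm z1)\<^sup>2" "q \<le> s + (norm z2)\<^sup>2"
  shows "\<bar>half_heat (s + b\<^sup>2) z1 - half_heat (s + b\<^sup>2) z2\<bar> \<le> \<bar>(norm z1)\<^sup>2 - (norm z2)\<^sup>2\<bar> * (Kc * sqrt pi / q\<^sup>2) * (1 / (q + b\<^sup>2))"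
proof -
  let ?D = "\<bar>(norm z1)\<^sup>2 - (norm z2)\<^sup>2\<bar>"
  have t: "s + b\<^sup>2 > 0" using s by (simp add: add_pos_nonneg)
  have bb: "\<bar>heat' (s + b\<^sup>2 + a\<^sup>2) z1 - heat' (s + b\<^sup>2 + a\<^sup>2) z2\<bar> \<le> (?D * (Kc / (q * sqrt q * (q + b\<^sup>2)))) * (1 / (q + a\<^sup>2))" for a
  proof -
    have "\<bar>heat' (s + b\<^sup>2 + a\<^sup>2) z1 - heat' (s + b\<^sup>2 + a\<^sup>2) z2\<bar> \<le> ?D * (Kc / ((q + a\<^sup>2 + b\<^sup>2) ^ 3 * sqrt (q + a\<^sup>2 + b\<^sup>2)))"
      unfolding heat'_eq_profile using s q by (intro heat'_profile_Lipschitz) (auto intro!: add_pos_nonneg)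
    also have "\<dots> \<le> ?D * (Kc / ((q * (q + b\<^sup>2) * (q + a\<^sup>2)) * sqrt q))"
    proof -
      let ?X = "q + a\<^sup>2 + b\<^sup>2"
      have X: "q + a\<^sup>2 > 0" "q + b\<^sup>2 > 0" "?X > 0" "q \<le> ?X" "q + b\<^sup>2 \<le> ?X" "q + a\<^sup>2 \<le> ?X"
        using q(1) zero_le_power2[of a] zero_le_power2[of b] by linarith+
      have "q * (q + b\<^sup>2) * (q + a\<^sup>2) \<le> ?X * ?X * ?X"
        using X q(1) by (intro mult_mono mult_nonneg_nonneg) auto
      then have "(q * (q + b\<^sup>2) * (q + a\<^sup>2)) * sqrt q \<le> ?X ^ 3 * sqrt ?X"
        using X q(1) unfolding power3_eq_cube by (intro mult_mono mult_nonneg_nonneg) auto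
      moreover have "0 < (q * (q + b\<^sup>2) * (q + a\<^sup>2)) * sqrt q"
        by (intro mult_pos_pos X(1,2) q(1)) (simp add: q(1))
      ultimately show ?thesis using Kc(1)
        by (intro mult_left_mono divide_left_mono) (auto intro: mult_pos_pos)
    qed
    also have "\<dots> = (?D * (Kc / (q * sqrt q * (q + b\<^sup>2)))) * (1 / (q + a\<^sup>2))" by (simp add: mult_ac)
    finally show ?thesis .
  qed
  have "\<bar>half_heat (s + b\<^sup>2) z1 - half_heat (s + b\<^sup>2) z2\<bar> = \<bar>\<integral>a. heat' (s + b\<^sup>2 + a\<^sup>2) z1 - heat' (s + b\<^sup>2 + a\<^sup>2) z2 \<partial>lborel\<bar> / sqrt pi"
    unfolding half_heat_def using integrable_heat'(1)[OF t] by (simp add: diff_divide_distrib[symmetric])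
  also have "\<dots> \<le> (\<integral>a. \<bar>heat' (s + b\<^sup>2 + a\<^sup>2) z1 - heat' (s + b\<^sup>2 + a\<^sup>2) z2\<bar> \<partial>lborel) / sqrt pi"
    by (intro divide_right_mono integral_abs_bound) auto
  also have "\<dots> \<le> (\<integral>a. (?D * (Kc / (q * sqrt q * (q + b\<^sup>2)))) * (1 / (q + a\<^sup>2)) \<partial>lborel) / sqrt pi"
    by (intro divide_right_mono integral_mono integrable_abs Bochner_Integration.integrable_diff integrable_heat'(1) t bb integrable_mult_right integrable_inverse_plus_square q) auto
  also have "\<dots> = (?D * (Kc / (q * sqrt q * (q + b\<^sup>2)))) * (pi / sqrt q) / sqrt pi"
    unfolding integral_mult_right_zero integral_inverse_plus_square[OF q(1)] ..
  also have "\<dots> = ?D * (Kc * sqrt pi / q\<^sup>2) * (1 / (q + b\<^sup>2))"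
  proof -
    have p: "pi / sqrt q / sqrt pi = sqrt pi / sqrt q"
    proof -
      have "pi / sqrt q / sqrt pi = (pi / sqrt pi) / sqrt q" by (simp add: mult.commute)
      then show ?thesis by (simp only: real_div_sqrt pi_ge_zero)
    qed
    have Q: "q + b\<^sup>2 > 0" using q by (simp add: add_pos_nonneg)
    have "?D * (Kc / (q * sqrt q * (q + b\<^sup>2))) * (sqrt pi / sqrt q) = ?D * (Kc * sqrt pi / (q * (sqrt q * sqrt q))) * (1 / (q + b\<^sup>2))"
      by (simp add: mult_ac)
    moreover have "?D * (Kc / (q * sqrt q * (q + b\<^sup>2))) * (pi / sqrt q) / sqrt pi = ?D * (Kc / (q * sqrt q * (q + b\<^sup>2))) * (sqrt pi / sqrt q)"
      unfolding p[symmetric] by simp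
    moreover have "sqrt q * sqrt q = q" using q(1) by simp
    ultimately show ?thesis by (simp only: power2_eq_square[of q])
  qed
  finally show ?thesis .
qed

section \<open>The inverse square kernel as an integral of heat kernels\<close>

lemma heat_at_sq:
  "heat (b\<^sup>2) z = exp (- (norm z)\<^sup>2 / (4 * b\<^sup>2)) / (8 * pi * sqrt pi * \<bar>b\<bar> ^ 3)"
proof -
  have "sqrt (4 * pi * b\<^sup>2) = 2 * sqrt pi * \<bar>b\<bar>" by (simp add: real_sqrt_mult)
  then have "sqrt (4 * pi * b\<^sup>2) ^ 3 = 8 * (sqrt pi * sqrt pi) * sqrt pi * \<bar>b\<bar> ^ 3"
    by (simp only: power_mult_distrib) (simp add: power3_eq_cube[of "sqrt pi"])
  then show ?thesis by (simp add: heat_def)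
qed

text \<open>In dimension three the integrand is b^-3 * exp (- \<rho> / (4 * b^2)), which has an
  elementary antiderivative. Up to the factor sqrt pi the value is 1 / (2 * pi^2 * |z|^2), the
  kernel of the inverse of the half Laplacian.\<close>

lemma
  assumes z: "z \<noteq> 0"
  shows integrable_heat_sq: "integrable lborel (\<lambda>b. heat (b\<^sup>2) z)"
    and integral_heat_sq: "(\<integral>b. heat (b\<^sup>2) z \<partial>lborel) = sqrt pi / (2 * pi\<^sup>2 * (norm z)\<^sup>2)"
proof -
  define \<rho> where "\<rho> = (norm z)\<^sup>2"
  have \<rho>: "\<rho> > 0" using z by (simp add: \<rho>_def)
  define c where "c = 1 / (8 * pi * sqrt pi)"
  have E: "einterval 0 \<infinity> = {0<..}" by (auto simp: einterval_def)
  have FTC: "set_integrable lborel (einterval 0 \<infinity>) (\<lambda>b. c * exp (- \<rho> / (4 * b\<^sup>2)) / b ^ 3)"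
    "(LBINT b=0..\<infinity>. c * exp (- \<rho> / (4 * b\<^sup>2)) / b ^ 3) = 2 * c / \<rho> - 0"
  proof -
    let ?F = "\<lambda>b. 2 * c / \<rho> * exp (- \<rho> / (4 * b\<^sup>2))"
    have 1: "DERIV ?F x :> c * exp (- \<rho> / (4 * x\<^sup>2)) / x ^ 3" if "0 < ereal x" for x
    proof -
      have "x > 0" using that by simp
      then show ?thesis using \<rho> by (auto intro!: derivative_eq_intros simp: power2_eq_square power3_eq_cube field_simps)
    qed
    have 2: "isCont (\<lambda>b. c * exp (- \<rho> / (4 * b\<^sup>2)) / b ^ 3) x" if "0 < ereal x" for x
      using that by (auto intro!: continuous_intros)
    have 3: "AE x in lborel. 0 < ereal x \<longrightarrow> ereal x < \<infinity> \<longrightarrow> 0 \<le> c * exp (- \<rho> / (4 * x\<^sup>2)) / x ^ 3"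
      by (auto simp: c_def)
    have "(?F \<longlongrightarrow> 0) (at_right 0)" using \<rho> by real_asymp
    then have 4: "((?F \<circ> real_of_ereal) \<longlongrightarrow> 0) (at_right 0)"
      by (simp add: zero_ereal_def ereal_tendsto_simps1)
    have "(?F \<longlongrightarrow> 2 * c / \<rho>) at_top" using \<rho> by real_asymp
    then have 5: "((?F \<circ> real_of_ereal) \<longlongrightarrow> 2 * c / \<rho>) (at_left \<infinity>)"
      by (simp add: ereal_tendsto_simps1)
    show "set_integrable lborel (einterval 0 \<infinity>) (\<lambda>b. c * exp (- \<rho> / (4 * b\<^sup>2)) / b ^ 3)"
      "(LBINT b=0..\<infinity>. c * exp (- \<rho> / (4 * b\<^sup>2)) / b ^ 3) = 2 * c / \<rho> - 0"
      using interval_integral_FTC_nonneg[OF _ 1 2 3 4 5] by auto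
  qed
  have heq: "c * exp (- \<rho> / (4 * b\<^sup>2)) / b ^ 3 = heat (b\<^sup>2) z" if "b > 0" for b
    using that by (simp add: heat_at_sq c_def \<rho>_def)
  let ?p = "\<lambda>b. indicator {0<..} b * heat (b\<^sup>2) z"
  have peq: "indicator {0<..} b *\<^sub>R (c * exp (- \<rho> / (4 * b\<^sup>2)) / b ^ 3) = ?p b" for b
    using heq by (auto simp: indicator_def)
  have ip: "integrable lborel ?p" using FTC(1) unfolding set_integrable_def E peq .
  have vp: "(\<integral>b. ?p b \<partial>lborel) = 2 * c / \<rho>"
    using FTC(2) unfolding interval_lebesgue_integral_def set_lebesgue_integral_def E peq by simp
  \<comment> \<open>The fundamental theorem covers b > 0; reflection supplies the other
    half-line.\<close>
  have in': "integrable lborel (\<lambda>b. ?p (0 - b))" "(\<integral>b. ?p (0 - b) \<partial>lborel) = 2 * c / \<rho>"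
    using integrable_reflect_iff[of ?p 0] integral_reflect[of ?p 0] ip vp by simp_all
  have ae: "AE b in lborel. ?p b + ?p (0 - b) = heat (b\<^sup>2) z"
    using AE_lborel_singleton[of "0::real"] by eventually_elim (auto simp: indicator_def)
  show "integrable lborel (\<lambda>b. heat (b\<^sup>2) z)"
    by (rule integrable_cong_AE_imp[OF Bochner_Integration.integrable_add[OF ip in'(1)] _ ae]) measurable
  have "(\<integral>b. heat (b\<^sup>2) z \<partial>lborel) = (\<integral>b. ?p b + ?p (0 - b) \<partial>lborel)"
    by (rule integral_cong_AE) (use ae in \<open>auto elim!: eventually_mono\<close>)
  also have "\<dots> = 4 * c / \<rho>" using Bochner_Integration.integral_add[OF ip in'(1)] vp in'(2) by simp
  also have "\<dots> = sqrt pi / (2 * pi\<^sup>2 * (norm z)\<^sup>2)"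
  proof -
    have "4 * c / \<rho> = 1 / sqrt pi / (2 * pi * \<rho>)" by (simp add: c_def)
    also have "1 / sqrt pi = sqrt pi / pi" using real_div_sqrt[of pi] by (simp add: field_simps)
    finally show ?thesis unfolding \<rho>_def[symmetric] by (simp add: power2_eq_square mult_ac)
  qed
  finally show "(\<integral>b. heat (b\<^sup>2) z \<partial>lborel) = sqrt pi / (2 * pi\<^sup>2 * (norm z)\<^sup>2)" .
qed

lemma integral_heat:
  assumes "t > 0"
  shows "integrable lborel (heat t)" "(\<integral>z. heat t z \<partial>lborel) = 1"
proof -
  have eq: "heat t z = exp (- (1 / (4 * t)) * (norm z)\<^sup>2) / sqrt (4 * pi * t) ^ 3" for z
    by (simp add: heat_def)
  show "integrable lborel (heat t)"
    unfolding eq[abs_def] using assms by (intro integrable_divide_zero integrable_gaussian) auto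
  have "sqrt (pi / (1 / (4 * t))) = sqrt (4 * pi * t)" by (rule arg_cong[of _ _ sqrt]) simp
  then have "sqrt (pi / (1 / (4 * t))) ^ DIM(real^3) = sqrt (4 * pi * t) ^ 3" by (simp only:) simp
  moreover have "(\<integral>(z::real^3). exp (- (1 / (4 * t)) * (norm z)\<^sup>2) \<partial>lborel) = sqrt (pi / (1 / (4 * t))) ^ DIM(real^3)"
    using assms by (intro integral_gaussian) simp
  ultimately have "(\<integral>(z::real^3). exp (- (1 / (4 * t)) * (norm z)\<^sup>2) \<partial>lborel) = sqrt (4 * pi * t) ^ 3"
    by (simp only:)
  then show "(\<integral>z. heat t z \<partial>lborel) = 1"
    unfolding eq integral_divide_zero using assms by simp
qed

text \<open>Uniform in s \<le> 1, hence usable as a dominating function away from the origin when s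
  tends to 0.\<close>

lemma heat_le_quartic:
  assumes s: "0 < s" "s \<le> 1" and z: "z \<noteq> 0"
  shows "heat s z \<le> Kc / (norm z) ^ 4"
proof -
  define \<rho> where "\<rho> = (norm z)\<^sup>2"
  have \<rho>: "\<rho> > 0" using z by (simp add: \<rho>_def)
  let ?H = "exp (- \<rho> / (4 * s))"
  have "s \<le> sqrt (s + \<rho>)"
    using s \<rho> by (intro real_le_rsqrt) (auto simp: power2_eq_square intro: order_trans[OF mult_left_le])
  then have *: "sqrt s \<le> sqrt (s + \<rho>) / sqrt s" using s by (simp add: field_simps)
  have "heat s z \<le> ?H / (s * sqrt s)"
    unfolding heat_def \<rho>_def using s heat_denominator[OF s(1)] by (intro divide_left_mono) auto
  also have "\<dots> \<le> Kc / (s + \<rho>)\<^sup>2"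
  proof -
    have "?H / (s * sqrt s) * (s + \<rho>)\<^sup>2 = ((s + \<rho>) / s)\<^sup>2 * (s / sqrt s) * ?H"
      using s by (simp add: power2_eq_square)
    also have "s / sqrt s = sqrt s" using s by (simp add: real_div_sqrt)
    also have "((s + \<rho>) / s)\<^sup>2 * sqrt s * ?H \<le> ((s + \<rho>) / s)\<^sup>2 * (sqrt (s + \<rho>) / sqrt s) * ?H"
      by (intro mult_right_mono mult_left_mono *) auto
    also have "\<dots> \<le> Kc" using Kc_le[of s \<rho> 2] s \<rho> by simp
    finally show ?thesis using s \<rho> by (simp add: field_simps)
  qed
  also have "\<dots> \<le> Kc / \<rho>\<^sup>2"
    using s \<rho> Kc(1) by (intro divide_left_mono power_mono) auto
  finally show ?thesis by (simp add: \<rho>_def)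
qed

lemma heat_tendsto_0:
  assumes "z \<noteq> 0"
  shows "(\<lambda>n. heat (1 / real (Suc n)) z) \<longlonglongrightarrow> 0"
proof -
  define \<rho> where "\<rho> = (norm z)\<^sup>2"
  have "\<rho> > 0" using assms by (simp add: \<rho>_def)
  then have "(\<lambda>n. exp (- \<rho> / (4 * (1 / real (Suc n)))) / sqrt (4 * pi * (1 / real (Suc n))) ^ 3) \<longlonglongrightarrow> 0"
    by real_asymp
  then show ?thesis by (simp add: heat_def \<rho>_def)
qed

text \<open>Integrability against the weight does not depend on its centre, because a translation
  costs only a factor depending on x.\<close>

lemma quartic_weight_translate:
  fixes x z :: "'a::real_normed_vector"
  shows "1 + norm (x - z) ^ 4 \<le> 8 * (1 + norm x ^ 4) * (1 + norm z ^ 4)"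
proof -
  have "norm (x - z) ^ 4 \<le> (norm x + norm z) ^ 4"
    by (intro power_mono norm_triangle_ineq4) auto
  also have "\<dots> = ((norm x + norm z)\<^sup>2)\<^sup>2" by simp
  also have "\<dots> \<le> (2 * ((norm x)\<^sup>2 + (norm z)\<^sup>2))\<^sup>2"
    using zero_le_power2[of "norm x - norm z"] by (intro power_mono) (auto simp: power2_eq_square algebra_simps)
  also have "\<dots> = 4 * ((norm x)\<^sup>2 + (norm z)\<^sup>2)\<^sup>2" by (simp only: power_mult_distrib) simp
  also have "\<dots> \<le> 4 * (2 * (((norm x)\<^sup>2)\<^sup>2 + ((norm z)\<^sup>2)\<^sup>2))"
    using zero_le_power2[of "(norm x)\<^sup>2 - (norm z)\<^sup>2"] by (simp add: power2_eq_square algebra_simps)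
  also have "\<dots> = 8 * norm x ^ 4 + 8 * norm z ^ 4" by simp
  finally have "norm (x - z) ^ 4 \<le> 8 * norm x ^ 4 + 8 * norm z ^ 4" .
  moreover have "0 \<le> norm x ^ 4 * norm z ^ 4" by simp
  moreover have "8 * (1 + norm x ^ 4) * (1 + norm z ^ 4) = 8 + 8 * norm x ^ 4 + 8 * norm z ^ 4 + 8 * (norm x ^ 4 * norm z ^ 4)"
    by (simp add: algebra_simps)
  ultimately show ?thesis by linarith
qed

lemma weight_integrable_times:
  fixes f :: "real^3 \<Rightarrow> real"
  assumes f: "integrable lborel (\<lambda>y. \<bar>f y\<bar> / (1 + norm y ^ 4))" and m: "f \<in> borel_measurable borel" "k \<in> borel_measurable borel"
    and k: "\<And>y. \<bar>k y\<bar> \<le> C / (1 + norm y ^ 4)"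
  shows "integrable lborel (\<lambda>y. f y * k y)"
proof (rule Bochner_Integration.integrable_bound)
  show "integrable lborel (\<lambda>y. C * (\<bar>f y\<bar> / (1 + norm y ^ 4)))" by (intro integrable_mult_right f)
  show "(\<lambda>y. f y * k y) \<in> borel_measurable lborel" using m by simp
  show "AE y in lborel. norm (f y * k y) \<le> norm (C * (\<bar>f y\<bar> / (1 + norm y ^ 4)))"
  proof (intro AE_I2)
    fix y
    have "norm (f y * k y) \<le> \<bar>f y\<bar> * (C / (1 + norm y ^ 4))"
      unfolding real_norm_def abs_mult by (intro mult_left_mono k) auto
    also have "\<dots> = C * (\<bar>f y\<bar> / (1 + norm y ^ 4))" by simp
    finally show "norm (f y * k y) \<le> norm (C * (\<bar>f y\<bar> / (1 + norm y ^ 4)))"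
      by (rule order_trans) (simp only: real_norm_def abs_ge_self)
  qed
qed

text \<open>The power 1 / A^(m + 1) is the integral of t^m * exp (- t * A) / m! over t \<ge> 0;
  Tonelli leaves Gaussians in x and a Gamma integral in t. The case m = 1 gives integrability of the
  quartic weight, the case m = 2 the mass of the spherical solution.\<close>

lemma nn_integral_inverse_power_quadratic:
  assumes m: "m \<ge> 1"
  shows "(\<integral>\<^sup>+(x::real^3). ennreal (1 / (1 + (norm x)\<^sup>2) ^ Suc m) \<partial>lborel) = ennreal (pi * sqrt pi * Gamma (real m - 1 / 2) / fact m)"
proof -
  let ?k = "\<lambda>(x::real^3) t. ennreal (t ^ m * exp (- t * (1 + (norm x)\<^sup>2)) / fact m) * indicator {0..} t"
  have "(\<integral>\<^sup>+(x::real^3). ennreal (1 / (1 + (norm x)\<^sup>2) ^ Suc m) \<partial>lborel) = (\<integral>\<^sup>+(x::real^3). \<integral>\<^sup>+t. ?k x t \<partial>lborel \<partial>lborel)"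
  proof (rule nn_integral_cong)
    fix x :: "real^3"
    define A where "A = 1 + (norm x)\<^sup>2"
    have A: "A > 0" by (simp add: A_def add_pos_nonneg)
    have "ennreal (fact m) = (\<integral>\<^sup>+t. ennreal (t ^ m * exp (- t)) * indicator {0..} t \<partial>lborel)"
      by (simp add: nn_intergal_power_times_exp_Ici)
    also have "\<dots> = ennreal \<bar>A\<bar> * (\<integral>\<^sup>+t. ennreal ((0 + A * t) ^ m * exp (- (0 + A * t))) * indicator {0..} (0 + A * t) \<partial>lborel)"
      using A by (subst nn_integral_real_affine[where c=A and t=0]) auto
    also have "(\<lambda>t. ennreal ((0 + A * t) ^ m * exp (- (0 + A * t))) * indicator {0..} (0 + A * t)) = (\<lambda>t. ennreal (fact m * A ^ m) * ?k x t)"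
    proof
      fix t :: real
      show "ennreal ((0 + A * t) ^ m * exp (- (0 + A * t))) * indicator {0..} (0 + A * t) = ennreal (fact m * A ^ m) * ?k x t"
      proof (cases "t \<ge> 0")
        case True
        have "(0 + A * t) ^ m * exp (- (0 + A * t)) = (fact m * A ^ m) * (t ^ m * exp (- t * A) / fact m)"
          by (simp add: power_mult_distrib mult.commute)
        moreover have "ennreal (fact m * A ^ m) * ennreal (t ^ m * exp (- t * A) / fact m) = ennreal ((fact m * A ^ m) * (t ^ m * exp (- t * A) / fact m))"
          by (rule ennreal_mult''[symmetric]) (use True in simp)
        moreover have "indicator {0..} (0 + A * t) = (1::ennreal)" "indicator {0..} t = (1::ennreal)"
          using True A by simp_all
        ultimately show ?thesis
          by (simp only: A_def[symmetric] mult_1_right)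
      next
        case False
        then have "A * t < 0" using A by (simp add: mult_pos_neg)
        then show ?thesis using False by simp
      qed
    qed
    also have "(\<integral>\<^sup>+t. ennreal (fact m * A ^ m) * ?k x t \<partial>lborel) = ennreal (fact m * A ^ m) * (\<integral>\<^sup>+t. ?k x t \<partial>lborel)"
      by (rule nn_integral_cmult) measurable
    finally have f: "ennreal (fact m) = ennreal \<bar>A\<bar> * (ennreal (fact m * A ^ m) * (\<integral>\<^sup>+t. ?k x t \<partial>lborel))" .
    let ?c = "fact m * A ^ Suc m"
    have c: "?c > 0" using A by simp
    have "ennreal \<bar>A\<bar> * ennreal (fact m * A ^ m) = ennreal ?c"
      using A by (subst ennreal_mult''[symmetric]) (auto simp: mult_ac)
    then have g: "ennreal (fact m) = ennreal ?c * (\<integral>\<^sup>+t. ?k x t \<partial>lborel)"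
      using f by (simp only: mult.assoc[symmetric])
    have "ennreal (1 / ?c) * ennreal ?c = 1"
      using c by (subst ennreal_mult''[symmetric]) auto
    then have "(\<integral>\<^sup>+t. ?k x t \<partial>lborel) = ennreal (1 / ?c) * ennreal (fact m)"
      unfolding g by (simp only: mult.assoc[symmetric] mult_1_left)
    also have "\<dots> = ennreal (1 / ?c * fact m)"
      using c by (subst ennreal_mult''[symmetric]) auto
    also have "1 / ?c * fact m = 1 / A ^ Suc m" by simp
    finally show "ennreal (1 / (1 + (norm x)\<^sup>2) ^ Suc m) = (\<integral>\<^sup>+t. ?k x t \<partial>lborel)"
      by (simp only: A_def)
  qed
  also have "\<dots> = (\<integral>\<^sup>+t. \<integral>\<^sup>+(x::real^3). ?k x t \<partial>lborel \<partial>lborel)"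
    by (rule lborel_pair.Fubini') measurable
  also have "\<dots> = (\<integral>\<^sup>+t. ennreal (pi * sqrt pi / fact m) * ennreal (indicator {0..} t * t powr (real m - 1 / 2 - 1) / exp t) \<partial>lborel)"
  proof (rule nn_integral_cong_AE, rule AE_mp[OF AE_lborel_singleton[of 0]], intro AE_I2 impI)
    fix t :: real assume t0: "t \<noteq> 0"
    show "(\<integral>\<^sup>+(x::real^3). ?k x t \<partial>lborel) = ennreal (pi * sqrt pi / fact m) * ennreal (indicator {0..} t * t powr (real m - 1 / 2 - 1) / exp t)"
    proof (cases "t > 0")
      case True
      have "?k x t = ennreal (t ^ m * exp (- t) / fact m) * ennreal (exp (- t * (norm x)\<^sup>2))" for x
        using True by (subst ennreal_mult''[symmetric]) (auto simp: distrib_left exp_add exp_diff exp_minus field_simps)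
      then have "(\<integral>\<^sup>+(x::real^3). ?k x t \<partial>lborel) = ennreal (t ^ m * exp (- t) / fact m) * (\<integral>\<^sup>+(x::real^3). ennreal (exp (- t * (norm x)\<^sup>2)) \<partial>lborel)"
        by (simp only:) (rule nn_integral_cmult, measurable)
      also have "(\<integral>\<^sup>+(x::real^3). ennreal (exp (- t * (norm x)\<^sup>2)) \<partial>lborel) = ennreal (sqrt (pi / t) ^ 3)"
        using integrable_gaussian[OF True, where 'a="real^3"] integral_gaussian[OF True, where 'a="real^3"]
        by (subst nn_integral_eq_integral) auto
      also have "ennreal (t ^ m * exp (- t) / fact m) * ennreal (sqrt (pi / t) ^ 3) = ennreal (pi * sqrt pi / fact m * (t powr (real m - 1 / 2 - 1) / exp t))"
      proof -
        have a: "sqrt (pi / t) ^ 3 = pi * sqrt pi / (t * sqrt t)"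
          using True by (simp add: real_sqrt_divide power_divide power3_eq_cube)
        have b: "t powr (real m - 1 / 2 - 1) = t ^ m / (t * sqrt t)"
        proof -
          have "t powr (3 / 2) = t powr 1 * t powr (1 / 2)" by (subst powr_add[symmetric]) simp
          then have "t powr (3 / 2) = t * sqrt t" using True by (simp add: powr_half_sqrt)
          then show ?thesis using True by (simp add: powr_diff powr_realpow)
        qed
        have "t ^ m * exp (- t) / fact m * sqrt (pi / t) ^ 3 = pi * sqrt pi / fact m * (t powr (real m - 1 / 2 - 1) / exp t)"
          unfolding a b by (simp add: exp_minus field_simps)
        then show ?thesis using True by (subst ennreal_mult''[symmetric]) simp_all
      qed
      finally show ?thesis using True by (subst (asm) ennreal_mult'') (auto)
    qed (use t0 in auto)
  qed
  also have "\<dots> = ennreal (pi * sqrt pi / fact m) * ennreal (Gamma (real m - 1 / 2))"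
    using m by (subst nn_integral_cmult) (auto simp: Gamma_conv_nn_integral_real)
  also have "\<dots> = ennreal (pi * sqrt pi * Gamma (real m - 1 / 2) / fact m)"
    using m by (subst ennreal_mult''[symmetric]) (auto intro!: Gamma_real_nonneg)
  finally show ?thesis .
qed

lemma integrable_quartic_weight: "integrable lborel (\<lambda>z::real^3. 1 / (1 + norm z ^ 4))"
proof (rule Bochner_Integration.integrable_bound)
  have "integrable lborel (\<lambda>z::real^3. 1 / (1 + (norm z)\<^sup>2) ^ Suc 1)"
    using nn_integral_inverse_power_quadratic[of 1]
    by (intro integrableI_bounded) (auto simp: add_nonneg_nonneg simp del: power_Suc)
  then show "integrable lborel (\<lambda>z::real^3. 2 * (1 / (1 + (norm z)\<^sup>2) ^ Suc 1))" by (rule integrable_mult_right)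
  show "AE z::real^3 in lborel. norm (1 / (1 + norm z ^ 4)) \<le> norm (2 * (1 / (1 + (norm z)\<^sup>2) ^ Suc 1))"
  proof (intro AE_I2)
    fix z :: "real^3"
    have "(1 + (norm z)\<^sup>2) ^ Suc 1 \<le> 2 * (1 + norm z ^ 4)"
      using zero_le_power2[of "(norm z)\<^sup>2 - 1"] by (simp add: power2_eq_square power4_eq_xxxx algebra_simps)
    moreover have "0 < (1 + (norm z)\<^sup>2) ^ Suc 1" "0 < 1 + norm z ^ 4" by (simp_all add: add_pos_nonneg)
    ultimately have "1 / (1 + norm z ^ 4) \<le> 2 * (1 / (1 + (norm z)\<^sup>2) ^ Suc 1)" by (simp add: field_simps)
    then show "norm (1 / (1 + norm z ^ 4)) \<le> norm (2 * (1 / (1 + (norm z)\<^sup>2) ^ Suc 1))"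
      by (simp add: add_nonneg_nonneg)
  qed
qed measurable

lemma heat_weight_0:
  assumes s: "0 < s" "s \<le> 1"
  shows "\<bar>heat s z\<bar> \<le> (heat s 0 + Kc) / (1 + norm z ^ 4)"
proof -
  have "heat s z \<le> heat s 0" unfolding heat_def using s by (intro divide_right_mono) auto
  moreover have "heat s z * norm z ^ 4 \<le> Kc"
  proof (cases "z = 0")
    case False
    then show ?thesis using heat_le_quartic[OF s False] by (simp add: field_simps)
  qed (use Kc(1) in auto)
  ultimately have "heat s z * (1 + norm z ^ 4) \<le> heat s 0 + Kc" by (simp add: distrib_left)
  moreover have "1 + norm z ^ 4 > 0" by (simp add: add_pos_nonneg)
  ultimately show ?thesis using heat_nonneg[of s z] s by (simp add: pos_le_divide_eq)
qed

lemma heat_weight: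
  assumes s: "0 < s" "s \<le> 1"
  shows "\<bar>heat s (x - y)\<bar> \<le> (heat s 0 + Kc) * (8 * (1 + norm x ^ 4)) / (1 + norm y ^ 4)"
proof -
  have p: "1 + norm (x - y) ^ 4 > 0" "1 + norm y ^ 4 > 0" by (simp_all add: add_pos_nonneg)
  have "1 + norm y ^ 4 \<le> 8 * (1 + norm x ^ 4) * (1 + norm (x - y) ^ 4)" using quartic_weight_translate[of x "x - y"] by simp
  then have "1 / (1 + norm (x - y) ^ 4) \<le> 8 * (1 + norm x ^ 4) / (1 + norm y ^ 4)"
    using p by (simp add: field_simps)
  then have "(heat s 0 + Kc) * (1 / (1 + norm (x - y) ^ 4)) \<le> (heat s 0 + Kc) * (8 * (1 + norm x ^ 4) / (1 + norm y ^ 4))"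
    using heat_nonneg[of s 0] s Kc(1) by (intro mult_left_mono) auto
  then show ?thesis using heat_weight_0[OF s, of "x - y"] by simp
qed

text \<open>Approximate identity for a continuous function that may be unbounded and is controlled
  only by the weight. Continuity handles a small ball; outside, the uniform quartic bound allows
  dominated convergence.\<close>

lemma heat_convolution_tendsto:
  fixes f :: "real^3 \<Rightarrow> real"
  assumes c: "continuous_on UNIV f" and w: "integrable lborel (\<lambda>y. \<bar>f y\<bar> / (1 + norm y ^ 4))"
  shows "(\<lambda>n. \<integral>y. f y * heat (1 / real (Suc n)) (x - y) \<partial>lborel) \<longlonglongrightarrow> f x"
proof -
  have [measurable]: "f \<in> borel_measurable borel" using c by (rule borel_measurable_continuous_onI)
  let ?s = "\<lambda>n. 1 / real (Suc n)"
  have s: "0 < ?s n" "?s n \<le> 1" for n by auto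
  have wz: "integrable lborel (\<lambda>z. \<bar>f (x - z)\<bar> / (1 + norm z ^ 4))"
  proof (rule Bochner_Integration.integrable_bound)
    show "integrable lborel (\<lambda>z. 8 * (1 + norm x ^ 4) * (\<bar>f (x - z)\<bar> / (1 + norm (x - z) ^ 4)))"
      using w integrable_reflect_iff[of "\<lambda>y. \<bar>f y\<bar> / (1 + norm y ^ 4)" x] by (intro integrable_mult_right) auto
    show "AE z in lborel. norm (\<bar>f (x - z)\<bar> / (1 + norm z ^ 4)) \<le> norm (8 * (1 + norm x ^ 4) * (\<bar>f (x - z)\<bar> / (1 + norm (x - z) ^ 4)))"
    proof (intro AE_I2)
      fix z :: "real^3"
      have p: "1 + norm (x - z) ^ 4 > 0" "1 + norm z ^ 4 > 0" by (simp_all add: add_pos_nonneg)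
      have "1 / (1 + norm z ^ 4) \<le> 8 * (1 + norm x ^ 4) / (1 + norm (x - z) ^ 4)"
        using quartic_weight_translate[of x z] p by (simp add: field_simps)
      then have "\<bar>f (x - z)\<bar> * (1 / (1 + norm z ^ 4)) \<le> \<bar>f (x - z)\<bar> * (8 * (1 + norm x ^ 4) / (1 + norm (x - z) ^ 4))"
        by (intro mult_left_mono) auto
      then show "norm (\<bar>f (x - z)\<bar> / (1 + norm z ^ 4)) \<le> norm (8 * (1 + norm x ^ 4) * (\<bar>f (x - z)\<bar> / (1 + norm (x - z) ^ 4)))"
        using p by (simp add: add_nonneg_nonneg mult_ac)
    qed
  qed measurable
  have w1: "integrable lborel (\<lambda>z::real^3. 1 / (1 + norm z ^ 4))" by (rule integrable_quartic_weight)
  define h where "h z = \<bar>f (x - z) - f x\<bar>" for z :: "real^3"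
  have [measurable]: "h \<in> borel_measurable borel" unfolding h_def by measurable
  have wh: "integrable lborel (\<lambda>z. \<bar>h z\<bar> / (1 + norm z ^ 4))"
  proof (rule Bochner_Integration.integrable_bound)
    show "integrable lborel (\<lambda>z. \<bar>f (x - z)\<bar> / (1 + norm z ^ 4) + \<bar>f x\<bar> * (1 / (1 + norm z ^ 4)))"
      by (intro Bochner_Integration.integrable_add wz integrable_mult_right w1)
    show "AE z in lborel. norm (\<bar>h z\<bar> / (1 + norm z ^ 4)) \<le> norm (\<bar>f (x - z)\<bar> / (1 + norm z ^ 4) + \<bar>f x\<bar> * (1 / (1 + norm z ^ 4)))"
    proof (intro AE_I2)
      fix z :: "real^3"
      have p: "1 + norm z ^ 4 > 0" by (simp add: add_pos_nonneg)
      have "\<bar>h z\<bar> \<le> \<bar>f (x - z)\<bar> + \<bar>f x\<bar>" by (simp add: h_def)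
      then have "\<bar>h z\<bar> / (1 + norm z ^ 4) \<le> (\<bar>f (x - z)\<bar> + \<bar>f x\<bar>) / (1 + norm z ^ 4)" using p by (intro divide_right_mono) auto
      then show "norm (\<bar>h z\<bar> / (1 + norm z ^ 4)) \<le> norm (\<bar>f (x - z)\<bar> / (1 + norm z ^ 4) + \<bar>f x\<bar> * (1 / (1 + norm z ^ 4)))"
        using p by (simp add: add_divide_distrib)
    qed
  qed measurable
  have hb: "\<bar>heat (?s n) z\<bar> \<le> (heat (?s n) 0 + Kc) / (1 + norm z ^ 4)" for n and z :: "real^3"
    by (rule heat_weight_0[OF s])
  have ih: "integrable lborel (\<lambda>z. h z * heat (?s n) z)" for n
    by (rule weight_integrable_times[OF wh _ _ hb]) measurable
  have if': "integrable lborel (\<lambda>z. f (x - z) * heat (?s n) z)" for n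
    by (rule weight_integrable_times[OF wz _ _ hb]) measurable
  have eqI: "(\<integral>y. f y * heat (?s n) (x - y) \<partial>lborel) - f x = (\<integral>z. (f (x - z) - f x) * heat (?s n) z \<partial>lborel)" for n
  proof -
    have "(\<integral>y. f y * heat (?s n) (x - y) \<partial>lborel) = (\<integral>z. f (x - z) * heat (?s n) z \<partial>lborel)"
      using integral_reflect[of "\<lambda>y. f y * heat (?s n) (x - y)" x] by simp
    moreover have "(\<integral>z. (f (x - z) - f x) * heat (?s n) z \<partial>lborel) = (\<integral>z. f (x - z) * heat (?s n) z \<partial>lborel) - (\<integral>z. f x * heat (?s n) z \<partial>lborel)"
      unfolding left_diff_distrib
      by (intro Bochner_Integration.integral_diff if' integrable_mult_right integral_heat(1) s)
    moreover have "(\<integral>z. f x * heat (?s n) z \<partial>lborel) = f x"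
      unfolding integral_mult_right_zero integral_heat(2)[OF s(1)[of n]] by simp
    ultimately show ?thesis by simp
  qed
  show ?thesis
  proof (rule LIMSEQ_I)
    fix r :: real assume r: "r > 0"
    have "isCont f x" using c by (simp add: continuous_on_eq_continuous_at)
    then obtain \<delta> where \<delta>: "\<delta> > 0" "\<And>y. dist y x < \<delta> \<Longrightarrow> dist (f y) (f x) < r / 2"
      using r unfolding continuous_at_eps_delta by (meson half_gt_zero)
    \<comment> \<open>The part of the error that continuity at x does not control.\<close>
    define J where "J n = (\<integral>z. indicator (- ball 0 \<delta>) z * (h z * heat (?s n) z) \<partial>lborel)" for n
    have [measurable]: "- ball (0::real^3) \<delta> \<in> sets borel" by auto
    let ?C = "Kc * (1 + 1 / \<delta> ^ 4)"
    have J: "J \<longlonglongrightarrow> (\<integral>(z::real^3). 0 \<partial>lborel)" unfolding J_def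
    proof (rule integral_dominated_convergence[where w="\<lambda>z. ?C * (\<bar>h z\<bar> / (1 + norm z ^ 4))"])
      show "integrable lborel (\<lambda>z. ?C * (\<bar>h z\<bar> / (1 + norm z ^ 4)))" by (intro integrable_mult_right wh)
      show "AE z in lborel. (\<lambda>n. indicator (- ball 0 \<delta>) z * (h z * heat (?s n) z)) \<longlonglongrightarrow> 0"
        using AE_lborel_singleton[of "0::real^3"]
      proof eventually_elim
        case (elim z)
        have "(\<lambda>n. indicator (- ball 0 \<delta>) z * (h z * heat (?s n) z)) \<longlonglongrightarrow> indicator (- ball 0 \<delta>) z * (h z * 0)"
          by (intro tendsto_mult tendsto_const heat_tendsto_0 elim)
        then show ?case by simp
      qed
      fix n
      show "AE z in lborel. norm (indicator (- ball 0 \<delta>) z * (h z * heat (?s n) z)) \<le> ?C * (\<bar>h z\<bar> / (1 + norm z ^ 4))"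
      proof (intro AE_I2)
        fix z :: "real^3"
        show "norm (indicator (- ball 0 \<delta>) z * (h z * heat (?s n) z)) \<le> ?C * (\<bar>h z\<bar> / (1 + norm z ^ 4))"
        proof (cases "norm z \<ge> \<delta>")
          case True
          then have z: "z \<noteq> 0" "norm z > 0" using \<delta>(1) by auto
          have p: "1 + norm z ^ 4 > 0" by (simp add: add_pos_nonneg)
          have "heat (?s n) z \<le> Kc / norm z ^ 4" by (rule heat_le_quartic[OF s z(1)])
          also have "\<dots> \<le> ?C / (1 + norm z ^ 4)"
          proof -
            have "\<delta> ^ 4 \<le> norm z ^ 4" using True \<delta>(1) by (intro power_mono) auto
            then have "1 + norm z ^ 4 \<le> (1 + 1 / \<delta> ^ 4) * norm z ^ 4" using \<delta>(1) by (simp add: field_simps)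
            then have "Kc * (1 + norm z ^ 4) \<le> Kc * ((1 + 1 / \<delta> ^ 4) * norm z ^ 4)" using Kc(1) by (intro mult_left_mono) auto
            then show ?thesis using z(2) p by (simp only: pos_divide_le_eq pos_le_divide_eq zero_less_power times_divide_eq_left)
          qed
          finally have "h z * heat (?s n) z \<le> \<bar>h z\<bar> * (?C / (1 + norm z ^ 4))"
            by (intro mult_mono) (auto simp: heat_nonneg h_def)
          moreover have "0 \<le> h z * heat (?s n) z" by (simp add: h_def heat_nonneg)
          ultimately show ?thesis using True by (simp add: mult_ac)
        next
          case False
          then show ?thesis using Kc(1) \<delta>(1) by (simp add: add_nonneg_nonneg)
        qed
      qed
    qed measurable
    then have "J \<longlonglongrightarrow> 0" by simp
    then obtain N where N: "\<And>n. n \<ge> N \<Longrightarrow> norm (J n - 0) < r / 2" using LIMSEQ_D[of J 0 "r/2"] r by auto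
    show "\<exists>N. \<forall>n\<ge>N. norm ((\<integral>y. f y * heat (?s n) (x - y) \<partial>lborel) - f x) < r"
    proof (intro exI[of _ N] allI impI)
      fix n assume n: "n \<ge> N"
      have iJ: "integrable lborel (\<lambda>z. indicator (- ball 0 \<delta>) z * (h z * heat (?s n) z))"
        using ih[of n] by (intro Bochner_Integration.integrable_bound[OF ih[of n]]) (auto simp: indicator_def)
      have "norm ((\<integral>y. f y * heat (?s n) (x - y) \<partial>lborel) - f x) \<le> (\<integral>z. norm ((f (x - z) - f x) * heat (?s n) z) \<partial>lborel)"
        unfolding eqI by (rule integral_norm_bound)
      also have "\<dots> = (\<integral>z. h z * heat (?s n) z \<partial>lborel)"
        by (intro Bochner_Integration.integral_cong refl) (simp add: h_def abs_mult heat_nonneg)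
      also have "\<dots> \<le> (\<integral>z. (r / 2) * heat (?s n) z + indicator (- ball 0 \<delta>) z * (h z * heat (?s n) z) \<partial>lborel)"
      proof (intro integral_mono ih Bochner_Integration.integrable_add iJ integrable_mult_right integral_heat(1) s)
        fix z :: "real^3"
        show "h z * heat (?s n) z \<le> (r / 2) * heat (?s n) z + indicator (- ball 0 \<delta>) z * (h z * heat (?s n) z)"
        proof (cases "norm z < \<delta>")
          case True
          then have "h z \<le> r / 2" using \<delta>(2)[of "x - z"] by (simp add: h_def dist_norm)
          then have "h z * heat (?s n) z \<le> (r / 2) * heat (?s n) z" by (intro mult_right_mono heat_nonneg) auto
          then show ?thesis using True by simp
        next
          case False
          have "0 \<le> (r / 2) * heat (?s n) z" using r by (intro mult_nonneg_nonneg heat_nonneg) auto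
          then show ?thesis using False by simp
        qed
      qed
      also have "\<dots> = (\<integral>z. (r / 2) * heat (?s n) z \<partial>lborel) + J n"
        unfolding J_def by (intro Bochner_Integration.integral_add iJ integrable_mult_right integral_heat(1) s)
      also have "\<dots> = r / 2 + J n"
        unfolding integral_mult_right_zero integral_heat(2)[OF s(1)[of n]] by simp
      also have "\<dots> < r" using N[OF n] by auto
      finally show "norm ((\<integral>y. f y * heat (?s n) (x - y) \<partial>lborel) - f x) < r" .
    qed
  qed
qed

lemma integrable_half_heat_sq:
  assumes s: "s > 0"
  shows "integrable lborel (\<lambda>b. half_heat (s + b\<^sup>2) z)"
proof (rule Bochner_Integration.integrable_bound)
  show "integrable lborel (\<lambda>b. (2 * Kc * sqrt pi / s) * (1 / (s + b\<^sup>2)))"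
    by (intro integrable_mult_right integrable_inverse_plus_square s)
  show "AE b in lborel. norm (half_heat (s + b\<^sup>2) z) \<le> norm ((2 * Kc * sqrt pi / s) * (1 / (s + b\<^sup>2)))"
  proof (intro AE_I2)
    fix b :: real
    have p: "s + b\<^sup>2 > 0" using s by (simp add: add_pos_nonneg)
    have "\<bar>half_heat (s + b\<^sup>2) z\<bar> \<le> 2 * Kc * sqrt pi / (s + b\<^sup>2 + (norm z)\<^sup>2)\<^sup>2"
      by (rule integrable_heat'(2)[OF p])
    also have "\<dots> \<le> 2 * Kc * sqrt pi / (s * (s + b\<^sup>2))"
      unfolding power2_eq_square[of "s + b\<^sup>2 + (norm z)\<^sup>2"] using s p Kc(1)
      by (intro divide_left_mono mult_mono mult_pos_pos) (auto intro: add_pos_nonneg)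
    finally show "norm (half_heat (s + b\<^sup>2) z) \<le> norm ((2 * Kc * sqrt pi / s) * (1 / (s + b\<^sup>2)))"
      using s p Kc(1) by simp
  qed
qed measurable

lemma heat_sq_le:
  assumes s: "s \<ge> 0" and q: "q > 0" "q \<le> s + (norm z)\<^sup>2" and sb: "s > 0 \<or> b \<noteq> 0"
  shows "heat (s + b\<^sup>2) z \<le> (Kc / sqrt q) * (1 / (q + b\<^sup>2))"
proof -
  have p: "s + b\<^sup>2 > 0" using s sb by (auto intro: add_pos_nonneg add_nonneg_pos)
  have "heat (s + b\<^sup>2) z \<le> Kc / ((s + b\<^sup>2 + (norm z)\<^sup>2) * sqrt (s + b\<^sup>2 + (norm z)\<^sup>2))"
    by (rule heat_le[OF p refl])
  also have "\<dots> \<le> Kc / ((q + b\<^sup>2) * sqrt q)"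
  proof -
    have 1: "q + b\<^sup>2 \<le> s + b\<^sup>2 + (norm z)\<^sup>2" "q + b\<^sup>2 > 0" using q by (auto intro: add_pos_nonneg)
    then have "sqrt q \<le> sqrt (s + b\<^sup>2 + (norm z)\<^sup>2)" using zero_le_power2[of b] by (intro real_sqrt_le_mono) linarith
    then show ?thesis using 1 q(1) Kc(1) by (intro divide_left_mono mult_mono mult_pos_pos) auto
  qed
  finally show ?thesis by (simp add: mult.commute)
qed

lemma
  assumes s: "s > 0"
  shows integrable_heat_shift: "integrable lborel (\<lambda>b. heat (s + b\<^sup>2) z)"
    and integral_heat_shift_le: "q > 0 \<Longrightarrow> q \<le> s + (norm z)\<^sup>2 \<Longrightarrow> (\<integral>b. heat (s + b\<^sup>2) z \<partial>lborel) \<le> Kc * pi / q"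
proof -
  have b: "norm (heat (s + b\<^sup>2) z) \<le> norm ((Kc / sqrt q) * (1 / (q + b\<^sup>2)))" if "q > 0" "q \<le> s + (norm z)\<^sup>2" for q b
    using heat_sq_le[of s q z b] heat_nonneg[of "s + b\<^sup>2" z] s that Kc(1) by (simp add: add_nonneg_nonneg)
  show i: "integrable lborel (\<lambda>b. heat (s + b\<^sup>2) z)"
    by (rule Bochner_Integration.integrable_bound[OF integrable_mult_right[OF integrable_inverse_plus_square[OF s], of "Kc / sqrt s"]])
       (use b[of s] s in auto)
  assume q: "q > 0" "q \<le> s + (norm z)\<^sup>2"
  have "(\<integral>b. heat (s + b\<^sup>2) z \<partial>lborel) \<le> (\<integral>b. (Kc / sqrt q) * (1 / (q + b\<^sup>2)) \<partial>lborel)"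
    using s q by (intro integral_mono i integrable_mult_right integrable_inverse_plus_square heat_sq_le) auto
  also have "\<dots> = (Kc / sqrt q) * (pi / sqrt q)"
    unfolding integral_mult_right_zero integral_inverse_plus_square[OF q(1)] ..
  also have "\<dots> = Kc * pi / q" using q(1) by simp
  finally show "(\<integral>b. heat (s + b\<^sup>2) z \<partial>lborel) \<le> Kc * pi / q" .
qed

text \<open>The dominating function takes q = |z|^2, which does not depend on the vanishing
  shift.\<close>

lemma integral_heat_shift_tendsto:
  assumes z: "z \<noteq> 0"
  shows "(\<lambda>n. \<integral>b. heat (1 / real (Suc n) + b\<^sup>2) z \<partial>lborel) \<longlonglongrightarrow> sqrt pi / (2 * pi\<^sup>2 * (norm z)\<^sup>2)"
  unfolding integral_heat_sq[OF z, symmetric]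
proof (rule integral_dominated_convergence[where w="\<lambda>b. (Kc / sqrt ((norm z)\<^sup>2)) * (1 / ((norm z)\<^sup>2 + b\<^sup>2))"])
  have q: "(norm z)\<^sup>2 > 0" using z by simp
  show "integrable lborel (\<lambda>b. (Kc / sqrt ((norm z)\<^sup>2)) * (1 / ((norm z)\<^sup>2 + b\<^sup>2)))"
    by (intro integrable_mult_right integrable_inverse_plus_square q)
  show "AE b in lborel. (\<lambda>n. heat (1 / real (Suc n) + b\<^sup>2) z) \<longlonglongrightarrow> heat (b\<^sup>2) z"
    using AE_lborel_singleton[of "0::real"]
  proof eventually_elim
    case (elim b)
    then have "isCont (\<lambda>t. heat t z) (b\<^sup>2)" by (intro DERIV_isCont[OF heat_deriv]) simp
    moreover have "(\<lambda>n. 1 / real (Suc n) + b\<^sup>2) \<longlonglongrightarrow> b\<^sup>2" by real_asymp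
    ultimately show ?case by (rule isCont_tendsto_compose)
  qed
  show "AE b in lborel. norm (heat (1 / real (Suc n) + b\<^sup>2) z) \<le> (Kc / sqrt ((norm z)\<^sup>2)) * (1 / ((norm z)\<^sup>2 + b\<^sup>2))" for n
    using heat_sq_le[of "1 / real (Suc n)" "(norm z)\<^sup>2" z] q
    by (intro AE_I2) (auto simp: heat_nonneg add_nonneg_nonneg simp del: real_sqrt_abs)
qed measurable

lemma integrable_bounded_times:
  fixes g k :: "'a::euclidean_space \<Rightarrow> real"
  assumes g: "integrable lborel g" and m: "k \<in> borel_measurable borel" and k: "\<And>y. \<bar>k y\<bar> \<le> C"
  shows "integrable lborel (\<lambda>y. g y * k y)"
proof (rule Bochner_Integration.integrable_bound)
  show "integrable lborel (\<lambda>y. C * \<bar>g y\<bar>)" using g by auto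
  show "(\<lambda>y. g y * k y) \<in> borel_measurable lborel" using g m by simp
  show "AE y in lborel. norm (g y * k y) \<le> norm (C * \<bar>g y\<bar>)"
  proof (intro AE_I2)
    fix y
    have "\<bar>g y\<bar> * \<bar>k y\<bar> \<le> \<bar>g y\<bar> * \<bar>C\<bar>" by (intro mult_left_mono order_trans[OF k]) auto
    then show "norm (g y * k y) \<le> norm (C * \<bar>g y\<bar>)" by (simp add: abs_mult mult.commute)
  qed
qed

lemma half_heat_weight:
  assumes \<tau>: "\<tau> > 0"
  shows "\<exists>C. \<forall>y. \<bar>half_heat \<tau> (x - y)\<bar> \<le> C / (1 + norm y ^ 4)"
proof -
  define m where "m = min 1 \<tau>"
  have m: "0 < m" "m \<le> 1" "m \<le> \<tau>" using \<tau> by (auto simp: m_def)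
  let ?B = "8 * (1 + norm x ^ 4)"
  have "\<bar>half_heat \<tau> (x - y)\<bar> \<le> (2 * Kc * sqrt pi * ?B / m\<^sup>2) / (1 + norm y ^ 4)" for y
  proof -
    let ?z = "x - y"
    have B: "?B > 0" by (simp add: add_pos_nonneg)
    have y: "1 + norm y ^ 4 \<le> ?B * (1 + norm ?z ^ 4)" using quartic_weight_translate[of x ?z] by simp
    have "m * (1 + (norm ?z)\<^sup>2) \<le> \<tau> + (norm ?z)\<^sup>2" using m mult_right_mono[of m 1 "(norm ?z)\<^sup>2"] by (simp add: distrib_left)
    then have "(m * (1 + (norm ?z)\<^sup>2))\<^sup>2 \<le> (\<tau> + (norm ?z)\<^sup>2)\<^sup>2" using m by (intro power_mono) (auto intro!: mult_nonneg_nonneg add_nonneg_nonneg)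
    moreover have "1 + norm ?z ^ 4 \<le> (1 + (norm ?z)\<^sup>2)\<^sup>2" by (simp add: power2_eq_square power4_eq_xxxx algebra_simps)
    then have "m\<^sup>2 * (1 + norm ?z ^ 4) \<le> (m * (1 + (norm ?z)\<^sup>2))\<^sup>2"
      unfolding power_mult_distrib by (intro mult_left_mono) auto
    ultimately have "m\<^sup>2 * (1 + norm ?z ^ 4) \<le> (\<tau> + (norm ?z)\<^sup>2)\<^sup>2" by linarith
    moreover have "m\<^sup>2 * ((1 + norm y ^ 4) / ?B) \<le> m\<^sup>2 * (1 + norm ?z ^ 4)"
      using y B by (intro mult_left_mono) (auto simp: pos_divide_le_eq mult.commute)
    ultimately have le: "m\<^sup>2 * ((1 + norm y ^ 4) / ?B) \<le> (\<tau> + (norm ?z)\<^sup>2)\<^sup>2" by linarith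
    have "\<bar>half_heat \<tau> ?z\<bar> \<le> 2 * Kc * sqrt pi / (\<tau> + (norm ?z)\<^sup>2)\<^sup>2" by (rule integrable_heat'(2)[OF \<tau>])
    also have "\<dots> \<le> 2 * Kc * sqrt pi / (m\<^sup>2 * ((1 + norm y ^ 4) / ?B))"
      using le Kc(1) m B \<tau> by (intro divide_left_mono mult_pos_pos zero_less_power divide_pos_pos) (auto intro!: add_pos_nonneg)
    finally show ?thesis by (simp add: mult_ac)
  qed
  then show ?thesis by blast
qed

text \<open>Both sides of the hypothesis are taken at time s + b^2 and integrated over b. On the
  left this turns \<open>half_heat\<close> into \<open>heat s\<close>, and s tending to 0 gives f;
  on the right it produces the inverse square kernel. The centres x and 0 are subtracted beforehand
  because Fubini on the left needs the faster decay of the difference.\<close>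

theorem half_laplacian_inversion:
  fixes f g :: "real^3 \<Rightarrow> real"
  assumes cf: "continuous_on UNIV f" and wf: "integrable lborel (\<lambda>y. \<bar>f y\<bar> / (1 + norm y ^ 4))"
    and cg: "continuous_on UNIV g" and ig: "integrable lborel g"
    and eq: "\<And>\<tau> x. \<tau> > 0 \<Longrightarrow> (\<integral>y. f y * half_heat \<tau> (x - y) \<partial>lborel) = (\<integral>y. g y * heat \<tau> (x - y) \<partial>lborel)"
  shows "f x - f 0 = ((\<integral>y. g y / (norm (x - y))\<^sup>2 \<partial>lborel) - (\<integral>y. g y / (norm (0 - y))\<^sup>2 \<partial>lborel)) / (2 * pi\<^sup>2)"
proof -
  have [measurable]: "f \<in> borel_measurable borel" "g \<in> borel_measurable borel"
    using cf cg by (auto intro: borel_measurable_continuous_onI)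
  define k where "k s z = (\<integral>b. heat (s + b\<^sup>2) z \<partial>lborel)" for s z
  have [measurable]: "(\<lambda>y. k s (h y)) \<in> borel_measurable borel" if [measurable]: "h \<in> borel_measurable borel" for s and h :: "real^3 \<Rightarrow> real^3"
    unfolding k_def by measurable
  have main: "sqrt pi * ((\<integral>y. f y * heat s (x - y) \<partial>lborel) - (\<integral>y. f y * heat s (0 - y) \<partial>lborel)) = (\<integral>y. g y * (k s (x - y) - k s (0 - y)) \<partial>lborel)"
    if s: "0 < s" "s \<le> 1" for s
  proof -
    \<comment> \<open>Chosen such that c * (1 + |y|^2) is a lower bound for both s + |x - y|^2 and s
      + |y|^2; the assumption s \<le> 1 is used here.\<close>
    define c where "c = s / (2 * (1 + (norm x)\<^sup>2))"
    have px: "1 + (norm x)\<^sup>2 > 0" by (simp add: add_pos_nonneg)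
    have c: "c > 0" "c \<le> s" using s px by (auto simp: c_def pos_divide_le_eq mult_le_cancel_left1 intro!: divide_pos_pos mult_pos_pos)
    define q where "q y = c * (1 + (norm y)\<^sup>2)" for y :: "real^3"
    have q: "q y > 0" "q y \<le> s + (norm (x - y))\<^sup>2" "q y \<le> s + (norm (0 - y))\<^sup>2" for y
    proof -
      show "q y > 0" using c by (simp add: q_def add_pos_nonneg)
      have "norm y \<le> norm x + norm (x - y)" by (metis diff_add_cancel norm_minus_commute norm_triangle_ineq add.commute)
      then have "(norm y)\<^sup>2 \<le> (norm x + norm (x - y))\<^sup>2" by (intro power_mono) auto
      also have "\<dots> \<le> 2 * (norm x)\<^sup>2 + 2 * (norm (x - y))\<^sup>2"
        using zero_le_power2[of "norm x - norm (x - y)"] by (simp add: power2_eq_square algebra_simps)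
      finally have "(norm y)\<^sup>2 \<le> 2 * (norm x)\<^sup>2 + 2 * (norm (x - y))\<^sup>2" .
      then have "1 + (norm y)\<^sup>2 \<le> 2 * (1 + (norm x)\<^sup>2) * (1 + (norm (x - y))\<^sup>2)"
      proof -
        have "2 * (1 + X) * (1 + Z) = 2 + 2 * X + 2 * Z + 2 * (X * Z)" for X Z :: real by (simp add: algebra_simps)
        moreover have "0 \<le> (norm x)\<^sup>2 * (norm (x - y))\<^sup>2" by simp
        ultimately show ?thesis using \<open>(norm y)\<^sup>2 \<le> 2 * (norm x)\<^sup>2 + 2 * (norm (x - y))\<^sup>2\<close> by (simp only:)
      qed
      then have "q y \<le> c * (2 * (1 + (norm x)\<^sup>2) * (1 + (norm (x - y))\<^sup>2))"
        unfolding q_def using c by (intro mult_left_mono) auto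
      also have "\<dots> = s * (1 + (norm (x - y))\<^sup>2)" using px by (simp add: c_def)
      also have "\<dots> \<le> s + (norm (x - y))\<^sup>2" using s mult_right_mono[of s 1 "(norm (x - y))\<^sup>2"] by (simp add: distrib_left)
      finally show "q y \<le> s + (norm (x - y))\<^sup>2" .
      have "q y \<le> s * (1 + (norm y)\<^sup>2)" unfolding q_def using c by (intro mult_right_mono) auto
      also have "\<dots> \<le> s + (norm y)\<^sup>2" using s mult_right_mono[of s 1 "(norm y)\<^sup>2"] by (simp add: distrib_left)
      finally show "q y \<le> s + (norm (0 - y))\<^sup>2" by simp
    qed
    define \<Delta> where "\<Delta> y b = half_heat (s + b\<^sup>2) (x - y) - half_heat (s + b\<^sup>2) (0 - y)" for y b
    have [measurable]: "(\<lambda>(y, b). \<Delta> y b) \<in> borel_measurable (lborel \<Otimes>\<^sub>M lborel)" "\<Delta> y \<in> borel_measurable borel" for y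
      unfolding \<Delta>_def by measurable
    have i\<Delta>: "integrable lborel (\<Delta> y)" for y
      unfolding \<Delta>_def[abs_def] by (intro Bochner_Integration.integrable_diff integrable_half_heat_sq s)
    \<comment> \<open>The squared distances of y from x and from 0 differ by at most M * (1 + |y|),
      so their difference costs only one power of |y|.\<close>
    define M where "M = (norm x)\<^sup>2 + 2 * norm x"
    have M: "M \<ge> 0" by (simp add: M_def)
    define C where "C = (2 * M / sqrt c) * (Kc * sqrt pi * pi) / c\<^sup>2"
    have k\<Delta>: "(\<integral>b. \<bar>\<Delta> y b\<bar> \<partial>lborel) \<le> C / (1 + norm y ^ 4)" for y
    proof -
      let ?D = "\<bar>(norm (x - y))\<^sup>2 - (norm (0 - y))\<^sup>2\<bar>"
      have D: "?D \<le> 2 * M / sqrt c * sqrt (q y)"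
      proof -
        have "(norm (x - y))\<^sup>2 - (norm (0 - y))\<^sup>2 = (norm x)\<^sup>2 - 2 * (x \<bullet> y)"
          by (simp add: power2_norm_eq_inner inner_diff_left inner_diff_right inner_commute)
        then have "?D \<le> (norm x)\<^sup>2 + 2 * \<bar>x \<bullet> y\<bar>"
          using abs_triangle_ineq4[of "(norm x)\<^sup>2" "2 * (x \<bullet> y)"] by (simp add: abs_mult)
        also have "\<dots> \<le> (norm x)\<^sup>2 + 2 * (norm x * norm y)" using Cauchy_Schwarz_ineq2[of x y] by simp
        also have "\<dots> \<le> M * (1 + norm y)" by (simp add: M_def algebra_simps)
        also have "\<dots> \<le> M * (2 * sqrt (1 + (norm y)\<^sup>2))"
        proof (intro mult_left_mono M)
          have "1 \<le> sqrt (1 + (norm y)\<^sup>2)" "norm y \<le> sqrt (1 + (norm y)\<^sup>2)" by (auto intro: real_le_rsqrt)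
          then show "1 + norm y \<le> 2 * sqrt (1 + (norm y)\<^sup>2)" by linarith
        qed
        also have "sqrt (1 + (norm y)\<^sup>2) = sqrt (q y) / sqrt c" using c by (simp add: q_def real_sqrt_mult)
        finally show ?thesis by (simp add: mult_ac)
      qed
      have "(\<integral>b. \<bar>\<Delta> y b\<bar> \<partial>lborel) \<le> (\<integral>b. ?D * (Kc * sqrt pi / (q y)\<^sup>2) * (1 / (q y + b\<^sup>2)) \<partial>lborel)"
        unfolding \<Delta>_def using i\<Delta>[of y] q[of y] unfolding \<Delta>_def[abs_def]
        by (intro integral_mono integrable_abs half_heat_diff_le s integrable_mult_right integrable_inverse_plus_square) auto
      also have "\<dots> = ?D * (Kc * sqrt pi / (q y)\<^sup>2) * (pi / sqrt (q y))"
        unfolding integral_mult_right_zero integral_inverse_plus_square[OF q(1)] ..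
      also have "\<dots> \<le> (2 * M / sqrt c * sqrt (q y)) * (Kc * sqrt pi / (q y)\<^sup>2) * (pi / sqrt (q y))"
        using Kc(1) q(1)[of y] by (intro mult_right_mono D) auto
      also have "\<dots> = (2 * M / sqrt c) * (Kc * sqrt pi * pi) / (q y)\<^sup>2"
        using q(1)[of y] by simp
      also have "\<dots> \<le> (2 * M / sqrt c) * (Kc * sqrt pi * pi) / (c\<^sup>2 * (1 + norm y ^ 4))"
      proof -
        have "1 + norm y ^ 4 \<le> (1 + (norm y)\<^sup>2)\<^sup>2" by (simp add: power2_eq_square power4_eq_xxxx algebra_simps)
        then have "c\<^sup>2 * (1 + norm y ^ 4) \<le> (q y)\<^sup>2" unfolding q_def power_mult_distrib by (intro mult_left_mono) auto
        moreover have "0 < 1 + norm y ^ 4" by (simp add: add_pos_nonneg)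
        then have "0 < (q y)\<^sup>2 * (c\<^sup>2 * (1 + norm y ^ 4))"
          using c q(1)[of y] by (intro mult_pos_pos) auto
        ultimately show ?thesis using M Kc(1) c by (intro divide_left_mono) (auto intro!: mult_nonneg_nonneg)
      qed
      finally show ?thesis by (simp add: C_def)
    qed
    \<comment> \<open>Absolute integrability holds because the integral of |\<Delta>| over b has
      been bounded by a multiple of the quartic weight.\<close>
    have "(\<integral>y. \<integral>b. f y * \<Delta> y b \<partial>lborel \<partial>lborel) = (\<integral>b. \<integral>y. f y * \<Delta> y b \<partial>lborel \<partial>lborel)"
    proof (rule integral_swap_lborel)
      show "AE y in lborel. integrable lborel (\<lambda>b. f y * \<Delta> y b)" by (intro AE_I2 integrable_mult_right i\<Delta>)
      have "integrable lborel (\<lambda>y. \<bar>f y * (\<integral>b. \<bar>\<Delta> y b\<bar> \<partial>lborel)\<bar>)"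
      proof (intro integrable_abs weight_integrable_times[OF wf])
        show "\<bar>\<integral>b. \<bar>\<Delta> y b\<bar> \<partial>lborel\<bar> \<le> C / (1 + norm y ^ 4)" for y using k\<Delta>[of y] by simp
      qed measurable
      then show "integrable lborel (\<lambda>y. \<integral>b. norm (f y * \<Delta> y b) \<partial>lborel)" by (simp add: abs_mult)
    qed measurable
    moreover have "(\<integral>b. f y * \<Delta> y b \<partial>lborel) = sqrt pi * (f y * heat s (x - y) - f y * heat s (0 - y))" for y
    proof -
      have "(\<integral>b. half_heat (s + b\<^sup>2) z \<partial>lborel) = sqrt pi * heat s z" for z
        using integral_half_heat[OF s(1), of z] by (simp add: field_simps)
      then show ?thesis unfolding \<Delta>_def using integrable_half_heat_sq[OF s(1)] by (simp add: algebra_simps)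
    qed
    \<comment> \<open>For fixed b the hypothesis applies at time s + b^2 at both centres, and trades
      f for g.\<close>
    moreover have "(\<integral>y. f y * \<Delta> y b \<partial>lborel) = (\<integral>y. g y * (heat (s + b\<^sup>2) (x - y) - heat (s + b\<^sup>2) (0 - y)) \<partial>lborel)" for b
    proof -
      have \<tau>: "s + b\<^sup>2 > 0" using s by (simp add: add_pos_nonneg)
      have i1: "integrable lborel (\<lambda>y. f y * half_heat (s + b\<^sup>2) (x' - y))" for x'
      proof -
        obtain C where "\<forall>y. \<bar>half_heat (s + b\<^sup>2) (x' - y)\<bar> \<le> C / (1 + norm y ^ 4)" using half_heat_weight[OF \<tau>, of x'] ..
        then show ?thesis by (intro weight_integrable_times[OF wf, of _ C]) auto
      qed
      have i2: "integrable lborel (\<lambda>y. g y * heat (s + b\<^sup>2) (x' - y))" for x'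
      proof (rule integrable_bounded_times[OF ig])
        show "\<bar>heat (s + b\<^sup>2) (x' - y)\<bar> \<le> 1 / sqrt (4 * pi * (s + b\<^sup>2)) ^ 3" for y
          using \<tau> by (simp add: heat_def divide_right_mono)
      qed measurable
      show ?thesis unfolding \<Delta>_def right_diff_distrib
        by (simp only: Bochner_Integration.integral_diff[OF i1 i1] Bochner_Integration.integral_diff[OF i2 i2] eq[OF \<tau>])
    qed
    moreover have "(\<integral>b. \<integral>y. g y * (heat (s + b\<^sup>2) (x - y) - heat (s + b\<^sup>2) (0 - y)) \<partial>lborel \<partial>lborel) =
        (\<integral>y. \<integral>b. g y * (heat (s + b\<^sup>2) (x - y) - heat (s + b\<^sup>2) (0 - y)) \<partial>lborel \<partial>lborel)"
    proof (rule integral_swap_lborel[symmetric])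
      have i3: "integrable lborel (\<lambda>b. heat (s + b\<^sup>2) (x - y) - heat (s + b\<^sup>2) (0 - y))" for y
        by (intro Bochner_Integration.integrable_diff integrable_heat_shift s)
      show "AE y in lborel. integrable lborel (\<lambda>b. g y * (heat (s + b\<^sup>2) (x - y) - heat (s + b\<^sup>2) (0 - y)))"
        by (intro AE_I2 integrable_mult_right i3)
      have "integrable lborel (\<lambda>y. \<bar>g y * (\<integral>b. \<bar>heat (s + b\<^sup>2) (x - y) - heat (s + b\<^sup>2) (0 - y)\<bar> \<partial>lborel)\<bar>)"
      proof (intro integrable_abs integrable_bounded_times[OF ig])
        fix y
        have "(\<integral>b. \<bar>heat (s + b\<^sup>2) (x - y) - heat (s + b\<^sup>2) (0 - y)\<bar> \<partial>lborel) \<le> (\<integral>b. heat (s + b\<^sup>2) (x - y) + heat (s + b\<^sup>2) (0 - y) \<partial>lborel)"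
        proof (intro integral_mono integrable_abs i3 Bochner_Integration.integrable_add integrable_heat_shift s)
          fix b
          have "0 \<le> s + b\<^sup>2" using s by simp
          from heat_nonneg[OF this, of "x - y"] heat_nonneg[OF this, of "0 - y"]
          show "\<bar>heat (s + b\<^sup>2) (x - y) - heat (s + b\<^sup>2) (0 - y)\<bar> \<le> heat (s + b\<^sup>2) (x - y) + heat (s + b\<^sup>2) (0 - y)" by linarith
        qed
        also have "\<dots> = k s (x - y) + k s (0 - y)" unfolding k_def
          by (intro Bochner_Integration.integral_add integrable_heat_shift s)
        also have "\<dots> \<le> Kc * pi / s + Kc * pi / s" unfolding k_def
          using s by (intro add_mono integral_heat_shift_le) auto
        finally show "\<bar>\<integral>b. \<bar>heat (s + b\<^sup>2) (x - y) - heat (s + b\<^sup>2) (0 - y)\<bar> \<partial>lborel\<bar> \<le> Kc * pi / s + Kc * pi / s" by simp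
      qed measurable
      then show "integrable lborel (\<lambda>y. \<integral>b. norm (g y * (heat (s + b\<^sup>2) (x - y) - heat (s + b\<^sup>2) (0 - y))) \<partial>lborel)"
        by (simp add: abs_mult)
    qed measurable
    moreover have "(\<integral>b. g y * (heat (s + b\<^sup>2) (x - y) - heat (s + b\<^sup>2) (0 - y)) \<partial>lborel) = g y * (k s (x - y) - k s (0 - y))" for y
      unfolding k_def using integrable_heat_shift[OF s(1)] by simp
    moreover have "(\<integral>y. sqrt pi * (f y * heat s (x - y) - f y * heat s (0 - y)) \<partial>lborel) = sqrt pi * ((\<integral>y. f y * heat s (x - y) \<partial>lborel) - (\<integral>y. f y * heat s (0 - y) \<partial>lborel))"
    proof -
      have "integrable lborel (\<lambda>y. f y * heat s (x' - y))" for x'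
      proof (rule weight_integrable_times[OF wf])
        fix y
        show "\<bar>heat s (x' - y)\<bar> \<le> (heat s 0 + Kc) * (8 * (1 + norm x' ^ 4)) / (1 + norm y ^ 4)"
          by (rule heat_weight[OF s])
      qed measurable
      from Bochner_Integration.integral_diff[OF this this]
      show ?thesis by (simp only: integral_mult_right_zero)
    qed
    ultimately show ?thesis by (simp only:)
  qed
  let ?s = "\<lambda>n. 1 / real (Suc n)"
  have L: "(\<lambda>n. sqrt pi * ((\<integral>y. f y * heat (?s n) (x - y) \<partial>lborel) - (\<integral>y. f y * heat (?s n) (0 - y) \<partial>lborel))) \<longlonglongrightarrow> sqrt pi * (f x - f 0)"
    by (intro tendsto_mult tendsto_diff tendsto_const heat_convolution_tendsto cf wf)
  let ?c = "sqrt pi / (2 * pi\<^sup>2)"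
  have ig2: "integrable lborel (\<lambda>y. g y / (norm (x' - y))\<^sup>2)" for x' by (rule integrable_div_dist_sq[OF ig cg])
  have R: "(\<lambda>n. \<integral>y. g y * (k (?s n) (x - y) - k (?s n) (0 - y)) \<partial>lborel) \<longlonglongrightarrow> (\<integral>y. ?c * (g y / (norm (x - y))\<^sup>2 - g y / (norm (0 - y))\<^sup>2) \<partial>lborel)"
  proof (rule integral_dominated_convergence[where w="\<lambda>y. Kc * pi * \<bar>g y / (norm (x - y))\<^sup>2\<bar> + Kc * pi * \<bar>g y / (norm (0 - y))\<^sup>2\<bar>"])
    show "integrable lborel (\<lambda>y. Kc * pi * \<bar>g y / (norm (x - y))\<^sup>2\<bar> + Kc * pi * \<bar>g y / (norm (0 - y))\<^sup>2\<bar>)"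
      by (intro Bochner_Integration.integrable_add integrable_mult_right integrable_abs ig2)
    have ae: "AE y in lborel. y \<noteq> x \<and> y \<noteq> 0"
      using AE_lborel_singleton[of x] AE_lborel_singleton[of "0::real^3"] by eventually_elim simp
    then show "AE y in lborel. (\<lambda>n. g y * (k (?s n) (x - y) - k (?s n) (0 - y))) \<longlonglongrightarrow> ?c * (g y / (norm (x - y))\<^sup>2 - g y / (norm (0 - y))\<^sup>2)"
    proof eventually_elim
      case (elim y)
      then have "x - y \<noteq> 0" "0 - y \<noteq> 0" by auto
      then have "(\<lambda>n. g y * (k (?s n) (x - y) - k (?s n) (0 - y))) \<longlonglongrightarrow> g y * (sqrt pi / (2 * pi\<^sup>2 * (norm (x - y))\<^sup>2) - sqrt pi / (2 * pi\<^sup>2 * (norm (0 - y))\<^sup>2))"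
        unfolding k_def by (intro tendsto_mult tendsto_diff tendsto_const integral_heat_shift_tendsto)
      then show ?case by (simp add: right_diff_distrib mult_ac)
    qed
    fix n
    have s: "0 < ?s n" by simp
    show "AE y in lborel. norm (g y * (k (?s n) (x - y) - k (?s n) (0 - y))) \<le> Kc * pi * \<bar>g y / (norm (x - y))\<^sup>2\<bar> + Kc * pi * \<bar>g y / (norm (0 - y))\<^sup>2\<bar>"
      using ae
    proof eventually_elim
      case (elim y)
      have kb: "0 \<le> k (?s n) z" "z \<noteq> 0 \<Longrightarrow> k (?s n) z \<le> Kc * pi / (norm z)\<^sup>2" for z
        unfolding k_def using s by (auto intro!: integral_nonneg_AE AE_I2 heat_nonneg integral_heat_shift_le add_nonneg_nonneg)
      have "\<bar>k (?s n) (x - y) - k (?s n) (0 - y)\<bar> \<le> k (?s n) (x - y) + k (?s n) (0 - y)"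
        using kb(1)[of "x - y"] kb(1)[of "0 - y"] by linarith
      also have "\<dots> \<le> Kc * pi / (norm (x - y))\<^sup>2 + Kc * pi / (norm (0 - y))\<^sup>2"
        using elim by (intro add_mono kb(2)) auto
      finally have "\<bar>g y\<bar> * \<bar>k (?s n) (x - y) - k (?s n) (0 - y)\<bar> \<le> \<bar>g y\<bar> * (Kc * pi / (norm (x - y))\<^sup>2 + Kc * pi / (norm (0 - y))\<^sup>2)"
        by (rule mult_left_mono) simp
      also have "\<dots> = Kc * pi * \<bar>g y / (norm (x - y))\<^sup>2\<bar> + Kc * pi * \<bar>g y / (norm (0 - y))\<^sup>2\<bar>"
        by (simp add: distrib_left mult_ac)
      finally show ?case by (simp only: real_norm_def abs_mult)
    qed
  qed measurable
  have s: "0 < ?s n" "?s n \<le> 1" for n by auto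
  have "sqrt pi * (f x - f 0) = (\<integral>y. ?c * (g y / (norm (x - y))\<^sup>2 - g y / (norm (0 - y))\<^sup>2) \<partial>lborel)"
    by (rule LIMSEQ_unique[OF L[unfolded main[OF s]] R])
  also have "\<dots> = ?c * ((\<integral>y. g y / (norm (x - y))\<^sup>2 \<partial>lborel) - (\<integral>y. g y / (norm (0 - y))\<^sup>2 \<partial>lborel))"
    by (simp only: integral_mult_right_zero Bochner_Integration.integral_diff[OF ig2 ig2])
  finally have "sqrt pi * (f x - f 0) = sqrt pi * (((\<integral>y. g y / (norm (x - y))\<^sup>2 \<partial>lborel) - (\<integral>y. g y / (norm (0 - y))\<^sup>2 \<partial>lborel)) / (2 * pi\<^sup>2))"
    by simp
  then show ?thesis by (subst (asm) mult_left_cancel) auto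
qed

subsection \<open>The Riesz representation of the Laplacian\<close>

lemma locally_integrable_measurable:
  fixes v :: "real^'n::finite \<Rightarrow> real"
  assumes "locally_integrable v"
  shows "v \<in> borel_measurable lebesgue"
proof (rule borel_measurable_LIMSEQ_real)
  let ?B = "\<lambda>n. cbox (- (real n *\<^sub>R One)) (real n *\<^sub>R One) :: (real^'n) set"
  show "(\<lambda>x. indicator (?B n) x * v x) \<in> borel_measurable lebesgue" for n
    by (rule borel_measurable_integrable[OF indicator_cbox_integrable[OF assms]])
  fix x :: "real^'n"
  have "x \<in> (\<Union>n. box (- (real n *\<^sub>R One)) (real n *\<^sub>R One))" by (simp add: UN_box_eq_UNIV)
  then obtain m where m: "x \<in> box (- (real m *\<^sub>R One)) (real m *\<^sub>R One)" by blast
  have "x \<in> ?B n" if "n \<ge> m" for n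
    using m that by (force simp: mem_box)
  then show "(\<lambda>n. indicator (?B n) x * v x) \<longlonglongrightarrow> v x"
    by (intro tendsto_eventually eventually_sequentiallyI[of m]) auto
qed

abbreviation gauss_at :: "real \<Rightarrow> real^3 \<Rightarrow> real^3 \<Rightarrow> complex" where
  "gauss_at \<tau> x \<equiv> \<lambda>y. complex_of_real (exp (- (1 / (4 * \<tau>)) * (norm (y - x))\<^sup>2))"

lemma gauss_at_eq_heat: "\<tau> > 0 \<Longrightarrow> gauss_at \<tau> x y = complex_of_real (sqrt (4 * pi * \<tau>) ^ 3 * heat \<tau> (x - y))"
  by (simp add: heat_def norm_minus_commute)

lemma fourier_gauss_at:
  assumes \<tau>: "\<tau> > 0"
  shows "fourier (gauss_at \<tau> x) \<xi> = cis (- (\<xi> \<bullet> x)) * complex_of_real (sqrt (4 * pi * \<tau>) ^ 3 * exp (- \<tau> * (norm \<xi>)\<^sup>2))"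
proof -
  let ?f = "\<lambda>y. cis (- (\<xi> \<bullet> y)) * gauss_at \<tau> x y"
  have "fourier (gauss_at \<tau> x) \<xi> = (\<integral>y. ?f y \<partial>lborel)"
    unfolding fourier_def by (subst integral_completion) auto
  also have "\<dots> = (\<integral>z. ?f (x + z) \<partial>lborel)" by (rule integral_translate[symmetric])
  also have "\<dots> = (\<integral>z. cis (- (\<xi> \<bullet> x)) * (cis ((- \<xi>) \<bullet> z) * complex_of_real (exp (- (1 / (4 * \<tau>)) * (norm z)\<^sup>2))) \<partial>lborel)"
    by (intro Bochner_Integration.integral_cong refl) (simp add: inner_add_right cis_mult)
  also have "\<dots> = cis (- (\<xi> \<bullet> x)) * (\<integral>z. cis ((- \<xi>) \<bullet> z) * complex_of_real (exp (- (1 / (4 * \<tau>)) * (norm z)\<^sup>2)) \<partial>lborel)"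
    by (rule integral_mult_right_zero)
  also have "(\<integral>z. cis ((- \<xi>) \<bullet> z) * complex_of_real (exp (- (1 / (4 * \<tau>)) * (norm z)\<^sup>2)) \<partial>lborel)
      = complex_of_real (sqrt (pi / (1 / (4 * \<tau>))) ^ DIM(real^3) * exp (- (norm (- \<xi>))\<^sup>2 / (4 * (1 / (4 * \<tau>)))))"
    using \<tau> by (intro integral_cis_gaussian) simp
  also have "sqrt (pi / (1 / (4 * \<tau>))) = sqrt (4 * pi * \<tau>)" by (rule arg_cong[of _ _ sqrt]) simp
  also have "- (norm (- \<xi>))\<^sup>2 / (4 * (1 / (4 * \<tau>))) = - \<tau> * (norm \<xi>)\<^sup>2" using \<tau> by simp
  finally show ?thesis by simp
qed

lemma half_laplacian_gauss_at:
  assumes \<tau>: "\<tau> > 0"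
  shows "half_laplacian (gauss_at \<tau> x) y = complex_of_real (sqrt (4 * pi * \<tau>) ^ 3 * half_heat \<tau> (x - y))"
proof -
  let ?c = "sqrt (4 * pi * \<tau>) ^ 3"
  let ?h = "\<lambda>\<xi>. cis (\<xi> \<bullet> y) * (complex_of_real (norm \<xi>) * (cis (- (\<xi> \<bullet> x)) * complex_of_real (?c * exp (- \<tau> * (norm \<xi>)\<^sup>2))))"
  have m: "?h \<in> borel_measurable lborel" by measurable
  have "(\<integral>\<xi>. ?h \<xi> \<partial>lebesgue) = (\<integral>\<xi>. ?h \<xi> \<partial>lborel)"
    by (rule integral_completion[OF m])
  also have "\<dots> = (\<integral>\<xi>. complex_of_real ?c * (cis (\<xi> \<bullet> (y - x)) * complex_of_real (norm \<xi> * exp (- \<tau> * (norm \<xi>)\<^sup>2))) \<partial>lborel)"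
  proof (intro Bochner_Integration.integral_cong refl)
    fix \<xi> :: "real^3"
    have "cis (\<xi> \<bullet> (y - x)) = cis (\<xi> \<bullet> y) * cis (- (\<xi> \<bullet> x))" by (simp add: cis_mult inner_diff_right)
    then show "?h \<xi> = complex_of_real ?c * (cis (\<xi> \<bullet> (y - x)) * complex_of_real (norm \<xi> * exp (- \<tau> * (norm \<xi>)\<^sup>2)))"
      by (simp add: mult_ac)
  qed
  also have "\<dots> = complex_of_real ?c * complex_of_real ((2 * pi) ^ 3 * half_heat \<tau> (y - x))"
    unfolding integral_mult_right_zero fourier_half_heat[OF \<tau>] ..
  finally show ?thesis
    unfolding half_laplacian_def inverse_fourier_def fourier_gauss_at[OF \<tau>]
    by (simp add: half_heat_minus[of \<tau> x y])
qed

text \<open>Gaussians of all widths and centres are the only test functions used. The constant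
  collects the unknown value at the origin, since the inversion recovers only differences.\<close>

theorem laplacian_representation:
  assumes u: "smooth u" and sol: "is_solution u (regular_distribution (\<lambda>x. 2 * exp (3 * u x)))"
    and int: "integrable lebesgue (\<lambda>x. exp (3 * u x))"
  shows "\<exists>c. \<forall>x. - laplacian u x = c + (\<integral>y. exp (3 * u y) / (norm (x - y))\<^sup>2 \<partial>lborel) / pi\<^sup>2"
proof -
  define f where "f x = - laplacian u x" for x
  define g where "g x = 2 * exp (3 * u x)" for x
  have cu: "continuous_on UNIV u" by (rule smooth_continuous_on[OF u])
  have cf: "continuous_on UNIV f" unfolding f_def[abs_def] by (intro continuous_intros continuous_on_laplacian u)
  have cg: "continuous_on UNIV g" unfolding g_def[abs_def] by (intro continuous_intros cu)
  have [measurable]: "f \<in> borel_measurable borel" "g \<in> borel_measurable borel" "u \<in> borel_measurable borel"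
    using cf cg cu by (auto intro: borel_measurable_continuous_onI)
  have ie: "integrable lborel (\<lambda>x. exp (3 * u x))"
    using int by (subst (asm) integrable_completion) auto
  then have ig: "integrable lborel g" unfolding g_def[abs_def] by (rule integrable_mult_right)
  \<comment> \<open>Replaces the chosen representative of the weak Laplacian by the continuous
    classical one under every integral below.\<close>
  have ae: "AE x in lebesgue. - weak_laplacian u x = f x"
    using weak_laplacian_eq_AE[OF u] by eventually_elim (simp add: f_def)
  have L: "locally_integrable (weak_laplacian u)" "integrable lebesgue (\<lambda>x. \<bar>weak_laplacian u x\<bar> / (1 + norm x ^ 4))"
    and sol': "\<And>\<phi>. schwartz \<phi> \<Longrightarrow> (\<integral>x. complex_of_real (- weak_laplacian u x) * half_laplacian \<phi> x \<partial>lebesgue) = regular_distribution (\<lambda>x. 2 * exp (3 * u x)) \<phi>"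
    using sol by (auto simp: is_solution_def L_half_def)
  have mw: "weak_laplacian u \<in> borel_measurable lebesgue" by (rule locally_integrable_measurable[OF L(1)])
  have wf: "integrable lborel (\<lambda>y. \<bar>f y\<bar> / (1 + norm y ^ 4))"
  proof -
    have m: "(\<lambda>y. \<bar>f y\<bar> / (1 + norm y ^ 4)) \<in> borel_measurable lborel" by measurable
    have "AE x in lebesgue. \<bar>weak_laplacian u x\<bar> / (1 + norm x ^ 4) = \<bar>f x\<bar> / (1 + norm x ^ 4)"
      using ae by eventually_elim (metis abs_minus_cancel)
    from integrable_cong_AE_imp[OF L(2) measurable_completion[OF m] this] integrable_completion[OF m]
    show ?thesis by simp
  qed
  have eq: "(\<integral>y. f y * half_heat \<tau> (x - y) \<partial>lborel) = (\<integral>y. g y * heat \<tau> (x - y) \<partial>lborel)" if \<tau>: "\<tau> > 0" for \<tau> x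
  proof -
    \<comment> \<open>The normalising factor between the plain Gaussian and the heat kernel; it
      occurs on both sides and is cancelled at the end.\<close>
    let ?c = "sqrt (4 * pi * \<tau>) ^ 3"
    have c: "?c \<noteq> 0" using \<tau> by simp
    have m1: "(\<lambda>y. complex_of_real (f y * half_heat \<tau> (x - y))) \<in> borel_measurable lborel" by measurable
    have m1': "(\<lambda>y. f y * half_heat \<tau> (x - y)) \<in> borel_measurable lborel" by measurable
    have m2': "(\<lambda>y. g y * heat \<tau> (x - y)) \<in> borel_measurable lborel" by measurable
    have m3: "(\<lambda>y. complex_of_real (?c * half_heat \<tau> (x - y))) \<in> borel_measurable lebesgue"
      by (rule measurable_completion) measurable
    have "(\<lambda>r. complex_of_real (- r)) \<in> borel_measurable borel" by measurable
    from measurable_compose[OF mw this]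
    have m4: "(\<lambda>y. complex_of_real (- weak_laplacian u y)) \<in> borel_measurable lebesgue" .
    have "schwartz (gauss_at \<tau> x)" using \<tau> by (intro schwartz_gaussian) simp
    from sol'[OF this]
    have "(\<integral>y. complex_of_real (- weak_laplacian u y) * half_laplacian (gauss_at \<tau> x) y \<partial>lebesgue) = (\<integral>y. complex_of_real (g y) * gauss_at \<tau> x y \<partial>lebesgue)"
      by (simp only: regular_distribution_def g_def)
    also have "(\<integral>y. complex_of_real (- weak_laplacian u y) * half_laplacian (gauss_at \<tau> x) y \<partial>lebesgue)
        = (\<integral>y. complex_of_real ?c * complex_of_real (f y * half_heat \<tau> (x - y)) \<partial>lebesgue)"
    proof (rule integral_cong_AE)
      show "(\<lambda>y. complex_of_real (- weak_laplacian u y) * half_laplacian (gauss_at \<tau> x) y) \<in> borel_measurable lebesgue"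
        unfolding half_laplacian_gauss_at[OF \<tau>]
        by (intro borel_measurable_times m3 m4)
      show "(\<lambda>y. complex_of_real ?c * complex_of_real (f y * half_heat \<tau> (x - y))) \<in> borel_measurable lebesgue"
        by (intro borel_measurable_times borel_measurable_const measurable_completion m1)
      show "AE y in lebesgue. complex_of_real (- weak_laplacian u y) * half_laplacian (gauss_at \<tau> x) y = complex_of_real ?c * complex_of_real (f y * half_heat \<tau> (x - y))"
        using ae
      proof eventually_elim
        case (elim y)
        show ?case unfolding half_laplacian_gauss_at[OF \<tau>] elim by simp
      qed
    qed
    also have "\<dots> = complex_of_real (?c * (\<integral>y. f y * half_heat \<tau> (x - y) \<partial>lborel))"
      by (simp only: integral_mult_right_zero integral_completion[OF m1'] integral_complex_of_real) (simp only: of_real_mult)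
    also have "(\<integral>y. complex_of_real (g y) * gauss_at \<tau> x y \<partial>lebesgue) = (\<integral>y. complex_of_real ?c * complex_of_real (g y * heat \<tau> (x - y)) \<partial>lebesgue)"
      unfolding gauss_at_eq_heat[OF \<tau>] by (intro Bochner_Integration.integral_cong refl) simp
    also have "\<dots> = complex_of_real (?c * (\<integral>y. g y * heat \<tau> (x - y) \<partial>lborel))"
      by (simp only: integral_mult_right_zero integral_completion[OF m2'] integral_complex_of_real) (simp only: of_real_mult)
    finally have "?c * (\<integral>y. f y * half_heat \<tau> (x - y) \<partial>lborel) = ?c * (\<integral>y. g y * heat \<tau> (x - y) \<partial>lborel)"
      by (simp only: of_real_eq_iff)
    then show ?thesis by (rule mult_left_cancel[OF c, THEN iffD1])
  qed
  let ?I = "\<lambda>x. \<integral>y. exp (3 * u y) / (norm (x - y))\<^sup>2 \<partial>lborel"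
  have "(\<integral>y. g y / (norm (x - y))\<^sup>2 \<partial>lborel) = 2 * ?I x" for x
    unfolding g_def by (subst integral_mult_right_zero[symmetric]) simp
  then have "f x - f 0 = (2 * ?I x - 2 * ?I 0) / (2 * pi\<^sup>2)" for x
    using half_laplacian_inversion[OF cf wf cg ig eq, of x] by (simp only:)
  then have d: "f x - f 0 = ?I x / pi\<^sup>2 - ?I 0 / pi\<^sup>2" for x
    by (simp add: diff_divide_distrib)
  have "f x = (f 0 - ?I 0 / pi\<^sup>2) + ?I x / pi\<^sup>2" for x
    using d[of x] by linarith
  then show ?thesis unfolding f_def by blast
qed

subsection \<open>Weighted ball averages\<close>

definition ball_weight :: "real^3 \<Rightarrow> real" where
  "ball_weight z = max 0 (1 - (norm z)\<^sup>2)"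

text \<open>The gradient of \<open>ball_weight_sq\<close> is \<open>- ball_weight z *\<^sub>R z\<close>, so that averages against these weights satisfy
  the mean value identities of balls and spheres without any surface integral.\<close>

definition ball_weight_sq :: "real^3 \<Rightarrow> real" where
  "ball_weight_sq z = (ball_weight z)\<^sup>2 / 4"

lemma continuous_on_ball_weight: "continuous_on S ball_weight" "continuous_on S ball_weight_sq"
  unfolding ball_weight_def[abs_def] ball_weight_sq_def[abs_def] by (auto intro!: continuous_intros)

lemma borel_measurable_ball_weight [measurable]: "ball_weight \<in> borel_measurable borel" "ball_weight_sq \<in> borel_measurable borel"
  by (intro borel_measurable_continuous_onI continuous_on_ball_weight)+

lemma ball_weight_bounds: "0 \<le> ball_weight z" "ball_weight z \<le> 1" "0 \<le> ball_weight_sq z" "ball_weight_sq z \<le> 1"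
proof -
  show 1: "0 \<le> ball_weight z" "ball_weight z \<le> 1" by (auto simp: ball_weight_def)
  then have "(ball_weight z)\<^sup>2 \<le> 1" by (simp add: power_le_one)
  then show "0 \<le> ball_weight_sq z" "ball_weight_sq z \<le> 1" by (auto simp: ball_weight_sq_def)
qed

lemma ball_weight_eq_0: "norm z > 1 \<Longrightarrow> ball_weight z = 0" "norm z > 1 \<Longrightarrow> ball_weight_sq z = 0"
proof -
  have *: "ball_weight z = 0" if "norm z > 1"
  proof -
    have "1 < (norm z)\<^sup>2" using that by (intro one_less_power) auto
    then show ?thesis unfolding ball_weight_def by (intro max_absorb1) linarith
  qed
  then show "norm z > 1 \<Longrightarrow> ball_weight z = 0" "norm z > 1 \<Longrightarrow> ball_weight_sq z = 0"
    by (simp_all add: ball_weight_sq_def)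
qed

text \<open>Squaring makes the positive part differentiable at 0, so that
  \<open>ball_weight_sq\<close> is continuously differentiable on the whole space and the divergence
  theorem applies without a boundary.\<close>

lemma max_0_sq_has_derivative: "((\<lambda>t. (max 0 t)\<^sup>2) has_real_derivative 2 * max 0 t) (at (t::real))"
proof -
  consider "t > 0" | "t < 0" | "t = 0" by linarith
  then show ?thesis
  proof cases
    case 1
    have "((\<lambda>t. t\<^sup>2) has_real_derivative 2 * max 0 t) (at t)" using 1 by (auto intro!: derivative_eq_intros)
    then show ?thesis
      by (rule has_field_derivative_transform_within_open[where S="{0<..}"]) (use 1 in auto)
  next
    case 2
    have "((\<lambda>t. 0) has_real_derivative 2 * max 0 t) (at t)" using 2 by (auto intro!: derivative_eq_intros)
    then show ?thesis
      by (rule has_field_derivative_transform_within_open[where S="{..<0}"]) (use 2 in auto)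
  next
    case 3
    have "((\<lambda>h::real. (max 0 h)\<^sup>2 / h) \<longlongrightarrow> 0) (at 0)"
    proof (rule Lim_null_comparison)
      show "\<forall>\<^sub>F h in at 0. norm ((max 0 h)\<^sup>2 / h) \<le> \<bar>h\<bar>"
        by (intro always_eventually allI) (auto simp: max_def power2_eq_square)
      show "((\<lambda>h::real. \<bar>h\<bar>) \<longlongrightarrow> 0) (at 0)" by (intro tendsto_rabs_zero tendsto_ident_at)
    qed
    then show ?thesis using 3 by (simp add: DERIV_def)
  qed
qed

lemma ball_weight_sq_has_derivative: "(ball_weight_sq has_derivative (\<lambda>h. - ball_weight z * (z \<bullet> h))) (at z)"
proof -
  have 1: "((\<lambda>z::real^3. 1 - z \<bullet> z) has_derivative (\<lambda>h. - (z \<bullet> h + h \<bullet> z))) (at z)"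
    by (auto intro!: derivative_eq_intros)
  have "((\<lambda>z::real^3. (1 / 4) * (max 0 (1 - z \<bullet> z))\<^sup>2) has_derivative (\<lambda>h. (1 / 4) * (2 * max 0 (1 - z \<bullet> z) * (- (z \<bullet> h + h \<bullet> z))))) (at z)"
    by (rule has_derivative_mult_right[OF has_derivative_compose[OF 1 max_0_sq_has_derivative[unfolded has_field_derivative_def]]])
  moreover have "(\<lambda>z::real^3. (1 / 4) * (max 0 (1 - z \<bullet> z))\<^sup>2) = ball_weight_sq"
    by (simp add: fun_eq_iff ball_weight_sq_def ball_weight_def power2_norm_eq_inner)
  moreover have "(\<lambda>h. (1 / 4) * (2 * max 0 (1 - z \<bullet> z) * (- (z \<bullet> h + h \<bullet> z)))) = (\<lambda>h. - ball_weight z * (z \<bullet> h))"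
    by (simp add: fun_eq_iff ball_weight_def power2_norm_eq_inner inner_commute)
  ultimately show ?thesis by simp
qed

lemma integrable_ball_weight_times:
  fixes k :: "real^3 \<Rightarrow> real"
  assumes "continuous_on UNIV k"
  shows "integrable lborel (\<lambda>z. ball_weight z * k z)" "integrable lborel (\<lambda>z. ball_weight_sq z * k z)"
proof -
  have *: "integrable lborel (\<lambda>z. w z * k z)" if w: "continuous_on UNIV w" "\<And>z. norm z > 1 \<Longrightarrow> w z = 0" for w :: "real^3 \<Rightarrow> real"
    by (rule integrable_continuous_compact_support[OF continuous_on_mult[OF w(1) assms], of 1]) (simp add: w)
  show "integrable lborel (\<lambda>z. ball_weight z * k z)" "integrable lborel (\<lambda>z. ball_weight_sq z * k z)"
    by (intro * continuous_on_ball_weight ball_weight_eq_0; assumption)+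
qed

lemma integrable_ball_weight: "integrable lborel ball_weight" "integrable lborel ball_weight_sq"
  using integrable_ball_weight_times[of "\<lambda>_. 1"] by auto

definition ball_mass :: real where "ball_mass = (\<integral>z. ball_weight z \<partial>lborel)"

lemma ball_mass_pos: "ball_mass > 0"
proof -
  have "ball_mass \<noteq> 0"
    using integral_eq_0_continuous[OF continuous_on_ball_weight(1) ball_weight_bounds(1) integrable_ball_weight(1), of 0]
    by (auto simp: ball_mass_def ball_weight_def)
  moreover have "ball_mass \<ge> 0" unfolding ball_mass_def by (intro integral_nonneg_AE) (auto simp: ball_weight_bounds)
  ultimately show ?thesis by simp
qed

text \<open>The difference is written as an integral of the derivative along the segments r
  \<mapsto> x + r * z. For fixed r, the divergence theorem for the field
  \<open>ball_weight_sq z *\<^sub>R G (x + r *\<^sub>R z)\<close> turns the average of the radial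
  derivative into r times an average of the divergence of G, that is, of the Laplacian of
  \<phi>.\<close>

lemma ball_average_identity:
  fixes \<phi> :: "real^3 \<Rightarrow> real"
  assumes d1: "\<And>x. (\<phi> has_derivative (\<lambda>h. G x \<bullet> h)) (at x)" and d2: "\<And>x. (G has_derivative G' x) (at x)"
    and c2: "\<And>b. b \<in> Basis \<Longrightarrow> continuous_on UNIV (\<lambda>x. G' x b \<bullet> b)" and R: "R > 0"
  shows "(\<integral>z. ball_weight z * \<phi> (x + R *\<^sub>R z) \<partial>lborel) - ball_mass * \<phi> x =
    (\<integral>r. indicator {0..R} r * (r * (\<integral>z. ball_weight_sq z * (\<Sum>b\<in>Basis. G' (x + r *\<^sub>R z) b \<bullet> b) \<partial>lborel)) \<partial>lborel)"
proof -
  have c0: "continuous_on UNIV \<phi>" using d1 by (intro has_derivative_continuous_on[where f'="\<lambda>x h. G x \<bullet> h"]) auto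
  have c1: "continuous_on UNIV G" using d2 by (intro has_derivative_continuous_on[where f'=G']) auto
  have [measurable]: "G \<in> borel_measurable borel" using c1 by (rule borel_measurable_continuous_onI)
  let ?k = "\<lambda>r z. G (x + r *\<^sub>R z) \<bullet> z"
  have ck: "continuous_on S (?k r)" "continuous_on T (\<lambda>r. ?k r z)" for S T r z
    by (intro continuous_intros continuous_on_compose2[OF c1]; simp)+
  have cp: "continuous_on (cball 0 R \<times> cball 0 1) (\<lambda>p. ?k (fst p) (snd p))"
    by (intro continuous_intros continuous_on_compose2[OF c1]) auto
  obtain B where B: "B \<ge> 0" "\<And>p. p \<in> cball 0 R \<times> cball 0 1 \<Longrightarrow> \<bar>?k (fst p) (snd p)\<bar> \<le> B"
    by (rule continuous_on_compact_abs_le[OF cp]) (auto intro!: compact_Times)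
  have FTC: "(\<integral>r. indicator {0..R} r *\<^sub>R ?k r z \<partial>lborel) = \<phi> (x + R *\<^sub>R z) - \<phi> x" for z
  proof -
    have "(\<integral>r. indicator {0..R} r *\<^sub>R ?k r z \<partial>lborel) = \<phi> (x + R *\<^sub>R z) - \<phi> (x + 0 *\<^sub>R z)"
    proof (rule integral_FTC_atLeastAtMost)
      fix r assume "0 \<le> r" "r \<le> R"
      have "((\<lambda>r. x + r *\<^sub>R z) has_derivative (\<lambda>h. h *\<^sub>R z)) (at r)"
        by (auto intro!: derivative_eq_intros)
      from has_derivative_compose[OF this d1]
      have "((\<lambda>r. \<phi> (x + r *\<^sub>R z)) has_derivative (\<lambda>h. h *\<^sub>R ?k r z)) (at r)"
        by simp
      then show "((\<lambda>r. \<phi> (x + r *\<^sub>R z)) has_vector_derivative ?k r z) (at r within {0..R})"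
        unfolding has_vector_derivative_def by (rule has_derivative_at_withinI)
    qed (use R ck in auto)
    then show ?thesis by simp
  qed
  have div: "(\<integral>z. ball_weight z * ?k r z \<partial>lborel) = r * (\<integral>z. ball_weight_sq z * (\<Sum>b\<in>Basis. G' (x + r *\<^sub>R z) b \<bullet> b) \<partial>lborel)" for r
  proof -
    let ?F' = "\<lambda>z h. ball_weight_sq z *\<^sub>R (G' (x + r *\<^sub>R z) (r *\<^sub>R h)) + (- ball_weight z * (z \<bullet> h)) *\<^sub>R G (x + r *\<^sub>R z)"
    have lin: "linear (G' y)" for y using d2 has_derivative_linear by blast
    have cb: "continuous_on UNIV (\<lambda>z. G' (x + r *\<^sub>R z) b \<bullet> b)" if "b \<in> Basis" for b
      by (rule continuous_on_compose2[OF c2[OF that]]) (auto intro!: continuous_intros)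
    have "(\<integral>z. (\<Sum>b\<in>Basis. ?F' z b \<bullet> b) \<partial>lborel) = 0"
    proof (rule integral_divergence_eq_0[where F="\<lambda>z. ball_weight_sq z *\<^sub>R G (x + r *\<^sub>R z)" and R=1])
      fix z
      have "((\<lambda>z. x + r *\<^sub>R z) has_derivative (\<lambda>h. r *\<^sub>R h)) (at z)"
        by (auto intro!: derivative_eq_intros)
      from has_derivative_compose[OF this d2]
      have "((\<lambda>z. G (x + r *\<^sub>R z)) has_derivative (\<lambda>h. G' (x + r *\<^sub>R z) (r *\<^sub>R h))) (at z)" .
      then show "((\<lambda>z. ball_weight_sq z *\<^sub>R G (x + r *\<^sub>R z)) has_derivative ?F' z) (at z)"
        by (intro has_derivative_scaleR ball_weight_sq_has_derivative)
      show "norm z > 1 \<Longrightarrow> ball_weight_sq z *\<^sub>R G (x + r *\<^sub>R z) = 0" by (simp add: ball_weight_eq_0)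
    next
      fix b :: "real^3" assume b: "b \<in> Basis"
      show "continuous_on UNIV (\<lambda>z. ?F' z b \<bullet> b)"
        unfolding linear_scale[OF lin] inner_add_left inner_scaleR_left
        by (intro continuous_intros continuous_on_ball_weight cb[OF b] continuous_on_compose2[OF c1]) auto
    qed
    moreover have "(\<Sum>b\<in>Basis. ?F' z b \<bullet> b) = r * (ball_weight_sq z * (\<Sum>b\<in>Basis. G' (x + r *\<^sub>R z) b \<bullet> b)) - ball_weight z * ?k r z" for z
    proof -
      have "?k r z = (\<Sum>b\<in>Basis. (G (x + r *\<^sub>R z) \<bullet> b) * (z \<bullet> b))" by (rule euclidean_inner)
      then show ?thesis
        unfolding linear_scale[OF lin] inner_add_left inner_scaleR_left sum.distrib
        by (simp add: sum_distrib_left sum_negf sum_subtractf mult_ac)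
    qed
    moreover have "integrable lborel (\<lambda>z. r * (ball_weight_sq z * (\<Sum>b\<in>Basis. G' (x + r *\<^sub>R z) b \<bullet> b)))"
      by (intro integrable_mult_right integrable_ball_weight_times continuous_on_sum cb)
    moreover have "integrable lborel (\<lambda>z. ball_weight z * ?k r z)"
      by (intro integrable_ball_weight_times ck)
    ultimately show ?thesis by simp
  qed
  have "(\<integral>z. ball_weight z * \<phi> (x + R *\<^sub>R z) \<partial>lborel) - ball_mass * \<phi> x = (\<integral>z. ball_weight z * (\<phi> (x + R *\<^sub>R z) - \<phi> x) \<partial>lborel)"
  proof -
    have "integrable lborel (\<lambda>z. ball_weight z * \<phi> (x + R *\<^sub>R z))"
      by (intro integrable_ball_weight_times continuous_on_compose2[OF c0]) (auto intro!: continuous_intros)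
    moreover have "integrable lborel (\<lambda>z. ball_weight z * \<phi> x)" using integrable_ball_weight by simp
    ultimately show ?thesis
      unfolding right_diff_distrib by (subst Bochner_Integration.integral_diff) (auto simp: ball_mass_def)
  qed
  also have "\<dots> = (\<integral>z. \<integral>r. ball_weight z * (indicator {0..R} r * ?k r z) \<partial>lborel \<partial>lborel)"
    unfolding FTC[symmetric] by simp
  also have "\<dots> = (\<integral>r. \<integral>z. ball_weight z * (indicator {0..R} r * ?k r z) \<partial>lborel \<partial>lborel)"
  proof (rule integral_swap_lborel)
    show "(\<lambda>(z, r). ball_weight z * (indicator {0..R} r * ?k r z)) \<in> borel_measurable (lborel \<Otimes>\<^sub>M lborel)" by measurable
    have i: "integrable lborel (\<lambda>r. indicator {0..R} r * ?k r z)" for z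
      using borel_integrable_compact[OF _ ck(2), of "{0..R}" z] by simp
    then show "AE z in lborel. integrable lborel (\<lambda>r. ball_weight z * (indicator {0..R} r * ?k r z))" by simp
    have b: "norm (ball_weight z * (indicator {0..R} r * ?k r z)) \<le> ball_weight z * (B * indicator {0..R} r)" for z r
    proof (cases "norm z \<le> 1 \<and> r \<in> {0..R}")
      case True
      then have "\<bar>?k r z\<bar> \<le> B" using B(2)[of "(r, z)"] by auto
      then show ?thesis using True ball_weight_bounds(1)[of z] by (simp add: abs_mult mult_left_mono)
    next
      case False
      then show ?thesis using B(1) ball_weight_bounds(1)[of z] by (auto simp: ball_weight_eq_0 indicator_def)
    qed
    show "integrable lborel (\<lambda>z. \<integral>r. norm (ball_weight z * (indicator {0..R} r * ?k r z)) \<partial>lborel)"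
    proof (rule Bochner_Integration.integrable_bound[OF integrable_mult_left[OF integrable_ball_weight(1), of "B * R"]])
      show "(\<lambda>z. \<integral>r. norm (ball_weight z * (indicator {0..R} r * ?k r z)) \<partial>lborel) \<in> borel_measurable lborel" by measurable
      show "AE z in lborel. norm (\<integral>r. norm (ball_weight z * (indicator {0..R} r * ?k r z)) \<partial>lborel) \<le> norm (ball_weight z * (B * R))"
      proof (intro AE_I2)
        fix z
        have "(\<integral>r. norm (ball_weight z * (indicator {0..R} r * ?k r z)) \<partial>lborel) \<le> (\<integral>r. ball_weight z * (B * indicator {0..R} r) \<partial>lborel)"
          using emeasure_lborel_cbox_finite[of 0 R]
          by (intro integral_mono integrable_norm integrable_mult_right i b integrable_real_indicator) auto
        also have "\<dots> = ball_weight z * (B * R)" using R by simp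
        finally show "norm (\<integral>r. norm (ball_weight z * (indicator {0..R} r * ?k r z)) \<partial>lborel) \<le> norm (ball_weight z * (B * R))"
          using R B(1) ball_weight_bounds(1)[of z] by simp
      qed
    qed
  qed
  also have "\<dots> = (\<integral>r. indicator {0..R} r * (\<integral>z. ball_weight z * ?k r z \<partial>lborel) \<partial>lborel)"
    unfolding mult.left_commute[of "ball_weight _"] integral_mult_right_zero ..
  finally show ?thesis unfolding div .
qed

section \<open>Averages of the logarithm and of the inverse square\<close>

lemma integrable_weight_div_affine:
  assumes r: "r > 0"
  shows "integrable lborel (\<lambda>z. ball_weight z / (norm (d + r *\<^sub>R z))\<^sup>2)"
    and "integrable lborel (\<lambda>z. ball_weight_sq z / (norm (d + r *\<^sub>R z))\<^sup>2)"
proof -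
  have eq: "k / (norm (d + r *\<^sub>R z))\<^sup>2 = (1 / r\<^sup>2) * (k / (norm ((- (1 / r)) *\<^sub>R d - z))\<^sup>2)" for z and k :: real
  proof -
    have "d + r *\<^sub>R z = (- r) *\<^sub>R ((- (1 / r)) *\<^sub>R d - z)" using r by (simp add: algebra_simps)
    then have "norm (d + r *\<^sub>R z) = r * norm ((- (1 / r)) *\<^sub>R d - z)" using r by (metis abs_minus_cancel abs_of_pos norm_scaleR)
    then show ?thesis by (simp add: power_mult_distrib)
  qed
  show "integrable lborel (\<lambda>z. ball_weight z / (norm (d + r *\<^sub>R z))\<^sup>2)" "integrable lborel (\<lambda>z. ball_weight_sq z / (norm (d + r *\<^sub>R z))\<^sup>2)"
    unfolding eq by (intro integrable_mult_right integrable_div_dist_sq integrable_ball_weight continuous_on_ball_weight)+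
qed

text \<open>If r \<le> |d| / 2, the singularity stays at distance |d| / 2. Otherwise rescaling by r
  leaves a bound of order 1 / r, which is at most 2 / |d|. Uniformity in r provides the dominating
  function for the radial integral.\<close>

lemma ball_weight_sq_potential_bounded:
  assumes d: "d \<noteq> 0"
  shows "\<exists>K\<ge>0. \<forall>r\<in>{0<..R}. r * (\<integral>z. ball_weight_sq z / (norm (d + r *\<^sub>R z))\<^sup>2 \<partial>lborel) \<le> K"
proof -
  define J where "J = (\<integral>(z::real^3). indicator (cball 0 1) z / (norm z)\<^sup>2 \<partial>lborel)"
  define M where "M = (\<integral>z. ball_weight_sq z \<partial>lborel)"
  have J0: "J \<ge> 0" unfolding J_def by (intro integral_nonneg_AE) auto
  have M0: "M \<ge> 0" unfolding M_def by (intro integral_nonneg_AE) (auto simp: ball_weight_bounds)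
  have nd: "norm d > 0" using d by simp
  define K where "K = \<bar>R\<bar> * (4 * M / (norm d)\<^sup>2) + 2 * (M + J) / norm d"
  have "r * (\<integral>z. ball_weight_sq z / (norm (d + r *\<^sub>R z))\<^sup>2 \<partial>lborel) \<le> K" if r: "r \<in> {0<..R}" for r
  proof -
    have r0: "r > 0" "r \<le> R" using r by auto
    note i = integrable_weight_div_affine(2)[OF r0(1), of d]
    show ?thesis
    proof (cases "r \<le> norm d / 2")
      case True
      have "(\<integral>z. ball_weight_sq z / (norm (d + r *\<^sub>R z))\<^sup>2 \<partial>lborel) \<le> (\<integral>z. ball_weight_sq z * (4 / (norm d)\<^sup>2) \<partial>lborel)"
      proof (intro integral_mono i integrable_mult_left integrable_ball_weight)
        fix z
        show "ball_weight_sq z / (norm (d + r *\<^sub>R z))\<^sup>2 \<le> ball_weight_sq z * (4 / (norm d)\<^sup>2)"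
        proof (cases "norm z \<le> 1")
          case z: True
          have "norm d - norm (r *\<^sub>R z) \<le> norm (d + r *\<^sub>R z)" by (rule norm_diff_ineq)
          moreover have "norm (r *\<^sub>R z) \<le> r" using r0 z by (simp add: mult_left_le)
          ultimately have "norm d / 2 \<le> norm (d + r *\<^sub>R z)" using True by linarith
          then have "(norm d / 2)\<^sup>2 \<le> (norm (d + r *\<^sub>R z))\<^sup>2" using nd by (intro power_mono) auto
          then have "ball_weight_sq z / (norm (d + r *\<^sub>R z))\<^sup>2 \<le> ball_weight_sq z / (norm d / 2)\<^sup>2"
            using nd by (intro divide_left_mono ball_weight_bounds mult_pos_pos) (auto intro: less_le_trans)
          then show ?thesis by (simp add: power_divide)
        qed (simp add: ball_weight_eq_0)
      qed
      also have "\<dots> = M * (4 / (norm d)\<^sup>2)" by (simp add: M_def)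
      finally have "r * (\<integral>z. ball_weight_sq z / (norm (d + r *\<^sub>R z))\<^sup>2 \<partial>lborel) \<le> R * (M * (4 / (norm d)\<^sup>2))"
        using r0 by (intro mult_mono integral_nonneg_AE) (auto simp: ball_weight_bounds)
      also have "\<dots> \<le> K" unfolding K_def using r0 J0 M0 by (simp add: mult_ac)
      finally show ?thesis .
    next
      case False
      define p where "p = (1 / r) *\<^sub>R d"
      have dp: "d + r *\<^sub>R z = r *\<^sub>R (p + z)" for z using r0 by (simp add: p_def algebra_simps)
      have ind: "integrable lborel (\<lambda>z. indicator (cball 0 1) (p + z) / (norm (p + z))\<^sup>2)"
        using integrable_translate_iff[of "\<lambda>z. indicator (cball 0 1) z / (norm z)\<^sup>2" p] integrable_indicator_div_norm_sq[of 1] by simp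
      have "(\<integral>z. ball_weight_sq z / (norm (d + r *\<^sub>R z))\<^sup>2 \<partial>lborel) \<le> (\<integral>z. (1 / r\<^sup>2) * (ball_weight_sq z + indicator (cball 0 1) (p + z) / (norm (p + z))\<^sup>2) \<partial>lborel)"
      proof (intro integral_mono i integrable_mult_right Bochner_Integration.integrable_add integrable_ball_weight ind)
        fix z
        have "ball_weight_sq z / (norm (p + z))\<^sup>2 \<le> ball_weight_sq z + indicator (cball 0 1) (p + z) / (norm (p + z))\<^sup>2"
        proof (cases "norm (p + z) \<le> 1")
          case True
          have "ball_weight_sq z / (norm (p + z))\<^sup>2 \<le> 1 / (norm (p + z))\<^sup>2" by (intro divide_right_mono ball_weight_bounds) auto
          then show ?thesis using True ball_weight_bounds(3)[of z] by simp
        next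
          case False
          then have "1 \<le> (norm (p + z))\<^sup>2" by simp
          then have "ball_weight_sq z / (norm (p + z))\<^sup>2 \<le> ball_weight_sq z / 1" by (intro divide_left_mono ball_weight_bounds) auto
          then show ?thesis using False by simp
        qed
        then have "(1 / r\<^sup>2) * (ball_weight_sq z / (norm (p + z))\<^sup>2) \<le> (1 / r\<^sup>2) * (ball_weight_sq z + indicator (cball 0 1) (p + z) / (norm (p + z))\<^sup>2)"
          by (rule mult_left_mono) simp
        then show "ball_weight_sq z / (norm (d + r *\<^sub>R z))\<^sup>2 \<le> (1 / r\<^sup>2) * (ball_weight_sq z + indicator (cball 0 1) (p + z) / (norm (p + z))\<^sup>2)"
          unfolding dp using r0 by (simp add: power_mult_distrib)
      qed
      also have "\<dots> = (1 / r\<^sup>2) * (M + J)"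
        unfolding integral_mult_right_zero Bochner_Integration.integral_add[OF integrable_ball_weight(2) ind]
          integral_translate[of "\<lambda>z. indicator (cball 0 1) z / (norm z)\<^sup>2"] M_def J_def ..
      finally have "r * (\<integral>z. ball_weight_sq z / (norm (d + r *\<^sub>R z))\<^sup>2 \<partial>lborel) \<le> r * ((1 / r\<^sup>2) * (M + J))"
        using r0 by (intro mult_left_mono) auto
      also have "\<dots> = (M + J) / r" using r0 by (simp add: power2_eq_square)
      also have "\<dots> \<le> (M + J) / (norm d / 2)" using False nd J0 M0 r0 by (intro divide_left_mono) auto
      also have "\<dots> \<le> K" unfolding K_def using M0 by (simp add: mult.commute)
      finally show ?thesis .
    qed
  qed
  moreover have "K \<ge> 0" unfolding K_def using J0 M0 by simp
  ultimately show ?thesis by blast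
qed

text \<open>In dimension three (3 * e + s^2) / (e + s^2)^2 is the Laplacian of ln (e + |x|^2) / 2 at
  |x| = s. The bounds do not involve e and dominate the passage to ln |x|, whose Laplacian is 1 /
  |x|^2.\<close>

lemma log_regularised_bounds:
  assumes e: "0 < e" "e \<le> 1" and s: "s > (0::real)"
  shows "\<bar>ln (e + s\<^sup>2) / 2\<bar> \<le> s\<^sup>2 + 1 / s\<^sup>2"
    and "0 \<le> (3 * e + s\<^sup>2) / (e + s\<^sup>2)\<^sup>2" "(3 * e + s\<^sup>2) / (e + s\<^sup>2)\<^sup>2 \<le> 3 / s\<^sup>2"
proof -
  have s2: "s\<^sup>2 > 0" using s by simp
  have p: "e + s\<^sup>2 > 0" using e s2 by linarith
  have "ln (e + s\<^sup>2) \<le> e + s\<^sup>2 - 1" by (rule ln_le_minus_one[OF p])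
  then have 1: "ln (e + s\<^sup>2) / 2 \<le> s\<^sup>2" using e s2 by linarith
  have "- ln (s\<^sup>2) = ln (1 / s\<^sup>2)" using s2 by (simp add: ln_div)
  also have "\<dots> \<le> 1 / s\<^sup>2 - 1" using s2 by (intro ln_le_minus_one) simp
  finally have "- ln (s\<^sup>2) \<le> 1 / s\<^sup>2 - 1" .
  moreover have "ln (s\<^sup>2) \<le> ln (e + s\<^sup>2)" using s2 p e by simp
  ultimately have 2: "- (ln (e + s\<^sup>2) / 2) \<le> 1 / s\<^sup>2"
    using s2 divide_pos_pos[of 1 "s\<^sup>2"] by linarith
  show "\<bar>ln (e + s\<^sup>2) / 2\<bar> \<le> s\<^sup>2 + 1 / s\<^sup>2"
    using 1 2 s2 divide_pos_pos[of 1 "s\<^sup>2"] by linarith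
  show "0 \<le> (3 * e + s\<^sup>2) / (e + s\<^sup>2)\<^sup>2" using e by simp
  have "(3 * e + s\<^sup>2) / (e + s\<^sup>2)\<^sup>2 \<le> 3 * (e + s\<^sup>2) / (e + s\<^sup>2)\<^sup>2"
    using e by (intro divide_right_mono) auto
  also have "\<dots> = 3 / (e + s\<^sup>2)"
  proof -
    have "3 * X / X\<^sup>2 = 3 / X" if "X > 0" for X :: real using that by (simp add: power2_eq_square)
    from this[OF p] show ?thesis .
  qed
  also have "\<dots> \<le> 3 / s\<^sup>2" using e by (intro divide_left_mono mult_pos_pos[OF p s2]) auto
  finally show "(3 * e + s\<^sup>2) / (e + s\<^sup>2)\<^sup>2 \<le> 3 / s\<^sup>2" .
qed

lemma log_regularised_tendsto:
  assumes s: "s > (0::real)"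
  shows "(\<lambda>n. ln (1 / real (Suc n) + s\<^sup>2) / 2) \<longlonglongrightarrow> ln s"
    and "(\<lambda>n. (3 * (1 / real (Suc n)) + s\<^sup>2) / (1 / real (Suc n) + s\<^sup>2)\<^sup>2) \<longlonglongrightarrow> 1 / s\<^sup>2"
proof -
  have z: "(\<lambda>n. 1 / real (Suc n)) \<longlonglongrightarrow> 0" by real_asymp
  have "(\<lambda>n. ln (1 / real (Suc n) + s\<^sup>2) / 2) \<longlonglongrightarrow> ln (0 + s\<^sup>2) / 2"
    using s by (intro tendsto_intros z) auto
  also have "ln (0 + s\<^sup>2) / 2 = ln s" using s by (simp add: ln_realpow)
  finally show "(\<lambda>n. ln (1 / real (Suc n) + s\<^sup>2) / 2) \<longlonglongrightarrow> ln s" .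
  have "(\<lambda>n. (3 * (1 / real (Suc n)) + s\<^sup>2) / (1 / real (Suc n) + s\<^sup>2)\<^sup>2) \<longlonglongrightarrow> (3 * 0 + s\<^sup>2) / (0 + s\<^sup>2)\<^sup>2"
    using s by (intro tendsto_intros z) auto
  then show "(\<lambda>n. (3 * (1 / real (Suc n)) + s\<^sup>2) / (1 / real (Suc n) + s\<^sup>2)\<^sup>2) \<longlonglongrightarrow> 1 / s\<^sup>2"
    using s by (simp add: power2_eq_square)
qed

lemma AE_affine_neq_0:
  assumes "r \<noteq> 0"
  shows "AE z in lborel. d + r *\<^sub>R (z::real^3) \<noteq> 0"
proof -
  have "AE z in lborel. z \<noteq> - ((1 / r) *\<^sub>R d)" by (rule AE_lborel_singleton)
  then show ?thesis
  proof eventually_elim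
    case (elim z)
    have "z = - ((1 / r) *\<^sub>R d)" if "d + r *\<^sub>R z = 0"
    proof -
      have "r *\<^sub>R z = - d" using that by (simp add: add_eq_0_iff)
      then have "(1 / r) *\<^sub>R (r *\<^sub>R z) = (1 / r) *\<^sub>R (- d)" by simp
      then show ?thesis using assms by simp
    qed
    then show ?case using elim by blast
  qed
qed

lemma log_regularised_average:
  assumes e: "e > 0" and R: "R > 0"
  shows "(\<integral>z. ball_weight z * (ln (e + (norm (d + R *\<^sub>R z))\<^sup>2) / 2) \<partial>lborel) - ball_mass * (ln (e + (norm d)\<^sup>2) / 2) =
    (\<integral>r. indicator {0..R} r * (r * (\<integral>z. ball_weight_sq z * ((3 * e + (norm (d + r *\<^sub>R z))\<^sup>2) / (e + (norm (d + r *\<^sub>R z))\<^sup>2)\<^sup>2) \<partial>lborel)) \<partial>lborel)"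
proof -
  let ?q = "\<lambda>x::real^3. e + x \<bullet> x"
  have q: "?q x > 0" for x using e by (simp add: add_pos_nonneg)
  then have q0: "?q x \<noteq> 0" for x by (metis less_irrefl)
  have dq: "(?q has_derivative (\<lambda>h. 2 * (x \<bullet> h))) (at x)" for x
    by (auto intro!: derivative_eq_intros simp: inner_commute)
  let ?G = "\<lambda>x::real^3. (1 / ?q x) *\<^sub>R x"
  let ?G' = "\<lambda>(x::real^3) h. (1 / ?q x) *\<^sub>R h + (- (2 * (x \<bullet> h)) / (?q x)\<^sup>2) *\<^sub>R x"
  have sum: "(\<Sum>b\<in>Basis. ?G' x b \<bullet> b) = (3 * e + (norm x)\<^sup>2) / (e + (norm x)\<^sup>2)\<^sup>2" for x
  proof -
    have "(\<Sum>b\<in>Basis. ?G' x b \<bullet> b) = (\<Sum>b\<in>(Basis::(real^3) set). 1 / ?q x) + (\<Sum>b\<in>Basis. - 2 / (?q x)\<^sup>2 * ((x \<bullet> b) * (x \<bullet> b)))"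
      unfolding sum.distrib[symmetric] by (intro sum.cong refl) (simp add: inner_diff_left inner_add_left)
    also have "\<dots> = 3 / ?q x - 2 / (?q x)\<^sup>2 * (x \<bullet> x)"
      unfolding sum_distrib_left[symmetric] euclidean_inner[of x x, symmetric] by simp
    also have "\<dots> = (3 * ?q x - 2 * (x \<bullet> x)) / (?q x)\<^sup>2"
    proof -
      have "3 / X - 2 / X\<^sup>2 * Y = (3 * X - 2 * Y) / X\<^sup>2" if "X \<noteq> 0" for X Y :: real
        using that by (simp add: diff_divide_distrib power2_eq_square)
      from this[OF q0] show ?thesis .
    qed
    finally show ?thesis by (simp add: power2_norm_eq_inner algebra_simps)
  qed
  have "(\<integral>z. ball_weight z * (\<lambda>x. ln (?q x) / 2) (d + R *\<^sub>R z) \<partial>lborel) - ball_mass * (\<lambda>x. ln (?q x) / 2) d =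
    (\<integral>r. indicator {0..R} r * (r * (\<integral>z. ball_weight_sq z * (\<Sum>b\<in>Basis. ?G' (d + r *\<^sub>R z) b \<bullet> b) \<partial>lborel)) \<partial>lborel)"
  proof (rule ball_average_identity[where G="?G" and G'="?G'", OF _ _ _ R])
    fix x
    have "((\<lambda>x. ln (?q x) * (1 / 2)) has_derivative (\<lambda>h. 2 * (x \<bullet> h) * inverse (?q x) * (1 / 2))) (at x)"
      by (rule has_derivative_mult_left[OF has_derivative_ln[OF q[of x] dq[of x]]])
    moreover have a1: "l * (1 / 2) = l / 2" for l :: real by simp
    moreover have a2: "2 * a * inverse Q * (1 / 2) = (1 / Q) * a" for a Q :: real by (simp add: inverse_eq_divide)
    ultimately show "((\<lambda>x. ln (?q x) / 2) has_derivative (\<lambda>h. ?G x \<bullet> h)) (at x)"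
      unfolding a1 a2 inner_scaleR_left by simp
    have "((\<lambda>x. 1 / ?q x) has_derivative (\<lambda>h. - (2 * (x \<bullet> h)) / (?q x)\<^sup>2)) (at x)"
    proof -
      have "((\<lambda>x. inverse (?q x)) has_derivative (\<lambda>h. - (inverse (?q x) * (2 * (x \<bullet> h)) * inverse (?q x)))) (at x)"
        by (rule Deriv.has_derivative_inverse[OF q0[of x] dq[of x]])
      then show ?thesis by (simp add: divide_inverse power2_eq_square mult_ac)
    qed
    from has_derivative_scaleR[OF this has_derivative_ident]
    show "(?G has_derivative ?G' x) (at x)" .
    show "continuous_on UNIV (\<lambda>x. ?G' x b \<bullet> b)" for b
      using q0 by (intro continuous_intros) auto
  qed
  then show ?thesis unfolding sum by (simp add: power2_norm_eq_inner)
qed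

text \<open>The limit of the regularised identity as e tends to 0. Since 1 / |x|^2 is locally
  integrable in dimension three, the singularity leaves no extra term.\<close>

lemma log_average:
  assumes d: "d \<noteq> 0" and R: "R > 0"
  shows "(\<integral>z. ball_weight z * ln (norm (d + R *\<^sub>R z)) \<partial>lborel) - ball_mass * ln (norm d) =
    (\<integral>r. indicator {0..R} r * (r * (\<integral>z. ball_weight_sq z / (norm (d + r *\<^sub>R z))\<^sup>2 \<partial>lborel)) \<partial>lborel)"
    and "integrable lborel (\<lambda>r. indicator {0..R} r * (r * (\<integral>z. ball_weight_sq z / (norm (d + r *\<^sub>R z))\<^sup>2 \<partial>lborel)))"
proof -
  let ?e = "\<lambda>n. 1 / real (Suc n)"
  have e: "0 < ?e n" "?e n \<le> 1" for n by auto
  let ?L = "\<lambda>n z. (3 * ?e n + (norm (z::real^3))\<^sup>2) / (?e n + (norm z)\<^sup>2)\<^sup>2"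
  obtain K where K: "K \<ge> 0" "\<And>r. r \<in> {0<..R} \<Longrightarrow> r * (\<integral>z. ball_weight_sq z / (norm (d + r *\<^sub>R z))\<^sup>2 \<partial>lborel) \<le> K"
    using ball_weight_sq_potential_bounded[OF d, of R] by blast
  have L1: "(\<lambda>n. \<integral>z. ball_weight z * (ln (?e n + (norm (d + R *\<^sub>R z))\<^sup>2) / 2) \<partial>lborel) \<longlonglongrightarrow> (\<integral>z. ball_weight z * ln (norm (d + R *\<^sub>R z)) \<partial>lborel)"
  proof (rule integral_dominated_convergence[where w="\<lambda>z. ball_weight z * (norm (d + R *\<^sub>R z))\<^sup>2 + ball_weight z / (norm (d + R *\<^sub>R z))\<^sup>2"])
    show "integrable lborel (\<lambda>z. ball_weight z * (norm (d + R *\<^sub>R z))\<^sup>2 + ball_weight z / (norm (d + R *\<^sub>R z))\<^sup>2)"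
      by (intro Bochner_Integration.integrable_add integrable_weight_div_affine R integrable_ball_weight_times continuous_intros)
    have ae: "AE z in lborel. d + R *\<^sub>R z \<noteq> 0" using R by (intro AE_affine_neq_0) auto
    then show "AE z in lborel. (\<lambda>n. ball_weight z * (ln (?e n + (norm (d + R *\<^sub>R z))\<^sup>2) / 2)) \<longlonglongrightarrow> ball_weight z * ln (norm (d + R *\<^sub>R z))"
    proof eventually_elim
      case (elim z)
      then show ?case by (intro tendsto_mult tendsto_const log_regularised_tendsto) simp
    qed
    fix n
    show "AE z in lborel. norm (ball_weight z * (ln (?e n + (norm (d + R *\<^sub>R z))\<^sup>2) / 2)) \<le> ball_weight z * (norm (d + R *\<^sub>R z))\<^sup>2 + ball_weight z / (norm (d + R *\<^sub>R z))\<^sup>2"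
      using ae
    proof eventually_elim
      case (elim z)
      then have "\<bar>ln (?e n + (norm (d + R *\<^sub>R z))\<^sup>2) / 2\<bar> \<le> (norm (d + R *\<^sub>R z))\<^sup>2 + 1 / (norm (d + R *\<^sub>R z))\<^sup>2"
        by (intro log_regularised_bounds e) simp
      then have "ball_weight z * \<bar>ln (?e n + (norm (d + R *\<^sub>R z))\<^sup>2) / 2\<bar> \<le> ball_weight z * ((norm (d + R *\<^sub>R z))\<^sup>2 + 1 / (norm (d + R *\<^sub>R z))\<^sup>2)"
        by (intro mult_left_mono ball_weight_bounds)
      then show ?case using ball_weight_bounds(1)[of z] by (simp add: abs_mult distrib_left)
    qed
  qed measurable
  have inner: "(\<lambda>n. \<integral>z. ball_weight_sq z * ?L n (d + r *\<^sub>R z) \<partial>lborel) \<longlonglongrightarrow> (\<integral>z. ball_weight_sq z / (norm (d + r *\<^sub>R z))\<^sup>2 \<partial>lborel)"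
    and bound: "\<bar>\<integral>z. ball_weight_sq z * ?L n (d + r *\<^sub>R z) \<partial>lborel\<bar> \<le> 3 * (\<integral>z. ball_weight_sq z / (norm (d + r *\<^sub>R z))\<^sup>2 \<partial>lborel)"
    if r: "r > 0" for r n
  proof -
    have ae: "AE z in lborel. d + r *\<^sub>R z \<noteq> 0" using r by (intro AE_affine_neq_0) auto
    have i3: "integrable lborel (\<lambda>z. 3 * (ball_weight_sq z / (norm (d + r *\<^sub>R z))\<^sup>2))"
      by (intro integrable_mult_right integrable_weight_div_affine r)
    have b: "AE z in lborel. norm (ball_weight_sq z * ?L n (d + r *\<^sub>R z)) \<le> 3 * (ball_weight_sq z / (norm (d + r *\<^sub>R z))\<^sup>2)" for n
      using ae
    proof eventually_elim
      case (elim z)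
      then have n: "norm (d + r *\<^sub>R z) > 0" by simp
      have "ball_weight_sq z * ?L n (d + r *\<^sub>R z) \<le> ball_weight_sq z * (3 / (norm (d + r *\<^sub>R z))\<^sup>2)"
        by (intro mult_left_mono log_regularised_bounds e n ball_weight_bounds)
      moreover have "0 \<le> ball_weight_sq z * ?L n (d + r *\<^sub>R z)"
        by (intro mult_nonneg_nonneg log_regularised_bounds e n ball_weight_bounds)
      ultimately show ?case by (simp add: mult.commute)
    qed
    show "(\<lambda>n. \<integral>z. ball_weight_sq z * ?L n (d + r *\<^sub>R z) \<partial>lborel) \<longlonglongrightarrow> (\<integral>z. ball_weight_sq z / (norm (d + r *\<^sub>R z))\<^sup>2 \<partial>lborel)"
    proof (rule integral_dominated_convergence[OF _ _ i3 _ b])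
      show "AE z in lborel. (\<lambda>n. ball_weight_sq z * ?L n (d + r *\<^sub>R z)) \<longlonglongrightarrow> ball_weight_sq z / (norm (d + r *\<^sub>R z))\<^sup>2"
        using ae
      proof eventually_elim
        case (elim z)
        then have "(\<lambda>n. ball_weight_sq z * ?L n (d + r *\<^sub>R z)) \<longlonglongrightarrow> ball_weight_sq z * (1 / (norm (d + r *\<^sub>R z))\<^sup>2)"
          by (intro tendsto_mult tendsto_const log_regularised_tendsto) simp
        then show ?case by simp
      qed
    qed measurable
    have m: "(\<lambda>z. ball_weight_sq z * ?L n (d + r *\<^sub>R z)) \<in> borel_measurable lborel" by measurable
    have "\<bar>\<integral>z. ball_weight_sq z * ?L n (d + r *\<^sub>R z) \<partial>lborel\<bar> \<le> (\<integral>z. norm (ball_weight_sq z * ?L n (d + r *\<^sub>R z)) \<partial>lborel)"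
      using integral_norm_bound[of lborel "\<lambda>z. ball_weight_sq z * ?L n (d + r *\<^sub>R z)"] by simp
    also have "\<dots> \<le> (\<integral>z. 3 * (ball_weight_sq z / (norm (d + r *\<^sub>R z))\<^sup>2) \<partial>lborel)"
    proof (intro integral_mono_AE i3 b integrable_norm)
      show "integrable lborel (\<lambda>z. ball_weight_sq z * ?L n (d + r *\<^sub>R z))"
      proof (rule Bochner_Integration.integrable_bound[OF i3 m])
        show "AE z in lborel. norm (ball_weight_sq z * ?L n (d + r *\<^sub>R z)) \<le> norm (3 * (ball_weight_sq z / (norm (d + r *\<^sub>R z))\<^sup>2))"
          using b[of n]
        proof eventually_elim
          case (elim z)
          show ?case by (rule order_trans[OF elim]) (simp only: real_norm_def abs_ge_self)
        qed
      qed
    qed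
    also have "\<dots> = 3 * (\<integral>z. ball_weight_sq z / (norm (d + r *\<^sub>R z))\<^sup>2 \<partial>lborel)" by (rule integral_mult_right_zero)
    finally show "\<bar>\<integral>z. ball_weight_sq z * ?L n (d + r *\<^sub>R z) \<partial>lborel\<bar> \<le> 3 * (\<integral>z. ball_weight_sq z / (norm (d + r *\<^sub>R z))\<^sup>2 \<partial>lborel)" .
  qed
  have iK: "integrable lborel (\<lambda>r. 3 * K * indicator {0..R} r)"
    using emeasure_lborel_cbox_finite[of 0 R] by (intro integrable_mult_right integrable_real_indicator) auto
  have N0: "0 \<le> (\<integral>z. ball_weight_sq z / (norm (d + r *\<^sub>R z))\<^sup>2 \<partial>lborel)" for r
    by (intro integral_nonneg_AE) (auto simp: ball_weight_bounds)
  have z: "indicator {0..R} r * (r * X) = (0::real)" if "r \<notin> {0<..R}" for r X :: real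
    using that by (cases "r = 0") (auto simp: indicator_def)
  have L2: "(\<lambda>n. \<integral>r. indicator {0..R} r * (r * (\<integral>z. ball_weight_sq z * ?L n (d + r *\<^sub>R z) \<partial>lborel)) \<partial>lborel) \<longlonglongrightarrow>
     (\<integral>r. indicator {0..R} r * (r * (\<integral>z. ball_weight_sq z / (norm (d + r *\<^sub>R z))\<^sup>2 \<partial>lborel)) \<partial>lborel)"
  proof (rule integral_dominated_convergence[OF _ _ iK])
    show "AE r in lborel. (\<lambda>n. indicator {0..R} r * (r * (\<integral>z. ball_weight_sq z * ?L n (d + r *\<^sub>R z) \<partial>lborel))) \<longlonglongrightarrow>
      indicator {0..R} r * (r * (\<integral>z. ball_weight_sq z / (norm (d + r *\<^sub>R z))\<^sup>2 \<partial>lborel))"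
    proof (intro AE_I2)
      fix r :: real
      show "(\<lambda>n. indicator {0..R} r * (r * (\<integral>z. ball_weight_sq z * ?L n (d + r *\<^sub>R z) \<partial>lborel))) \<longlonglongrightarrow>
        indicator {0..R} r * (r * (\<integral>z. ball_weight_sq z / (norm (d + r *\<^sub>R z))\<^sup>2 \<partial>lborel))"
      proof (cases "r \<in> {0<..R}")
        case True
        then show ?thesis by (intro tendsto_mult tendsto_const inner) simp
      next
        case False
        show ?thesis unfolding z[OF False] by (rule tendsto_const)
      qed
    qed
    fix n
    show "AE r in lborel. norm (indicator {0..R} r * (r * (\<integral>z. ball_weight_sq z * ?L n (d + r *\<^sub>R z) \<partial>lborel))) \<le> 3 * K * indicator {0..R} r"
    proof (intro AE_I2)
      fix r :: real
      show "norm (indicator {0..R} r * (r * (\<integral>z. ball_weight_sq z * ?L n (d + r *\<^sub>R z) \<partial>lborel))) \<le> 3 * K * indicator {0..R} r"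
      proof (cases "r \<in> {0<..R}")
        case True
        then have r: "r > 0" by simp
        have "\<bar>r * (\<integral>z. ball_weight_sq z * ?L n (d + r *\<^sub>R z) \<partial>lborel)\<bar> \<le> r * (3 * (\<integral>z. ball_weight_sq z / (norm (d + r *\<^sub>R z))\<^sup>2 \<partial>lborel))"
          unfolding abs_mult using r bound[OF r, of n] by (intro mult_mono) auto
        also have "\<dots> \<le> 3 * K" using K(2)[OF True] by simp
        finally show ?thesis using True by (simp add: indicator_def)
      next
        case False
        show ?thesis unfolding z[OF False] using K(1) by simp
      qed
    qed
  qed measurable
  have L3: "(\<lambda>n. (\<integral>z. ball_weight z * (ln (?e n + (norm (d + R *\<^sub>R z))\<^sup>2) / 2) \<partial>lborel) - ball_mass * (ln (?e n + (norm d)\<^sup>2) / 2)) \<longlonglongrightarrow>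
     (\<integral>z. ball_weight z * ln (norm (d + R *\<^sub>R z)) \<partial>lborel) - ball_mass * ln (norm d)"
    using d by (intro tendsto_diff L1 tendsto_mult tendsto_const log_regularised_tendsto) simp
  show "(\<integral>z. ball_weight z * ln (norm (d + R *\<^sub>R z)) \<partial>lborel) - ball_mass * ln (norm d) =
    (\<integral>r. indicator {0..R} r * (r * (\<integral>z. ball_weight_sq z / (norm (d + r *\<^sub>R z))\<^sup>2 \<partial>lborel)) \<partial>lborel)"
    by (rule LIMSEQ_unique[OF L3[unfolded log_regularised_average[OF e(1) R]] L2])
  show "integrable lborel (\<lambda>r. indicator {0..R} r * (r * (\<integral>z. ball_weight_sq z / (norm (d + r *\<^sub>R z))\<^sup>2 \<partial>lborel)))"
  proof (rule Bochner_Integration.integrable_bound[OF iK])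
    show "AE r in lborel. norm (indicator {0..R} r * (r * (\<integral>z. ball_weight_sq z / (norm (d + r *\<^sub>R z))\<^sup>2 \<partial>lborel))) \<le> norm (3 * K * indicator {0..R} r)"
    proof (intro AE_I2)
      fix r :: real
      show "norm (indicator {0..R} r * (r * (\<integral>z. ball_weight_sq z / (norm (d + r *\<^sub>R z))\<^sup>2 \<partial>lborel))) \<le> norm (3 * K * indicator {0..R} r)"
      proof (cases "r \<in> {0<..R}")
        case True
        then show ?thesis using K(1) K(2)[OF True] N0[of r] by (simp add: indicator_def abs_mult)
      next
        case False
        show ?thesis unfolding z[OF False] using K(1) by simp
      qed
    qed
  qed measurable
qed

subsection \<open>The logarithmic potential\<close>

text \<open>The factor 1 + |y| keeps the kernel above - ln (1 + |x|) for all y, so that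
  integrability of the density suffices without a logarithmic moment. It cancels in differences of
  values.\<close>

definition logpot :: "(real^3 \<Rightarrow> real) \<Rightarrow> real^3 \<Rightarrow> real" where
  "logpot \<rho> x = (\<integral>y. ln ((1 + norm y) / norm (x - y)) * \<rho> y \<partial>lborel)"

lemma log_kernel_lower: "- ln (1 + norm x) \<le> ln ((1 + norm y) / norm (x - y))"
proof (cases "x = y")
  case True
  \<comment> \<open>On the diagonal the quotient is 0 and \<open>ln 0 = 0\<close>.\<close>
  then show ?thesis by simp
next
  case False
  have "norm (x - y) \<le> norm x + norm y" by (rule norm_triangle_ineq4)
  also have "\<dots> \<le> (1 + norm x) * (1 + norm y)" by (simp add: algebra_simps)
  finally have "1 / (1 + norm x) \<le> (1 + norm y) / norm (x - y)"
    using False by (simp add: field_simps add_pos_nonneg)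
  then have "ln (1 / (1 + norm x)) \<le> ln ((1 + norm y) / norm (x - y))"
    using False by (intro ln_mono) (auto intro!: divide_pos_pos add_pos_nonneg)
  moreover have "0 < 1 + norm x" by (simp add: add_pos_nonneg)
  then have "1 + norm x \<noteq> 0" by (rule less_imp_neq[symmetric])
  then have "ln (1 / (1 + norm x)) = - ln (1 + norm x)" by (simp add: ln_div)
  ultimately show ?thesis by linarith
qed

lemma log_kernel_abs_le: "\<bar>ln ((1 + norm y) / norm (x - y))\<bar> \<le> ln (2 + norm x) + 1 / (norm (x - y))\<^sup>2"
proof (cases "x = y")
  case True
  then show ?thesis by simp
next
  case False
  then have d: "norm (x - y) > 0" by simp
  define s where "s = norm (x - y)"
  have s: "s > 0" using d by (simp add: s_def)
  have l0: "ln (1 + norm x) \<le> ln (2 + norm x)" by (simp add: add_pos_nonneg)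
  have low: "- (ln (2 + norm x) + 1 / s\<^sup>2) \<le> ln ((1 + norm y) / s)"
    using log_kernel_lower[of x y] l0 s unfolding s_def by (smt (verit) divide_nonneg_nonneg zero_le_power2)
  have "norm y \<le> norm x + s" unfolding s_def by (metis norm_minus_commute norm_triangle_sub)
  then have n: "1 + norm y \<le> 1 + norm x + s" by simp
  have "ln ((1 + norm y) / s) \<le> ln (2 + norm x) + 1 / s\<^sup>2"
  proof (cases "s \<le> 1")
    case True
    have "ln ((1 + norm y) / s) = ln (1 + norm y) + ln (1 / s)"
    proof -
      have "0 < 1 + norm y" by (simp add: add_pos_nonneg)
      then have "1 + norm y \<noteq> 0" by (rule less_imp_neq[symmetric])
      then show ?thesis using s by (simp add: ln_div)
    qed
    also have "ln (1 + norm y) \<le> ln (2 + norm x)" using n True by (simp add: add_pos_nonneg)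
    also have "ln (1 / s) \<le> 1 / s - 1" using s by (intro ln_le_minus_one) simp
    also have "1 / s - 1 \<le> 1 / s\<^sup>2"
    proof -
      have "1 / s \<le> 1 / s\<^sup>2" using s True by (simp add: field_simps power2_eq_square)
      then show ?thesis by simp
    qed
    finally show ?thesis by simp
  next
    case False
    have "(1 + norm y) / s \<le> (1 + norm x + s) / s" using n s by (intro divide_right_mono) auto
    also have "\<dots> = (1 + norm x) / s + 1" using s by (simp add: field_simps)
    also have "\<dots> \<le> (1 + norm x) / 1 + 1" using False by (intro add_right_mono divide_left_mono) auto
    finally have "(1 + norm y) / s \<le> 2 + norm x" by simp
    then have "ln ((1 + norm y) / s) \<le> ln (2 + norm x)" using s by (intro ln_mono) (auto intro!: divide_pos_pos add_pos_nonneg)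
    then show ?thesis using s by (smt (verit) divide_nonneg_nonneg zero_le_power2)
  qed
  with low show ?thesis unfolding s_def by linarith
qed

locale log_density =
  fixes \<rho> :: "real^3 \<Rightarrow> real"
  assumes cont: "continuous_on UNIV \<rho>" and pos: "\<rho> y > 0" and int: "integrable lborel \<rho>"
begin

lemma nonneg: "\<rho> y \<ge> 0"
  using pos[of y] by simp

lemma measurable_density [measurable]: "\<rho> \<in> borel_measurable borel"
  by (rule borel_measurable_continuous_onI[OF cont])

lemma integrable_riesz: "integrable lborel (\<lambda>y. \<rho> y / (norm (x - y))\<^sup>2)"
  by (rule integrable_div_dist_sq[OF int cont])

text \<open>This is minus the Laplacian of \<open>logpot \<rho>\<close>, in the averaged sense made
  precise by \<open>logpot_average\<close>.\<close>

definition riesz :: "real^3 \<Rightarrow> real" where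
  "riesz x = (\<integral>y. \<rho> y / (norm (x - y))\<^sup>2 \<partial>lborel)"

lemma integrable_logpot: "integrable lborel (\<lambda>y. ln ((1 + norm y) / norm (x - y)) * \<rho> y)"
  and abs_logpot_le: "(\<integral>y. \<bar>ln ((1 + norm y) / norm (x - y)) * \<rho> y\<bar> \<partial>lborel) \<le> ln (2 + norm x) * (\<integral>y. \<rho> y \<partial>lborel) + riesz x"
proof -
  have i: "integrable lborel (\<lambda>y. ln (2 + norm x) * \<rho> y + \<rho> y / (norm (x - y))\<^sup>2)"
    by (intro Bochner_Integration.integrable_add integrable_mult_right int integrable_riesz)
  have b: "\<bar>ln ((1 + norm y) / norm (x - y)) * \<rho> y\<bar> \<le> ln (2 + norm x) * \<rho> y + \<rho> y / (norm (x - y))\<^sup>2" for y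
    using mult_right_mono[OF log_kernel_abs_le[of y x] nonneg[of y]] nonneg[of y] by (simp add: abs_mult distrib_right)
  show ii: "integrable lborel (\<lambda>y. ln ((1 + norm y) / norm (x - y)) * \<rho> y)"
  proof (rule Bochner_Integration.integrable_bound[OF i])
    show "AE y in lborel. norm (ln ((1 + norm y) / norm (x - y)) * \<rho> y) \<le> norm (ln (2 + norm x) * \<rho> y + \<rho> y / (norm (x - y))\<^sup>2)"
      by (intro AE_I2) (simp only: real_norm_def order_trans[OF b abs_ge_self])
  qed measurable
  have "(\<integral>y. \<bar>ln ((1 + norm y) / norm (x - y)) * \<rho> y\<bar> \<partial>lborel) \<le> (\<integral>y. ln (2 + norm x) * \<rho> y + \<rho> y / (norm (x - y))\<^sup>2 \<partial>lborel)"
    by (intro integral_mono integrable_abs ii i b)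
  also have "\<dots> = ln (2 + norm x) * (\<integral>y. \<rho> y \<partial>lborel) + riesz x"
    unfolding riesz_def Bochner_Integration.integral_add[OF integrable_mult_right[OF int] integrable_riesz] by simp
  finally show "(\<integral>y. \<bar>ln ((1 + norm y) / norm (x - y)) * \<rho> y\<bar> \<partial>lborel) \<le> ln (2 + norm x) * (\<integral>y. \<rho> y \<partial>lborel) + riesz x" .
qed

lemma logpot_ge: "- ln (1 + norm x) * (\<integral>y. \<rho> y \<partial>lborel) \<le> logpot \<rho> x"
proof -
  have "(\<integral>y. - ln (1 + norm x) * \<rho> y \<partial>lborel) \<le> logpot \<rho> x"
    unfolding logpot_def
    by (intro integral_mono integrable_mult_right int integrable_logpot mult_right_mono log_kernel_lower nonneg)
  then show ?thesis by (simp only: integral_mult_right_zero)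
qed

lemma logpot_diff: "logpot \<rho> x - logpot \<rho> x' = (\<integral>y. ln (norm (x' - y) / norm (x - y)) * \<rho> y \<partial>lborel)"
  and integrable_logpot_diff: "integrable lborel (\<lambda>y. ln (norm (x' - y) / norm (x - y)) * \<rho> y)"
proof -
  have ae: "AE y in lborel. ln ((1 + norm y) / norm (x - y)) * \<rho> y - ln ((1 + norm y) / norm (x' - y)) * \<rho> y = ln (norm (x' - y) / norm (x - y)) * \<rho> y"
    using AE_lborel_singleton[of x] AE_lborel_singleton[of x']
  proof eventually_elim
    case (elim y)
    then have "ln ((1 + norm y) / norm (x - y)) - ln ((1 + norm y) / norm (x' - y)) = ln (norm (x' - y) / norm (x - y))"
    proof -
      have "0 < 1 + norm y" by (simp add: add_pos_nonneg)
      then have "1 + norm y \<noteq> 0" by (rule less_imp_neq[symmetric])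
      then show ?thesis using elim by (simp add: ln_div)
    qed
    then show ?case by (simp only: left_diff_distrib[symmetric])
  qed
  note i = Bochner_Integration.integrable_diff[OF integrable_logpot[of x] integrable_logpot[of x']]
  show "integrable lborel (\<lambda>y. ln (norm (x' - y) / norm (x - y)) * \<rho> y)"
    by (rule integrable_cong_AE_imp[OF i _ ae]) measurable
  have "logpot \<rho> x - logpot \<rho> x' = (\<integral>y. ln ((1 + norm y) / norm (x - y)) * \<rho> y - ln ((1 + norm y) / norm (x' - y)) * \<rho> y \<partial>lborel)"
    unfolding logpot_def by (rule Bochner_Integration.integral_diff[OF integrable_logpot integrable_logpot, symmetric])
  also have "\<dots> = (\<integral>y. ln (norm (x' - y) / norm (x - y)) * \<rho> y \<partial>lborel)"
    by (rule integral_cong_AE[OF _ _ ae]) measurable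
  finally show "logpot \<rho> x - logpot \<rho> x' = (\<integral>y. ln (norm (x' - y) / norm (x - y)) * \<rho> y \<partial>lborel)" .
qed

lemma borel_measurable_logpot [measurable]: "logpot \<rho> \<in> borel_measurable borel"
  unfolding logpot_def[abs_def] by measurable

lemma borel_measurable_riesz [measurable]: "riesz \<in> borel_measurable borel"
  unfolding riesz_def[abs_def] by measurable

text \<open>The equation between potential and \<open>riesz\<close> in integrated form, so that the
  potential need not be differentiated: \<open>log_average\<close> is integrated against
  \<open>\<rho>\<close>, and Fubini reorders the variables z, y and r.\<close>

lemma logpot_average:
  assumes cr: "continuous_on UNIV riesz" and R: "R > 0"
  shows "integrable lborel (\<lambda>z. ball_weight z * logpot \<rho> (x + R *\<^sub>R z))"
    and "(\<integral>z. ball_weight z * logpot \<rho> (x + R *\<^sub>R z) \<partial>lborel) - ball_mass * logpot \<rho> x =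
      - (\<integral>r. indicator {0..R} r * (r * (\<integral>z. ball_weight_sq z * riesz (x + r *\<^sub>R z) \<partial>lborel)) \<partial>lborel)"
    and "integrable lborel (\<lambda>r. indicator {0..R} r * (r * (\<integral>z. ball_weight_sq z * riesz (x + r *\<^sub>R z) \<partial>lborel)))"
proof -
  let ?k = "\<lambda>x y. ln ((1 + norm y) / norm (x - (y::real^3)))"
  let ?f = "\<lambda>z y. ball_weight z * (?k (x + R *\<^sub>R z) y * \<rho> y)"
  let ?N = "\<lambda>r y. \<integral>z. ball_weight_sq z / (norm (x - y + r *\<^sub>R z))\<^sup>2 \<partial>lborel"
  have cR: "continuous_on UNIV (\<lambda>z. riesz (x + r *\<^sub>R z))" for r
    by (rule continuous_on_compose2[OF cr]) (auto intro!: continuous_intros)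
  have m1: "(\<lambda>(z, y). ?f z y) \<in> borel_measurable (lborel \<Otimes>\<^sub>M lborel)" by measurable
  have i1: "AE z in lborel. integrable lborel (?f z)"
    by (intro AE_I2 integrable_mult_right integrable_logpot)
  have i2: "integrable lborel (\<lambda>z. \<integral>y. norm (?f z y) \<partial>lborel)"
  proof (rule Bochner_Integration.integrable_bound)
    show "integrable lborel (\<lambda>z. ball_weight z * (ln (2 + norm (x + R *\<^sub>R z)) * (\<integral>y. \<rho> y \<partial>lborel) + riesz (x + R *\<^sub>R z)))"
      by (intro integrable_ball_weight_times continuous_intros cR) (auto intro: add_pos_nonneg simp: add_pos_nonneg less_imp_neq[symmetric])
    show "AE z in lborel. norm (\<integral>y. norm (?f z y) \<partial>lborel) \<le> norm (ball_weight z * (ln (2 + norm (x + R *\<^sub>R z)) * (\<integral>y. \<rho> y \<partial>lborel) + riesz (x + R *\<^sub>R z)))"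
    proof (intro AE_I2)
      fix z
      have "norm (\<integral>y. norm (?f z y) \<partial>lborel) = ball_weight z * (\<integral>y. \<bar>?k (x + R *\<^sub>R z) y * \<rho> y\<bar> \<partial>lborel)"
        using ball_weight_bounds(1)[of z] by (simp add: abs_mult integral_nonneg_AE)
      also have "\<dots> \<le> ball_weight z * (ln (2 + norm (x + R *\<^sub>R z)) * (\<integral>y. \<rho> y \<partial>lborel) + riesz (x + R *\<^sub>R z))"
        by (intro mult_left_mono abs_logpot_le ball_weight_bounds)
      finally show "norm (\<integral>y. norm (?f z y) \<partial>lborel) \<le> norm (ball_weight z * (ln (2 + norm (x + R *\<^sub>R z)) * (\<integral>y. \<rho> y \<partial>lborel) + riesz (x + R *\<^sub>R z)))"
        by (rule order_trans) (simp only: real_norm_def abs_ge_self)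
    qed
  qed measurable
  note ip = integrable_pair_lborel[OF m1 i1 i2]
  have fz: "(\<integral>y. ?f z y \<partial>lborel) = ball_weight z * logpot \<rho> (x + R *\<^sub>R z)" for z
    unfolding logpot_def by (rule integral_mult_right_zero)
  show "integrable lborel (\<lambda>z. ball_weight z * logpot \<rho> (x + R *\<^sub>R z))"
    using lborel_pair.integrable_fst[OF ip] unfolding fz .
  have iy: "integrable lborel (\<lambda>y. \<integral>z. ?f z y \<partial>lborel)"
    using lborel_pair.integrable_snd[OF ip] .
  have ae: "AE y in lborel. (\<integral>z. ?f z y \<partial>lborel) = ball_mass * (?k x y * \<rho> y) - \<rho> y * (\<integral>r. indicator {0..R} r * (r * ?N r y) \<partial>lborel)"
    using AE_lborel_singleton[of x]
  proof eventually_elim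
    case (elim y)
    then have d: "x - y \<noteq> 0" by simp
    have il: "integrable lborel (\<lambda>z. ball_weight z * ln (norm (x - y + R *\<^sub>R z)))"
    proof (rule Bochner_Integration.integrable_bound)
      show "integrable lborel (\<lambda>z. ball_weight z * (norm (x - y + R *\<^sub>R z))\<^sup>2 + ball_weight z / (norm (x - y + R *\<^sub>R z))\<^sup>2)"
        by (intro Bochner_Integration.integrable_add integrable_weight_div_affine R integrable_ball_weight_times continuous_intros)
      show "AE z in lborel. norm (ball_weight z * ln (norm (x - y + R *\<^sub>R z))) \<le> norm (ball_weight z * (norm (x - y + R *\<^sub>R z))\<^sup>2 + ball_weight z / (norm (x - y + R *\<^sub>R z))\<^sup>2)"
      proof (rule AE_mp[OF AE_affine_neq_0[of R "x - y"]], use R in simp, intro AE_I2 impI)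
        fix z assume "x - y + R *\<^sub>R z \<noteq> 0"
        then have s: "norm (x - y + R *\<^sub>R z) > 0" by simp
        have "\<bar>ln (norm (x - y + R *\<^sub>R z))\<bar> \<le> (norm (x - y + R *\<^sub>R z))\<^sup>2 + 1 / (norm (x - y + R *\<^sub>R z))\<^sup>2"
          by (rule LIMSEQ_le_const2[OF tendsto_rabs[OF log_regularised_tendsto(1)[OF s]]])
             (intro exI[of _ 0] allI impI log_regularised_bounds(1) s; simp)
        then have "ball_weight z * \<bar>ln (norm (x - y + R *\<^sub>R z))\<bar> \<le> ball_weight z * ((norm (x - y + R *\<^sub>R z))\<^sup>2 + 1 / (norm (x - y + R *\<^sub>R z))\<^sup>2)"
          by (intro mult_left_mono ball_weight_bounds)
        then show "norm (ball_weight z * ln (norm (x - y + R *\<^sub>R z))) \<le> norm (ball_weight z * (norm (x - y + R *\<^sub>R z))\<^sup>2 + ball_weight z / (norm (x - y + R *\<^sub>R z))\<^sup>2)"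
          using ball_weight_bounds(1)[of z] by (simp add: abs_mult distrib_left)
      qed
    qed measurable
    have "(\<integral>z. ?f z y \<partial>lborel) = (\<integral>z. \<rho> y * (ln (1 + norm y) * ball_weight z - ball_weight z * ln (norm (x - y + R *\<^sub>R z))) \<partial>lborel)"
    proof (rule integral_cong_AE)
      show "AE z in lborel. ?f z y = \<rho> y * (ln (1 + norm y) * ball_weight z - ball_weight z * ln (norm (x - y + R *\<^sub>R z)))"
      proof (rule AE_mp[OF AE_affine_neq_0[of R "x - y"]], use R in simp, intro AE_I2 impI)
        fix z assume nz: "x - y + R *\<^sub>R z \<noteq> 0"
        have e: "x + R *\<^sub>R z - y = x - y + R *\<^sub>R z" by simp
        have "?k (x + R *\<^sub>R z) y = ln (1 + norm y) - ln (norm (x - y + R *\<^sub>R z))"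
          unfolding e using nz by (intro ln_divide_pos) (auto intro: add_pos_nonneg)
        then show "?f z y = \<rho> y * (ln (1 + norm y) * ball_weight z - ball_weight z * ln (norm (x - y + R *\<^sub>R z)))"
          by (simp only:) (simp add: algebra_simps)
      qed
    qed measurable
    also have "\<dots> = \<rho> y * (ln (1 + norm y) * ball_mass - (\<integral>z. ball_weight z * ln (norm (x - y + R *\<^sub>R z)) \<partial>lborel))"
      unfolding integral_mult_right_zero Bochner_Integration.integral_diff[OF integrable_mult_right[OF integrable_ball_weight(1)] il] ball_mass_def ..
    also have "(\<integral>z. ball_weight z * ln (norm (x - y + R *\<^sub>R z)) \<partial>lborel) = ball_mass * ln (norm (x - y)) + (\<integral>r. indicator {0..R} r * (r * ?N r y) \<partial>lborel)"
      using log_average(1)[OF d R] by linarith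
    also have "\<rho> y * (ln (1 + norm y) * ball_mass - (ball_mass * ln (norm (x - y)) + (\<integral>r. indicator {0..R} r * (r * ?N r y) \<partial>lborel)))
       = ball_mass * ((ln (1 + norm y) - ln (norm (x - y))) * \<rho> y) - \<rho> y * (\<integral>r. indicator {0..R} r * (r * ?N r y) \<partial>lborel)"
      by (simp add: algebra_simps)
    also have "ln (1 + norm y) - ln (norm (x - y)) = ?k x y"
      using d by (intro ln_divide_pos[symmetric]) (auto intro: add_pos_nonneg)
    finally show ?case .
  qed
  \<comment> \<open>The contribution of the mass at y to the deviation of the average from the
    central value.\<close>
  define T where "T y = \<rho> y * (\<integral>r. indicator {0..R} r * (r * ?N r y) \<partial>lborel)" for y
  have [measurable]: "T \<in> borel_measurable borel" unfolding T_def by measurable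
  have ik: "integrable lborel (\<lambda>y. ball_mass * (?k x y * \<rho> y))" by (intro integrable_mult_right integrable_logpot)
  \<comment> \<open>Integrability is read off from the identity \<open>ae\<close>, as a difference
    of two functions already known to be integrable, and not from an estimate of T.\<close>
  have iT: "integrable lborel T"
  proof (rule integrable_cong_AE_imp[OF Bochner_Integration.integrable_diff[OF ik iy]])
    show "AE y in lborel. ball_mass * (?k x y * \<rho> y) - (\<integral>z. ?f z y \<partial>lborel) = T y"
      using ae by eventually_elim (simp add: T_def)
  qed measurable
  have "(\<integral>z. ball_weight z * logpot \<rho> (x + R *\<^sub>R z) \<partial>lborel) = (\<integral>y. \<integral>z. ?f z y \<partial>lborel \<partial>lborel)"
    unfolding fz[symmetric] by (rule integral_swap_lborel[OF m1 i1 i2])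
  also have "\<dots> = (\<integral>y. ball_mass * (?k x y * \<rho> y) - T y \<partial>lborel)"
    by (rule integral_cong_AE) (use ae in \<open>simp_all add: T_def\<close>)
  also have "\<dots> = ball_mass * logpot \<rho> x - (\<integral>y. T y \<partial>lborel)"
    unfolding Bochner_Integration.integral_diff[OF ik iT] logpot_def by simp
  finally have e1: "(\<integral>z. ball_weight z * logpot \<rho> (x + R *\<^sub>R z) \<partial>lborel) - ball_mass * logpot \<rho> x = - (\<integral>y. T y \<partial>lborel)"
    by simp
  let ?g = "\<lambda>y r. \<rho> y * (indicator {0..R} r * (r * ?N r y))"
  have N0: "0 \<le> ?N r y" for r y by (intro integral_nonneg_AE) (auto simp: ball_weight_bounds)
  have m2: "(\<lambda>(y, r). ?g y r) \<in> borel_measurable (lborel \<Otimes>\<^sub>M lborel)" by measurable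
  have j1: "AE y in lborel. integrable lborel (?g y)"
    using AE_lborel_singleton[of x]
  proof eventually_elim
    case (elim y)
    then show ?case by (intro integrable_mult_right log_average(2) R) simp
  qed
  have ng: "norm (?g y r) = ?g y r" for y r using N0 nonneg by (auto simp: indicator_def)
  have Tg: "(\<integral>r. ?g y r \<partial>lborel) = T y" for y unfolding T_def by (rule integral_mult_right_zero)
  have j2: "integrable lborel (\<lambda>y. \<integral>r. norm (?g y r) \<partial>lborel)"
    unfolding ng Tg by (rule iT)
  have gr: "(\<integral>y. ?g y r \<partial>lborel) = indicator {0..R} r * (r * (\<integral>z. ball_weight_sq z * riesz (x + r *\<^sub>R z) \<partial>lborel))" for r
  proof (cases "r > 0")
    case True
    have "(\<integral>z. \<integral>y. ball_weight_sq z * (\<rho> y / (norm (x + r *\<^sub>R z - y))\<^sup>2) \<partial>lborel \<partial>lborel) = (\<integral>y. \<integral>z. ball_weight_sq z * (\<rho> y / (norm (x + r *\<^sub>R z - y))\<^sup>2) \<partial>lborel \<partial>lborel)"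
    proof (rule integral_swap_lborel)
      show "AE z in lborel. integrable lborel (\<lambda>y. ball_weight_sq z * (\<rho> y / (norm (x + r *\<^sub>R z - y))\<^sup>2))"
        by (intro AE_I2 integrable_mult_right integrable_riesz)
      have "(\<integral>y. norm (ball_weight_sq z * (\<rho> y / (norm (x + r *\<^sub>R z - y))\<^sup>2)) \<partial>lborel) = ball_weight_sq z * riesz (x + r *\<^sub>R z)" for z
      proof -
        have "norm (ball_weight_sq z * (\<rho> y / (norm (x + r *\<^sub>R z - y))\<^sup>2)) = ball_weight_sq z * (\<rho> y / (norm (x + r *\<^sub>R z - y))\<^sup>2)" for y
          using nonneg[of y] ball_weight_bounds(3)[of z] by (simp add: abs_mult)
        then show ?thesis unfolding riesz_def by (simp only: integral_mult_right_zero)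
      qed
      then show "integrable lborel (\<lambda>z. \<integral>y. norm (ball_weight_sq z * (\<rho> y / (norm (x + r *\<^sub>R z - y))\<^sup>2)) \<partial>lborel)"
        by (simp only:) (intro integrable_ball_weight_times cR)
    qed measurable
    moreover have "(\<integral>y. ball_weight_sq z * (\<rho> y / (norm (x + r *\<^sub>R z - y))\<^sup>2) \<partial>lborel) = ball_weight_sq z * riesz (x + r *\<^sub>R z)" for z
      unfolding riesz_def by (rule integral_mult_right_zero)
    moreover have "(\<integral>z. ball_weight_sq z * (\<rho> y / (norm (x + r *\<^sub>R z - y))\<^sup>2) \<partial>lborel) = \<rho> y * ?N r y" for y
    proof -
      have "ball_weight_sq z * (\<rho> y / (norm (x + r *\<^sub>R z - y))\<^sup>2) = \<rho> y * (ball_weight_sq z / (norm (x - y + r *\<^sub>R z))\<^sup>2)" for z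
        by (simp add: diff_add_eq)
      then show ?thesis by (simp only: integral_mult_right_zero)
    qed
    ultimately have "(\<integral>z. ball_weight_sq z * riesz (x + r *\<^sub>R z) \<partial>lborel) = (\<integral>y. \<rho> y * ?N r y \<partial>lborel)" by (simp only:)
    then show ?thesis
      by (simp only: mult.left_commute[of "\<rho> _"] integral_mult_right_zero)
  next
    case False
    have z: "indicator {0..R} r * (r * X) = (0::real)" for X
      using False by (cases "r = 0") (auto simp: indicator_def)
    show ?thesis unfolding z by simp
  qed
  have "(\<integral>y. T y \<partial>lborel) = (\<integral>r. \<integral>y. ?g y r \<partial>lborel \<partial>lborel)"
    unfolding Tg[symmetric] by (rule integral_swap_lborel[OF m2 j1 j2])
  then show "(\<integral>z. ball_weight z * logpot \<rho> (x + R *\<^sub>R z) \<partial>lborel) - ball_mass * logpot \<rho> x =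
      - (\<integral>r. indicator {0..R} r * (r * (\<integral>z. ball_weight_sq z * riesz (x + r *\<^sub>R z) \<partial>lborel)) \<partial>lborel)"
    unfolding e1 gr by simp
  show "integrable lborel (\<lambda>r. indicator {0..R} r * (r * (\<integral>z. ball_weight_sq z * riesz (x + r *\<^sub>R z) \<partial>lborel)))"
    using lborel_pair.integrable_snd[OF integrable_pair_lborel[OF m2 j1 j2]] unfolding gr .
qed

end

subsection \<open>A Liouville theorem\<close>

lemma sum_Basis_vec:
  fixes f :: "real^'n \<Rightarrow> 'b::comm_monoid_add"
  shows "(\<Sum>b\<in>Basis. f b) = (\<Sum>i\<in>UNIV. f (axis i 1))"
proof -
  have B: "(Basis :: (real^'n) set) = range (\<lambda>i. axis i (1::real))" by (auto simp: Basis_vec_def)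
  have I: "inj (\<lambda>i::'n. axis i (1::real))" by (auto simp: inj_def axis_eq_axis)
  show ?thesis unfolding B sum.reindex[OF I] by (simp add: o_def)
qed

lemma smooth_ball_average:
  assumes u: "smooth u" and R: "R > 0"
  shows "(\<integral>z. ball_weight z * u (x + R *\<^sub>R z) \<partial>lborel) - ball_mass * u x =
    (\<integral>r. indicator {0..R} r * (r * (\<integral>z. ball_weight_sq z * laplacian u (x + r *\<^sub>R z) \<partial>lborel)) \<partial>lborel)"
proof -
  let ?G = "\<lambda>x. \<Sum>i\<in>UNIV. partial i u x *\<^sub>R axis i (1::real)"
  let ?G' = "\<lambda>x h. \<Sum>i\<in>UNIV. (\<Sum>j\<in>UNIV. h $ j *\<^sub>R partial j (partial i u) x) *\<^sub>R axis i (1::real)"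
  have s: "(\<Sum>b\<in>Basis. ?G' x b \<bullet> b) = laplacian u x" for x
    unfolding sum_Basis_vec sum_axis_scaleR
    by (simp add: inner_sum_left inner_axis_axis laplacian_def if_distrib sum.delta cong: if_cong)
  have "(\<integral>z. ball_weight z * u (x + R *\<^sub>R z) \<partial>lborel) - ball_mass * u x =
    (\<integral>r. indicator {0..R} r * (r * (\<integral>z. ball_weight_sq z * (\<Sum>b\<in>Basis. ?G' (x + r *\<^sub>R z) b \<bullet> b) \<partial>lborel)) \<partial>lborel)"
  proof (rule ball_average_identity[where G="?G" and G'="?G'", OF _ _ _ R])
    fix x
    show "(u has_derivative (\<lambda>h. ?G x \<bullet> h)) (at x)"
      using smooth_has_derivative[OF u, of x]
      by (simp add: inner_sum_left inner_axis' mult.commute)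
    show "(?G has_derivative ?G' x) (at x)"
      by (intro has_derivative_sum has_derivative_scaleR_left smooth_has_derivative smooth_partial u)
  next
    fix b :: "real^3"
    show "continuous_on UNIV (\<lambda>x. ?G' x b \<bullet> b)"
      by (intro continuous_intros smooth_continuous_on smooth_partial u)
  qed
  then show ?thesis unfolding s .
qed

lemma norm_sq_ball_average:
  assumes R: "R > 0"
  shows "(\<integral>z. ball_weight z * (norm (x + R *\<^sub>R z))\<^sup>2 \<partial>lborel) - ball_mass * (norm x)\<^sup>2 =
    (\<integral>r. indicator {0..R} r * (r * (\<integral>z. ball_weight_sq z * 6 \<partial>lborel)) \<partial>lborel)"
proof -
  have s: "(\<Sum>b\<in>(Basis::(real^3) set). (2 *\<^sub>R b) \<bullet> b) = 6" by simp
  have d1: "((\<lambda>x. x \<bullet> x) has_derivative (\<lambda>h. 2 *\<^sub>R x \<bullet> h)) (at x)" for x :: "real^3"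
    by (auto intro!: derivative_eq_intros simp: inner_commute)
  have d2: "((\<lambda>x. 2 *\<^sub>R x) has_derivative (\<lambda>h. 2 *\<^sub>R h)) (at x)" for x :: "real^3"
    by (auto intro!: derivative_eq_intros)
  have c: "continuous_on UNIV (\<lambda>x::real^3. (2 *\<^sub>R b) \<bullet> b)" for b :: "real^3"
    by (intro continuous_intros)
  show ?thesis
    using ball_average_identity[where \<phi>="\<lambda>x. x \<bullet> x" and G="\<lambda>x. 2 *\<^sub>R x" and G'="\<lambda>x h. 2 *\<^sub>R h", OF d1 d2 c R, of x]
    unfolding s by (simp add: power2_norm_eq_inner)
qed

text \<open>Harmonicity expressed by averages, since \<open>logpot\<close> is not known to be
  differentiable. Integrability is included because the integral of a non-integrable function would
  be 0 by convention.\<close>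

definition mean_value :: "(real^3 \<Rightarrow> real) \<Rightarrow> bool" where
  "mean_value h \<longleftrightarrow> (\<forall>x. \<forall>R>0. integrable lborel (\<lambda>z. ball_weight z * h (x + R *\<^sub>R z)) \<and>
     (\<integral>z. ball_weight z * h (x + R *\<^sub>R z) \<partial>lborel) = ball_mass * h x)"

lemma mean_valueD:
  assumes "mean_value h" "R > 0"
  shows "integrable lborel (\<lambda>z. ball_weight z * h (x + R *\<^sub>R z))"
    and "(\<integral>z. ball_weight z * h (x + R *\<^sub>R z) \<partial>lborel) = ball_mass * h x"
  using assms by (simp_all add: mean_value_def)

text \<open>The averaged Laplacians cancel: u contributes - c - riesz / pi^2, the potential term
  riesz / pi^2, and the quadratic term c, because the Laplacian of |x|^2 is 6.\<close>

lemma (in log_density) mean_value_difference: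
  assumes u: "smooth u" and c: "\<And>x. - laplacian u x = c + riesz x / pi\<^sup>2"
  shows "mean_value (\<lambda>x. u x - logpot \<rho> x / pi\<^sup>2 + (c / 6) * (norm x)\<^sup>2)"
  unfolding mean_value_def
proof (intro allI impI)
  fix x and R :: real assume R: "R > 0"
  let ?h = "\<lambda>x. u x - logpot \<rho> x / pi\<^sup>2 + (c / 6) * (norm x)\<^sup>2"
  have ri: "riesz x = pi\<^sup>2 * (- laplacian u x - c)" for x using c[of x] by (simp add: field_simps)
  have cr: "continuous_on UNIV riesz"
    unfolding ri[abs_def] by (intro continuous_intros continuous_on_laplacian u)
  note L = logpot_average[OF cr R, of x]
  have cc: "continuous_on UNIV (\<lambda>z::real^3. x + r *\<^sub>R z)" for r by (intro continuous_intros)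
  have i1: "integrable lborel (\<lambda>z. ball_weight z * u (x + R *\<^sub>R z))"
    by (intro integrable_ball_weight_times continuous_on_compose2[OF smooth_continuous_on[OF u, of UNIV] cc]) auto
  have i3: "integrable lborel (\<lambda>z. ball_weight z * (norm (x + R *\<^sub>R z))\<^sup>2)"
    by (intro integrable_ball_weight_times continuous_intros)
  have eq: "ball_weight z * ?h (x + R *\<^sub>R z) = ball_weight z * u (x + R *\<^sub>R z) - ball_weight z * logpot \<rho> (x + R *\<^sub>R z) / pi\<^sup>2 + (c / 6) * (ball_weight z * (norm (x + R *\<^sub>R z))\<^sup>2)" for z
    by (simp add: algebra_simps)
  define Y where "Y r = (\<integral>z. ball_weight_sq z * riesz (x + r *\<^sub>R z) \<partial>lborel)" for r
  define X where "X = (\<integral>z. ball_weight_sq z \<partial>lborel)"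
  have lap: "(\<integral>z. ball_weight_sq z * laplacian u (x + r *\<^sub>R z) \<partial>lborel) = - c * X - Y r / pi\<^sup>2" for r
  proof -
    have l: "laplacian u y = - c - riesz y / pi\<^sup>2" for y using c[of y] by linarith
    have "ball_weight_sq z * laplacian u (x + r *\<^sub>R z) = - c * ball_weight_sq z - ball_weight_sq z * riesz (x + r *\<^sub>R z) / pi\<^sup>2" for z
      unfolding l by (simp add: algebra_simps)
    moreover have "integrable lborel (\<lambda>z. ball_weight_sq z * riesz (x + r *\<^sub>R z))"
      by (intro integrable_ball_weight_times continuous_on_compose2[OF cr cc]) auto
    ultimately show ?thesis
      using integrable_ball_weight(2) by (simp add: X_def Y_def)
  qed
  have iX: "integrable lborel (\<lambda>r. indicator {0..R} r * (r * X))"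
    using borel_integrable_compact[of "{0..R}" "\<lambda>r. r * X"] by (simp add: continuous_intros)
  have iY: "integrable lborel (\<lambda>r. indicator {0..R} r * (r * Y r))" using L(3) by (simp add: Y_def)
  have "(\<integral>z. ball_weight z * u (x + R *\<^sub>R z) \<partial>lborel) - ball_mass * u x = (\<integral>r. - c * (indicator {0..R} r * (r * X)) - (indicator {0..R} r * (r * Y r)) / pi\<^sup>2 \<partial>lborel)"
    unfolding smooth_ball_average[OF u R] lap by (intro Bochner_Integration.integral_cong refl) (simp add: algebra_simps)
  also have "\<dots> = - c * (\<integral>r. indicator {0..R} r * (r * X) \<partial>lborel) - (\<integral>r. indicator {0..R} r * (r * Y r) \<partial>lborel) / pi\<^sup>2"
    using Bochner_Integration.integral_diff[OF integrable_mult_right[OF iX, of "- c"] integrable_divide_zero[OF iY, of "pi\<^sup>2"]]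
    by (simp only: integral_mult_right_zero integral_divide_zero)
  finally have e1: "(\<integral>z. ball_weight z * u (x + R *\<^sub>R z) \<partial>lborel) - ball_mass * u x = - c * (\<integral>r. indicator {0..R} r * (r * X) \<partial>lborel) - (\<integral>r. indicator {0..R} r * (r * Y r) \<partial>lborel) / pi\<^sup>2" .
  have e2: "(\<integral>z. ball_weight z * logpot \<rho> (x + R *\<^sub>R z) \<partial>lborel) - ball_mass * logpot \<rho> x = - (\<integral>r. indicator {0..R} r * (r * Y r) \<partial>lborel)"
    using L(2) by (simp add: Y_def)
  have e3: "(\<integral>z. ball_weight z * (norm (x + R *\<^sub>R z))\<^sup>2 \<partial>lborel) - ball_mass * (norm x)\<^sup>2 = 6 * (\<integral>r. indicator {0..R} r * (r * X) \<partial>lborel)"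
  proof -
    have "(\<integral>z. ball_weight_sq z * 6 \<partial>lborel) = X * 6" by (simp add: X_def)
    then have "(\<integral>r. indicator {0..R} r * (r * (\<integral>z. ball_weight_sq z * 6 \<partial>lborel)) \<partial>lborel) = (\<integral>r. 6 * (indicator {0..R} r * (r * X)) \<partial>lborel)"
      by (simp only:) (intro Bochner_Integration.integral_cong refl, simp)
    then show ?thesis unfolding norm_sq_ball_average[OF R] integral_mult_right_zero .
  qed
  note ia = Bochner_Integration.integrable_diff[OF i1 integrable_divide_zero[OF L(1), of "pi\<^sup>2"]]
  note ib = integrable_mult_right[OF i3, of "c / 6"]
  have "(\<integral>z. ball_weight z * ?h (x + R *\<^sub>R z) \<partial>lborel) = (\<integral>z. ball_weight z * u (x + R *\<^sub>R z) \<partial>lborel) - (\<integral>z. ball_weight z * logpot \<rho> (x + R *\<^sub>R z) \<partial>lborel) / pi\<^sup>2 + (c / 6) * (\<integral>z. ball_weight z * (norm (x + R *\<^sub>R z))\<^sup>2 \<partial>lborel)"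
    unfolding eq Bochner_Integration.integral_add[OF ia ib] Bochner_Integration.integral_diff[OF i1 integrable_divide_zero[OF L(1)]]
    by simp
  also have "\<dots> = (ball_mass * u x - c * (\<integral>r. indicator {0..R} r * (r * X) \<partial>lborel) - (\<integral>r. indicator {0..R} r * (r * Y r) \<partial>lborel) / pi\<^sup>2)
     - (ball_mass * logpot \<rho> x - (\<integral>r. indicator {0..R} r * (r * Y r) \<partial>lborel)) / pi\<^sup>2
     + (c / 6) * (ball_mass * (norm x)\<^sup>2 + 6 * (\<integral>r. indicator {0..R} r * (r * X) \<partial>lborel))"
  proof -
    have "(\<integral>z. ball_weight z * u (x + R *\<^sub>R z) \<partial>lborel) = ball_mass * u x - c * (\<integral>r. indicator {0..R} r * (r * X) \<partial>lborel) - (\<integral>r. indicator {0..R} r * (r * Y r) \<partial>lborel) / pi\<^sup>2"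
      using e1 by linarith
    moreover have "(\<integral>z. ball_weight z * logpot \<rho> (x + R *\<^sub>R z) \<partial>lborel) = ball_mass * logpot \<rho> x - (\<integral>r. indicator {0..R} r * (r * Y r) \<partial>lborel)"
      using e2 by linarith
    moreover have "(\<integral>z. ball_weight z * (norm (x + R *\<^sub>R z))\<^sup>2 \<partial>lborel) = ball_mass * (norm x)\<^sup>2 + 6 * (\<integral>r. indicator {0..R} r * (r * X) \<partial>lborel)"
      using e3 by linarith
    ultimately show ?thesis by (simp only:)
  qed
  also have "\<dots> = ball_mass * ?h x"
  proof -
    have "(a - c * s - t / p) - (b - t) / p + (c / 6) * (d + 6 * s) = a - b / p + (c / 6) * d" for a b d s t p :: real
      by (simp add: diff_divide_distrib distrib_left)
    then show ?thesis by (simp only:) (simp add: algebra_simps)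
  qed
  finally show "integrable lborel (\<lambda>z. ball_weight z * ?h (x + R *\<^sub>R z)) \<and> (\<integral>z. ball_weight z * ?h (x + R *\<^sub>R z) \<partial>lborel) = ball_mass * ?h x"
    using Bochner_Integration.integrable_add[OF ia ib] unfolding eq by simp
qed

lemma ball_weight_Lipschitz: "\<bar>ball_weight z - ball_weight w\<bar> \<le> 2 * norm (z - w)"
proof -
  have bw: "ball_weight z = 1 - (min 1 (norm z))\<^sup>2" for z
  proof (cases "norm z \<le> 1")
    case True
    then have "(norm z)\<^sup>2 \<le> 1" by (simp add: power_le_one)
    then show ?thesis using True by (simp add: ball_weight_def)
  next
    case False
    then show ?thesis by (simp add: ball_weight_eq_0)
  qed
  let ?a = "min 1 (norm z)" and ?b = "min 1 (norm w)"
  have "ball_weight z - ball_weight w = (?b - ?a) * (?b + ?a)"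
    unfolding bw by (simp add: power2_eq_square algebra_simps)
  then have "\<bar>ball_weight z - ball_weight w\<bar> = \<bar>?b - ?a\<bar> * \<bar>?b + ?a\<bar>" by (simp add: abs_mult)
  also have "\<dots> \<le> norm (z - w) * 2"
  proof (intro mult_mono)
    have "\<bar>?b - ?a\<bar> \<le> \<bar>norm z - norm w\<bar>" by (auto simp: min_def)
    also have "\<dots> \<le> norm (z - w)" by (rule norm_triangle_ineq3)
    finally show "\<bar>?b - ?a\<bar> \<le> norm (z - w)" .
  qed auto
  finally show ?thesis by simp
qed

definition mean_abs :: "(real^3 \<Rightarrow> real) \<Rightarrow> real \<Rightarrow> real" where
  "mean_abs h R = (\<integral>z. ball_weight z * \<bar>h (R *\<^sub>R z)\<bar> \<partial>lborel)"

text \<open>A gradient estimate obtained by moving the translation onto the Lipschitz weight. Both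
  shifted weights live in the ball of radius 3 * R, where the weight of scale 6 * R is at least 3 /
  4; the constant 576 is 2 * (4 / 3) * 6^3.\<close>

lemma mean_value_Lipschitz:
  assumes h: "mean_value h" and R: "R \<ge> 1" "norm x \<le> R" "norm a \<le> R"
  shows "\<bar>h (x + a) - h x\<bar> \<le> 576 / ball_mass * norm a / R * mean_abs h (6 * R)"
proof -
  have R0: "R > 0" using R by simp
  let ?f = "\<lambda>x y. ball_weight ((1 / R) *\<^sub>R (y - x)) * h y"
  have fa: "?f x (x + R *\<^sub>R z) = ball_weight z * h (x + R *\<^sub>R z)" for x z using R0 by simp
  have fi: "integrable lborel (?f x)" and fe: "(\<integral>y. ?f x y \<partial>lborel) = R ^ 3 * (ball_mass * h x)" for x
  proof -
    have "integrable lborel (\<lambda>z. ?f x (x + R *\<^sub>R z))" unfolding fa using h R0 by (simp add: mean_value_def)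
    then show "integrable lborel (?f x)" using integrable_affine_iff[of R "?f x" x] R0 by simp
    have "(\<integral>z. ?f x (x + R *\<^sub>R z) \<partial>lborel) = (\<integral>y. ?f x y \<partial>lborel) /\<^sub>R \<bar>R\<bar> ^ DIM(real^3)" using R0 by (intro integral_affine) simp
    moreover have "(\<integral>z. ?f x (x + R *\<^sub>R z) \<partial>lborel) = ball_mass * h x" unfolding fa using h R0 by (simp add: mean_value_def)
    ultimately show "(\<integral>y. ?f x y \<partial>lborel) = R ^ 3 * (ball_mass * h x)" using R0 by (simp add: field_simps power3_eq_cube)
  qed
  let ?g = "\<lambda>y. ball_weight ((1 / (6 * R)) *\<^sub>R y) * \<bar>h y\<bar>"
  have ga: "?g (0 + (6 * R) *\<^sub>R z) = \<bar>ball_weight z * h (0 + (6 * R) *\<^sub>R z)\<bar>" for z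
    using R0 ball_weight_bounds(1)[of z] by (simp add: abs_mult)
  have gi: "integrable lborel ?g"
  proof -
    have "integrable lborel (\<lambda>z. ?g (0 + (6 * R) *\<^sub>R z))"
      unfolding ga using R0 by (intro integrable_abs mean_valueD(1)[OF h]) simp
    then show ?thesis using integrable_affine_iff[of "6 * R" ?g 0] R0 by simp
  qed
  have ge: "(\<integral>y. ?g y \<partial>lborel) = (6 * R) ^ 3 * mean_abs h (6 * R)"
  proof -
    have "(\<integral>z. ?g (0 + (6 * R) *\<^sub>R z) \<partial>lborel) = (\<integral>y. ?g y \<partial>lborel) /\<^sub>R \<bar>6 * R\<bar> ^ DIM(real^3)" using R0 by (intro integral_affine) simp
    moreover have "(\<integral>z. ?g (0 + (6 * R) *\<^sub>R z) \<partial>lborel) = mean_abs h (6 * R)"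
      unfolding mean_abs_def using R0 by simp
    ultimately show ?thesis using R0 by (simp add: field_simps power3_eq_cube)
  qed
  have b: "\<bar>?f (x + a) y - ?f x y\<bar> \<le> (2 * norm a / R) * (4 / 3) * ?g y" for y
  proof (cases "norm y \<le> 3 * R")
    case True
    have "\<bar>ball_weight ((1 / R) *\<^sub>R (y - (x + a))) - ball_weight ((1 / R) *\<^sub>R (y - x))\<bar> \<le> 2 * norm ((1 / R) *\<^sub>R (y - (x + a)) - (1 / R) *\<^sub>R (y - x))"
      by (rule ball_weight_Lipschitz)
    also have "(1 / R) *\<^sub>R (y - (x + a)) - (1 / R) *\<^sub>R (y - x) = - ((1 / R) *\<^sub>R a)" by (simp add: algebra_simps)
    also have "2 * norm (- ((1 / R) *\<^sub>R a)) = 2 * norm a / R" using R0 by simp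
    finally have l: "\<bar>ball_weight ((1 / R) *\<^sub>R (y - (x + a))) - ball_weight ((1 / R) *\<^sub>R (y - x))\<bar> \<le> 2 * norm a / R" .
    have "norm ((1 / (6 * R)) *\<^sub>R y) \<le> 1 / 2" using True R0 by (simp add: field_simps)
    then have "(norm ((1 / (6 * R)) *\<^sub>R y))\<^sup>2 \<le> (1 / 2)\<^sup>2" by (intro power_mono) auto
    then have w: "1 \<le> 4 / 3 * ball_weight ((1 / (6 * R)) *\<^sub>R y)" unfolding ball_weight_def by (simp add: power2_eq_square)
    have "\<bar>?f (x + a) y - ?f x y\<bar> = \<bar>ball_weight ((1 / R) *\<^sub>R (y - (x + a))) - ball_weight ((1 / R) *\<^sub>R (y - x))\<bar> * \<bar>h y\<bar>"
      by (simp only: left_diff_distrib[symmetric] abs_mult)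
    also have "\<dots> \<le> (2 * norm a / R) * (1 * \<bar>h y\<bar>)"
      unfolding mult_1_left by (rule mult_right_mono[OF l]) simp
    also have "\<dots> \<le> (2 * norm a / R) * (4 / 3 * ball_weight ((1 / (6 * R)) *\<^sub>R y) * \<bar>h y\<bar>)"
      using w R0 by (intro mult_left_mono mult_right_mono) auto
    finally show ?thesis by (simp only: mult.assoc)
  next
    case False
    have z: "ball_weight ((1 / R) *\<^sub>R (y - x')) = 0" if "norm x' \<le> 2 * R" for x'
    proof (rule ball_weight_eq_0)
      have "norm y - norm x' \<le> norm (y - x')" by (rule norm_triangle_ineq2)
      then have "R < norm (y - x')" using False that by linarith
      then show "1 < norm ((1 / R) *\<^sub>R (y - x'))" using R0 by simp
    qed
    have "norm (x + a) \<le> 2 * R" using norm_triangle_ineq[of x a] R by linarith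
    moreover have "norm x \<le> 2 * R" using R by linarith
    ultimately have "?f (x + a) y - ?f x y = 0" by (simp add: z)
    moreover have "0 \<le> (2 * norm a / R) * (4 / 3) * ?g y" using R0 ball_weight_bounds(1) by simp
    ultimately show ?thesis by (simp only: abs_zero)
  qed
  have "R ^ 3 * ball_mass * \<bar>h (x + a) - h x\<bar> = \<bar>(\<integral>y. ?f (x + a) y \<partial>lborel) - (\<integral>y. ?f x y \<partial>lborel)\<bar>"
    unfolding fe using R0 ball_mass_pos by (simp add: abs_mult flip: right_diff_distrib)
  also have "\<dots> = \<bar>\<integral>y. ?f (x + a) y - ?f x y \<partial>lborel\<bar>" by (subst Bochner_Integration.integral_diff[OF fi fi]) simp
  also have "\<dots> \<le> (\<integral>y. \<bar>?f (x + a) y - ?f x y\<bar> \<partial>lborel)" by (rule integral_abs_bound)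
  also have "\<dots> \<le> (\<integral>y. (2 * norm a / R) * (4 / 3) * ?g y \<partial>lborel)"
    by (intro integral_mono integrable_abs Bochner_Integration.integrable_diff fi integrable_mult_right gi b)
  also have "\<dots> = (2 * norm a / R) * (4 / 3) * ((6 * R) ^ 3 * mean_abs h (6 * R))" unfolding integral_mult_right_zero ge ..
  also have "\<dots> = R ^ 3 * ball_mass * (576 / ball_mass * norm a / R * mean_abs h (6 * R))"
    using ball_mass_pos by (simp add: power_mult_distrib)
  finally show ?thesis
    by (rule mult_left_le_imp_le) (use R0 ball_mass_pos in simp)
qed


lemma mean_value_translate_diff:
  assumes h: "mean_value h"
  shows "mean_value (\<lambda>x. h (x + a) - h x)"
  unfolding mean_value_def
proof (intro allI impI)
  fix x and R :: real assume R: "R > 0"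
  have e: "ball_weight z * (h (x + R *\<^sub>R z + a) - h (x + R *\<^sub>R z)) = ball_weight z * h (x + a + R *\<^sub>R z) - ball_weight z * h (x + R *\<^sub>R z)" for z
    by (simp add: algebra_simps)
  show "integrable lborel (\<lambda>z. ball_weight z * (h (x + R *\<^sub>R z + a) - h (x + R *\<^sub>R z))) \<and>
    (\<integral>z. ball_weight z * (h (x + R *\<^sub>R z + a) - h (x + R *\<^sub>R z)) \<partial>lborel) = ball_mass * (h (x + a) - h x)"
    unfolding e using mean_valueD[OF h R, of "x + a"] mean_valueD[OF h R, of x]
    by (simp add: right_diff_distrib)
qed

text \<open>Growth is measured in the mean because the upper bound on u passes through exp (3 * u),
  which is integrable but not known to be bounded.\<close>

definition growth :: "nat \<Rightarrow> (real^3 \<Rightarrow> real) \<Rightarrow> bool" where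
  "growth k h \<longleftrightarrow> (\<exists>C\<ge>0. \<forall>R\<ge>1. mean_abs h R \<le> C * R ^ k)"

text \<open>The Lipschitz estimate carries a factor 1 / R, so each difference lowers the order of
  growth by one.\<close>

lemma growth_translate_diff:
  assumes h: "mean_value h" and g: "growth (Suc k) h"
  shows "growth k (\<lambda>x. h (x + a) - h x)"
proof -
  obtain C where C: "C \<ge> 0" "\<And>R. R \<ge> 1 \<Longrightarrow> mean_abs h R \<le> C * R ^ Suc k" using g unfolding growth_def by metis
  \<comment> \<open>The estimate is applied at scale R * A, which exceeds |a| for every R \<ge>
    1.\<close>
  define A where "A = 1 + norm a"
  have A: "A \<ge> 1" "norm a \<le> A" by (simp_all add: A_def)
  define K where "K = 576 / ball_mass * norm a * (C * 6 ^ Suc k * A ^ k)"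
  have K: "K \<ge> 0" using C A ball_mass_pos by (simp add: K_def)
  have "mean_abs (\<lambda>x. h (x + a) - h x) R \<le> (K * ball_mass) * R ^ k" if R: "R \<ge> 1" for R
  proof -
    have AR: "R * A \<ge> 1" "R \<le> R * A" "norm a \<le> R * A"
      using mult_mono[of 1 R 1 A] mult_left_mono[of 1 A R] mult_right_mono[of 1 R A] A R by linarith+
    have b: "ball_weight z * \<bar>h (R *\<^sub>R z + a) - h (R *\<^sub>R z)\<bar> \<le> ball_weight z * (K * R ^ k)" for z
    proof (cases "norm z \<le> 1")
      case True
      have "norm (R *\<^sub>R z) \<le> R * A" using True AR(2) R mult_left_mono[of "norm z" 1 R] by simp
      then have "\<bar>h (R *\<^sub>R z + a) - h (R *\<^sub>R z)\<bar> \<le> 576 / ball_mass * norm a / (R * A) * mean_abs h (6 * (R * A))"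
        using AR by (intro mean_value_Lipschitz h)
      also have "\<dots> \<le> 576 / ball_mass * norm a / (R * A) * (C * (6 * (R * A)) ^ Suc k)"
        using AR(1) R A ball_mass_pos by (intro mult_left_mono C(2), linarith) simp
      also have "\<dots> = K * R ^ k"
        using R A by (simp add: K_def power_mult_distrib field_simps)
      finally show ?thesis by (intro mult_left_mono ball_weight_bounds)
    next
      case False
      then show ?thesis by (simp add: ball_weight_eq_0)
    qed
    have "integrable lborel (\<lambda>z. ball_weight z * (h (0 + R *\<^sub>R z + a) - h (0 + R *\<^sub>R z)))"
      using R by (intro mean_valueD[OF mean_value_translate_diff[OF h]]) simp
    then have "integrable lborel (\<lambda>z. \<bar>ball_weight z * (h (R *\<^sub>R z + a) - h (R *\<^sub>R z))\<bar>)" by simp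
    then have i: "integrable lborel (\<lambda>z. ball_weight z * \<bar>h (R *\<^sub>R z + a) - h (R *\<^sub>R z)\<bar>)"
      using ball_weight_bounds(1) by (simp add: abs_mult)
    have "mean_abs (\<lambda>x. h (x + a) - h x) R \<le> (\<integral>z. ball_weight z * (K * R ^ k) \<partial>lborel)"
      unfolding mean_abs_def by (intro integral_mono i b integrable_mult_left integrable_ball_weight)
    then show ?thesis by (simp add: ball_mass_def mult.commute mult.left_commute)
  qed
  then show ?thesis unfolding growth_def using K ball_mass_pos by (intro exI[of _ "K * ball_mass"]) simp
qed

text \<open>With a bounded mean the Lipschitz estimate decays like 1 / R, and R is
  arbitrary.\<close>

lemma growth_0_constant:
  assumes h: "mean_value h" and g: "growth 0 h"
  shows "h (x + a) = h x"
proof (rule ccontr)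
  assume "\<not> ?thesis"
  then have D: "\<bar>h (x + a) - h x\<bar> > 0" (is "?D > 0") by simp
  obtain C where C: "C \<ge> 0" "\<And>R. R \<ge> 1 \<Longrightarrow> mean_abs h R \<le> C" using g unfolding growth_def by auto
  define K where "K = 576 / ball_mass * norm a * C"
  have K: "K \<ge> 0" using C ball_mass_pos by (simp add: K_def)
  \<comment> \<open>The last summand makes R times the supposed difference exceed its upper bound
    K.\<close>
  define R where "R = 1 + norm x + norm a + (K + 1) / ?D"
  have q: "(K + 1) / ?D \<ge> 0" using K by simp
  have R: "R \<ge> 1" "norm x \<le> R" "norm a \<le> R" "(K + 1) / ?D \<le> R" using q norm_ge_zero[of x] norm_ge_zero[of a] unfolding R_def by linarith+
  have "?D \<le> 576 / ball_mass * norm a / R * mean_abs h (6 * R)" by (rule mean_value_Lipschitz[OF h R(1-3)])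
  also have "\<dots> \<le> 576 / ball_mass * norm a / R * C" using R ball_mass_pos by (intro mult_left_mono C(2)) auto
  also have "\<dots> = K / R" by (simp add: K_def)
  finally have "?D * R \<le> K" using R by (simp add: field_simps)
  moreover have "K + 1 \<le> ?D * R" using R(4) D by (simp add: field_simps)
  ultimately show False by simp
qed

lemma mean_value_continuous:
  assumes h: "mean_value h"
  shows "continuous_on UNIV h"
proof (rule continuous_at_imp_continuous_on, rule ballI)
  fix x :: "real^3"
  define K where "K = 576 / ball_mass / (1 + norm x) * mean_abs h (6 * (1 + norm x))"
  have "((\<lambda>a. h (x + a) - h x) \<longlongrightarrow> 0) (at 0)"
  proof (rule Lim_null_comparison)
    show "\<forall>\<^sub>F a in at 0. norm (h (x + a) - h x) \<le> norm a * K"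
      unfolding eventually_at
    proof (intro exI[of _ 1] conjI ballI impI)
      fix a :: "real^3" assume "a \<noteq> 0 \<and> dist a 0 < 1"
      then have "\<bar>h (x + a) - h x\<bar> \<le> 576 / ball_mass * norm a / (1 + norm x) * mean_abs h (6 * (1 + norm x))"
        by (intro mean_value_Lipschitz h) (auto intro: order_trans[of _ 1])
      then show "norm (h (x + a) - h x) \<le> norm a * K" by (simp add: K_def mult.commute mult.left_commute)
    qed simp
    show "((\<lambda>a. norm a * K) \<longlongrightarrow> 0) (at (0::real^3))"
      by (intro tendsto_mult_left_zero tendsto_norm_zero tendsto_ident_at)
  qed
  then have "((\<lambda>a. h (x + a)) \<longlongrightarrow> h x) (at 0)" by (rule LIM_zero_cancel)
  then show "isCont h x" by (simp add: isCont_iff)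
qed

text \<open>Cauchy's functional equation: additivity gives homogeneity over the rationals, and
  continuity extends it to the reals.\<close>

lemma continuous_additive_linear:
  fixes f :: "'a::real_normed_vector \<Rightarrow> real"
  assumes add: "\<And>x y. f (x + y) = f x + f y" and c: "continuous_on UNIV f"
  shows "linear f"
proof (rule linearI)
  interpret additive f by standard (rule add)
  fix x and r :: real
  have n: "f (real n *\<^sub>R x) = real n * f x" for n x
    by (induction n) (simp_all add: zero add algebra_simps)
  have i: "f (real_of_int k *\<^sub>R x) = real_of_int k * f x" for k x
  proof (cases "k \<ge> 0")
    case True
    then show ?thesis using n[of "nat k" x] by simp
  next
    case False
    then show ?thesis using n[of "nat (- k)" x] minus[of "real_of_int k *\<^sub>R x"] by simp
  qed
  have "closed {t. f (t *\<^sub>R x) = t * f x}"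
    by (intro closed_Collect_eq continuous_intros continuous_on_compose2[OF c]) auto
  moreover have "\<rat> \<subseteq> {t. f (t *\<^sub>R x) = t * f x}"
  proof
    fix t :: real assume "t \<in> \<rat>"
    then obtain k l :: int where l: "l > 0" "coprime k l" and t: "t = of_int k / of_int l" by (rule Rats_cases')
    have "of_int l * f (t *\<^sub>R x) = f (of_int l *\<^sub>R (t *\<^sub>R x))" by (rule i[symmetric])
    also have "\<dots> = of_int k * f x" using l i[of k x] by (simp add: t)
    finally show "t \<in> {t. f (t *\<^sub>R x) = t * f x}" using l by (simp add: t field_simps)
  qed
  ultimately have "closure \<rat> \<subseteq> {t. f (t *\<^sub>R x) = t * f x}" by (intro closure_minimal)
  then show "f (r *\<^sub>R x) = r *\<^sub>R f x" by (auto simp: Rats_closure_real)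
qed (rule add)

text \<open>Two differences reduce quadratic growth to bounded mean, so third differences vanish.
  The second mixed difference at 0 is then additive in each argument, and continuity makes it
  bilinear.\<close>

lemma quadratic_growth_polynomial:
  assumes h: "mean_value h" and g: "growth 2 h"
  obtains L B where "linear L" "bilinear B" "\<And>x y. B x y = B y x" "\<And>x. h x = h 0 + L x + B x x / 2"
proof -
  have third: "h (a + b + c) - h (a + b) - h (a + c) + h a - h (b + c) + h b + h c - h 0 = 0" for a b c
  proof -
    have "growth (Suc (Suc 0)) h" using g by (simp add: numeral_2_eq_2)
    then have "growth (Suc 0) (\<lambda>x. h (x + a) - h x)" by (rule growth_translate_diff[OF h])
    then have g2: "growth 0 (\<lambda>x. (h (x + b + a) - h (x + b)) - (h (x + a) - h x))"
      by (rule growth_translate_diff[OF mean_value_translate_diff[OF h]])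
    have m2: "mean_value (\<lambda>x. (h (x + b + a) - h (x + b)) - (h (x + a) - h x))"
      by (rule mean_value_translate_diff[OF mean_value_translate_diff[OF h]])
    show ?thesis using growth_0_constant[OF m2 g2, of 0 c] by (simp add: add.commute add.left_commute)
  qed
  have c: "continuous_on UNIV h" by (rule mean_value_continuous[OF h])
  define B where "B a b = h (a + b) - h a - h b + h 0" for a b
  have Bs: "B a b = B b a" for a b by (simp add: B_def add.commute)
  have Ba: "B (a + c) b = B a b + B c b" for a b c
    using third[of a c b] by (simp add: B_def add.commute add.left_commute)
  have Bl: "linear (\<lambda>a. B a b)" for b
    by (rule continuous_additive_linear[OF Ba])
       (auto simp: B_def intro!: continuous_intros continuous_on_compose2[OF c])
  have Bl': "linear (\<lambda>b. B a b)" for a using Bl[of a] by (simp add: Bs[of a])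
  have Bb: "bilinear B" using Bl Bl' by (simp add: bilinear_def)
  define L where "L x = h x - h 0 - B x x / 2" for x
  have "linear L"
  proof (rule continuous_additive_linear)
    fix x y
    have "B (x + y) (x + y) = B x x + 2 * B x y + B y y"
      using Ba Bs by (metis (no_types, opaque_lifting) ab_semigroup_add_class.add_ac(1) mult_2)
    then show "L (x + y) = L x + L y" by (simp add: L_def B_def[of x y] field_simps)
  next
    show "continuous_on UNIV L"
      unfolding L_def B_def by (intro continuous_intros continuous_on_compose2[OF c] subset_UNIV) simp_all
  qed
  then show ?thesis using Bb Bs by (intro that[of L B]) (simp_all add: L_def)
qed


text \<open>Only an upper bound on u is at hand, in the mean. The mean value property converts it
  into a two-sided bound: |h| is at most twice an upper bound minus h, and the average of h is the
  known value at 0.\<close>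

lemma (in log_density) quadratic_difference:
  assumes u: "smooth u" and \<rho>: "\<And>x. \<rho> x = exp (3 * u x)"
    and c: "\<And>x. - laplacian u x = c + riesz x / pi\<^sup>2"
  obtains p L B where "linear L" "bilinear B" "\<And>x y. B x y = B y x"
    "\<And>x. u x = logpot \<rho> x / pi\<^sup>2 + (p + L x + B x x / 2)"
proof -
  let ?V = "\<integral>y. \<rho> y \<partial>lborel"
  have V: "?V \<ge> 0" by (intro integral_nonneg_AE) (simp add: nonneg)
  define h where "h x = u x - logpot \<rho> x / pi\<^sup>2 + (c / 6) * (norm x)\<^sup>2" for x
  have h: "mean_value h" unfolding h_def[abs_def] by (rule mean_value_difference[OF u c])
  define K where "K = ?V / pi\<^sup>2 + \<bar>c\<bar> / 6"
  have K: "K \<ge> 0" using V by (simp add: K_def)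
  have "mean_abs h R \<le> (2 * ?V + 2 * ball_mass * K + ball_mass * \<bar>h 0\<bar>) * R ^ 2" if R: "R \<ge> 1" for R
  proof -
    have R2: "R\<^sup>2 \<ge> 1" "R \<le> R\<^sup>2" using R self_le_power[of R 2] by auto
    have i\<rho>: "integrable lborel (\<lambda>z. \<rho> (0 + R *\<^sub>R z))" using integrable_affine_iff[of R \<rho> 0] int R by simp
    have V': "(\<integral>z. \<rho> (0 + R *\<^sub>R z) \<partial>lborel) \<le> ?V"
    proof -
      have "(\<integral>z. \<rho> (0 + R *\<^sub>R z) \<partial>lborel) = ?V /\<^sub>R \<bar>R\<bar> ^ DIM(real^3)" using R by (intro integral_affine) simp
      also have "\<dots> = ?V / R ^ 3" using R by (simp add: divide_inverse mult.commute)
      also have "\<dots> \<le> ?V / 1" using R V by (intro divide_left_mono) auto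
      finally show ?thesis by simp
    qed
    \<comment> \<open>Holds for either sign of a, as soon as X is a nonnegative upper bound.\<close>
    have abs_le_twice: "a \<le> X \<Longrightarrow> 0 \<le> X \<Longrightarrow> \<bar>a\<bar> \<le> 2 * X - a" for a X :: real by linarith
    have b: "ball_weight z * \<bar>h (R *\<^sub>R z)\<bar> \<le> 2 * (\<rho> (0 + R *\<^sub>R z) + K * R\<^sup>2 * ball_weight z) - ball_weight z * h (R *\<^sub>R z)" for z
    proof (cases "norm z \<le> 1")
      case True
      then have n: "norm (R *\<^sub>R z) \<le> R" using mult_left_mono[of "norm z" 1 R] R by simp
      have "ln (1 + norm (R *\<^sub>R z)) \<le> R\<^sup>2" using ln_add_one_self_le_self[of "norm (R *\<^sub>R z)"] n R2 by simp
      then have "ln (1 + norm (R *\<^sub>R z)) * ?V \<le> R\<^sup>2 * ?V" using V by (rule mult_right_mono)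
      then have "- logpot \<rho> (R *\<^sub>R z) \<le> R\<^sup>2 * ?V" using logpot_ge[of "R *\<^sub>R z"] by linarith
      then have l: "- logpot \<rho> (R *\<^sub>R z) / pi\<^sup>2 \<le> R\<^sup>2 * ?V / pi\<^sup>2" by (rule divide_right_mono) simp
      have "(norm (R *\<^sub>R z))\<^sup>2 \<le> R\<^sup>2" using n by (intro power_mono) auto
      then have q: "(c / 6) * (norm (R *\<^sub>R z))\<^sup>2 \<le> \<bar>c\<bar> / 6 * R\<^sup>2" by (intro mult_mono) auto
      \<comment> \<open>From t \<le> exp (3 * t): the finite mass thus bounds u from above on
        average.\<close>
      have "u (R *\<^sub>R z) \<le> \<rho> (R *\<^sub>R z)"
        using exp_ge_add_one_self[of "3 * u (R *\<^sub>R z)"] nonneg[of "R *\<^sub>R z"] unfolding \<rho> by linarith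
      moreover have "K * R\<^sup>2 = R\<^sup>2 * ?V / pi\<^sup>2 + \<bar>c\<bar> / 6 * R\<^sup>2" by (simp add: K_def algebra_simps)
      ultimately have "h (R *\<^sub>R z) \<le> \<rho> (R *\<^sub>R z) + K * R\<^sup>2" using l q unfolding h_def by linarith
      moreover have "0 \<le> \<rho> (R *\<^sub>R z) + K * R\<^sup>2" using K nonneg by simp
      ultimately have "\<bar>h (R *\<^sub>R z)\<bar> \<le> 2 * (\<rho> (R *\<^sub>R z) + K * R\<^sup>2) - h (R *\<^sub>R z)"
        by (rule abs_le_twice)
      then have "ball_weight z * \<bar>h (R *\<^sub>R z)\<bar> \<le> ball_weight z * (2 * (\<rho> (R *\<^sub>R z) + K * R\<^sup>2) - h (R *\<^sub>R z))"
        by (intro mult_left_mono ball_weight_bounds)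
      also have "\<dots> = 2 * (ball_weight z * \<rho> (R *\<^sub>R z) + K * R\<^sup>2 * ball_weight z) - ball_weight z * h (R *\<^sub>R z)"
        by (simp add: algebra_simps)
      finally show ?thesis
        using mult_right_mono[OF ball_weight_bounds(2)[of z] nonneg[of "R *\<^sub>R z"]] by simp
    next
      case False
      then show ?thesis using nonneg by (simp add: ball_weight_eq_0)
    qed
    have R0: "R > 0" using R by simp
    have ih: "integrable lborel (\<lambda>z. ball_weight z * h (R *\<^sub>R z))" using mean_valueD(1)[OF h R0, of 0] by simp
    then have "integrable lborel (\<lambda>z. \<bar>ball_weight z * h (R *\<^sub>R z)\<bar>)" by simp
    then have i: "integrable lborel (\<lambda>z. ball_weight z * \<bar>h (R *\<^sub>R z)\<bar>)"
      using ball_weight_bounds(1) by (simp add: abs_mult)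
    note ia = Bochner_Integration.integrable_add[OF i\<rho> integrable_mult_right[OF integrable_ball_weight(1), of "K * R\<^sup>2"]]
    note i2 = integrable_mult_right[OF ia, of 2]
    have "mean_abs h R \<le> (\<integral>z. 2 * (\<rho> (0 + R *\<^sub>R z) + K * R\<^sup>2 * ball_weight z) - ball_weight z * h (R *\<^sub>R z) \<partial>lborel)"
      unfolding mean_abs_def by (intro integral_mono i Bochner_Integration.integrable_diff i2 ih b)
    also have "\<dots> = 2 * ((\<integral>z. \<rho> (0 + R *\<^sub>R z) \<partial>lborel) + K * R\<^sup>2 * ball_mass) - ball_mass * h 0"
      using mean_valueD(2)[OF h R0, of 0]
      unfolding Bochner_Integration.integral_diff[OF i2 ih] integral_mult_right_zero ball_mass_def
        Bochner_Integration.integral_add[OF i\<rho> integrable_mult_right[OF integrable_ball_weight(1)]] by simp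
    also have "\<dots> \<le> 2 * ?V * R\<^sup>2 + 2 * ball_mass * K * R\<^sup>2 + ball_mass * \<bar>h 0\<bar> * R\<^sup>2"
    proof -
      have "2 * ?V * 1 \<le> 2 * ?V * R\<^sup>2" using V R2(1) by (intro mult_left_mono) auto
      moreover have "ball_mass * \<bar>h 0\<bar> * 1 \<le> ball_mass * \<bar>h 0\<bar> * R\<^sup>2" using ball_mass_pos R2(1) by (intro mult_left_mono) auto
      moreover have "- (ball_mass * h 0) \<le> ball_mass * \<bar>h 0\<bar>"
        using ball_mass_pos mult_left_mono[of "- h 0" "\<bar>h 0\<bar>" ball_mass] by simp
      ultimately show ?thesis using V' by (simp add: algebra_simps)
    qed
    finally show ?thesis by (simp add: algebra_simps)
  qed
  moreover have "2 * ?V + 2 * ball_mass * K + ball_mass * \<bar>h 0\<bar> \<ge> 0" using V K ball_mass_pos by simp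
  ultimately have "growth 2 h" unfolding growth_def by (intro exI conjI allI impI)
  then obtain L B where L: "linear L" and B: "bilinear B" and Bs: "\<And>x y. B x y = B y x"
    and e: "\<And>x. h x = h 0 + L x + B x x / 2"
    using quadratic_growth_polynomial[OF h] by metis
  show ?thesis
  proof (rule that[OF L])
    have l: "linear (\<lambda>x. B x y)" "linear (\<lambda>x. B y x)" for y using B by (auto simp: bilinear_def)
    \<comment> \<open>The function h contains (c / 6) * |x|^2, which is removed again by correcting
      the bilinear form with - c / 3 times the inner product.\<close>
    have s: "B x y - c / 3 * (x \<bullet> y) = B y x - c / 3 * (y \<bullet> x)" for x y by (simp add: Bs[of x] inner_commute)
    have l': "linear (\<lambda>x. B x y - c / 3 * (x \<bullet> y))" for y
      by (intro linear_compose_sub l) (auto intro!: linearI simp: algebra_simps inner_simps)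
    have "linear (\<lambda>x. B y x - c / 3 * (y \<bullet> x))" for y
      using l'[of y] unfolding s[of y] .
    with l' show "bilinear (\<lambda>x y. B x y - c / 3 * (x \<bullet> y))"
      unfolding bilinear_def by blast
    show "B x y - c / 3 * (x \<bullet> y) = B y x - c / 3 * (y \<bullet> x)" for x y by (rule s)
    show "u x = logpot \<rho> x / pi\<^sup>2 + (h 0 + L x + (B x x - c / 3 * (x \<bullet> x)) / 2)" for x
      using e[of x] unfolding h_def[of x] power2_norm_eq_inner by (simp add: field_simps)
  qed
qed

subsection \<open>The quadratic part\<close>

context log_density
begin

definition mass :: real where "mass = (\<integral>y. \<rho> y \<partial>lborel)"

lemma mass_nonneg: "mass \<ge> 0"
  unfolding mass_def by (intro integral_nonneg_AE) (simp add: nonneg)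

text \<open>From below the potential loses only a logarithm. If P grew linearly along a tube, the
  density would grow exponentially there, and a unit ball around t * e would eventually carry more
  than the total mass.\<close>

lemma no_linear_growth_on_tube:
  assumes \<rho>: "\<And>x. \<rho> x = exp (3 * (logpot \<rho> x / pi\<^sup>2 + P x))"
    and d: "d > 0" and P: "\<And>t z. t \<ge> 0 \<Longrightarrow> norm z \<le> 1 \<Longrightarrow> t * d - C \<le> P (t *\<^sub>R e + z)"
  shows False
proof -
  define K where "K = 3 * mass / pi\<^sup>2"
  have K: "K \<ge> 0" using mass_nonneg by (simp add: K_def)
  define m where "m = measure lborel (cball (0::real^3) 1)"
  have m: "m > 0" unfolding m_def by simp
  have "m * exp (3 * (t * d - C) - K * ln (2 + t * norm e)) \<le> mass" if t: "t \<ge> 0" for t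
  proof -
    have lb: "exp (3 * (t * d - C) - K * ln (2 + t * norm e)) \<le> \<rho> (t *\<^sub>R e + z)" if z: "norm z \<le> 1" for z
    proof -
      have "norm (t *\<^sub>R e + z) \<le> t * norm e + 1" using norm_triangle_ineq[of "t *\<^sub>R e" z] z t by simp
      then have "ln (1 + norm (t *\<^sub>R e + z)) \<le> ln (2 + t * norm e)" by (intro ln_mono) (auto intro: add_pos_nonneg)
      then have "K * ln (1 + norm (t *\<^sub>R e + z)) \<le> K * ln (2 + t * norm e)" using K by (rule mult_left_mono)
      moreover have "- (K * ln (1 + norm (t *\<^sub>R e + z))) \<le> 3 * (logpot \<rho> (t *\<^sub>R e + z) / pi\<^sup>2)"
      proof -
        have "- ln (1 + norm (t *\<^sub>R e + z)) * mass / pi\<^sup>2 \<le> logpot \<rho> (t *\<^sub>R e + z) / pi\<^sup>2"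
          using logpot_ge[of "t *\<^sub>R e + z"] unfolding mass_def by (rule divide_right_mono) simp
        moreover have "- (K * ln (1 + norm (t *\<^sub>R e + z))) = 3 * (- ln (1 + norm (t *\<^sub>R e + z)) * mass / pi\<^sup>2)"
          by (simp add: K_def)
        ultimately show ?thesis by linarith
      qed
      ultimately show ?thesis using P[OF t z] unfolding \<rho>[of "t *\<^sub>R e + z"] by simp
    qed
    have "m * exp (3 * (t * d - C) - K * ln (2 + t * norm e)) = (\<integral>z. indicator (cball 0 1) z * exp (3 * (t * d - C) - K * ln (2 + t * norm e)) \<partial>(lborel :: (real^3) measure))"
      by (simp add: m_def)
    also have "\<dots> \<le> (\<integral>z. \<rho> (t *\<^sub>R e + z) \<partial>lborel)"
    proof (rule integral_mono)
      show "integrable lborel (\<lambda>z. \<rho> (t *\<^sub>R e + z))" using int integrable_translate_iff[of \<rho> "t *\<^sub>R e"] by simp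
      show "indicator (cball 0 1) z * exp (3 * (t * d - C) - K * ln (2 + t * norm e)) \<le> \<rho> (t *\<^sub>R e + z)" for z
        using lb[of z] nonneg by (auto simp: indicator_def)
    qed (intro integrable_mult_left integrable_real_indicator emeasure_bounded_finite; simp)
    also have "\<dots> = mass" unfolding mass_def by (rule integral_translate)
    finally show ?thesis .
  qed
  then have "\<forall>\<^sub>F t in at_top. m * exp (3 * (t * d - C) - K * ln (2 + t * norm e)) \<le> mass"
    by (intro eventually_mono[OF eventually_ge_at_top[of 0]]) auto
  moreover have "filterlim (\<lambda>t. m * exp (3 * (t * d - C) - K * ln (2 + t * norm e))) at_top at_top"
  proof (cases "e = 0")
    case True
    show ?thesis unfolding True using m d by simp real_asymp
  next
    case False
    define r where "r = norm e"
    have "r > 0" using False by (simp add: r_def)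
    then show ?thesis unfolding r_def[symmetric] using m d by real_asymp
  qed
  then have "\<forall>\<^sub>F t in at_top. m * exp (3 * (t * d - C) - K * ln (2 + t * norm e)) > mass"
    by (simp add: filterlim_at_top_dense)
  ultimately have "\<forall>\<^sub>F t in (at_top :: real filter). False"
    by eventually_elim simp
  then show False by simp
qed

text \<open>A direction with B e e > 0, or one in the kernel of B on which L is positive, would give
  the forbidden growth. Hence L vanishes on the kernel of B, so by symmetry of B its gradient lies
  in the range of the matrix of B, and the square can be completed.\<close>

lemma quadratic_part_nonpos:
  assumes \<rho>: "\<And>x. \<rho> x = exp (3 * (logpot \<rho> x / pi\<^sup>2 + (p + L x + B x x / 2)))"
    and L: "linear L" and B: "bilinear B" and Bs: "\<And>x y. B x y = B y x"
  obtains q x0 where "\<And>x. p + L x + B x x / 2 = q + B (x - x0) (x - x0) / 2" "\<And>x. B x x \<le> 0"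
proof -
  interpret B: bounded_bilinear B using B by (simp add: bilinear_conv_bounded_bilinear)
  interpret L: bounded_linear L using L by (simp add: linear_conv_bounded_linear)
  obtain CL where CL: "\<And>x. norm (L x) \<le> norm x * CL" using L.bounded by blast
  obtain CB where CB: "\<And>x y. norm (B x y) \<le> norm x * norm y * CB" using B.bounded by blast
  let ?P = "\<lambda>x. p + L x + B x x / 2"
  have C0: "CL \<ge> 0" "CB \<ge> 0"
    using CL[of "axis 1 1"] CB[of "axis 1 1" "axis 1 1"] norm_ge_zero[of "L (axis 1 1)"] norm_ge_zero[of "B (axis 1 1) (axis 1 1)"]
    by (simp_all add: norm_axis_1 del: norm_ge_zero)
  have exp: "?P (t *\<^sub>R e + z) = p + t * L e + L z + t\<^sup>2 * (B e e / 2) + t * B e z + B z z / 2" for t e z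
    by (simp add: L.add L.scaleR B.add_left B.add_right B.scaleR_left B.scaleR_right Bs[of z e] power2_eq_square field_simps)
  have bz: "\<bar>L z\<bar> \<le> CL" "\<bar>B z z\<bar> \<le> CB" "\<bar>B e z\<bar> \<le> norm e * CB" if "norm z \<le> 1" for e z
  proof -
    show "\<bar>L z\<bar> \<le> CL" using CL[of z] mult_right_mono[OF that C0(1)] by simp
    have zz: "norm z * norm z \<le> 1 * 1" using that by (intro mult_mono) auto
    show "\<bar>B z z\<bar> \<le> CB" using CB[of z z] mult_right_mono[OF zz C0(2)] by simp
    have ez: "norm e * norm z \<le> norm e * 1" using that by (intro mult_left_mono) auto
    show "\<bar>B e z\<bar> \<le> norm e * CB" using CB[of e z] mult_right_mono[OF ez C0(2)] by simp
  qed
  have neg: "B e e \<le> 0" for e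
  proof (rule ccontr)
    assume "\<not> B e e \<le> 0"
    define b where "b = B e e / 2"
    have b: "b > 0" using \<open>\<not> B e e \<le> 0\<close> by (simp add: b_def)
    \<comment> \<open>Chosen so that, after the quadratic term has been traded for t * k minus a
      constant, linear growth with rate 1 remains against the terms L e and B e z.\<close>
    define k where "k = 1 + \<bar>L e\<bar> + norm e * CB"
    show False
    proof (rule no_linear_growth_on_tube[OF \<rho>, of 1 "k\<^sup>2 / (4 * b) + \<bar>p\<bar> + CL + CB" e])
      fix t :: real and z :: "real^3" assume t: "t \<ge> 0" and z: "norm z \<le> 1"
      have "0 \<le> (2 * b * t - k)\<^sup>2 / (4 * b)" using b by simp
      also have "\<dots> = t\<^sup>2 * b - t * k + k\<^sup>2 / (4 * b)" using b by (simp add: power2_eq_square field_simps)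
      finally have 1: "t * k - k\<^sup>2 / (4 * b) \<le> t\<^sup>2 * b" by simp
      have "t * (- \<bar>L e\<bar> - norm e * CB) \<le> t * (L e + B e z)"
        using t bz(3)[OF z, of e] by (intro mult_left_mono) auto
      then have "t - t * k \<le> t * L e + t * B e z" by (simp add: k_def algebra_simps)
      then show "t * 1 - (k\<^sup>2 / (4 * b) + \<bar>p\<bar> + CL + CB) \<le> ?P (t *\<^sub>R e + z)"
        using 1 bz(1,2)[OF z] C0 unfolding exp b_def[symmetric] by linarith
    qed simp
  qed
  have ker: "L e \<le> 0" if e: "\<And>y. B e y = 0" for e
  proof (rule ccontr)
    assume "\<not> L e \<le> 0"
    show False
    proof (rule no_linear_growth_on_tube[OF \<rho>, of "L e" "\<bar>p\<bar> + CL + CB" e])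
      fix t :: real and z :: "real^3" assume z: "norm z \<le> 1"
      show "t * L e - (\<bar>p\<bar> + CL + CB) \<le> ?P (t *\<^sub>R e + z)"
        using bz(1,2)[OF z] C0 unfolding exp e by simp
    qed (use \<open>\<not> L e \<le> 0\<close> in simp)
  qed
  define a where "a = adjoint L 1"
  have a: "L y = y \<bullet> a" for y unfolding a_def using adjoint_works[OF L, of y 1] by simp
  define A where "A x = adjoint (B x) 1" for x
  have A: "B x y = y \<bullet> A x" for x y
    unfolding A_def using adjoint_works[of "B x" y 1] B by (simp add: bilinear_def)
  have linA: "linear A"
  proof (rule linearI)
    show "A (x + y) = A x + A y" for x y
      by (rule vector_eq_ldot[THEN iffD1]) (simp add: inner_add_right B.add_left flip: A)
    show "A (r *\<^sub>R x) = r *\<^sub>R A x" for r x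
      by (rule vector_eq_ldot[THEN iffD1]) (simp add: B.scaleR_left flip: A)
  qed
  \<comment> \<open>Splits the gradient of L into its part y in the range of \<open>A\<close> and
    the orthogonal remainder n; by symmetry n lies in the kernel of B.\<close>
  obtain y n where y: "y \<in> span (range A)" and n: "\<And>w. w \<in> span (range A) \<Longrightarrow> orthogonal n w" and an: "a = y + n"
    using orthogonal_subspace_decomp_exists[of "range A" a] by metis
  have sA: "span (range A) = range A" by (simp add: span_eq_iff linear_subspace_image[OF linA])
  obtain x1 where x1: "y = A x1" using y unfolding sA by auto
  have Bn: "B n x = 0" for x
    using n[of "A x"] unfolding Bs[of n] A[of x n] orthogonal_def by (simp add: span_base)
  have "L n = 0" using ker[of n] ker[of "- n"] Bn by (simp add: L.neg B.minus_left)
  \<comment> \<open>The range part y does not contribute, because it is paired with n through B.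
    Since L vanishes on the kernel, n is 0.\<close>
  moreover have "L n = n \<bullet> n" unfolding a an x1 inner_add_right A[symmetric] using Bn[of x1] Bs[of x1 n] by simp
  ultimately have "n = 0" by simp
  then have Lx: "L x = B x1 x" for x using a A an x1 by simp
  show ?thesis
  proof (rule that[OF _ neg])
    show "p + L x + B x x / 2 = (p - B x1 x1 / 2) + B (x - - x1) (x - - x1) / 2" for x
      by (simp add: Lx B.add_left B.add_right Bs[of x x1] field_simps)
  qed
qed

end

subsection \<open>The Pohozaev identity\<close>

lemma continuous_on_derivative_apply:
  fixes f' :: "'a::euclidean_space \<Rightarrow> 'a \<Rightarrow> real"
  assumes "\<And>x. linear (f' x)" "\<And>b. continuous_on UNIV (\<lambda>x. f' x b)" "continuous_on UNIV h"
  shows "continuous_on UNIV (\<lambda>x. f' x (h x))"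
proof -
  have "f' x (h x) = (\<Sum>b\<in>Basis. (h x \<bullet> b) * f' x b)" for x
    using Linear_Algebra.linear_componentwise[OF assms(1), of x "h x" 1] by simp
  then show ?thesis using assms(2,3) by (simp add: continuous_intros)
qed

locale compactly_supported_C1 =
  fixes \<Psi> :: "real^3 \<Rightarrow> real" and \<Psi>' :: "real^3 \<Rightarrow> real^3 \<Rightarrow> real" and R :: real and x0 :: "real^3"
  assumes D: "\<And>x. (\<Psi> has_derivative \<Psi>' x) (at x)" and D_cont: "\<And>b. continuous_on UNIV (\<lambda>x. \<Psi>' x b)"
    and outside: "\<And>x. norm x > R \<Longrightarrow> \<Psi> x = 0"
begin

text \<open>The divergence of the radial field \<open>\<Psi> x *\<^sub>R (x - x0)\<close>, the 3
  being the dimension. Testing against it generates the dilation identity.\<close>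

definition divergence :: "real^3 \<Rightarrow> real" where
  "divergence x = 3 * \<Psi> x + \<Psi>' x (x - x0)"

lemma continuous: "continuous_on UNIV \<Psi>"
  by (rule has_derivative_continuous_on[OF has_derivative_at_withinI[OF D]])

lemma continuous_divergence: "continuous_on UNIV divergence"
  unfolding divergence_def[abs_def]
  by (intro continuous_on_add continuous_on_mult continuous_on_const continuous
      continuous_on_derivative_apply[OF has_derivative_linear[OF D] D_cont] continuous_intros)

lemma divergence_outside: "norm x > R \<Longrightarrow> divergence x = 0"
proof -
  assume x: "norm x > R"
  have "(\<Psi> has_derivative (\<lambda>_. 0)) (at x)"
  proof (rule has_derivative_transform_within_open[of "\<lambda>_. 0" _ _ _ "- cball 0 R"])
    show "x \<in> - cball 0 R" using x by simp
  qed (use outside in auto)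
  with D[of x] have "\<Psi>' x = (\<lambda>_. 0)" by (rule has_derivative_unique)
  then show ?thesis using outside[OF x] by (simp add: divergence_def)
qed

lemma integrable_times:
  assumes "continuous_on UNIV g"
  shows "integrable lborel (\<lambda>x. \<Psi> x * g x)" "integrable lborel (\<lambda>x. g x * divergence x)"
    "integrable lborel (\<lambda>x. \<bar>\<Psi> x\<bar> * g x)" "integrable lborel (\<lambda>x. \<bar>divergence x\<bar> * g x)"
  by (rule integrable_continuous_compact_support[where R=R],
      intro continuous_intros continuous continuous_divergence assms,
      simp add: outside divergence_outside)+

lemma by_parts:
  assumes f: "\<And>x. (f has_derivative f' x) (at x)" and cf: "\<And>b. continuous_on UNIV (\<lambda>x. f' x b)"
  shows "(\<integral>x. f x * divergence x \<partial>lborel) = - (\<integral>x. \<Psi> x * f' x (x - x0) \<partial>lborel)"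
proof -
  have c: "continuous_on UNIV f"
    by (rule has_derivative_continuous_on[OF has_derivative_at_withinI[OF f]])
  let ?F = "\<lambda>x. (f x * \<Psi> x) *\<^sub>R (x - x0)"
  let ?F' = "\<lambda>x h. (f x * \<Psi> x) *\<^sub>R h + (f x * \<Psi>' x h + f' x h * \<Psi> x) *\<^sub>R (x - x0)"
  have F: "(?F has_derivative ?F' x) (at x)" for x
    by (rule derivative_eq_intros f D | simp)+
  have "(\<integral>x. (\<Sum>b\<in>Basis. ?F' x b \<bullet> b) \<partial>lborel) = 0"
  proof (rule integral_divergence_eq_0[where F'="?F'"])
    show "continuous_on UNIV (\<lambda>x. ?F' x b \<bullet> b)" for b
      by (intro continuous_intros c continuous D_cont cf)
    show "?F x = 0" if "norm x > R" for x using outside[OF that] by simp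
  qed (rule F)
  moreover have "(\<Sum>b\<in>Basis. ?F' x b \<bullet> b) = f x * divergence x + \<Psi> x * f' x (x - x0)" for x
  proof -
    have l: "g (x - x0) = (\<Sum>b\<in>Basis. g b * ((x - x0) \<bullet> b))" if "linear g" for g :: "real^3 \<Rightarrow> real"
      using Linear_Algebra.linear_componentwise[OF that, of "x - x0" 1] by (simp add: mult.commute)
    have "(\<Sum>b\<in>Basis. ?F' x b \<bullet> b) = (\<Sum>b\<in>(Basis::(real^3) set). f x * \<Psi> x * (b \<bullet> b)) + (\<Sum>b\<in>Basis. f x * (\<Psi>' x b * ((x - x0) \<bullet> b))) + (\<Sum>b\<in>Basis. \<Psi> x * (f' x b * ((x - x0) \<bullet> b)))"
      unfolding sum.distrib[symmetric] by (intro sum.cong refl) (simp add: inner_add_left algebra_simps)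
    also have "\<dots> = f x * \<Psi> x * 3 + f x * \<Psi>' x (x - x0) + \<Psi> x * f' x (x - x0)"
      unfolding sum_distrib_left[symmetric] l[OF has_derivative_linear[OF f]] l[OF has_derivative_linear[OF D]] by simp
    finally show ?thesis by (simp add: divergence_def algebra_simps)
  qed
  moreover have "(\<integral>x. f x * divergence x + \<Psi> x * f' x (x - x0) \<partial>lborel) = (\<integral>x. f x * divergence x \<partial>lborel) + (\<integral>x. \<Psi> x * f' x (x - x0) \<partial>lborel)"
    by (intro Bochner_Integration.integral_add integrable_times c
        continuous_on_derivative_apply[OF has_derivative_linear[OF f] cf] continuous_intros)
  ultimately show ?thesis by simp
qed

lemma integral_divergence: "(\<integral>x. divergence x \<partial>lborel) = 0"
  using by_parts[of "\<lambda>_. 1" "\<lambda>_ _. 0"] by simp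

end

text \<open>Integration by parts for ln (e + |x - y|^2) / 2, followed by e tending to 0. The limit
  is dominated through the local integrability of the inverse square kernel.\<close>

lemma (in compactly_supported_C1) log_by_parts:
  fixes y :: "real^3"
  shows "integrable lborel (\<lambda>x. ln (norm (x - y)) * divergence x)"
    and "(\<integral>x. ln (norm (x - y)) * divergence x \<partial>lborel) = - (\<integral>x. \<Psi> x * ((x - y) \<bullet> (x - x0) / (norm (x - y))\<^sup>2) \<partial>lborel)"
proof -
  have iy: "integrable lborel (\<lambda>x. g x / (norm (x - y))\<^sup>2)" if g: "continuous_on UNIV g" "\<And>x. norm x > R \<Longrightarrow> g x = 0" for g :: "real^3 \<Rightarrow> real"
    using integrable_div_dist_sq[OF integrable_continuous_compact_support[OF g] g(1), where x=y] by (simp add: norm_minus_commute)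
  define e :: "nat \<Rightarrow> real" where "e n = 1 / real (Suc n)" for n
  have e: "e n > 0" "e n \<le> 1" for n by (auto simp: e_def)
  have e0: "e \<longlonglongrightarrow> 0" unfolding e_def by real_asymp
  have [measurable]: "\<Psi> \<in> borel_measurable borel" "divergence \<in> borel_measurable borel"
    by (intro borel_measurable_continuous_onI continuous continuous_divergence)+
  have q: "e n + (x - y) \<bullet> (x - y) > 0" for n x using e(1)[of n] by (simp add: add_pos_nonneg)
  have eq: "(\<integral>x. ln (e n + (norm (x - y))\<^sup>2) / 2 * divergence x \<partial>lborel) = - (\<integral>x. \<Psi> x * ((x - y) \<bullet> (x - x0) / (e n + (norm (x - y))\<^sup>2)) \<partial>lborel)" for n
  proof -
    let ?f = "\<lambda>x. ln (e n + (x - y) \<bullet> (x - y)) / 2" and ?f' = "\<lambda>x h. (x - y) \<bullet> h / (e n + (x - y) \<bullet> (x - y))"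
    have "(?f has_derivative ?f' x) (at x)" for x
      using q[of n x] by (auto intro!: derivative_eq_intros simp: inner_commute fun_eq_iff divide_simps)
    moreover have "continuous_on UNIV (\<lambda>x. ?f' x b)" for b
      using q[of n] by (intro continuous_intros) (auto simp: less_imp_neq[symmetric])
    ultimately show ?thesis using by_parts[of ?f ?f'] by (simp add: power2_norm_eq_inner)
  qed
  have ae: "AE x in lborel. x \<noteq> y" by (rule AE_lborel_singleton)
  have i1: "integrable lborel (\<lambda>x. \<bar>divergence x\<bar> * (norm (x - y))\<^sup>2 + \<bar>divergence x\<bar> / (norm (x - y))\<^sup>2)"
    by (intro Bochner_Integration.integrable_add integrable_times iy continuous_intros continuous_divergence) (simp add: divergence_outside)
  have i2: "integrable lborel (\<lambda>x. \<bar>\<Psi> x\<bar> * norm (x - x0) + \<bar>\<Psi> x\<bar> * norm (x - x0) / (norm (x - y))\<^sup>2)"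
    by (intro Bochner_Integration.integrable_add integrable_times iy continuous_intros continuous) (simp add: outside)
  have t1: "AE x in lborel. (\<lambda>n. ln (e n + (norm (x - y))\<^sup>2) / 2 * divergence x) \<longlonglongrightarrow> ln (norm (x - y)) * divergence x"
    using ae by eventually_elim (unfold e_def, intro tendsto_mult tendsto_const log_regularised_tendsto, simp)
  have b1: "AE x in lborel. norm (ln (e n + (norm (x - y))\<^sup>2) / 2 * divergence x) \<le> \<bar>divergence x\<bar> * (norm (x - y))\<^sup>2 + \<bar>divergence x\<bar> / (norm (x - y))\<^sup>2" for n
    using ae
  proof eventually_elim
    case (elim x)
    then have "\<bar>ln (e n + (norm (x - y))\<^sup>2) / 2\<bar> \<le> (norm (x - y))\<^sup>2 + 1 / (norm (x - y))\<^sup>2"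
      by (intro log_regularised_bounds e) simp
    from mult_left_mono[OF this abs_ge_zero[of "divergence x"]] show ?case
      by (simp add: abs_mult distrib_left mult.commute)
  qed
  have t2: "AE x in lborel. (\<lambda>n. \<Psi> x * ((x - y) \<bullet> (x - x0) / (e n + (norm (x - y))\<^sup>2))) \<longlonglongrightarrow> \<Psi> x * ((x - y) \<bullet> (x - x0) / (norm (x - y))\<^sup>2)"
    using ae
  proof eventually_elim
    case (elim x)
    have "(\<lambda>n. \<Psi> x * ((x - y) \<bullet> (x - x0) / (e n + (norm (x - y))\<^sup>2))) \<longlonglongrightarrow> \<Psi> x * ((x - y) \<bullet> (x - x0) / (0 + (norm (x - y))\<^sup>2))"
      using elim by (intro tendsto_intros e0) simp
    then show ?case by simp
  qed
  have b2: "AE x in lborel. norm (\<Psi> x * ((x - y) \<bullet> (x - x0) / (e n + (norm (x - y))\<^sup>2))) \<le> \<bar>\<Psi> x\<bar> * norm (x - x0) + \<bar>\<Psi> x\<bar> * norm (x - x0) / (norm (x - y))\<^sup>2" for n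
    using ae
  proof eventually_elim
    case (elim x)
    define s where "s = norm (x - y)"
    have s: "s > 0" using elim by (simp add: s_def)
    have "\<bar>(x - y) \<bullet> (x - x0) / (e n + s\<^sup>2)\<bar> \<le> s * norm (x - x0) / s\<^sup>2"
      using e(1)[of n] s Cauchy_Schwarz_ineq2[of "x - y" "x - x0"] unfolding abs_divide
      by (intro frac_le) (auto simp: s_def[symmetric])
    also have "\<dots> = norm (x - x0) * (1 / s)" using s by (simp add: power2_eq_square)
    also have "\<dots> \<le> norm (x - x0) * (1 + 1 / s\<^sup>2)"
      by (intro mult_left_mono inverse_le_one_plus_inverse_square s) simp
    finally have "\<bar>\<Psi> x\<bar> * \<bar>(x - y) \<bullet> (x - x0) / (e n + s\<^sup>2)\<bar> \<le> \<bar>\<Psi> x\<bar> * (norm (x - x0) * (1 + 1 / s\<^sup>2))"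
      by (rule mult_left_mono) simp
    then show ?case unfolding s_def[symmetric] by (simp only: real_norm_def abs_mult) (simp add: distrib_left)
  qed
  show "integrable lborel (\<lambda>x. ln (norm (x - y)) * divergence x)"
    by (rule integrable_dominated_convergence[OF _ _ i1 t1 b1]) measurable
  have l1: "(\<lambda>n. (\<integral>x. ln (e n + (norm (x - y))\<^sup>2) / 2 * divergence x \<partial>lborel)) \<longlonglongrightarrow> (\<integral>x. ln (norm (x - y)) * divergence x \<partial>lborel)"
    by (rule integral_dominated_convergence[OF _ _ i1 t1 b1]) measurable
  have l2: "(\<lambda>n. (\<integral>x. \<Psi> x * ((x - y) \<bullet> (x - x0) / (e n + (norm (x - y))\<^sup>2)) \<partial>lborel)) \<longlonglongrightarrow> (\<integral>x. \<Psi> x * ((x - y) \<bullet> (x - x0) / (norm (x - y))\<^sup>2) \<partial>lborel)"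
    by (rule integral_dominated_convergence[OF _ _ i2 t2 b2]) measurable
  show "(\<integral>x. ln (norm (x - y)) * divergence x \<partial>lborel) = - (\<integral>x. \<Psi> x * ((x - y) \<bullet> (x - x0) / (norm (x - y))\<^sup>2) \<partial>lborel)"
    by (rule LIMSEQ_unique[OF l1]) (unfold eq, intro tendsto_minus l2)
qed

context log_density
begin

text \<open>The x-integration by parts is done for fixed y inside the potential, so no derivative of
  \<open>logpot\<close> occurs. The outcome is an absolutely convergent double integral, which can
  be symmetrised in its two variables.\<close>

lemma
  fixes R :: real
  assumes C: "compactly_supported_C1 \<Psi> \<Psi>' R" and cr: "continuous_on UNIV riesz"
  shows integrable_virial: "integrable (lborel \<Otimes>\<^sub>M lborel) (\<lambda>(x, y). \<Psi> x * \<rho> y * ((x - y) \<bullet> (x - x0) / (norm (x - y))\<^sup>2))" (is "integrable _ (\<lambda>(x, y). ?H x y)")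
    and integral_logpot_divergence: "(\<integral>x. logpot \<rho> x * compactly_supported_C1.divergence \<Psi> \<Psi>' x0 x \<partial>lborel) =
      integral\<^sup>L (lborel \<Otimes>\<^sub>M lborel) (\<lambda>(x, y). \<Psi> x * \<rho> y * ((x - y) \<bullet> (x - x0) / (norm (x - y))\<^sup>2))"
proof -
  interpret compactly_supported_C1 \<Psi> \<Psi>' R x0 by (rule C)
  have [measurable]: "\<Psi> \<in> borel_measurable borel" "divergence \<in> borel_measurable borel"
    by (intro borel_measurable_continuous_onI continuous continuous_divergence)+
  have mH: "(\<lambda>(x, y). ?H x y) \<in> borel_measurable (lborel \<Otimes>\<^sub>M lborel)" by measurable
  have bH: "norm (?H x y) \<le> \<bar>\<Psi> x\<bar> * norm (x - x0) * (\<rho> y + \<rho> y / (norm (x - y))\<^sup>2)" for x y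
  proof (cases "x = y")
    case True
    then show ?thesis using nonneg by simp
  next
    case False
    define s where "s = norm (x - y)"
    have s: "s > 0" using False by (simp add: s_def)
    have "\<bar>(x - y) \<bullet> (x - x0) / s\<^sup>2\<bar> \<le> s * norm (x - x0) / s\<^sup>2"
      using Cauchy_Schwarz_ineq2[of "x - y" "x - x0"] unfolding abs_divide
      by (intro frac_le) (use s in \<open>auto simp: s_def[symmetric]\<close>)
    also have "\<dots> = norm (x - x0) * (1 / s)" using s by (simp add: power2_eq_square)
    also have "\<dots> \<le> norm (x - x0) * (1 + 1 / s\<^sup>2)"
      by (intro mult_left_mono inverse_le_one_plus_inverse_square s) simp
    finally have "(\<bar>\<Psi> x\<bar> * \<rho> y) * \<bar>(x - y) \<bullet> (x - x0) / s\<^sup>2\<bar> \<le> (\<bar>\<Psi> x\<bar> * \<rho> y) * (norm (x - x0) * (1 + 1 / s\<^sup>2))"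
      by (rule mult_left_mono) (simp add: nonneg)
    moreover have "norm (?H x y) = (\<bar>\<Psi> x\<bar> * \<rho> y) * \<bar>(x - y) \<bullet> (x - x0) / s\<^sup>2\<bar>"
      using nonneg[of y] by (simp add: abs_mult s_def)
    moreover have "(\<bar>\<Psi> x\<bar> * \<rho> y) * (norm (x - x0) * (1 + 1 / s\<^sup>2)) = \<bar>\<Psi> x\<bar> * norm (x - x0) * (\<rho> y + \<rho> y / s\<^sup>2)"
      by (simp add: algebra_simps)
    ultimately show ?thesis by (simp only: s_def)
  qed
  have ib: "integrable lborel (\<lambda>y. \<bar>\<Psi> x\<bar> * norm (x - x0) * (\<rho> y + \<rho> y / (norm (x - y))\<^sup>2))" for x
    by (intro integrable_mult_right Bochner_Integration.integrable_add int integrable_riesz)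
  have bb: "(\<integral>y. \<bar>\<Psi> x\<bar> * norm (x - x0) * (\<rho> y + \<rho> y / (norm (x - y))\<^sup>2) \<partial>lborel) = \<bar>\<Psi> x\<bar> * (norm (x - x0) * (mass + riesz x))" for x
    unfolding integral_mult_right_zero Bochner_Integration.integral_add[OF int integrable_riesz] mass_def riesz_def by simp
  have iH1: "integrable lborel (?H x)" for x
  proof (rule Bochner_Integration.integrable_bound[OF ib[of x]])
    show "AE y in lborel. norm (?H x y) \<le> norm (\<bar>\<Psi> x\<bar> * norm (x - x0) * (\<rho> y + \<rho> y / (norm (x - y))\<^sup>2))"
      by (intro AE_I2 order_trans[OF bH]) (simp only: real_norm_def abs_ge_self)
  qed measurable
  have iH2: "integrable lborel (\<lambda>x. \<integral>y. norm (?H x y) \<partial>lborel)"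
  proof (rule Bochner_Integration.integrable_bound)
    show "integrable lborel (\<lambda>x. \<bar>\<Psi> x\<bar> * (norm (x - x0) * (mass + riesz x)))"
      by (intro integrable_times continuous_intros cr)
    show "AE x in lborel. norm (\<integral>y. norm (?H x y) \<partial>lborel) \<le> norm (\<bar>\<Psi> x\<bar> * (norm (x - x0) * (mass + riesz x)))"
    proof (intro AE_I2)
      fix x
      have "norm (\<integral>y. norm (?H x y) \<partial>lborel) = (\<integral>y. norm (?H x y) \<partial>lborel)"
        by (simp add: integral_nonneg_AE)
      also have "\<dots> \<le> \<bar>\<Psi> x\<bar> * (norm (x - x0) * (mass + riesz x))"
        unfolding bb[symmetric] by (intro integral_mono integrable_norm iH1 ib bH)
      finally show "norm (\<integral>y. norm (?H x y) \<partial>lborel) \<le> norm (\<bar>\<Psi> x\<bar> * (norm (x - x0) * (mass + riesz x)))"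
        by (rule order_trans) (simp only: real_norm_def abs_ge_self)
    qed
  qed measurable
  show iH: "integrable (lborel \<Otimes>\<^sub>M lborel) (\<lambda>(x, y). ?H x y)"
    by (rule integrable_pair_lborel[OF mH _ iH2]) (intro AE_I2 iH1)
  let ?k = "\<lambda>x y. ln ((1 + norm y) / norm (x - y))"
  let ?f = "\<lambda>x y. divergence x * (?k x y * \<rho> y)"
  have fx: "(\<integral>y. ?f x y \<partial>lborel) = logpot \<rho> x * divergence x" for x
    unfolding integral_mult_right_zero logpot_def by simp
  have "(\<integral>x. \<integral>y. ?f x y \<partial>lborel \<partial>lborel) = (\<integral>y. \<integral>x. ?f x y \<partial>lborel \<partial>lborel)"
  proof (rule integral_swap_lborel)
    show "AE x in lborel. integrable lborel (?f x)" by (intro AE_I2 integrable_mult_right integrable_logpot)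
    show "integrable lborel (\<lambda>x. \<integral>y. norm (?f x y) \<partial>lborel)"
    proof (rule Bochner_Integration.integrable_bound)
      have "1 + (1 + norm x) \<noteq> 0" for x :: "real^3" by (simp add: add_pos_nonneg less_imp_neq[symmetric])
      then show "integrable lborel (\<lambda>x. \<bar>divergence x\<bar> * (ln (2 + norm x) * mass + riesz x))"
        by (intro integrable_times continuous_intros cr) simp
      show "AE x in lborel. norm (\<integral>y. norm (?f x y) \<partial>lborel) \<le> norm (\<bar>divergence x\<bar> * (ln (2 + norm x) * mass + riesz x))"
      proof (intro AE_I2)
        fix x
        have "norm (\<integral>y. norm (?f x y) \<partial>lborel) = \<bar>divergence x\<bar> * (\<integral>y. \<bar>?k x y * \<rho> y\<bar> \<partial>lborel)"
          by (simp add: abs_mult integral_nonneg_AE)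
        also have "\<dots> \<le> \<bar>divergence x\<bar> * (ln (2 + norm x) * mass + riesz x)"
          unfolding mass_def by (intro mult_left_mono abs_logpot_le) simp
        finally show "norm (\<integral>y. norm (?f x y) \<partial>lborel) \<le> norm (\<bar>divergence x\<bar> * (ln (2 + norm x) * mass + riesz x))"
          by (rule order_trans) (simp only: real_norm_def abs_ge_self)
      qed
    qed measurable
  qed measurable
  moreover have "(\<integral>x. ?f x y \<partial>lborel) = (\<integral>x. ?H x y \<partial>lborel)" for y
  proof -
    have iD: "integrable lborel (\<lambda>x. ln (1 + norm y) * divergence x)"
      using integrable_times(2)[of "\<lambda>_. ln (1 + norm y)"] by simp
    have "(\<integral>x. ?f x y \<partial>lborel) = (\<integral>x. \<rho> y * (ln (1 + norm y) * divergence x - ln (norm (x - y)) * divergence x) \<partial>lborel)"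
    proof (rule integral_cong_AE)
      show "AE x in lborel. ?f x y = \<rho> y * (ln (1 + norm y) * divergence x - ln (norm (x - y)) * divergence x)"
        using AE_lborel_singleton[of y]
      proof eventually_elim
        case (elim x)
        have "?k x y = ln (1 + norm y) - ln (norm (x - y))"
          using elim by (intro ln_divide_pos) (auto intro: add_pos_nonneg)
        then show ?case by (simp only:) (simp add: algebra_simps)
      qed
    qed measurable
    also have "\<dots> = \<rho> y * (\<integral>x. \<Psi> x * ((x - y) \<bullet> (x - x0) / (norm (x - y))\<^sup>2) \<partial>lborel)"
      unfolding integral_mult_right_zero Bochner_Integration.integral_diff[OF iD log_by_parts(1)] log_by_parts(2) integral_divergence by simp
    also have "\<dots> = (\<integral>x. ?H x y \<partial>lborel)"
      unfolding integral_mult_right_zero[symmetric] by (intro Bochner_Integration.integral_cong refl) simp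
    finally show ?thesis .
  qed
  ultimately show "(\<integral>x. logpot \<rho> x * divergence x \<partial>lborel) = integral\<^sup>L (lborel \<Otimes>\<^sub>M lborel) (\<lambda>(x, y). ?H x y)"
    unfolding fx using lborel_pair.integral_snd[OF iH] by simp
qed

end

text \<open>The square makes the cutoff continuously differentiable; up to the factor 4 it is
  \<open>ball_weight_sq\<close> in rescaled variables.\<close>

definition cutoff :: "real^3 \<Rightarrow> real \<Rightarrow> real^3 \<Rightarrow> real" where
  "cutoff x0 R x = (ball_weight ((x - x0) /\<^sub>R R))\<^sup>2"

lemma cutoff_bounds: "0 \<le> cutoff x0 R x" "cutoff x0 R x \<le> 1"
  using ball_weight_bounds(1,2)[of "(x - x0) /\<^sub>R R"] by (auto simp: cutoff_def power_le_one)

lemma borel_measurable_cutoff [measurable]: "cutoff x0 R \<in> borel_measurable borel"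
  unfolding cutoff_def[abs_def] by measurable

lemma cutoff_has_derivative:
  "(cutoff x0 R has_derivative (\<lambda>h. - 4 * ball_weight ((x - x0) /\<^sub>R R) * (((x - x0) /\<^sub>R R) \<bullet> (h /\<^sub>R R)))) (at x)"
proof -
  have 1: "((\<lambda>x. (x - x0) /\<^sub>R R) has_derivative (\<lambda>h. h /\<^sub>R R)) (at x)" by (auto intro!: derivative_eq_intros)
  have "cutoff x0 R = (\<lambda>x. 4 * ball_weight_sq ((x - x0) /\<^sub>R R))"
    by (simp add: fun_eq_iff cutoff_def ball_weight_sq_def)
  then show ?thesis
    using has_derivative_mult_right[OF has_derivative_compose[OF 1 ball_weight_sq_has_derivative], of 4] by (simp add: mult.assoc)
qed

text \<open>A bound independent of R for the error of symmetrisation. For |v| \<le> 2 in rescaled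
  variables it is the Lipschitz bound; for |v| > 2 the cutoff vanishes at y, and it can be nonzero
  at x only if |v| \<le> 2 * |w - v|.\<close>

lemma cutoff_quotient_le:
  assumes R: "R > 0"
  shows "\<bar>cutoff x0 R x - cutoff x0 R y\<bar> * norm (y - x0) \<le> 8 * norm (x - y)"
proof -
  define w v where "w = (x - x0) /\<^sub>R R" and "v = (y - x0) /\<^sub>R R"
  have wv: "w - v = (x - y) /\<^sub>R R" by (simp add: w_def v_def algebra_simps)
  have "\<bar>(ball_weight w)\<^sup>2 - (ball_weight v)\<^sup>2\<bar> * norm v \<le> 8 * norm (w - v)"
  proof (cases "norm v \<le> 2")
    case True
    have "\<bar>(ball_weight w)\<^sup>2 - (ball_weight v)\<^sup>2\<bar> = \<bar>ball_weight w - ball_weight v\<bar> * \<bar>ball_weight w + ball_weight v\<bar>"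
      unfolding abs_mult[symmetric] by (simp add: power2_eq_square algebra_simps)
    also have "\<dots> \<le> (2 * norm (w - v)) * 2"
      using ball_weight_bounds(1,2)[of v] ball_weight_bounds(1,2)[of w] by (intro mult_mono ball_weight_Lipschitz) auto
    finally have "\<bar>(ball_weight w)\<^sup>2 - (ball_weight v)\<^sup>2\<bar> * norm v \<le> ((2 * norm (w - v)) * 2) * 2"
      using True by (intro mult_mono) auto
    then show ?thesis by simp
  next
    case v: False
    show ?thesis
    proof (cases "norm w \<le> 1")
      case True
      have "norm v \<le> norm w + norm (w - v)" by (metis norm_minus_commute norm_triangle_sub)
      then have "norm v \<le> 2 * norm (w - v)" using v True by linarith
      moreover have "\<bar>(ball_weight w)\<^sup>2 - (ball_weight v)\<^sup>2\<bar> \<le> 1"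
        using v ball_weight_bounds(1,2)[of w] by (simp add: ball_weight_eq_0 power_le_one)
      then have "\<bar>(ball_weight w)\<^sup>2 - (ball_weight v)\<^sup>2\<bar> * norm v \<le> 1 * norm v" by (rule mult_right_mono) simp
      ultimately show ?thesis using norm_ge_zero[of "w - v"] by linarith
    next
      case False
      then show ?thesis using v by (simp add: ball_weight_eq_0)
    qed
  qed
  then have "R * (\<bar>(ball_weight w)\<^sup>2 - (ball_weight v)\<^sup>2\<bar> * norm v) \<le> R * (8 * norm (w - v))"
    using R by (intro mult_left_mono) auto
  then show ?thesis using R unfolding wv unfolding w_def v_def cutoff_def by simp
qed

lemma cutoff_tendsto: "(\<lambda>n. cutoff x0 (real (Suc n)) x) \<longlonglongrightarrow> 1"
    and cutoff_scaled_tendsto: "(\<lambda>n. (x - x0) /\<^sub>R real (Suc n)) \<longlonglongrightarrow> 0"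
proof -
  have "(\<lambda>n. inverse (real (Suc n))) \<longlonglongrightarrow> 0" by (rule LIMSEQ_inverse_real_of_nat)
  from tendsto_scaleR[OF this tendsto_const[of "x - x0"]]
  show t: "(\<lambda>n. (x - x0) /\<^sub>R real (Suc n)) \<longlonglongrightarrow> 0" by simp
  have "isCont ball_weight 0" using continuous_on_ball_weight(1)[of UNIV] by (simp add: continuous_on_eq_continuous_at)
  from isCont_tendsto_compose[OF this t] have "(\<lambda>n. ball_weight ((x - x0) /\<^sub>R real (Suc n))) \<longlonglongrightarrow> ball_weight 0" .
  then have "(\<lambda>n. (ball_weight ((x - x0) /\<^sub>R real (Suc n)))\<^sup>2) \<longlonglongrightarrow> (ball_weight 0)\<^sup>2" by (rule tendsto_power)
  then show "(\<lambda>n. cutoff x0 (real (Suc n)) x) \<longlonglongrightarrow> 1" unfolding cutoff_def by (simp add: ball_weight_def)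
qed

context log_density
begin

lemma mass_pos: "mass > 0"
proof -
  have "mass \<noteq> 0" using integral_eq_0_continuous[OF cont nonneg int, of 0] pos[of 0] by (auto simp: mass_def)
  then show ?thesis using mass_nonneg by simp
qed

lemma integrable_density_pair: "integrable (lborel \<Otimes>\<^sub>M lborel) (\<lambda>(x, y). \<rho> x * \<rho> y)"
proof (rule integrable_pair_lborel)
  show "integrable lborel (\<lambda>x. \<integral>y. norm (\<rho> x * \<rho> y) \<partial>lborel)"
    using int nonneg by (simp add: abs_mult)
  show "AE x in lborel. integrable lborel (\<lambda>y. \<rho> x * \<rho> y)" using int by simp
qed measurable

text \<open>Without the cutoff, the kernel and its reflection under exchange of \<open>x\<close> and \<open>y\<close> add up to \<open>1\<close>.\<close>

lemma virial_tendsto: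
  assumes i: "\<And>n. integrable (lborel \<Otimes>\<^sub>M lborel) (\<lambda>(x, y). cutoff x0 (real (Suc n)) x * \<rho> x * \<rho> y * ((x - y) \<bullet> (x - x0) / (norm (x - y))\<^sup>2))" (is "\<And>n. integrable ?M (\<lambda>(x, y). ?G n x y)")
  shows "(\<lambda>n. integral\<^sup>L (lborel \<Otimes>\<^sub>M lborel) (\<lambda>(x, y). cutoff x0 (real (Suc n)) x * \<rho> x * \<rho> y * ((x - y) \<bullet> (x - x0) / (norm (x - y))\<^sup>2))) \<longlonglongrightarrow> mass\<^sup>2 / 2"
proof -
  \<comment> \<open>On the diagonal division by zero makes the integrand, and hence its limit, equal
    to 0. The diagonal does not affect the integral.\<close>
  let ?L = "\<lambda>(x::real^3, y::real^3). if x = y then 0 else \<rho> x * \<rho> y"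
  let ?c = "\<lambda>n. cutoff x0 (real (Suc n))"
  \<comment> \<open>The sum of the kernel and its reflection, divided by the densities: the value
    without cutoff plus an error controlled by the difference of the cutoffs at x and y.\<close>
  let ?s = "\<lambda>n x y. ?c n x + (?c n x - ?c n y) * ((x - y) \<bullet> (y - x0) / (norm (x - y))\<^sup>2)"
  let ?S = "\<lambda>n (x, y). ?G n x y + ?G n y x"
  have sw: "integrable ?M (\<lambda>(x, y). ?G n y x)" for n
    using lborel_pair.integrable_product_swap[OF i[of n]] by simp
  have iS: "integrable ?M (?S n)" for n
    using Bochner_Integration.integrable_add[OF i[of n] sw[of n]] by (simp add: case_prod_unfold)
  have "integral\<^sup>L ?M (\<lambda>(x, y). ?G n y x) = integral\<^sup>L ?M (\<lambda>(x, y). ?G n x y)" for n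
    using lborel_pair.integral_product_swap[of "\<lambda>(x, y). ?G n x y"] by simp
  then have eS: "integral\<^sup>L ?M (?S n) = 2 * integral\<^sup>L ?M (\<lambda>(x, y). ?G n x y)" for n
    using Bochner_Integration.integral_add[OF i[of n] sw[of n]] by (simp add: case_prod_unfold)
  have S: "?S n (x, y) = \<rho> x * \<rho> y * ?s n x y" if "x \<noteq> y" for n x y
  proof -
    have nz: "(norm (x - y))\<^sup>2 \<noteq> 0" using that by simp
    have "(x - y) \<bullet> (x - x0) = (norm (x - y))\<^sup>2 + (x - y) \<bullet> (y - x0)"
      by (simp add: power2_norm_eq_inner inner_diff_left inner_diff_right inner_commute)
    then have 1: "(x - y) \<bullet> (x - x0) / (norm (x - y))\<^sup>2 = 1 + (x - y) \<bullet> (y - x0) / (norm (x - y))\<^sup>2"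
      using nz by (simp add: add_divide_distrib)
    have 2: "(y - x) \<bullet> (y - x0) / (norm (y - x))\<^sup>2 = - ((x - y) \<bullet> (y - x0) / (norm (x - y))\<^sup>2)"
      by (simp add: norm_minus_commute inner_diff_left minus_divide_left)
    have "a * r * s * (1 + q) + b * s * r * (- q) = r * s * (a + (a - b) * q)" for a b r s q :: real
      by (simp add: algebra_simps)
    then show ?thesis unfolding prod.case 1 2 .
  qed
  have quot: "\<bar>(x - y) \<bullet> (y - x0) / (norm (x - y))\<^sup>2\<bar> \<le> norm (y - x0) / norm (x - y)" if "x \<noteq> y" for x y
  proof -
    have "\<bar>(x - y) \<bullet> (y - x0) / (norm (x - y))\<^sup>2\<bar> \<le> norm (x - y) * norm (y - x0) / (norm (x - y))\<^sup>2"
      unfolding abs_divide using Cauchy_Schwarz_ineq2[of "x - y" "y - x0"] by (simp add: divide_right_mono)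
    then show ?thesis using that by (simp add: power2_eq_square)
  qed
  have "(\<lambda>n. integral\<^sup>L ?M (?S n)) \<longlonglongrightarrow> integral\<^sup>L ?M ?L"
  proof (rule integral_dominated_convergence)
    show "integrable ?M (\<lambda>(x, y). 9 * (\<rho> x * \<rho> y))"
      \<comment> \<open>The factor 9 is 1 for the cutoff plus 8 from
        \<open>cutoff_quotient_le\<close>.\<close>
      using integrable_mult_right[OF integrable_density_pair, of 9] by (simp add: case_prod_unfold)
    show "?S n \<in> borel_measurable ?M" for n using iS[of n] by (rule borel_measurable_integrable)
    show "AE z in ?M. (\<lambda>n. ?S n z) \<longlonglongrightarrow> ?L z"
    proof (intro AE_I2)
      fix z :: "(real^3) \<times> (real^3)"
      obtain x y where z: "z = (x, y)" by (cases z)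
      show "(\<lambda>n. ?S n z) \<longlonglongrightarrow> ?L z"
      proof (cases "x = y")
        case True
        then show ?thesis by (simp add: z)
      next
        case False
        have "(\<lambda>n. \<rho> x * \<rho> y * ?s n x y) \<longlonglongrightarrow> \<rho> x * \<rho> y * (1 + (1 - 1) * ((x - y) \<bullet> (y - x0) / (norm (x - y))\<^sup>2))"
          by (intro tendsto_intros cutoff_tendsto)
        then show ?thesis unfolding z S[OF False] using False by simp
      qed
    qed
    show "AE z in ?M. norm (?S n z) \<le> (\<lambda>(x, y). 9 * (\<rho> x * \<rho> y)) z" for n
    proof (intro AE_I2)
      fix z :: "(real^3) \<times> (real^3)"
      obtain x y where z: "z = (x, y)" by (cases z)
      show "norm (?S n z) \<le> (\<lambda>(x, y). 9 * (\<rho> x * \<rho> y)) z"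
      proof (cases "x = y")
        case True
        then show ?thesis by (simp add: z nonneg)
      next
        case False
        have "\<bar>?c n x - ?c n y\<bar> * \<bar>(x - y) \<bullet> (y - x0) / (norm (x - y))\<^sup>2\<bar> \<le> \<bar>?c n x - ?c n y\<bar> * (norm (y - x0) / norm (x - y))"
          by (intro mult_left_mono quot False) simp
        also have "\<dots> = (\<bar>?c n x - ?c n y\<bar> * norm (y - x0)) / norm (x - y)" by simp
        also have "\<dots> \<le> (8 * norm (x - y)) / norm (x - y)" by (intro divide_right_mono cutoff_quotient_le) auto
        also have "\<dots> = 8" using False by simp
        finally have "\<bar>(?c n x - ?c n y) * ((x - y) \<bullet> (y - x0) / (norm (x - y))\<^sup>2)\<bar> \<le> 8" by (simp only: abs_mult)
        then have "\<bar>?s n x y\<bar> \<le> 9" using cutoff_bounds[of x0 "real (Suc n)" x] by linarith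
        then have "(\<rho> x * \<rho> y) * \<bar>?s n x y\<bar> \<le> (\<rho> x * \<rho> y) * 9" by (rule mult_left_mono) (simp add: nonneg)
        moreover have "norm (\<rho> x * \<rho> y * ?s n x y) = (\<rho> x * \<rho> y) * \<bar>?s n x y\<bar>"
          using nonneg[of x] nonneg[of y] by (simp add: abs_mult)
        ultimately show ?thesis unfolding z S[OF False] by simp
      qed
    qed
  qed measurable
  moreover have "integral\<^sup>L ?M ?L = mass\<^sup>2"
  proof -
    have mL: "?L \<in> borel_measurable ?M" by measurable
    have inner: "(\<integral>y. ?L (x, y) \<partial>lborel) = \<rho> x * mass" for x
    proof -
      have "(\<integral>y. ?L (x, y) \<partial>lborel) = (\<integral>y. \<rho> x * \<rho> y \<partial>lborel)"
      proof (rule integral_cong_AE)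
        show "AE y in lborel. ?L (x, y) = \<rho> x * \<rho> y"
          using AE_lborel_singleton[of x] by eventually_elim simp
        show "(\<lambda>y. ?L (x, y)) \<in> borel_measurable lborel" unfolding prod.case by measurable
      qed measurable
      then show ?thesis by (simp add: mass_def)
    qed
    have "integrable ?M ?L"
      by (rule Bochner_Integration.integrable_bound[OF integrable_density_pair mL]) (auto simp: nonneg)
    then have "integral\<^sup>L ?M ?L = (\<integral>x. \<integral>y. ?L (x, y) \<partial>lborel \<partial>lborel)" by (rule lborel_pair.integral_fst'[symmetric])
    also have "\<dots> = (\<integral>x. \<rho> x * mass \<partial>lborel)" unfolding inner ..
    finally show ?thesis by (simp add: mass_def power2_eq_square)
  qed
  ultimately have "(\<lambda>n. 2 * integral\<^sup>L ?M (\<lambda>(x, y). ?G n x y)) \<longlonglongrightarrow> mass\<^sup>2" unfolding eS by simp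
  from tendsto_mult_left[OF this, of "1 / 2"] show ?thesis by simp
qed


text \<open>The field is the cutoff times \<open>\<rho>\<close> times x - x0. Integrability of B (x
  - x0) (x - x0) against \<open>\<rho>\<close> is not presupposed: since B \<le> 0, the cutoff
  integrals decrease to their limit, which is therefore at most the nonpositive value at radius 1.
  Equality there forces B = 0.\<close>

lemma pohozaev:
  assumes u: "smooth u" and \<rho>: "\<And>x. \<rho> x = exp (3 * u x)" and cr: "continuous_on UNIV riesz"
    and rep: "\<And>x. u x = logpot \<rho> x / pi\<^sup>2 + (q + B (x - x0) (x - x0) / 2)"
    and B: "bilinear B" and Bs: "\<And>x y. B x y = B y x" and neg: "\<And>x. B x x \<le> 0"
  shows "mass < 2 * pi\<^sup>2 \<or> (mass = 2 * pi\<^sup>2 \<and> (\<forall>x. B x x = 0))"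
proof -
  interpret B: bounded_bilinear B using B by (simp add: bilinear_conv_bounded_bilinear)
  define u' where "u' x h = (\<Sum>i\<in>UNIV. h $ i *\<^sub>R partial i u x)" for x h :: "real^3"
  have du: "(u has_derivative u' x) (at x)" for x unfolding u'_def[abs_def] by (rule smooth_has_derivative[OF u])
  have cu': "continuous_on UNIV (\<lambda>x. u' x b)" for b
    unfolding u'_def by (intro continuous_intros smooth_continuous_on smooth_partial u)
  have cu: "continuous_on UNIV u" by (rule smooth_continuous_on[OF u])
  have cBB: "continuous_on UNIV (\<lambda>x. B (x - x0) (x - x0))"
    by (intro B.continuous_on continuous_intros)
  let ?w = "\<lambda>R x. (x - x0) /\<^sub>R R"
  let ?\<Psi> = "\<lambda>R x. cutoff x0 R x * \<rho> x"
  let ?c' = "\<lambda>R x h. - 4 * ball_weight (?w R x) * (?w R x \<bullet> (h /\<^sub>R R))"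
  let ?\<Psi>' = "\<lambda>R x h. cutoff x0 R x * (\<rho> x * (3 * u' x h)) + ?c' R x h * \<rho> x"
  have ccut: "continuous_on UNIV (cutoff x0 R)" for R
    by (rule has_derivative_continuous_on[OF has_derivative_at_withinI[OF cutoff_has_derivative]])
  have C1: "compactly_supported_C1 (?\<Psi> R) (?\<Psi>' R) (norm x0 + R)" if R: "R > 0" for R
  proof
    have d\<rho>: "(\<rho> has_derivative (\<lambda>h. \<rho> x * (3 * u' x h))) (at x)" for x
      unfolding \<rho> using du[of x] by (auto intro!: derivative_eq_intros)
    show "(?\<Psi> R has_derivative ?\<Psi>' R x) (at x)" for x
      by (rule has_derivative_mult[OF cutoff_has_derivative d\<rho>])
    have bw: "continuous_on UNIV (\<lambda>x. ball_weight (?w R x))"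
      by (rule continuous_on_compose2[OF continuous_on_ball_weight(1)[of UNIV]]) (auto intro!: continuous_intros)
    show "continuous_on UNIV (\<lambda>x. ?\<Psi>' R x b)" for b
      by (intro continuous_intros ccut cont cu' bw)
    show "?\<Psi> R x = 0" if x: "norm x0 + R < norm x" for x
    proof -
      have "norm x - norm x0 \<le> norm (x - x0)" by (rule norm_triangle_ineq2)
      then have "1 < norm (x - x0) / R" using x R by (simp add: less_divide_eq)
      also have "\<dots> = norm (?w R x)" using R by (simp add: divide_inverse mult.commute)
      finally have "1 < norm (?w R x)" .
      then show ?thesis by (simp add: cutoff_def ball_weight_eq_0)
    qed
  qed
  define H where "H R = integral\<^sup>L (lborel \<Otimes>\<^sub>M lborel) (\<lambda>(x, y). ?\<Psi> R x * \<rho> y * ((x - y) \<bullet> (x - x0) / (norm (x - y))\<^sup>2))" for R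
  define b where "b R = (\<integral>x. ?\<Psi> R x * B (x - x0) (x - x0) \<partial>lborel)" for R
  have ib: "integrable lborel (\<lambda>x. ?\<Psi> R x * B (x - x0) (x - x0))" if "R > 0" for R
    by (rule compactly_supported_C1.integrable_times(1)[OF C1[OF that] cBB])
  have cw: "?c' R x (x - x0) = - 4 * (ball_weight (?w R x) * (norm (?w R x))\<^sup>2)" for R x
    unfolding power2_norm_eq_inner by (simp only: mult.assoc)
  \<comment> \<open>The gradient of \<open>\<rho>\<close> is 3 * \<open>\<rho>\<close> times that of
    u, so the divergence evaluates both the u-term and the mass. The last integral comes from the
    gradient of the cutoff and tends to 0 with growing R.\<close>
  have key: "b R = H R / pi\<^sup>2 - (\<integral>x. ?\<Psi> R x \<partial>lborel) + 4 / 3 * (\<integral>x. ball_weight (?w R x) * (norm (?w R x))\<^sup>2 * \<rho> x \<partial>lborel)"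
    if R: "R > 0" for R
  proof -
    interpret C: compactly_supported_C1 "?\<Psi> R" "?\<Psi>' R" "norm x0 + R" x0 by (rule C1[OF R])
    let ?Q = "\<lambda>x. q + B (x - x0) (x - x0) / 2"
    let ?X = "\<lambda>x. ball_weight (?w R x) * (norm (?w R x))\<^sup>2 * \<rho> x"
    define U where "U = (\<integral>x. ?\<Psi> R x * u' x (x - x0) \<partial>lborel)"
    have i1: "integrable lborel (?\<Psi> R)" using C.integrable_times(1)[of "\<lambda>_. 1"] by simp
    have i2: "integrable lborel (\<lambda>x. ?\<Psi> R x * u' x (x - x0))"
      by (intro C.integrable_times continuous_on_derivative_apply[OF has_derivative_linear[OF du] cu'] continuous_intros)
    have iD: "integrable lborel C.divergence" using C.integrable_times(2)[of "\<lambda>_. 1"] by simp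
    have X: "?X x = (3 * ?\<Psi> R x + 3 * (?\<Psi> R x * u' x (x - x0)) - C.divergence x) / 4" for x
      unfolding C.divergence_def cw by (simp add: algebra_simps)
    have "(\<integral>x. ?X x \<partial>lborel) = (3 * (\<integral>x. ?\<Psi> R x \<partial>lborel) + 3 * U - 0) / 4"
      unfolding X U_def C.integral_divergence[symmetric] using i1 i2 iD by simp
    moreover have "(\<integral>x. u x * C.divergence x \<partial>lborel) = - U"
      unfolding U_def by (rule C.by_parts[OF du cu'])
    moreover have "(\<integral>x. ?Q x * C.divergence x \<partial>lborel) = - b R"
      unfolding b_def
    proof (rule C.by_parts[where f' = "\<lambda>x h. B (x - x0) h"])
      show "((\<lambda>x. q + B (x - x0) (x - x0) / 2) has_derivative B (x - x0)) (at x)" for x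
      proof -
        have d: "((\<lambda>x. x - x0) has_derivative (\<lambda>h. h)) (at x)" by (auto intro!: derivative_eq_intros)
        have "((\<lambda>x. 1 / 2 * B (x - x0) (x - x0)) has_derivative (\<lambda>h. 1 / 2 * (B (x - x0) h + B h (x - x0)))) (at x)"
          by (intro has_derivative_mult_right B.FDERIV d)
        from has_derivative_add[OF has_derivative_const this, of q] show ?thesis by (simp add: Bs[of _ "x - x0"])
      qed
      show "continuous_on UNIV (\<lambda>x. B (x - x0) h)" for h by (intro B.continuous_on continuous_intros)
    qed
    moreover have "(\<integral>x. logpot \<rho> x * C.divergence x \<partial>lborel) = H R"
      unfolding H_def by (rule integral_logpot_divergence[OF C1[OF R] cr])
    moreover have "(\<integral>x. logpot \<rho> x * C.divergence x \<partial>lborel) = pi\<^sup>2 * ((\<integral>x. u x * C.divergence x \<partial>lborel) - (\<integral>x. ?Q x * C.divergence x \<partial>lborel))"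
    proof -
      have "logpot \<rho> x = pi\<^sup>2 * (u x - ?Q x)" for x unfolding rep by simp
      then have e: "logpot \<rho> x * C.divergence x = pi\<^sup>2 * (u x * C.divergence x - ?Q x * C.divergence x)" for x
        by (simp add: left_diff_distrib)
      have j: "integrable lborel (\<lambda>x. u x * C.divergence x)" "integrable lborel (\<lambda>x. ?Q x * C.divergence x)"
        by (intro C.integrable_times cu continuous_intros cBB; simp)+
      show ?thesis unfolding e integral_mult_right_zero Bochner_Integration.integral_diff[OF j] ..
    qed
    ultimately show ?thesis by simp
  qed
  define R where "R n = real (Suc n)" for n
  have R: "R n > 0" for n by (simp add: R_def)
  have H: "(\<lambda>n. H (R n)) \<longlonglongrightarrow> mass\<^sup>2 / 2"
    unfolding H_def R_def by (rule virial_tendsto) (rule integrable_virial[OF C1[OF R[unfolded R_def]] cr])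
  have "(\<lambda>n. (\<integral>x. ?\<Psi> (R n) x \<partial>lborel)) \<longlonglongrightarrow> mass"
    unfolding mass_def
  proof (rule integral_dominated_convergence[where w=\<rho>])
    show "AE x in lborel. (\<lambda>n. ?\<Psi> (R n) x) \<longlonglongrightarrow> \<rho> x"
    proof (intro AE_I2)
      fix x
      show "(\<lambda>n. ?\<Psi> (R n) x) \<longlonglongrightarrow> \<rho> x"
        using tendsto_mult_right[OF cutoff_tendsto[of x0 x], of "\<rho> x"] by (simp add: R_def)
    qed
    show "AE x in lborel. norm (?\<Psi> (R n) x) \<le> \<rho> x" for n
      using cutoff_bounds nonneg mult_right_mono[OF cutoff_bounds(2)[of x0 "R n"] nonneg] by (intro AE_I2) (simp add: abs_mult)
  qed (auto simp: int)
  moreover have "(\<lambda>n. (\<integral>x. ball_weight (?w (R n) x) * (norm (?w (R n) x))\<^sup>2 * \<rho> x \<partial>lborel)) \<longlonglongrightarrow> (\<integral>x. 0 \<partial>(lborel::(real^3) measure))"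
  proof (rule integral_dominated_convergence[where w=\<rho>])
    show "AE x in lborel. (\<lambda>n. ball_weight (?w (R n) x) * (norm (?w (R n) x))\<^sup>2 * \<rho> x) \<longlonglongrightarrow> 0"
    proof (intro AE_I2)
      fix x
      have t: "(\<lambda>n. ?w (R n) x) \<longlonglongrightarrow> 0" unfolding R_def by (rule cutoff_scaled_tendsto)
      have "isCont ball_weight 0" using continuous_on_ball_weight(1)[of UNIV] by (simp add: continuous_on_eq_continuous_at)
      from isCont_tendsto_compose[OF this t]
      have "(\<lambda>n. ball_weight (?w (R n) x) * (norm (?w (R n) x))\<^sup>2 * \<rho> x) \<longlonglongrightarrow> ball_weight 0 * (norm (0::real^3))\<^sup>2 * \<rho> x"
        by (intro tendsto_intros t)
      then show "(\<lambda>n. ball_weight (?w (R n) x) * (norm (?w (R n) x))\<^sup>2 * \<rho> x) \<longlonglongrightarrow> 0" by simp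
    qed
    have bw1: "\<bar>ball_weight z * (norm z)\<^sup>2\<bar> \<le> 1" for z
    proof (cases "norm z \<le> 1")
      case True
      then have "ball_weight z * (norm z)\<^sup>2 \<le> 1 * 1"
        by (intro mult_mono ball_weight_bounds) (auto simp: power_le_one)
      then show ?thesis using ball_weight_bounds(1)[of z] by simp
    qed (simp add: ball_weight_eq_0)
    show "AE x in lborel. norm (ball_weight (?w (R n) x) * (norm (?w (R n) x))\<^sup>2 * \<rho> x) \<le> \<rho> x" for n
    proof (intro AE_I2)
      fix x
      show "norm (ball_weight (?w (R n) x) * (norm (?w (R n) x))\<^sup>2 * \<rho> x) \<le> \<rho> x"
        using mult_right_mono[OF bw1[of "?w (R n) x"] nonneg[of x]] nonneg[of x] by (simp only: real_norm_def abs_mult abs_of_nonneg)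
    qed
  qed (auto simp: int)
  ultimately have lim: "(\<lambda>n. b (R n)) \<longlonglongrightarrow> (mass\<^sup>2 / 2) / pi\<^sup>2 - mass + 4 / 3 * 0"
    unfolding key[OF R] by (intro tendsto_intros H) simp_all
  \<comment> \<open>The cutoffs increase with the radius and are multiplied by a nonpositive
    quantity.\<close>
  have mono: "b (R n) \<le> b (R 0)" for n
    unfolding b_def
  proof (intro integral_mono ib R)
    fix x
    have "inverse (real (Suc n)) \<le> 1" by (simp add: field_simps)
    then have "norm (?w (R n) x) \<le> norm (?w (R 0) x)"
      using mult_right_mono[of "inverse (real (Suc n))" 1 "norm (x - x0)"] by (simp add: R_def)
    then have "ball_weight (?w (R 0) x) \<le> ball_weight (?w (R n) x)"
      unfolding ball_weight_def by (intro max.mono diff_left_mono power_mono) auto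
    then have "cutoff x0 (R 0) x \<le> cutoff x0 (R n) x"
      unfolding cutoff_def by (intro power_mono ball_weight_bounds)
    then have "?\<Psi> (R 0) x \<le> ?\<Psi> (R n) x" by (intro mult_right_mono nonneg)
    then show "?\<Psi> (R n) x * B (x - x0) (x - x0) \<le> ?\<Psi> (R 0) x * B (x - x0) (x - x0)"
      by (rule mult_right_mono_neg) (rule neg)
  qed
  then have le: "(mass\<^sup>2 / 2) / pi\<^sup>2 - mass + 4 / 3 * 0 \<le> b (R 0)"
    by (intro LIMSEQ_le_const2[OF lim]) auto
  have g: "0 \<le> - (?\<Psi> (R 0) x * B (x - x0) (x - x0))" for x
    using neg[of "x - x0"] nonneg[of x] cutoff_bounds(1)[of x0 "R 0" x] by (simp add: mult_nonneg_nonpos)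
  have "0 \<le> (\<integral>x. - (?\<Psi> (R 0) x * B (x - x0) (x - x0)) \<partial>lborel)" by (intro integral_nonneg_AE AE_I2 g)
  then have b0: "b (R 0) \<le> 0" by (simp add: b_def)
  \<comment> \<open>As the mass is positive, the sign of this limit is the sign of
    \<open>mass - 2 * pi\<^sup>2\<close>.\<close>
  have fac: "(mass\<^sup>2 / 2) / pi\<^sup>2 - mass = mass * (mass - 2 * pi\<^sup>2) / (2 * pi\<^sup>2)"
    by (simp add: power2_eq_square field_simps)
  show ?thesis
  proof (cases "b (R 0) = 0")
    case False
    then have "mass * (mass - 2 * pi\<^sup>2) / (2 * pi\<^sup>2) < 0" using le b0 unfolding fac by simp
    then have "mass * (mass - 2 * pi\<^sup>2) < 0" by (simp add: divide_less_0_iff)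
    then show ?thesis using mass_pos by (simp add: mult_less_0_iff)
  next
    case True
    have z: "- (?\<Psi> (R 0) x * B (x - x0) (x - x0)) = 0" for x
    proof (rule integral_eq_0_continuous[OF _ g])
      show "continuous_on UNIV (\<lambda>x. - (?\<Psi> (R 0) x * B (x - x0) (x - x0)))"
        by (intro continuous_intros ccut cont cBB)
      show "integrable lborel (\<lambda>x. - (?\<Psi> (R 0) x * B (x - x0) (x - x0)))" using ib[OF R] by simp
      show "(\<integral>x. - (?\<Psi> (R 0) x * B (x - x0) (x - x0)) \<partial>lborel) = 0" using True by (simp add: b_def)
    qed
    have B0: "B x x = 0" for x
    proof (cases "x = 0")
      case True
      then show ?thesis by (simp add: B.zero_left)
    next
      case False
      \<comment> \<open>Rescaled to norm 1 / 2, so that x0 + y lies where the cutoff of radius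
        \<open>R 0 = 1\<close> is positive.\<close>
      define y where "y = (1 / (2 * norm x)) *\<^sub>R x"
      have "norm y = 1 / 2" using False by (simp add: y_def)
      then have "norm y * norm y = 1 / 2 * (1 / 2)" by (simp only:)
      then have "cutoff x0 (R 0) (x0 + y) \<noteq> 0" by (simp add: cutoff_def ball_weight_def R_def power2_eq_square)
      then have "B y y = 0" using z[of "x0 + y"] pos[of "x0 + y"] by simp
      then show ?thesis using False by (simp add: y_def B.scaleR_left B.scaleR_right)
    qed
    have "b (R n) = 0" for n unfolding b_def by (simp add: B0)
    then have "(\<lambda>n. 0) \<longlonglongrightarrow> (mass\<^sup>2 / 2) / pi\<^sup>2 - mass + 4 / 3 * 0" using lim by simp
    then have "(mass\<^sup>2 / 2) / pi\<^sup>2 - mass = 0" by (simp add: LIMSEQ_const_iff)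
    then have "mass = 2 * pi\<^sup>2" using mass_pos unfolding fac by simp
    then show ?thesis using B0 by auto
  qed
qed

end

subsection \<open>Inversion in spheres\<close>

text \<open>At the origin division by zero gives the value 0, so that the involution law holds
  without exception.\<close>

definition inversion :: "real \<Rightarrow> real^3 \<Rightarrow> real^3" where
  "inversion l y = (l\<^sup>2 / (norm y)\<^sup>2) *\<^sub>R y"

lemma norm_inversion: "norm (inversion l y) = l\<^sup>2 / norm y"
  by (simp add: inversion_def power2_eq_square)

lemma inversion_inversion: "l > 0 \<Longrightarrow> inversion l (inversion l y) = y"
  by (cases "y = 0") (simp_all add: inversion_def power2_eq_square)

lemma inversion_has_derivative:
  assumes "y \<noteq> 0"
  shows "(inversion l has_derivative (\<lambda>h. (l\<^sup>2 / (norm y)\<^sup>2) *\<^sub>R (h - (2 * (y \<bullet> h) / (norm y)\<^sup>2) *\<^sub>R y))) (at y)"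
proof -
  have n: "(norm y)\<^sup>2 = y \<bullet> y" for y :: "real^3" by (rule power2_norm_eq_inner)
  have "((\<lambda>y. inverse (y \<bullet> y)) has_derivative (\<lambda>h. - (inverse (y \<bullet> y) * (y \<bullet> h + h \<bullet> y) * inverse (y \<bullet> y)))) (at y)"
    using assms by (intro Deriv.has_derivative_inverse) (auto intro!: derivative_eq_intros)
  then have "((\<lambda>y. (l\<^sup>2 * inverse (y \<bullet> y)) *\<^sub>R y) has_derivative
      (\<lambda>h. (l\<^sup>2 * inverse (y \<bullet> y)) *\<^sub>R h + (l\<^sup>2 * (- (inverse (y \<bullet> y) * (y \<bullet> h + h \<bullet> y) * inverse (y \<bullet> y)))) *\<^sub>R y)) (at y)"
    by (intro has_derivative_scaleR has_derivative_mult_right has_derivative_ident)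
  moreover have "(\<lambda>y. (l\<^sup>2 * inverse (y \<bullet> y)) *\<^sub>R y) = inversion l"
    by (simp add: fun_eq_iff inversion_def n divide_inverse)
  moreover have "(l\<^sup>2 * inverse (y \<bullet> y)) *\<^sub>R h + (l\<^sup>2 * (- (inverse (y \<bullet> y) * (y \<bullet> h + h \<bullet> y) * inverse (y \<bullet> y)))) *\<^sub>R y
      = (l\<^sup>2 / (norm y)\<^sup>2) *\<^sub>R (h - (2 * (y \<bullet> h) / (norm y)\<^sup>2) *\<^sub>R y)" for h
    by (simp add: n inner_commute[of h y] divide_inverse scaleR_diff_right algebra_simps)
  ultimately show ?thesis by simp
qed

text \<open>The derivative is (l / |y|)^2 times the reflection in the plane orthogonal to y. The
  reflection is orthogonal, so only the cube of the scalar remains.\<close>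

lemma det_inversion_derivative:
  fixes y :: "real^3"
  assumes "y \<noteq> 0"
  shows "\<bar>det (matrix (\<lambda>h. (l\<^sup>2 / (norm y)\<^sup>2) *\<^sub>R (h - (2 * (y \<bullet> h) / (norm y)\<^sup>2) *\<^sub>R y)))\<bar> = (l / norm y) ^ 6"
proof -
  let ?T = "\<lambda>h. h - (2 * (y \<bullet> h) / (norm y)\<^sup>2) *\<^sub>R y"
  let ?c = "l\<^sup>2 / (norm y)\<^sup>2"
  have lin: "linear ?T" by (intro linearI) (simp_all add: inner_simps algebra_simps add_divide_distrib)
  have "orthogonal_transformation ?T"
    unfolding orthogonal_transformation
  proof (intro conjI allI lin)
    fix h
    define t where "t = (y \<bullet> h) / (y \<bullet> y)"
    have t: "t * (y \<bullet> y) = y \<bullet> h" using assms by (simp add: t_def)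
    have "(norm (?T h))\<^sup>2 = (h - (2 * t) *\<^sub>R y) \<bullet> (h - (2 * t) *\<^sub>R y)"
      by (simp add: power2_norm_eq_inner t_def)
    also have "\<dots> = h \<bullet> h - 4 * t * (y \<bullet> h) + 4 * t * (t * (y \<bullet> y))"
      by (simp add: inner_simps inner_commute[of h y] algebra_simps)
    finally have "(norm (?T h))\<^sup>2 = (norm h)\<^sup>2" by (simp add: t power2_norm_eq_inner)
    then show "norm (?T h) = norm h" by simp
  qed
  then have T: "\<bar>det (matrix ?T)\<bar> = 1"
    using det_orthogonal_matrix[of "matrix ?T"] by (auto simp: orthogonal_transformation_matrix)
  have "matrix (\<lambda>h. ?c *\<^sub>R ?T h) = matrix ((*\<^sub>R) ?c) ** matrix ?T"
    using matrix_compose[OF lin, of "(*\<^sub>R) ?c"] by (simp add: o_def linear_scale_self)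
  then have "\<bar>det (matrix (\<lambda>h. ?c *\<^sub>R ?T h))\<bar> = \<bar>?c ^ 3\<bar>"
    by (simp only: det_mul abs_mult T det_matrix_scaleR) simp
  then show ?thesis by (simp add: power_divide flip: power_mult)
qed

lemma
  fixes f :: "real^3 \<Rightarrow> real"
  assumes l: "l > 0" and f: "integrable lborel (\<lambda>z. indicator {z. l < norm z} z * f z)"
  shows integrable_inversion: "integrable lborel (\<lambda>z. indicator {z. 0 < norm z \<and> norm z < l} z * ((l / norm z) ^ 6 * f (inversion l z)))"
    and integral_inversion: "(\<integral>z. indicator {z. 0 < norm z \<and> norm z < l} z * ((l / norm z) ^ 6 * f (inversion l z)) \<partial>lborel) =
      (\<integral>z. indicator {z. l < norm z} z * f z \<partial>lborel)"
proof -
  let ?S = "{z::real^3. 0 < norm z \<and> norm z < l}" and ?E = "{z::real^3. l < norm z}"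
  have SB: "?S \<in> sets borel" by measurable
  then have S: "?S \<in> sets lebesgue" by (intro sets_completionI_sets) (simp only: sets_lborel)
  have der: "(inversion l has_derivative (\<lambda>h. (l\<^sup>2 / (norm z)\<^sup>2) *\<^sub>R (h - (2 * (z \<bullet> h) / (norm z)\<^sup>2) *\<^sub>R z))) (at z within ?S)"
    if "z \<in> ?S" for z
    by (rule has_derivative_at_withinI[OF inversion_has_derivative]) (use that in auto)
  have inj: "inj_on (inversion l) ?S"
    by (rule inj_on_inverseI[of _ "inversion l"]) (rule inversion_inversion[OF l])
  have img: "inversion l ` ?S = ?E"
  proof
    show "inversion l ` ?S \<subseteq> ?E" using l by (auto simp: norm_inversion power2_eq_square less_divide_eq)
    show "?E \<subseteq> inversion l ` ?S"
    proof
      fix z assume z: "z \<in> ?E"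
      then have "norm z > 0" using l by (simp only: mem_Collect_eq less_trans[of 0 l])
      then have "0 < l\<^sup>2 / norm z" "l\<^sup>2 / norm z < l" using z l by (simp_all add: power2_eq_square divide_less_eq)
      then have "inversion l z \<in> ?S" unfolding mem_Collect_eq norm_inversion by simp
      then show "z \<in> inversion l ` ?S" by (rule rev_image_eqI) (simp add: inversion_inversion l)
    qed
  qed
  have fE: "f absolutely_integrable_on ?E"
    using f by (simp add: set_integrable_def integrable_completion borel_measurable_integrable)
  let ?D = "\<lambda>z. (l / norm z) ^ 6 * f (inversion l z)"
  define J where "J z = \<bar>det (matrix (\<lambda>h. (l\<^sup>2 / (norm z)\<^sup>2) *\<^sub>R (h - (2 * (z \<bullet> h) / (norm z)\<^sup>2) *\<^sub>R z)))\<bar>" for z :: "real^3"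
  \<comment> \<open>The change of variables theorem is used for \<open>real^1\<close>-valued
    functions; the result is translated back to real ones below.\<close>
  have cov: "(\<lambda>z. J z *\<^sub>R (vec (f (inversion l z)) :: real^1)) absolutely_integrable_on ?S \<and>
      integral ?S (\<lambda>z. J z *\<^sub>R (vec (f (inversion l z)) :: real^1)) = vec b
     \<longleftrightarrow> (\<lambda>z. vec (f z) :: real^1) absolutely_integrable_on (inversion l ` ?S) \<and> integral (inversion l ` ?S) (\<lambda>z. vec (f z) :: real^1) = vec b" for b
    unfolding J_def by (rule has_absolute_integral_change_of_variables[OF S der inj])
  have J: "J z * f (inversion l z) = ?D z" if "z \<in> ?S" for z
    using that unfolding J_def by (subst det_inversion_derivative) auto
  have "(\<lambda>z. J z * f (inversion l z)) absolutely_integrable_on ?S \<and> integral ?S (\<lambda>z. J z * f (inversion l z)) = integral ?E f"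
    using cov[of "integral ?E f"] fE unfolding img by (simp add: absolutely_integrable_on_1_iff integral_on_1_eq)
  moreover have "integral ?S (\<lambda>z. J z * f (inversion l z)) = integral ?S ?D"
    by (rule Henstock_Kurzweil_Integration.integral_cong[OF J])
  moreover have "(\<lambda>z. J z * f (inversion l z)) absolutely_integrable_on ?S \<longleftrightarrow> ?D absolutely_integrable_on ?S"
    by (rule set_integrable_cong[OF refl refl J])
  ultimately have a: "?D absolutely_integrable_on ?S" and b: "integral ?S ?D = integral ?E f" by simp_all
  have m: "(\<lambda>z. indicator ?S z * ?D z) \<in> borel_measurable borel"
  proof -
    have [measurable]: "inversion l \<in> borel_measurable borel" unfolding inversion_def[abs_def] by measurable
    have [measurable]: "(\<lambda>z. indicator ?E z * f z) \<in> borel_measurable borel" using f by simp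
    have "indicator ?S z * ?D z = indicator ?S z * ((l / norm z) ^ 6 * (indicator ?E (inversion l z) * f (inversion l z)))" for z
      using img by (auto simp: indicator_def)
    then show ?thesis by (simp only:) measurable
  qed
  show i: "integrable lborel (\<lambda>z. indicator ?S z * ?D z)"
    using a m by (simp add: set_integrable_def integrable_completion)
  have "(\<integral>z. indicator ?S z * ?D z \<partial>lborel) = (LINT z:?S|lebesgue. ?D z)"
    using m by (simp add: set_lebesgue_integral_def integral_completion)
  also have "\<dots> = integral ?E f" using set_lebesgue_integral_eq_integral(2)[OF a] b by simp
  also have "\<dots> = (LINT z:?E|lebesgue. f z)" by (rule set_lebesgue_integral_eq_integral(2)[OF fE, symmetric])
  also have "\<dots> = (\<integral>z. indicator ?E z * f z \<partial>lborel)"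
    using f by (simp add: set_lebesgue_integral_def integral_completion borel_measurable_integrable)
  finally show "(\<integral>z. indicator ?S z * ?D z \<partial>lborel) = (\<integral>z. indicator ?E z * f z \<partial>lborel)" .
qed

subsection \<open>Moving spheres\<close>

text \<open>Equals (|y| / l)^2 times the squared distance from z to the inverted point of y, as in
  the method of images. In this form it is symmetric in y and z and also defined at y = 0.\<close>

definition image_form :: "real \<Rightarrow> real^3 \<Rightarrow> real^3 \<Rightarrow> real" where
  "image_form l y z = l\<^sup>2 - 2 * (y \<bullet> z) + (norm y)\<^sup>2 * (norm z)\<^sup>2 / l\<^sup>2"

text \<open>The logarithm of the ratio between the rescaled distance from z to the image of y and
  the distance from z to y; it plays the part of a Green function of the ball.\<close>

definition image_kernel :: "real \<Rightarrow> real^3 \<Rightarrow> real^3 \<Rightarrow> real" where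
  "image_kernel l y z = ln (image_form l y z / (norm (y - z))\<^sup>2) / 2"

lemma norm_inversion_diff:
  assumes "l > 0" "y \<noteq> 0"
  shows "(norm y)\<^sup>2 * (norm (inversion l y - z))\<^sup>2 = l\<^sup>2 * image_form l y z"
proof -
  define a where "a = (norm y)\<^sup>2"
  have a: "a \<noteq> 0" "y \<bullet> y = a" using assms by (simp_all add: a_def power2_norm_eq_inner)
  have "(norm (inversion l y - z))\<^sup>2 = (l\<^sup>2 / a) * (l\<^sup>2 / a) * a - 2 * (l\<^sup>2 / a) * (y \<bullet> z) + (norm z)\<^sup>2"
    unfolding inversion_def a_def[symmetric]
    by (simp add: power2_norm_eq_inner inner_diff_left inner_diff_right inner_commute[of z y] a algebra_simps)
  then have "a * (norm (inversion l y - z))\<^sup>2 = l\<^sup>2 * l\<^sup>2 - 2 * l\<^sup>2 * (y \<bullet> z) + a * (norm z)\<^sup>2"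
    using a(1) by (simp add: field_simps)
  also have "\<dots> = l\<^sup>2 * image_form l y z"
    using assms(1) unfolding image_form_def a_def by (simp add: field_simps)
  finally show ?thesis by (simp only: a_def)
qed

lemma image_form_commute: "image_form l y z = image_form l z y"
  by (simp add: image_form_def inner_commute mult.commute)

text \<open>The factorisation displays the sign of the kernel: positive if both points lie inside
  the sphere, zero if one of them lies on it.\<close>

lemma image_form_diff: "l > 0 \<Longrightarrow> image_form l y z - (norm (y - z))\<^sup>2 = (l\<^sup>2 - (norm y)\<^sup>2) * (l\<^sup>2 - (norm z)\<^sup>2) / l\<^sup>2"
  by (simp add: image_form_def power2_norm_eq_inner inner_diff_left inner_diff_right inner_commute[of z y] field_simps)

lemma image_form_inversion:
  assumes "l > 0" "z \<noteq> 0"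
  shows "image_form l y (inversion l z) = l\<^sup>2 / (norm z)\<^sup>2 * (norm (y - z))\<^sup>2"
proof -
  have "l\<^sup>2 * image_form l (inversion l z) y = (norm (inversion l z))\<^sup>2 * (norm (inversion l (inversion l z) - y))\<^sup>2"
    using assms by (intro norm_inversion_diff[symmetric]) (simp_all add: inversion_def)
  also have "\<dots> = l\<^sup>2 * (l\<^sup>2 / (norm z)\<^sup>2 * (norm (y - z))\<^sup>2)"
    using assms by (simp add: inversion_inversion norm_inversion power_divide norm_minus_commute power2_eq_square)
  finally have "l\<^sup>2 * image_form l y (inversion l z) = l\<^sup>2 * (l\<^sup>2 / (norm z)\<^sup>2 * (norm (y - z))\<^sup>2)"
    by (simp only: image_form_commute)
  then show ?thesis by (rule mult_left_cancel[THEN iffD1, rotated]) (use assms in simp)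
qed

lemma image_form_gt:
  assumes "norm y < l" "norm z < l"
  shows "(norm (y - z))\<^sup>2 < image_form l y z"
proof -
  have l: "l > 0" using assms norm_ge_zero[of y] by linarith
  have "(norm y)\<^sup>2 < l\<^sup>2" "(norm z)\<^sup>2 < l\<^sup>2" using assms by (intro power_strict_mono; simp)+
  then have "0 < (l\<^sup>2 - (norm y)\<^sup>2) * (l\<^sup>2 - (norm z)\<^sup>2) / l\<^sup>2" using l by simp
  then show ?thesis using image_form_diff[OF l, of y z] by simp
qed

lemma image_kernel_pos:
  assumes "norm y < l" "norm z < l" "y \<noteq> z"
  shows "0 < image_kernel l y z"
proof -
  have "1 < image_form l y z / (norm (y - z))\<^sup>2"
    using image_form_gt[OF assms(1,2)] assms(3) by (simp add: less_divide_eq)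
  then show ?thesis unfolding image_kernel_def by (intro divide_pos_pos ln_gt_zero) auto
qed

lemma image_kernel_nonneg: "norm y < l \<Longrightarrow> norm z < l \<Longrightarrow> 0 \<le> image_kernel l y z"
  using image_kernel_pos[of y l z] by (cases "y = z") (auto simp: image_kernel_def)

lemma image_kernel_sphere:
  assumes "l > 0" "norm z = l" "y \<noteq> z"
  shows "image_kernel l y z = 0"
  using image_form_diff[OF assms(1), of y z] assms by (simp add: image_kernel_def)

text \<open>Inverting z interchanges the two distances up to the common factor l / |z|, which
  cancels in the ratio.\<close>

lemma image_kernel_inversion:
  assumes "norm y < l" "0 < norm z" "norm z < l" "y \<noteq> z"
  shows "image_kernel l y (inversion l z) = - image_kernel l y z"
proof -
  have l: "l > 0" by (rule less_trans[OF assms(2,3)])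
  have z: "z \<noteq> 0" using assms by auto
  have M: "image_form l y z > 0" using image_form_gt[OF assms(1,3)] zero_le_power2[of "norm (y - z)"] by linarith
  have d: "(norm (y - z))\<^sup>2 > 0" using assms(4) by simp
  have "(norm z)\<^sup>2 * (norm (y - inversion l z))\<^sup>2 = l\<^sup>2 * image_form l y z"
    using norm_inversion_diff[OF l z, of y] by (simp add: norm_minus_commute image_form_commute)
  then have "(norm (y - inversion l z))\<^sup>2 = l\<^sup>2 / (norm z)\<^sup>2 * image_form l y z" using z by (simp add: field_simps)
  then have "image_kernel l y (inversion l z) = ln ((norm (y - z))\<^sup>2 / image_form l y z) / 2"
    unfolding image_kernel_def image_form_inversion[OF l z] using l z by simp
  also have "\<dots> = - image_kernel l y z"
    unfolding image_kernel_def using M d by (simp only: ln_divide_pos) (simp add: diff_divide_distrib)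
  finally show ?thesis .
qed

lemma image_form_le:
  assumes "norm y \<le> l" "norm z \<le> l" "l > 0"
  shows "image_form l y z \<le> (2 * l)\<^sup>2"
proof -
  have "- (y \<bullet> z) \<le> norm y * norm z" using Cauchy_Schwarz_ineq2[of y z] by linarith
  also have "\<dots> \<le> l * l" using assms by (intro mult_mono) auto
  finally have 1: "- 2 * (y \<bullet> z) \<le> 2 * l\<^sup>2" by (simp add: power2_eq_square)
  have "(norm y)\<^sup>2 * (norm z)\<^sup>2 \<le> l\<^sup>2 * l\<^sup>2" using assms by (intro mult_mono power_mono) auto
  then have "(norm y)\<^sup>2 * (norm z)\<^sup>2 / l\<^sup>2 \<le> l\<^sup>2" using assms(3) by (simp add: divide_le_eq)
  then show ?thesis using 1 by (simp add: image_form_def power2_eq_square)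
qed

lemma borel_measurable_image_kernel [measurable]:
  "(\<lambda>z. image_kernel l y z) \<in> borel_measurable borel"
  unfolding image_kernel_def image_form_def by measurable

text \<open>The borderline case of the Pohozaev alternative: no quadratic part and the critical
  mass.\<close>

locale bubble = log_density +
  fixes u :: "real^3 \<Rightarrow> real" and q :: real
  assumes density: "\<rho> x = exp (3 * u x)" and rep: "u x = logpot \<rho> x / pi\<^sup>2 + q"
    and mass: "mass = 2 * pi\<^sup>2" and u_cont: "continuous_on UNIV u"
begin

text \<open>Only \<open>y \<noteq> 0\<close> is meaningful.\<close>

definition gap :: "real \<Rightarrow> real^3 \<Rightarrow> real" where
  "gap l y = u (inversion l y) + 2 * ln (l / norm y) - u y"

text \<open>The critical mass enters here: \<open>mass / pi\<^sup>2 = 2\<close> is exactly the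
  coefficient of ln (l / |y|) in \<open>gap\<close>, so the conformal factor can be absorbed under
  the integral and completes the kernel.\<close>

lemma
  assumes l: "l > 0" and y: "y \<noteq> 0"
  shows integrable_image_kernel: "integrable lborel (\<lambda>z. image_kernel l y z * \<rho> z)"
    and gap_eq: "gap l y = - (\<integral>z. image_kernel l y z * \<rho> z \<partial>lborel) / pi\<^sup>2"
proof -
  have ae: "AE z in lborel. - (ln (norm (y - z) / norm (inversion l y - z)) * \<rho> z + ln (l / norm y) * \<rho> z) = image_kernel l y z * \<rho> z"
    using AE_lborel_singleton[of y] AE_lborel_singleton[of "inversion l y"]
  proof eventually_elim
    case (elim z)
    define a b where "a = norm (y - z)" and "b = norm (inversion l y - z)"
    have p: "a > 0" "b > 0" "norm y > 0" using elim y by (simp_all add: a_def b_def)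
    have "image_form l y z = (norm y * b / l)\<^sup>2"
      using norm_inversion_diff[OF l y, of z] l by (simp add: b_def power_mult_distrib power_divide)
    then have "image_kernel l y z = ln ((norm y * b / l / a)\<^sup>2) / 2"
      by (simp add: image_kernel_def a_def power_divide power_mult_distrib)
    also have "\<dots> = ln (norm y * b / l / a)" using p l by (simp add: ln_realpow)
    also have "\<dots> = - (ln (a / b) + ln (l / norm y))"
      using p l by (simp add: ln_divide_pos ln_mult_pos)
    finally have k: "image_kernel l y z = - (ln (a / b) + ln (l / norm y))" .
    show ?case unfolding k a_def b_def by (simp add: algebra_simps)
  qed
  have i: "integrable lborel (\<lambda>z. - (ln (norm (y - z) / norm (inversion l y - z)) * \<rho> z + ln (l / norm y) * \<rho> z))"
    by (intro integrable_minus Bochner_Integration.integrable_add integrable_logpot_diff integrable_mult_right int)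
  show "integrable lborel (\<lambda>z. image_kernel l y z * \<rho> z)"
    by (rule integrable_cong_AE_imp[OF i _ ae]) measurable
  have "(\<integral>z. image_kernel l y z * \<rho> z \<partial>lborel) = (\<integral>z. - (ln (norm (y - z) / norm (inversion l y - z)) * \<rho> z + ln (l / norm y) * \<rho> z) \<partial>lborel)"
    by (rule integral_cong_AE[symmetric, OF _ _ ae]) measurable
  also have "\<dots> = - ((logpot \<rho> (inversion l y) - logpot \<rho> y) + ln (l / norm y) * mass)"
    unfolding integral_minus Bochner_Integration.integral_add[OF integrable_logpot_diff integrable_mult_right[OF int]] logpot_diff mass_def
    by simp
  finally show "gap l y = - (\<integral>z. image_kernel l y z * \<rho> z \<partial>lborel) / pi\<^sup>2"
    unfolding gap_def rep mass by (simp add: diff_divide_distrib add_divide_distrib)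
qed

text \<open>The Jacobian (l / |z|)^6 of the inversion coincides with the cube of the conformal
  factor (l / |z|)^2, so the density transforms by the gap alone.\<close>

lemma density_inversion:
  assumes l: "l > 0" and z: "z \<noteq> 0"
  shows "(l / norm z) ^ 6 * \<rho> (inversion l z) = \<rho> z * exp (3 * gap l z)"
proof -
  have "exp (real 6 * ln (l / norm z)) = (l / norm z) ^ 6"
    unfolding exp_of_nat_mult using l z by simp
  then have e: "(l / norm z) ^ 6 = exp (6 * ln (l / norm z))" by simp
  show ?thesis unfolding e density gap_def mult_exp_exp by (simp add: algebra_simps)
qed

text \<open>The kernel is odd under inversion of \<open>z\<close>, which folds the exterior of the sphere onto the ball.\<close>

lemma
  assumes y: "0 < norm y" "norm y < l"
  shows integrable_gap_kernel: "integrable lborel (\<lambda>z. indicator {z. 0 < norm z \<and> norm z < l} z * (image_kernel l y z * \<rho> z * (exp (3 * gap l z) - 1)))"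
    and gap_integral_equation: "gap l y = (\<integral>z. indicator {z. 0 < norm z \<and> norm z < l} z * (image_kernel l y z * \<rho> z * (exp (3 * gap l z) - 1)) \<partial>lborel) / pi\<^sup>2"
proof -
  have l: "l > 0" by (rule less_trans[OF y])
  have y0: "y \<noteq> 0" using y by auto
  let ?S = "{z::real^3. 0 < norm z \<and> norm z < l}" and ?E = "{z::real^3. l < norm z}"
  let ?f = "\<lambda>z. image_kernel l y z * \<rho> z"
  note i = integrable_image_kernel[OF l y0]
  have ind: "integrable lborel (\<lambda>z. indicator A z * ?f z)" if [measurable]: "A \<in> sets borel" for A
  proof (rule Bochner_Integration.integrable_bound[OF i])
    show "AE z in lborel. norm (indicator A z * ?f z) \<le> norm (?f z)" by (intro AE_I2) (simp add: indicator_def)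
  qed measurable
  have iS: "integrable lborel (\<lambda>z. indicator ?S z * ?f z)" by (rule ind) measurable
  have iE: "integrable lborel (\<lambda>z. indicator ?E z * ?f z)" by (rule ind) measurable
  note inv = integrable_inversion[OF l iE] integral_inversion[OF l iE]
  have ae: "AE z in lborel. - (indicator ?S z * ((l / norm z) ^ 6 * ?f (inversion l z))) - indicator ?S z * ?f z =
      indicator ?S z * (image_kernel l y z * \<rho> z * (exp (3 * gap l z) - 1))"
    using AE_lborel_singleton[of y]
  proof eventually_elim
    case (elim z)
    show ?case
    proof (cases "z \<in> ?S")
      case True
      have k: "image_kernel l y (inversion l z) = - image_kernel l y z"
        using True y elim by (intro image_kernel_inversion) auto
      have "(l / norm z) ^ 6 * ?f (inversion l z) = - image_kernel l y z * ((l / norm z) ^ 6 * \<rho> (inversion l z))"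
        unfolding k by simp
      also have "(l / norm z) ^ 6 * \<rho> (inversion l z) = \<rho> z * exp (3 * gap l z)"
        using True l by (intro density_inversion) auto
      finally show ?thesis using True by (simp add: algebra_simps)
    qed simp
  qed
  note id = Bochner_Integration.integrable_diff[OF integrable_minus[OF inv(1)] iS]
  have [measurable]: "u \<in> borel_measurable borel" by (rule borel_measurable_continuous_onI[OF u_cont])
  have [measurable]: "inversion l \<in> borel_measurable borel" unfolding inversion_def[abs_def] by measurable
  have m: "(\<lambda>z. indicator ?S z * (image_kernel l y z * \<rho> z * (exp (3 * gap l z) - 1))) \<in> borel_measurable lborel"
    unfolding gap_def by measurable
  show "integrable lborel (\<lambda>z. indicator ?S z * (image_kernel l y z * \<rho> z * (exp (3 * gap l z) - 1)))"
    by (rule integrable_cong_AE_imp[OF id m ae])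
  have "(\<integral>z. indicator ?S z * (image_kernel l y z * \<rho> z * (exp (3 * gap l z) - 1)) \<partial>lborel)
      = (\<integral>z. - (indicator ?S z * ((l / norm z) ^ 6 * ?f (inversion l z))) - indicator ?S z * ?f z \<partial>lborel)"
    by (rule integral_cong_AE[symmetric, OF _ m ae]) (use id in simp)
  also have "\<dots> = - (\<integral>z. indicator ?E z * ?f z \<partial>lborel) - (\<integral>z. indicator ?S z * ?f z \<partial>lborel)"
    unfolding Bochner_Integration.integral_diff[OF integrable_minus[OF inv(1)] iS] integral_minus inv(2) ..
  also have "\<dots> = - (\<integral>z. indicator ?E z * ?f z + indicator ?S z * ?f z \<partial>lborel)"
    unfolding Bochner_Integration.integral_add[OF iE iS] by simp
  also have "(\<integral>z. indicator ?E z * ?f z + indicator ?S z * ?f z \<partial>lborel) = (\<integral>z. ?f z \<partial>lborel)"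
  proof (rule integral_cong_AE)
    show "AE z in lborel. indicator ?E z * ?f z + indicator ?S z * ?f z = ?f z"
      using AE_lborel_singleton[of y] AE_lborel_singleton[of 0]
    proof eventually_elim
      case (elim z)
      have "image_kernel l y z = 0" if "norm z = l" using image_kernel_sphere[OF l that] elim by auto
      then show ?case using elim by (auto simp: indicator_def)
    qed
  qed measurable
  finally show "gap l y = (\<integral>z. indicator ?S z * (image_kernel l y z * \<rho> z * (exp (3 * gap l z) - 1)) \<partial>lborel) / pi\<^sup>2"
    unfolding gap_eq[OF l y0] by simp
qed

end

text \<open>From ln (e * X) \<le> e * X - 1 with a free parameter e: the singular part receives a
  small coefficient at the price of a constant, which is later multiplied by a small
  measure.\<close>

lemma image_kernel_le:
  assumes yz: "norm y < l" "norm z < l" and L: "l \<le> L" and e: "e > 0"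
  shows "image_kernel l y z \<le> 2 * e * L\<^sup>2 * (indicator (cball 0 (2 * L)) (y - z) / (norm (y - z))\<^sup>2) + \<bar>ln e\<bar> / 2"
proof (cases "y = z")
  case True
  then show ?thesis by (simp add: image_kernel_def)
next
  case False
  have l: "l > 0" using yz(1) norm_ge_zero[of y] by linarith
  define d where "d = (norm (y - z))\<^sup>2"
  have d: "d > 0" using False by (simp add: d_def)
  define X where "X = image_form l y z / d"
  have X: "X > 0" unfolding X_def using image_form_gt[OF yz, folded d_def] d by (intro divide_pos_pos) linarith+
  have "image_form l y z \<le> (2 * l)\<^sup>2" using yz l by (intro image_form_le) auto
  also have "\<dots> \<le> (2 * L)\<^sup>2" using l L by (intro power_mono) auto
  finally have XL: "X \<le> (2 * L)\<^sup>2 / d" using d by (simp add: X_def divide_right_mono)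
  have "ln (e * X) \<le> e * X - 1" using e X by (intro ln_le_minus_one) simp
  moreover have "ln (e * X) = ln e + ln X" using e X by (simp add: ln_mult_pos)
  moreover have "e * X \<le> e * ((2 * L)\<^sup>2 / d)" using XL e by (intro mult_left_mono) auto
  ultimately have "ln X \<le> e * ((2 * L)\<^sup>2 / d) + \<bar>ln e\<bar>" by linarith
  then have "image_kernel l y z \<le> (e * ((2 * L)\<^sup>2 / d) + \<bar>ln e\<bar>) / 2"
    by (simp add: image_kernel_def X_def d_def)
  moreover have "norm (y - z) \<le> 2 * L" using norm_triangle_ineq4[of y z] yz L by linarith
  ultimately show ?thesis unfolding d_def[symmetric] by (simp add: power_mult_distrib field_simps)
qed

context bubble
begin

text \<open>The part of the punctured ball where the moving sphere comparison
  \<open>gap l \<ge> 0\<close> fails.\<close>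

definition ill :: "real \<Rightarrow> (real^3) set" where
  "ill l = {z. 0 < norm z \<and> norm z < l \<and> gap l z < 0}"

lemma borel_measurable_gap [measurable]: "gap l \<in> borel_measurable borel"
proof -
  have [measurable]: "u \<in> borel_measurable borel" by (rule borel_measurable_continuous_onI[OF u_cont])
  have [measurable]: "inversion l \<in> borel_measurable borel" unfolding inversion_def[abs_def] by measurable
  show ?thesis unfolding gap_def[abs_def] by measurable
qed

lemma ill_measurable [measurable]: "ill l \<in> sets borel"
  unfolding ill_def by measurable

lemma ill_finite: "emeasure lborel (ill l) < \<infinity>"
proof (rule emeasure_bounded_finite)
  show "bounded (ill l)" by (rule bounded_subset[OF bounded_cball[of 0 l]]) (auto simp: ill_def)
qed

lemma continuous_on_gap:
  assumes l: "l > 0"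
  shows "continuous_on (- {0}) (gap l)"
  unfolding gap_def[abs_def] inversion_def
  using l by (intro continuous_intros continuous_on_compose2[OF u_cont]) auto

lemma gap_tendsto:
  assumes f: "(f \<longlongrightarrow> l) F" and l: "l > 0" and y: "y \<noteq> 0"
  shows "((\<lambda>n. gap (f n) y) \<longlongrightarrow> gap l y) F"
proof -
  have "((\<lambda>n. inversion (f n) y) \<longlongrightarrow> inversion l y) F"
    unfolding inversion_def using y by (intro tendsto_intros f) simp
  moreover have "isCont u (inversion l y)" using u_cont by (simp add: continuous_on_eq_continuous_at)
  ultimately have "((\<lambda>n. u (inversion (f n) y)) \<longlongrightarrow> u (inversion l y)) F"
    by (rule isCont_tendsto_compose[rotated])
  then show ?thesis unfolding gap_def using y l by (intro tendsto_intros f) auto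
qed

text \<open>As y approaches the origin its inversion runs to infinity, where u is bounded below by -
  2 * ln (1 + |x|) plus a constant. The term 2 * ln (l / |y|) in the gap compensates exactly this
  loss.\<close>

lemma gap_bounded_below:
  assumes l: "l > 0"
  obtains m where "\<And>y. 0 < norm y \<Longrightarrow> norm y < l \<Longrightarrow> - gap l y \<le> m"
proof -
  obtain C where C: "\<And>y. y \<in> cball 0 l \<Longrightarrow> \<bar>u y\<bar> \<le> C"
    using continuous_on_compact_abs_le[OF continuous_on_subset[OF u_cont] compact_cball[of 0 l]] by auto
  show ?thesis
  proof (rule that[of "C - q + 2 * ln (1 + l)"])
    fix y :: "real^3" assume y: "0 < norm y" "norm y < l"
    let ?s = "1 + l\<^sup>2 / norm y"
    have "- ln ?s * (2 * pi\<^sup>2) \<le> logpot \<rho> (inversion l y)"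
      using logpot_ge[of "inversion l y"] mass unfolding norm_inversion mass_def by simp
    then have "- ln ?s * (2 * pi\<^sup>2) / pi\<^sup>2 \<le> logpot \<rho> (inversion l y) / pi\<^sup>2" by (rule divide_right_mono) simp
    then have 1: "- 2 * ln ?s + q \<le> u (inversion l y)" unfolding rep by simp
    have "ln ?s - ln (l / norm y) = ln (?s / (l / norm y))"
      using y l by (intro ln_divide_pos[symmetric]) (auto intro: add_pos_nonneg)
    also have "?s / (l / norm y) = (norm y + l\<^sup>2) / l" using y l by (simp add: field_simps power2_eq_square)
    also have "ln \<dots> \<le> ln (1 + l)"
    proof (rule ln_mono)
      show "0 < (norm y + l\<^sup>2) / l" using y l by (intro divide_pos_pos add_pos_pos) auto
      show "(norm y + l\<^sup>2) / l \<le> 1 + l" using y l by (simp add: divide_le_eq power2_eq_square algebra_simps)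
    qed
    finally have 2: "ln ?s - ln (l / norm y) \<le> ln (1 + l)" .
    have "u y \<le> C" using C[of y] y by simp
    then show "- gap l y \<le> C - q + 2 * ln (1 + l)" using 1 2 unfolding gap_def by linarith
  qed
qed

text \<open>The integral equation bounds the supremum of \<open>- gap l\<close> over \<open>ill l\<close> by half of itself once \<open>ill l\<close> is small.\<close>

lemma ill_small_empty:
  assumes L: "L > 0"
  obtains d where "d > 0" "\<And>l. 0 < l \<Longrightarrow> l \<le> L \<Longrightarrow> measure lborel (ill l) < d \<Longrightarrow> ill l = {}"
proof -
  obtain C' where C': "\<And>y. y \<in> cball 0 L \<Longrightarrow> \<bar>\<rho> y\<bar> \<le> C'"
    using continuous_on_compact_abs_le[OF continuous_on_subset[OF cont] compact_cball[of 0 L]] by auto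
  define C where "C = \<bar>C'\<bar> + 1"
  have C: "C > 0" "\<And>y. norm y \<le> L \<Longrightarrow> \<rho> y \<le> C" using C' by (force simp: C_def)+
  define J :: "real^3 \<Rightarrow> real" where "J x = indicator (cball 0 (2 * L)) x / (norm x)\<^sup>2" for x
  have iJ: "integrable lborel J" unfolding J_def by (rule integrable_indicator_div_norm_sq)
  define I where "I = (\<integral>x. J x \<partial>lborel)"
  have J0: "J x \<ge> 0" for x by (simp add: J_def)
  have I: "I \<ge> 0" unfolding I_def by (intro integral_nonneg_AE AE_I2 J0)
  \<comment> \<open>The parameter e makes the singular part of the kernel contribute at most pi^2 /
    4, and d below does the same for the constant part; together they give the factor 1 / 2.\<close>
  define e where "e = pi\<^sup>2 / (24 * C * L\<^sup>2 * (I + 1))"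
  have e: "e > 0" using C L I unfolding e_def by (intro divide_pos_pos mult_pos_pos) auto
  define b where "b = \<bar>ln e\<bar>"
  have b: "b \<ge> 0" by (simp add: b_def)
  define d where "d = pi\<^sup>2 / (6 * C * (b + 1))"
  have d: "d > 0" using C b unfolding d_def by (intro divide_pos_pos mult_pos_pos) auto
  have frac: "p * (t / (c * (t + 1))) \<le> p / c" if "t \<ge> 0" "p \<ge> 0" "c > 0" for t p c :: real
  proof -
    have "t / (c * (t + 1)) \<le> 1 / c" using that by (simp add: divide_le_eq)
    then have "p * (t / (c * (t + 1))) \<le> p * (1 / c)" using that(2) by (rule mult_left_mono)
    then show ?thesis by simp
  qed
  have small: "3 * C * (2 * e * L\<^sup>2 * I + b / 2 * d) \<le> pi\<^sup>2 / 2"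
  proof -
    have "3 * C * (2 * e * L\<^sup>2 * I) = pi\<^sup>2 * (I / (4 * (I + 1)))"
    proof -
      have gen: "3 * c * (2 * (p / (24 * c * m * j)) * m * i) = p * (i / (4 * j))" if "c \<noteq> 0" "m \<noteq> 0" for c m j p i :: real
        using that by (cases "j = 0") (simp_all add: field_simps)
      show ?thesis unfolding e_def by (rule gen) (use C(1) L in simp_all)
    qed
    also have "\<dots> \<le> pi\<^sup>2 / 4" by (rule frac) (use I in auto)
    finally have 1: "3 * C * (2 * e * L\<^sup>2 * I) \<le> pi\<^sup>2 / 4" .
    have "3 * C * (b / 2 * d) = pi\<^sup>2 * (b / (4 * (b + 1)))"
    proof -
      have gen: "3 * c * (i / 2 * (p / (6 * c * j))) = p * (i / (4 * j))" if "c \<noteq> 0" for c j p i :: real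
        using that by (cases "j = 0") (simp_all add: field_simps)
      show ?thesis unfolding d_def by (rule gen) (use C(1) in simp)
    qed
    also have "\<dots> \<le> pi\<^sup>2 / 4" by (rule frac) (use b in auto)
    finally show ?thesis using 1 unfolding distrib_left by linarith
  qed
  show ?thesis
  proof (rule that[OF d])
    fix l assume l: "0 < l" "l \<le> L" and m: "measure lborel (ill l) < d"
    show "ill l = {}"
    proof (rule ccontr)
      assume ne: "ill l \<noteq> {}"
      obtain m0 where m0: "\<And>y. 0 < norm y \<Longrightarrow> norm y < l \<Longrightarrow> - gap l y \<le> m0" using gap_bounded_below[OF l(1)] by blast
      let ?A = "(\<lambda>y. - gap l y) ` ill l"
      define S where "S = Sup ?A"
      have bdd: "bdd_above ?A" by (rule bdd_aboveI2[of _ _ m0]) (auto simp: ill_def m0)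
      have S: "- gap l y \<le> S" if "y \<in> ill l" for y unfolding S_def using that by (intro cSup_upper bdd) auto
      obtain y0 where y0: "y0 \<in> ill l" using ne by auto
      have S0: "S > 0" using S[OF y0] y0 by (simp add: ill_def)
      have "- gap l y \<le> S / 2" if y: "y \<in> ill l" for y
      proof -
        have y': "0 < norm y" "norm y < l" using y by (auto simp: ill_def)
        let ?B = "{z::real^3. 0 < norm z \<and> norm z < l}"
        let ?G = "\<lambda>z. indicator ?B z * (image_kernel l y z * \<rho> z * (exp (3 * gap l z) - 1))"
        let ?U = "\<lambda>z. 3 * C * S * (2 * e * L\<^sup>2 * J (y - z) + b / 2 * indicator (ill l) z)"
        have iJy: "integrable lborel (\<lambda>z. J (y - z))" using iJ integrable_reflect_iff[of J y] by simp
        have iN: "integrable lborel (indicator (ill l) :: _ \<Rightarrow> real)"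
          by (rule integrable_real_indicator[OF _ ill_finite]) simp
        note iU = Bochner_Integration.integrable_add[OF integrable_mult_right[OF iJy] integrable_mult_right[OF iN]]
        have U0: "0 \<le> ?U z" for z
          using C(1) S0 e b J0 by (intro mult_nonneg_nonneg add_nonneg_nonneg) auto
        \<comment> \<open>Outside \<open>ill l\<close> the integrand is nonnegative and may be
          dropped; on it 1 - exp (3 * gap) is at most 3 * S.\<close>
        have le: "- ?G z \<le> ?U z" for z
        proof (cases "z \<in> ill l")
          case True
          then have z: "0 < norm z" "norm z < l" "gap l z < 0" "norm z \<le> L" using l by (auto simp: ill_def)
          have k: "image_kernel l y z \<le> 2 * e * L\<^sup>2 * J (y - z) + b / 2"
            unfolding J_def b_def by (rule image_kernel_le[OF y'(2) z(2) l(2) e])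
          have "1 + 3 * gap l z \<le> exp (3 * gap l z)" by (rule exp_ge_add_one_self)
          then have g: "1 - exp (3 * gap l z) \<le> 3 * S" using S[OF True] by linarith
          have "(image_kernel l y z * \<rho> z) * (1 - exp (3 * gap l z)) \<le> ((2 * e * L\<^sup>2 * J (y - z) + b / 2) * C) * (3 * S)"
            using k C(2)[OF z(4)] g z y' nonneg[of z] image_kernel_nonneg[OF y'(2) z(2)] J0[of "y - z"] e b C(1)
            by (intro mult_mono) auto
          then show ?thesis using True z by (simp add: algebra_simps)
        next
          case False
          show ?thesis
          proof (cases "z \<in> ?B")
            case True
            then have "0 \<le> exp (3 * gap l z) - 1" using False by (simp add: ill_def)
            moreover have "0 \<le> image_kernel l y z" using True y' by (intro image_kernel_nonneg) auto
            ultimately have "0 \<le> ?G z" by (simp add: nonneg)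
            then show ?thesis using U0[of z] by linarith
          next
            case False
            then show ?thesis using U0[of z] by simp
          qed
        qed
        have "pi\<^sup>2 * (- gap l y) = - (\<integral>z. ?G z \<partial>lborel)"
          unfolding gap_integral_equation[OF y'] by simp
        also have "\<dots> = (\<integral>z. - ?G z \<partial>lborel)" by simp
        also have "\<dots> \<le> (\<integral>z. ?U z \<partial>lborel)"
          by (intro integral_mono integrable_minus integrable_gap_kernel y' integrable_mult_right iU le)
        also have "\<dots> = 3 * C * S * (2 * e * L\<^sup>2 * I + b / 2 * measure lborel (ill l))"
          unfolding integral_mult_right_zero Bochner_Integration.integral_add[OF integrable_mult_right[OF iJy] integrable_mult_right[OF iN]]
            I_def integral_reflect[of J y] by simp
        also have "\<dots> \<le> 3 * C * S * (2 * e * L\<^sup>2 * I + b / 2 * d)"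
          using C(1) S0 b m by (intro mult_left_mono add_left_mono) auto
        also have "\<dots> = S * (3 * C * (2 * e * L\<^sup>2 * I + b / 2 * d))" by simp
        also have "\<dots> \<le> S * (pi\<^sup>2 / 2)" using S0 by (intro mult_left_mono small) auto
        finally have "pi\<^sup>2 * (- gap l y) \<le> pi\<^sup>2 * (S / 2)" by (simp add: mult.commute)
        then show ?thesis by (rule mult_left_le_imp_le) simp
      qed
      then have "S \<le> S / 2" unfolding S_def using ne by (intro cSup_least) auto
      then show False using S0 by simp
    qed
  qed
qed

text \<open>Only interior points need an assumption: points outside the limiting sphere leave the
  balls eventually, and the sphere itself is a null set.\<close>

lemma measure_ill_tendsto:
  assumes f: "f \<longlonglongrightarrow> l" and y: "\<And>y. 0 < norm y \<Longrightarrow> norm y < l \<Longrightarrow> \<forall>\<^sub>F n in sequentially. y \<notin> ill (f n)"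
    and b: "\<And>n. f n \<le> L"
  shows "(\<lambda>n. measure lborel (ill (f n))) \<longlonglongrightarrow> 0"
proof -
  have "(\<lambda>n. \<integral>z. (indicator (ill (f n)) z :: real) \<partial>lborel) \<longlonglongrightarrow> (\<integral>z. 0 \<partial>(lborel :: (real^3) measure))"
  proof (rule integral_dominated_convergence[where w = "indicator (cball 0 L) :: real^3 \<Rightarrow> real"])
    show "integrable lborel (indicator (cball 0 L) :: real^3 \<Rightarrow> real)"
      by (intro integrable_real_indicator emeasure_bounded_finite) auto
    have "sphere (0::real^3) l \<in> null_sets lborel"
      using negligible_sphere[of "0::real^3" l] by (auto simp: null_sets_completion_iff negligible_iff_null_sets)
    then have "AE z in lborel. z \<notin> sphere (0::real^3) l" by (rule AE_not_in)
    then show "AE z in lborel. (\<lambda>n. indicator (ill (f n)) z :: real) \<longlonglongrightarrow> 0"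
    proof eventually_elim
      case (elim z)
      have "\<forall>\<^sub>F n in sequentially. z \<notin> ill (f n)"
      proof (cases "0 < norm z \<and> norm z < l")
        case True
        then show ?thesis using y by auto
      next
        case False
        then have "z = 0 \<or> l < norm z" using elim by auto
        then show ?thesis
        proof
          assume "l < norm z"
          with f have "\<forall>\<^sub>F n in sequentially. f n < norm z" by (rule order_tendstoD)
          then show ?thesis by eventually_elim (simp add: ill_def)
        qed (simp add: ill_def)
      qed
      then have "\<forall>\<^sub>F n in sequentially. (indicator (ill (f n)) z :: real) = 0" by eventually_elim simp
      then show ?case by (rule tendsto_eventually)
    qed
    show "AE z in lborel. norm (indicator (ill (f n)) z :: real) \<le> indicator (cball 0 L) z" for n
      using b[of n] by (intro AE_I2) (auto simp: ill_def indicator_def)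
  qed simp_all
  then show ?thesis by simp
qed


text \<open>If no sphere failed, the choice l = sqrt 2 * |y| would give \<open>\<rho>\<close> y
  \<le> 8 * \<open>\<rho>\<close> (2 * y) for all y. Both sides have the same integral, so equality
  would hold everywhere, which is absurd at y = 0.\<close>

lemma exists_ill: "\<exists>l>0. ill l \<noteq> {}"
proof (rule ccontr)
  assume "\<not> ?thesis"
  then have ok: "ill l = {}" if "l > 0" for l using that by blast
  let ?g = "\<lambda>y. 8 * \<rho> (0 + 2 *\<^sub>R y) - \<rho> y"
  have g: "0 \<le> ?g y" for y
  proof (cases "y = 0")
    case False
    \<comment> \<open>The radius whose inversion sends y to 2 * y.\<close>
    define l where "l = sqrt 2 * norm y"
    have l: "l > 0" "norm y < l" "l\<^sup>2 = 2 * (norm y)\<^sup>2" using False by (simp_all add: l_def power_mult_distrib)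
    have "y \<notin> ill l" using ok[OF l(1)] by simp
    then have "0 \<le> gap l y" using False l by (simp add: ill_def)
    moreover have "inversion l y = 2 *\<^sub>R y" using False by (simp add: inversion_def l)
    moreover have "l / norm y = sqrt 2" using False by (simp add: l_def)
    then have "2 * ln (l / norm y) = ln 2" by (simp add: ln_sqrt)
    ultimately have "u y \<le> u (2 *\<^sub>R y) + ln 2" unfolding gap_def by simp
    then have "exp (3 * u y) \<le> exp (3 * u (2 *\<^sub>R y) + real 3 * ln 2)" by simp
    also have "\<dots> = exp (3 * u (2 *\<^sub>R y)) * 2 ^ 3" unfolding exp_add exp_of_nat_mult by simp
    finally show ?thesis unfolding density by simp
  qed (simp add: nonneg)
  have i2: "integrable lborel (\<lambda>y. 8 * \<rho> (0 + 2 *\<^sub>R y))"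
    using int integrable_affine_iff[of 2 \<rho> 0] by simp
  have "?g 0 = 0"
  proof (rule integral_eq_0_continuous[OF _ g])
    show "continuous_on UNIV ?g" by (intro continuous_intros continuous_on_compose2[OF cont] cont) auto
    show "integrable lborel ?g" by (intro Bochner_Integration.integrable_diff i2 int)
    have "(\<integral>y. \<rho> (0 + 2 *\<^sub>R y) \<partial>lborel) = mass / 8"
      unfolding mass_def by (subst integral_affine) simp_all
    then show "(\<integral>y. ?g y \<partial>lborel) = 0"
      unfolding Bochner_Integration.integral_diff[OF i2 int] integral_mult_right_zero mass_def by simp
  qed
  then show False using pos[of 0] by simp
qed

text \<open>A strong maximum principle: if the gap vanishes at one point, the integral of a
  nonnegative function vanishes. The kernel is positive, so the gap vanishes almost everywhere in
  the ball, and by continuity everywhere.\<close>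

lemma gap_strict:
  assumes l: "ill l = {}" and y1: "0 < norm y1" "norm y1 < l" "gap l y1 \<noteq> 0" and y: "0 < norm y" "norm y < l"
  shows "gap l y > 0"
proof -
  have l0: "l > 0" by (rule less_trans[OF y])
  let ?B = "{z::real^3. 0 < norm z \<and> norm z < l}"
  let ?G = "\<lambda>z. indicator ?B z * (image_kernel l y z * \<rho> z * (exp (3 * gap l z) - 1))"
  have g: "0 \<le> gap l z" if "0 < norm z" "norm z < l" for z
  proof -
    have "z \<notin> ill l" using l by simp
    then show ?thesis using that by (simp add: ill_def)
  qed
  have G0: "0 \<le> ?G z" for z
  proof (cases "z \<in> ?B")
    case True
    then have "0 \<le> exp (3 * gap l z) - 1" using g[of z] by simp
    moreover have "0 \<le> image_kernel l y z" using True y by (intro image_kernel_nonneg) auto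
    ultimately show ?thesis by (simp add: nonneg)
  qed simp
  have "gap l y \<noteq> 0"
  proof
    assume "gap l y = 0"
    then have "(\<integral>z. ?G z \<partial>lborel) = 0" using gap_integral_equation[OF y] by simp
    then have "AE z in lborel. ?G z = 0"
      using integral_nonneg_eq_0_iff_AE[OF integrable_gap_kernel[OF y]] G0 by simp
    then have ae: "AE z in lborel. z \<in> - (?B \<inter> {z \<in> - {0}. 0 < gap l z})"
      using AE_lborel_singleton[of y]
    proof eventually_elim
      case (elim z)
      show ?case
      proof
        assume z: "z \<in> ?B \<inter> {z \<in> - {0}. 0 < gap l z}"
        then have "0 < image_kernel l y z" using y elim by (intro image_kernel_pos) auto
        moreover have "0 < exp (3 * gap l z) - 1" using z by simp
        ultimately have "0 < ?G z" using z pos[of z] by simp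
        with elim(1) show False by (simp only: less_irrefl)
      qed
    qed
    have "open {z \<in> - {0}. 0 < gap l z}"
    proof -
      have "open (gap l -` {0<..} \<inter> - {0})"
        using continuous_on_open_vimage[of "- {0}" "gap l"] continuous_on_gap[OF l0] by (simp add: open_Compl)
      moreover have "gap l -` {0<..} \<inter> - {0} = {z \<in> - {0}. 0 < gap l z}" by auto
      ultimately show ?thesis by simp
    qed
    moreover have "open ?B" by (intro open_Collect_conj open_Collect_less continuous_intros)
    ultimately have "closed (- (?B \<inter> {z \<in> - {0}. 0 < gap l z}))" by (intro closed_Compl open_Int)
    then have "y1 \<in> - (?B \<inter> {z \<in> - {0}. 0 < gap l z})"
      by (rule mem_closed_if_AE_lebesgue) (rule AE_completion[OF ae])
    then show False using y1 g[OF y1(1,2)] by auto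
  qed
  then show ?thesis using g[OF y] by simp
qed

text \<open>The sphere is the critical one, whose radius is the infimum of the radii at which the
  comparison fails. Were the gap positive somewhere inside, it would be positive throughout, and
  failing spheres of slightly larger radius would have failure sets of vanishing measure.\<close>

lemma exists_symmetric_sphere: "\<exists>l>0. \<forall>y. y \<noteq> 0 \<longrightarrow> gap l y = 0"
proof -
  define Bad where "Bad = {l. 0 < l \<and> ill l \<noteq> {}}"
  have ne: "Bad \<noteq> {}" using exists_ill by (auto simp: Bad_def)
  have bdd: "bdd_below Bad" by (rule bdd_belowI[of _ 0]) (simp add: Bad_def)
  define l where "l = Inf Bad"
  have l0: "l \<ge> 0" unfolding l_def using ne by (intro cInf_greatest) (auto simp: Bad_def)
  have "\<exists>x\<in>Bad. x < l + 1 / real (Suc n)" for n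
    using cInf_lessD[OF ne, of "l + 1 / real (Suc n)"] unfolding l_def by simp
  then obtain f where f: "\<And>n. f n \<in> Bad" "\<And>n. f n < l + 1 / real (Suc n)" by metis
  have fl: "l \<le> f n" for n unfolding l_def using f(1) bdd by (intro cInf_lower)
  have f1: "f n \<le> l + 1" for n
  proof -
    have "1 / real (Suc n) \<le> 1" by simp
    then show ?thesis using f(2)[of n] by linarith
  qed
  have lim: "f \<longlonglongrightarrow> l"
  proof (rule real_tendsto_sandwich[OF _ _ tendsto_const])
    show "(\<lambda>n. l + 1 / real (Suc n)) \<longlonglongrightarrow> l" by real_asymp
    show "\<forall>\<^sub>F n in sequentially. f n \<le> l + 1 / real (Suc n)" using f(2) by (intro always_eventually allI less_imp_le)
  qed (use fl in simp)
  have "l + 1 > 0" using l0 by simp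
  then obtain d where d: "d > 0" "\<And>k. 0 < k \<Longrightarrow> k \<le> l + 1 \<Longrightarrow> measure lborel (ill k) < d \<Longrightarrow> ill k = {}"
    using ill_small_empty by blast
  \<comment> \<open>The principle used twice, once for positivity of the critical radius and once
    for vanishing of the gap: failure sets that shrink to nothing pointwise shrink in measure, and
    are then empty although the radii are bad.\<close>
  have contra: False if y: "\<And>y. 0 < norm y \<Longrightarrow> norm y < l \<Longrightarrow> \<forall>\<^sub>F n in sequentially. y \<notin> ill (f n)"
  proof -
    have "(\<lambda>n. measure lborel (ill (f n))) \<longlonglongrightarrow> 0" by (rule measure_ill_tendsto[OF lim y f1])
    then have "\<forall>\<^sub>F n in sequentially. measure lborel (ill (f n)) < d" using d(1) by (rule order_tendstoD)
    then obtain n where "measure lborel (ill (f n)) < d" by (auto simp: eventually_sequentially)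
    then have "ill (f n) = {}" using f(1)[of n] f1[of n] by (intro d(2)) (auto simp: Bad_def)
    then show False using f(1)[of n] by (simp add: Bad_def)
  qed
  have lpos: "l > 0"
  proof (rule ccontr)
    assume "\<not> l > 0"
    show False
    proof (rule contra)
      fix y :: "real^3" assume "0 < norm y" "norm y < l"
      with \<open>\<not> l > 0\<close> have False by linarith
      then show "\<forall>\<^sub>F n in sequentially. y \<notin> ill (f n)" ..
    qed
  qed
  have good: "0 \<le> gap l y" if y: "0 < norm y" "norm y < l" for y
  proof -
    \<comment> \<open>Radii below the infimum are not bad; the comparison passes to their limit. The
      first radius of this sequence is 0, so it is used only eventually.\<close>
    have t: "(\<lambda>n. l * (1 - 1 / real (Suc n))) \<longlonglongrightarrow> l" by real_asymp
    then have "\<forall>\<^sub>F n in sequentially. norm y < l * (1 - 1 / real (Suc n))" using y(2) by (rule order_tendstoD)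
    then have "\<forall>\<^sub>F n in sequentially. 0 \<le> gap (l * (1 - 1 / real (Suc n))) y"
    proof eventually_elim
      case (elim n)
      let ?k = "l * (1 - 1 / real (Suc n))"
      have "?k < l * 1" using lpos by (intro mult_strict_left_mono) auto
      then have "?k \<notin> Bad" using cInf_lower[OF _ bdd, of ?k] unfolding l_def[symmetric] by auto
      moreover have "0 < ?k" using elim y by linarith
      ultimately have "y \<notin> ill ?k" by (simp add: Bad_def)
      then show ?case using elim y by (simp add: ill_def)
    qed
    then show ?thesis
      by (rule tendsto_lowerbound[OF gap_tendsto[OF t lpos] _ sequentially_bot, rotated]) (use y in auto)
  qed
  then have empty: "ill l = {}" unfolding ill_def by fastforce
  have zero: "gap l y = 0" if y: "0 < norm y" "norm y < l" for y
  proof (rule ccontr)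
    assume y1: "gap l y \<noteq> 0"
    show False
    proof (rule contra)
      fix z :: "real^3" assume z: "0 < norm z" "norm z < l"
      have "0 < gap l z" by (rule gap_strict[OF empty y y1 z])
      moreover have "(\<lambda>n. gap (f n) z) \<longlonglongrightarrow> gap l z" using z by (intro gap_tendsto lim lpos) auto
      ultimately have "\<forall>\<^sub>F n in sequentially. 0 < gap (f n) z" by (rule order_tendstoD(1)[rotated])
      then show "\<forall>\<^sub>F n in sequentially. z \<notin> ill (f n)" by eventually_elim (simp add: ill_def)
    qed
  qed
  have "gap l y = 0" if y: "y \<noteq> 0" for y
  proof -
    have ny: "norm y > 0" using y by simp
    consider "norm y < l" | "norm y = l" | "norm y > l" by linarith
    then show ?thesis
    proof cases
      case 1
      then show ?thesis using zero[of y] y by simp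
    next
      case 2
      then have "inversion l y = y" using lpos by (simp add: inversion_def)
      then show ?thesis using 2 lpos by (simp add: gap_def)
    next
      case 3
      have n: "0 < norm (inversion l y)" "norm (inversion l y) < l"
        unfolding norm_inversion using 3 lpos ny by (simp_all add: power2_eq_square divide_less_eq)
      \<comment> \<open>Under inversion the gap changes sign, so its vanishing inside the sphere
        carries over to the outside.\<close>
      have "ln (l / norm (inversion l y)) = - ln (l / norm y)"
        unfolding norm_inversion using lpos ny by (simp add: ln_divide_pos power2_eq_square ln_mult_pos)
      then show ?thesis using zero[OF n] unfolding gap_def inversion_inversion[OF lpos] by simp
    qed
  qed
  then show ?thesis using lpos by blast
qed

end

subsection \<open>Classification\<close>

context bubble
begin

text \<open>The potential of the translated density differs from the translated potential by a
  constant, which is absorbed into a new q. Thus every point may serve as centre.\<close>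

lemma translate: "\<exists>q'. bubble (\<lambda>x. \<rho> (a + x)) (\<lambda>x. u (a + x)) q'"
proof -
  interpret T: log_density "\<lambda>x. \<rho> (a + x)"
  proof
    show "continuous_on UNIV (\<lambda>x. \<rho> (a + x))"
      by (rule continuous_on_compose2[OF cont]) (auto intro!: continuous_intros)
    show "integrable lborel (\<lambda>x. \<rho> (a + x))" using int integrable_translate_iff[of \<rho> a] by simp
  qed (rule pos)
  have d: "logpot (\<lambda>x. \<rho> (a + x)) x - logpot (\<lambda>x. \<rho> (a + x)) 0 = logpot \<rho> (a + x) - logpot \<rho> a" for x
    using integral_translate[of "\<lambda>y. ln (norm (a - y) / norm (a + x - y)) * \<rho> y" a]
    unfolding T.logpot_diff logpot_diff by simp
  have "bubble (\<lambda>x. \<rho> (a + x)) (\<lambda>x. u (a + x)) (logpot \<rho> a / pi\<^sup>2 + q - logpot (\<lambda>x. \<rho> (a + x)) 0 / pi\<^sup>2)"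
  proof
    show "\<rho> (a + x) = exp (3 * u (a + x))" for x by (rule density)
    show "u (a + x) = logpot (\<lambda>x. \<rho> (a + x)) x / pi\<^sup>2 + (logpot \<rho> a / pi\<^sup>2 + q - logpot (\<lambda>x. \<rho> (a + x)) 0 / pi\<^sup>2)" for x
    proof -
      have "logpot \<rho> (a + x) = logpot (\<lambda>x. \<rho> (a + x)) x - logpot (\<lambda>x. \<rho> (a + x)) 0 + logpot \<rho> a" using d[of x] by simp
      then show ?thesis unfolding rep[of "a + x"] by (simp add: add_divide_distrib diff_divide_distrib)
    qed
    show "T.mass = 2 * pi\<^sup>2" unfolding T.mass_def integral_translate mass[unfolded mass_def] ..
    show "continuous_on UNIV (\<lambda>x. u (a + x))"
      by (rule continuous_on_compose2[OF u_cont]) (auto intro!: continuous_intros)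
  qed
  then show ?thesis ..
qed

lemma exists_symmetric_sphere_at: "\<exists>l>0. \<forall>y. y \<noteq> 0 \<longrightarrow> u (a + inversion l y) + 2 * ln (l / norm y) = u (a + y)"
proof -
  obtain q' where "bubble (\<lambda>x. \<rho> (a + x)) (\<lambda>x. u (a + x)) q'" using translate by blast
  then interpret T: bubble "\<lambda>x. \<rho> (a + x)" "\<lambda>x. u (a + x)" q' .
  show ?thesis using T.exists_symmetric_sphere unfolding T.gap_def by simp
qed

text \<open>\<open>exp (A - u a)\<close> is the squared radius of the symmetric sphere around \<open>a\<close>; the inversion in this sphere turns
  the Taylor expansion of \<open>\<lambda>x. exp (A - u x)\<close> at \<open>a\<close> into its expansion at infinity, which does not depend on \<open>a\<close>.\<close>

lemma reciprocal_expansion: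
  "\<exists>A. \<forall>a e f'. norm e = 1 \<longrightarrow> ((\<lambda>x. exp (A - u x)) has_derivative f') (at a) \<longrightarrow>
    ((\<lambda>s. (exp (A - u (s *\<^sub>R e)) - s\<^sup>2) / s) \<longlongrightarrow> f' e - 2 * (e \<bullet> a)) at_top"
proof -
  obtain lam where lam: "\<And>a. lam a > 0" "\<And>a y. y \<noteq> 0 \<Longrightarrow> u (a + inversion (lam a) y) + 2 * ln (lam a / norm y) = u (a + y)"
    using exists_symmetric_sphere_at by metis
  \<comment> \<open>Here s * D is s * e - a, the position relative to a of the far point s * e, and
    \<open>h a e s\<close> is its inversion in the symmetric sphere around a. As s grows, D tends to
    e and h to 0.\<close>
  define D :: "real^3 \<Rightarrow> real^3 \<Rightarrow> real \<Rightarrow> real^3" where "D a e s = e - (1 / s) *\<^sub>R a" for a e s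
  define h where "h a e s = ((lam a)\<^sup>2 / (s * (norm (D a e s))\<^sup>2)) *\<^sub>R D a e s" for a e s
  have s0: "((\<lambda>s::real. 1 / s) \<longlongrightarrow> 0) at_top" by real_asymp
  have D: "(D a e \<longlongrightarrow> e) at_top" for a e
  proof -
    have "(D a e \<longlongrightarrow> e - 0 *\<^sub>R a) at_top" unfolding D_def by (intro tendsto_intros s0)
    then show ?thesis by simp
  qed
  have nD: "((\<lambda>s. norm (D a e s)) \<longlongrightarrow> 1) at_top" if "norm e = 1" for a e
    using tendsto_norm[OF D[of a e]] that by simp
  have h: "(h a e \<longlongrightarrow> 0) at_top" if e: "norm e = 1" for a e
  proof -
    have "((\<lambda>s. ((lam a)\<^sup>2 * (1 / s) / (norm (D a e s))\<^sup>2) *\<^sub>R D a e s) \<longlongrightarrow> ((lam a)\<^sup>2 * 0 / 1\<^sup>2) *\<^sub>R e) at_top"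
      by (intro tendsto_intros s0 nD D e) simp
    then show ?thesis by (simp add: h_def[abs_def])
  qed
  have ev: "\<forall>\<^sub>F s in at_top. s > 0 \<and> norm (D a e s) > 0" if "norm e = 1" for a e
    using order_tendstoD(1)[OF nD[OF that, of a] zero_less_one] eventually_gt_at_top[of 0] by eventually_elim simp
  have val: "u (s *\<^sub>R e) = u (a + h a e s) + 2 * ln (lam a) - 2 * ln s - 2 * ln (norm (D a e s))"
    if s: "s > 0" "norm (D a e s) > 0" for a e s
  proof -
    have y: "s *\<^sub>R e - a = s *\<^sub>R D a e s" using s by (simp add: D_def algebra_simps)
    have "inversion (lam a) (s *\<^sub>R D a e s) = h a e s"
      using s by (simp add: inversion_def h_def power2_eq_square)
    moreover have "ln (lam a / norm (s *\<^sub>R D a e s)) = ln (lam a) - ln s - ln (norm (D a e s))"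
      using s lam(1)[of a] by (simp add: ln_divide_pos ln_mult_pos)
    moreover have "u (s *\<^sub>R e) = u (a + (s *\<^sub>R D a e s))" by (simp add: y[symmetric])
    ultimately show ?thesis using lam(2)[of "s *\<^sub>R D a e s" a] s by simp
  qed
  have lim: "((\<lambda>s. u (s *\<^sub>R e) + 2 * ln s) \<longlongrightarrow> u a + 2 * ln (lam a)) at_top" if e: "norm e = 1" for a e
  proof -
    have "isCont u (a + 0)" using u_cont by (simp add: continuous_on_eq_continuous_at)
    moreover have "((\<lambda>s. a + h a e s) \<longlongrightarrow> a + 0) at_top" by (intro tendsto_intros h e)
    ultimately have "((\<lambda>s. u (a + h a e s)) \<longlongrightarrow> u (a + 0)) at_top" by (rule isCont_tendsto_compose)
    then have "((\<lambda>s. u (a + h a e s) + 2 * ln (lam a) - 2 * ln (norm (D a e s))) \<longlongrightarrow> u (a + 0) + 2 * ln (lam a) - 2 * ln 1) at_top"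
      by (intro tendsto_intros nD e) simp_all
    moreover have "\<forall>\<^sub>F s in at_top. u (a + h a e s) + 2 * ln (lam a) - 2 * ln (norm (D a e s)) = u (s *\<^sub>R e) + 2 * ln s"
      using ev[OF e, of a]
    proof eventually_elim
      case (elim s)
      then show ?case using val[of s a e] by linarith
    qed
    ultimately show ?thesis by (simp add: tendsto_cong)
  qed
  \<comment> \<open>The asymptotic constant of u along a ray. Computing it from the sphere around
    any a gives u a + 2 * ln (lam a), which is therefore independent of a.\<close>
  define A where "A = u 0 + 2 * ln (lam 0)"
  have A: "A = u a + 2 * ln (lam a)" for a
    unfolding A_def using tendsto_unique[OF _ lim[of "axis 1 1" 0] lim[of "axis 1 1" a]] by (simp add: norm_axis_1)
  let ?Q = "\<lambda>x. exp (A - u x)"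
  have Qlam: "?Q a = (lam a)\<^sup>2" for a
  proof -
    have "?Q a = exp (real 2 * ln (lam a))" using A[of a] by simp
    also have "\<dots> = (lam a)\<^sup>2" unfolding exp_of_nat_mult using lam(1)[of a] by simp
    finally show ?thesis .
  qed
  show ?thesis
  proof (intro exI[of _ A] allI impI)
    fix a e :: "real^3" and f' assume e: "norm e = 1" and f': "(?Q has_derivative f') (at a)"
    interpret f': bounded_linear f' by (rule has_derivative_bounded_linear[OF f'])
    \<comment> \<open>The remainder quotient of the first order expansion of \<open>?Q\<close> at a;
      evaluated along h it tends to 0.\<close>
    let ?G = "\<lambda>k. (?Q (a + k) - ?Q a - f' k) / norm k"
    have G: "(?G \<longlongrightarrow> 0) (at 0)"
      using f' unfolding has_derivative_at by (auto intro: tendsto_norm_zero_cancel)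
    have hnz: "\<forall>\<^sub>F s in at_top. h a e s \<noteq> 0"
      using ev[OF e, of a] by eventually_elim (use lam(1)[of a] in \<open>simp add: h_def\<close>)
    have Gh: "((\<lambda>s. ?G (h a e s)) \<longlongrightarrow> 0) at_top"
      by (rule filterlim_compose[OF G]) (simp add: filterlim_at h e hnz)
    have "((\<lambda>s. - 2 * (e \<bullet> a) + (norm a)\<^sup>2 * (1 / s) + f' (D a e s) + norm (D a e s) * ?G (h a e s)) \<longlongrightarrow>
        - 2 * (e \<bullet> a) + (norm a)\<^sup>2 * 0 + f' e + 1 * 0) at_top"
      by (intro tendsto_add tendsto_const tendsto_mult s0 f'.tendsto D nD e Gh)
    moreover have "\<forall>\<^sub>F s in at_top. - 2 * (e \<bullet> a) + (norm a)\<^sup>2 * (1 / s) + f' (D a e s) + norm (D a e s) * ?G (h a e s) = (?Q (s *\<^sub>R e) - s\<^sup>2) / s"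
      using ev[OF e, of a]
    proof eventually_elim
      case (elim s)
      define n where "n = norm (D a e s)"
      have s: "s > 0" "n > 0" using elim unfolding n_def by (rule conjunct1, rule conjunct2)
      have l: "lam a > 0" by (rule lam)
      have nh: "norm (h a e s) = (lam a)\<^sup>2 / (s * n)"
        using s by (simp add: h_def n_def[symmetric] power2_eq_square)
      have "?Q (s *\<^sub>R e) = exp ((A - u (a + h a e s)) + real 2 * ln s + real 2 * ln n - real 2 * ln (lam a))"
        using val[of s a e] s by (simp add: n_def)
      also have "\<dots> = ?Q (a + h a e s) * s\<^sup>2 * n\<^sup>2 / (lam a)\<^sup>2"
        unfolding exp_diff[of _ "real 2 * ln (lam a)"] exp_add exp_of_nat_mult using s l by simp
      finally have 1: "?Q (s *\<^sub>R e) = ?Q (a + h a e s) * s\<^sup>2 * n\<^sup>2 / (lam a)\<^sup>2" .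
      have fh: "f' (h a e s) = (lam a)\<^sup>2 / (s * n\<^sup>2) * f' (D a e s)"
        unfolding h_def f'.scaleR n_def by simp
      have "n * ?G (h a e s) = (?Q (a + h a e s) - (lam a)\<^sup>2 - (lam a)\<^sup>2 / (s * n\<^sup>2) * f' (D a e s)) * (s * n\<^sup>2) / (lam a)\<^sup>2"
        unfolding nh fh Qlam using s by (simp add: power2_eq_square)
      also have "\<dots> = ?Q (s *\<^sub>R e) / s - s * n\<^sup>2 - f' (D a e s)"
        unfolding 1 using s l by (simp add: field_simps power2_eq_square)
      finally have 2: "n * ?G (h a e s) = ?Q (s *\<^sub>R e) / s - s * n\<^sup>2 - f' (D a e s)" .
      have "n\<^sup>2 = e \<bullet> e - 2 * (e \<bullet> a) * (1 / s) + (a \<bullet> a) * (1 / s) * (1 / s)"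
        unfolding n_def D_def power2_norm_eq_inner using s(1)
        by (simp add: inner_diff_left inner_diff_right inner_commute[of a e] field_simps)
      moreover have "e \<bullet> e = 1" using e by (simp add: norm_eq_1)
      ultimately have "s * n\<^sup>2 = s - 2 * (e \<bullet> a) + (norm a)\<^sup>2 * (1 / s)"
        using s by (simp add: power2_norm_eq_inner field_simps)
      moreover have "(?Q (s *\<^sub>R e) - s\<^sup>2) / s = ?Q (s *\<^sub>R e) / s - s"
        using s by (simp add: diff_divide_distrib power2_eq_square)
      ultimately show ?case using 2 unfolding n_def[symmetric] by linarith
    qed
    ultimately show "((\<lambda>s. (?Q (s *\<^sub>R e) - s\<^sup>2) / s) \<longlongrightarrow> f' e - 2 * (e \<bullet> a)) at_top"
      by (simp add: tendsto_cong)
  qed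
qed


text \<open>The limit at infinity in \<open>reciprocal_expansion\<close> does not involve a, so the
  gradient of exp (A - u) at x minus 2 * x is constant. Integration gives D + |x - x0|^2. Inversion
  symmetry leaves an additive constant in u free; the critical mass fixes it.\<close>

lemma spherical_if_differentiable:
  assumes du: "\<And>x. (u has_derivative u' x) (at x)"
  shows "spherical u"
proof -
  obtain A where "\<forall>a e f'. norm e = 1 \<longrightarrow> ((\<lambda>x. exp (A - u x)) has_derivative f') (at a) \<longrightarrow>
        ((\<lambda>s. (exp (A - u (s *\<^sub>R e)) - s\<^sup>2) / s) \<longlongrightarrow> f' e - 2 * (e \<bullet> a)) at_top"
    using reciprocal_expansion ..
  note A = this[rule_format]
  define Q where "Q x = exp (A - u x)" for x
  define Q' where "Q' x h = - Q x * u' x h" for x h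
  have dQ: "(Q has_derivative Q' x) (at x)" for x
  proof -
    have "((\<lambda>x. exp (A - u x)) has_derivative (\<lambda>h. (0 - u' x h) * exp (A - u x))) (at x)"
      by (intro has_derivative_exp has_derivative_diff has_derivative_const du)
    then show ?thesis by (simp add: Q_def[abs_def] Q'_def[abs_def] mult.commute)
  qed
  have lin: "linear (Q' x)" for x by (rule has_derivative_linear[OF dQ])
  have unit: "Q' x e = 2 * (e \<bullet> x) + Q' 0 e" if e: "norm e = 1" for x e
    using tendsto_unique[OF _ A[OF e dQ[of x, unfolded Q_def[abs_def]]] A[OF e dQ[of 0, unfolded Q_def[abs_def]]]] by simp
  have Q': "Q' x h = 2 * (h \<bullet> x) + Q' 0 h" for x h
  proof (cases "h = 0")
    case True
    then show ?thesis using linear_0[OF lin] by simp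
  next
    case False
    define e where "e = (1 / norm h) *\<^sub>R h"
    have e1: "norm e = 1" using False by (simp add: e_def)
    have he: "h = norm h *\<^sub>R e" using False by (simp add: e_def)
    have "Q' x h = norm h * Q' x e" for x
      by (subst he, subst linear_scale[OF lin]) simp
    then have "Q' x h = norm h * (2 * (e \<bullet> x) + Q' 0 e)" and "Q' 0 h = norm h * Q' 0 e"
      by (simp_all only: unit[OF e1, of x])
    moreover have "h \<bullet> x = norm h * (e \<bullet> x)" by (subst he) simp
    ultimately show ?thesis by (simp only: distrib_left mult.left_commute)
  qed
  define b where "b = adjoint (Q' 0) 1"
  have b: "Q' 0 h = h \<bullet> b" for h unfolding b_def using adjoint_works[OF lin[of 0], of h 1] by simp
  \<comment> \<open>Completes the square: the gradient 2 * x + b equals 2 * (x - x0).\<close>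
  define x0 where "x0 = - (1 / 2) *\<^sub>R b"
  have "\<exists>c. \<forall>x\<in>UNIV. Q x - (x - x0) \<bullet> (x - x0) = c"
  proof (rule has_derivative_zero_constant)
    fix x
    have "((\<lambda>x. Q x - (x - x0) \<bullet> (x - x0)) has_derivative (\<lambda>h. Q' x h - ((x - x0) \<bullet> h + h \<bullet> (x - x0)))) (at x)"
      by (intro has_derivative_diff dQ has_derivative_inner) (auto intro!: derivative_eq_intros)
    moreover have "Q' x h - ((x - x0) \<bullet> h + h \<bullet> (x - x0)) = 0" for h
      unfolding Q'[of x h] b x0_def by (simp add: inner_simps inner_commute[of x h] inner_commute[of b h])
    ultimately show "((\<lambda>x. Q x - (x - x0) \<bullet> (x - x0)) has_derivative (\<lambda>h. 0)) (at x within UNIV)" by simp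
  qed simp
  then obtain D where D: "Q x = D + (norm (x - x0))\<^sup>2" for x
    unfolding power2_norm_eq_inner by (metis UNIV_I diff_add_cancel)
  have D0: "D > 0" using D[of x0] by (simp add: Q_def) (metis exp_gt_zero)
  define r where "r = sqrt D"
  have r: "r > 0" "r\<^sup>2 = D" using D0 by (simp_all add: r_def)
  have u: "u x = A - ln (Q x)" for x by (simp add: Q_def)
  have \<rho>: "\<rho> x = exp A ^ 3 / (r\<^sup>2 + (norm (x - x0))\<^sup>2) ^ 3" for x
  proof -
    have "\<rho> x = exp (real 3 * A - real 3 * (A - u x))" unfolding density by simp
    also have "\<dots> = exp A ^ 3 / Q x ^ 3" unfolding exp_diff exp_of_nat_mult Q_def ..
    finally show ?thesis by (simp only: D r)
  qed
  \<comment> \<open>The case m = 2 of \<open>nn_integral_inverse_power_quadratic\<close>, with Gamma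
    (3 / 2) = sqrt pi / 2.\<close>
  have "(\<integral>\<^sup>+(x::real^3). ennreal (1 / (1 + (norm x)\<^sup>2) ^ 3) \<partial>lborel) = ennreal (pi\<^sup>2 / 4)"
  proof -
    have "Gamma (1 / 2 + 1 :: real) = 1 / 2 * Gamma (1 / 2)" by (rule Gamma_plus1) auto
    then have g: "Gamma (real 2 - 1 / 2) = sqrt pi / 2" by (simp add: Gamma_one_half_real)
    have "pi * sqrt pi * Gamma (real 2 - 1 / 2) / fact 2 = pi * (sqrt pi * sqrt pi) / 4"
      unfolding g by (simp add: fact_2)
    then have "pi * sqrt pi * Gamma (real 2 - 1 / 2) / fact 2 = pi\<^sup>2 / 4"
      by (simp only: real_sqrt_mult_self abs_of_pos[OF pi_gt_zero] power2_eq_square)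
    then show ?thesis using nn_integral_inverse_power_quadratic[of 2] by (simp add: numeral_3_eq_3 numeral_2_eq_2)
  qed
  then have I: "(\<integral>(x::real^3). 1 / (1 + (norm x)\<^sup>2) ^ 3 \<partial>lborel) = pi\<^sup>2 / 4"
    by (intro integral_eq_nn_integral[THEN trans]) auto
  have "mass / r ^ 3 = (\<integral>z. \<rho> (x0 + r *\<^sub>R z) \<partial>lborel)"
    unfolding mass_def using integral_affine[of r \<rho> x0] r(1) by (simp add: divide_inverse mult.commute)
  also have "\<dots> = (\<integral>(z::real^3). (exp A ^ 3 / (r\<^sup>2) ^ 3) * (1 / (1 + (norm z)\<^sup>2) ^ 3) \<partial>lborel)"
  proof (intro Bochner_Integration.integral_cong refl)
    fix z :: "real^3"
    have "r\<^sup>2 + (norm (x0 + r *\<^sub>R z - x0))\<^sup>2 = r\<^sup>2 * (1 + (norm z)\<^sup>2)" using r(1) by (simp add: power_mult_distrib algebra_simps)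
    then show "\<rho> (x0 + r *\<^sub>R z) = (exp A ^ 3 / (r\<^sup>2) ^ 3) * (1 / (1 + (norm z)\<^sup>2) ^ 3)"
      unfolding \<rho> by (simp only: power_mult_distrib[of "r\<^sup>2"]) simp
  qed
  also have "\<dots> = exp A ^ 3 / (r\<^sup>2) ^ 3 * (pi\<^sup>2 / 4)" unfolding integral_mult_right_zero I ..
  \<comment> \<open>Comparison with the mass 2 * pi^2; it forces exp A = 2 * r, so that l = 1 / r is
    the parameter of the spherical solution.\<close>
  finally have "8 * r ^ 6 = r ^ 3 * exp A ^ 3" unfolding mass using r(1) by (simp add: field_simps)
  moreover have "8 * r ^ 6 = r ^ 3 * (2 * r) ^ 3" by (simp add: power_mult_distrib flip: power_add)
  ultimately have "r ^ 3 * exp A ^ 3 = r ^ 3 * (2 * r) ^ 3" by (simp only:)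
  then have "exp A ^ 3 = (2 * r) ^ 3"
    by (rule mult_left_cancel[THEN iffD1, rotated]) (use r(1) in simp)
  then have A2: "exp A = 2 * r" by (rule power_eq_imp_eq_base) (use r(1) in simp_all)
  have "u x = ln (2 * (1 / r) / (1 + (1 / r)\<^sup>2 * (norm (x - x0))\<^sup>2))" for x
  proof -
    have q: "Q x > 0" by (simp add: Q_def)
    have "u x = ln (exp A) - ln (Q x)" by (simp add: u)
    also have "\<dots> = ln (2 * r / Q x)" unfolding A2 using r(1) q by (intro ln_divide_pos[symmetric]) auto
    also have "2 * r / Q x = 2 * (1 / r) / (1 + (1 / r)\<^sup>2 * (norm (x - x0))\<^sup>2)"
    proof -
      have "1 + (1 / r)\<^sup>2 * (norm (x - x0))\<^sup>2 = Q x / (r * r)"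
        unfolding D[of x] r(2)[symmetric] using r(1) by (simp add: field_simps power2_eq_square)
      then show ?thesis using r(1) q by simp
    qed
    finally show ?thesis .
  qed
  then have "u = (\<lambda>x. ln (2 * (1 / r) / (1 + (1 / r)\<^sup>2 * (norm (x - x0))\<^sup>2)))" by (rule ext)
  moreover have "1 / r > 0" using r(1) by simp
  ultimately show ?thesis unfolding spherical_def by (intro exI conjI)
qed

end

theorem theorem5:
  fixes u :: "real ^ 3 \<Rightarrow> real"
  assumes "smooth u"
    and "is_solution u (regular_distribution (\<lambda>x. 2 * exp (3 * u x)))"
    and "integrable lebesgue (\<lambda>x. exp (3 * u x))"
    and "\<not> spherical u"
  shows "(LINT x|lebesgue. exp (3 * u x)) < 2 * pi\<^sup>2"
proof -
  define \<rho> where "\<rho> x = exp (3 * u x)" for x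
  have cu: "continuous_on UNIV u" by (rule smooth_continuous_on[OF assms(1)])
  have c\<rho>: "continuous_on UNIV \<rho>" unfolding \<rho>_def[abs_def] by (intro continuous_intros cu)
  have m: "\<rho> \<in> borel_measurable lborel" using borel_measurable_continuous_onI[OF c\<rho>] by simp
  interpret log_density \<rho>
  proof
    show "integrable lborel \<rho>"
      using assms(3) integrable_completion[OF m] by (simp add: \<rho>_def[abs_def])
  qed (simp_all add: c\<rho>, simp add: \<rho>_def)
  have mass: "(LINT x|lebesgue. exp (3 * u x)) = mass"
    unfolding mass_def using integral_completion[OF m] by (simp add: \<rho>_def[abs_def])
  obtain c where "\<And>x. - laplacian u x = c + (\<integral>y. exp (3 * u y) / (norm (x - y))\<^sup>2 \<partial>lborel) / pi\<^sup>2"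
    using laplacian_representation[OF assms(1-3)] by blast
  then have c: "- laplacian u x = c + riesz x / pi\<^sup>2" for x by (simp add: riesz_def \<rho>_def)
  have r: "riesz x = pi\<^sup>2 * (- laplacian u x - c)" for x unfolding c[of x] by simp
  have cr: "continuous_on UNIV riesz"
    unfolding r[abs_def] by (intro continuous_intros continuous_on_laplacian assms(1))
  obtain p L B where L: "linear L" and B: "bilinear B" and Bs: "\<And>x y. B x y = B y x"
    and e: "\<And>x. u x = logpot \<rho> x / pi\<^sup>2 + (p + L x + B x x / 2)"
    using quadratic_difference[OF assms(1) \<rho>_def c] by metis
  have e\<rho>: "\<rho> x = exp (3 * (logpot \<rho> x / pi\<^sup>2 + (p + L x + B x x / 2)))" for x
    unfolding e[of x, symmetric] by (rule \<rho>_def)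
  obtain q x0 where q: "\<And>x. p + L x + B x x / 2 = q + B (x - x0) (x - x0) / 2" and neg: "\<And>x. B x x \<le> 0"
    using quadratic_part_nonpos[OF e\<rho> L B Bs] by metis
  have rep: "u x = logpot \<rho> x / pi\<^sup>2 + (q + B (x - x0) (x - x0) / 2)" for x unfolding e[of x] q ..
  \<comment> \<open>Removes the equality case of the Pohozaev alternative, in which u would be a
    bubble and hence spherical.\<close>
  have "\<not> (mass = 2 * pi\<^sup>2 \<and> (\<forall>x. B x x = 0))"
  proof
    assume z: "mass = 2 * pi\<^sup>2 \<and> (\<forall>x. B x x = 0)"
    have zz: "mass = 2 * pi\<^sup>2" "B x x = 0" for x using z by blast+
    have rep0: "u x = logpot \<rho> x / pi\<^sup>2 + q" for x using rep[of x] unfolding zz by simp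
    interpret bubble \<rho> u q
      by unfold_locales (rule \<rho>_def, rule rep0, rule zz(1), rule cu)
    show False using spherical_if_differentiable[OF smooth_has_derivative[OF assms(1)]] assms(4) by simp
  qed
  then show ?thesis using pohozaev[OF assms(1) \<rho>_def cr rep B Bs neg] unfolding mass by blast
qed

end
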